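(* Let $l\ge1$, $n\ge0$. (I) The standard modules $\mathcal S^n_{\underline\mu}$ of $P^l_n$ with $\underline\mu\in\bigsqcup_{\mathbf m\in h^l_n}\Lambda_{\mathbf m}$ are $A^l_n$-modules (i.e. the action of $P^l_n$ factors through the quotient $A^l_n$). (II) Over $k=\mathbb C$ every such $\mathcal S^n_{\underline\mu}$ is simple, and $A^l_n$ is semisimple.
   Context: $k$ is a commutative ring, $\delta\in k$. Partitions and products: for $n,m\ge 0$ let $\mathsf P_{n,m}$ be the set of set partitions of the disjoint union $\{1,\dots,n\}\cup\{1',\dots,m'\}$. For $p\in\mathsf P_{n,m}$, $p'\in\mathsf P_{m,r}$: rename each $i'$ of $p$ and each $i\in\{1,\dots,m\}$ of $p'$ as $i''$; take the finest partition of $\{1,\dots,n\}\cup\{1'',\dots,m''\}\cup\{1',\dots,r'\}$ such that every part of $p$ and of $p'$ is contained in a part; let $c$ be the number of its parts contained in $\{1'',\dots,m''\}$; delete all $i''$ (and empty parts) to get $q$; then $pp'=\delta^cq$. $p\otimes p'$ is side-by-side juxtaposition ($p'$ to the right); $1_n$ has parts $\{i,i'\}$. A part $s$ is $l$-tone if $|s\cap\{1,\dots,n\}|\equiv|s\cap\{1',\dots,m'\}|$ mod $l$; a partition is $l$-tone if all its parts are. The tonal partition algebra $P^l_n$ is the $k$-algebra with basis the set $\mathsf P^l_n$ of $l$-tone partitions in $\mathsf P_{n,n}$. Propagating vector: a part is propagating if it meets both rows. For $p\in\mathsf P^l_n$ let $\#^i(p)$ ($1\le i\le l$) be the number of propagating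 parts $s$ with $|s\cap\{1,\dots,n\}|\equiv i$ mod $l$, and $\#^-(p)=(\#^1(p),\dots,\#^l(p))$. Index poset: for $\mathbf m=(m_1,\dots,m_l)$ let $r_{\mathbf m}=\sum_i i\,m_i$; $\gamma^{l,n}=\{\mathbf m\in\mathbb N_0^l:(n-r_{\mathbf m})/l\in\mathbb N_0\}$. With $\epsilon_i$ the standard basis of $\mathbb Z^l$, indices read mod $l$ in $\{1,\dots,l\}$, let $v_{ij}=\epsilon_{i+j}-\epsilon_i-\epsilon_j$ ($1\le i\le j\le l$); $\mathbf m\ge\mathbf m'$ iff $\mathbf m'-\mathbf m$ is a nonnegative integral combination of the $v_{ij}$. Put $h^l_n=\{\mathbf m\in\gamma^{l,n}\mid\mathbf m\not\le(n-l,0,\dots,0)\}$. Elements and quotients: $b^i\in\mathsf P_{i,i}$ has the single part $\{1,\dots,i,1',\dots,i'\}$; $w\in\mathsf P_{l,0}$, $w^\star\in\mathsf P_{0,l}$ are the one-part partitions; $a^{\mathbf m}=(b^l)^{\otimes m_l}\otimes\cdots\otimes(b^1)^{\otimes m_1}\otimes(ww^\star)^{\otimes(n-r_{\mathbf m})/l}$. $I^{<\mathbf m}=\sum_{\mathbf m'<\mathbf m}P^l_na^{\mathbf m'}P^l_n$ and $P^{\mathbf m}_n=P^l_n/I^{<\mathbf m}$. With $W^l=(ww^\star)\otimes1_{n-l}$, $A^l_n=P^l_n/P^l_nW^lP^l_n=P^l_n/P^l_na^{(n-l,0,\dots,0)}P^l_n$ (for $n<l$ the ideal is understood to be $0$).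 Standard modules: let $S_{\mathbf m}=S_{m_1}\times\cdots\times S_{m_l}$. The left ideal $P^{\mathbf m}_na^{\mathbf m}$ has basis the classes of those $p\in\mathsf P^l_n$ with $\#^-(p)=\mathbf m$ and with the same restriction to the bottom row, and the same non-propagating bottom parts, as $a^{\mathbf m}$. It is a right $S_{\mathbf m}$-module by permuting, for each $i$, the $m_i$ bottom blocks of size $i$ attached to propagating parts: if $B_{i,1},\dots,B_{i,m_i}$ are these blocks from left to right, then in $p\cdot\sigma$ the propagating part of $p$ with bottom block $B_{i,\sigma_i(j)}$ is given the bottom block $B_{i,j}$. Let $\Lambda_{\mathbf m}$ be the set of $l$-tuples $(\mu^1,\dots,\mu^l)$ of integer partitions with $\mu^i\vdash m_i$. Let $\mathrm{Sp}_{\underline\mu}$ be the Specht module over $k$ of $S_{\mathbf m}$ (outer tensor product of Specht modules of the factors). The standard module is $\mathcal S^n_{\underline\mu}\cong P^{\mathbf m}_na^{\mathbf m}\otimes_{kS_{\mathbf m}}\mathrm{Sp}_{\underline\mu}$ for $\underline\mu\in\Lambda_{\mathbf m}$. *)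

theory Defs
  imports Complex_Main "HOL-Algebra.Algebra"
begin

section \<open>Modules over noncommutative rings\<close>

text \<open>
  Throughout, the sort \<open>{comm_ring, comm_monoid_mult}\<close> is that of commutative rings with \<open>1\<close>;
  unlike \<open>comm_ring_1\<close> it admits the zero ring.

  The locale \<^locale>\<open>module\<close> of HOL-Algebra requires a commutative ring of scalars; the following
  is the same notion of a unital left module over an arbitrary ring. As there, the fields
  \<open>mult\<close> and \<open>one\<close> of the record \<open>M\<close> are irrelevant (and left \<^term>\<open>undefined\<close> below).
  The library's \<^locale>\<open>submodule\<close> does not depend on commutativity and is used as it stands.
\<close>

locale left_module = R?: ring R + M?: abelian_group M
    for R :: "('a, 'c) ring_scheme" (structure) and M :: "('a, 'b, 'd) module_scheme" (structure) +
  assumes smult_closed: "\<lbrakk>a \<in> carrier R; x \<in> carrier M\<rbrakk> \<Longrightarrow> a \<odot>\<^bsub>M\<^esub> x \<in> carrier M"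
    and smult_l_distr: "\<lbrakk>a \<in> carrier R; b \<in> carrier R; x \<in> carrier M\<rbrakk>
      \<Longrightarrow> (a \<oplus> b) \<odot>\<^bsub>M\<^esub> x = a \<odot>\<^bsub>M\<^esub> x \<oplus>\<^bsub>M\<^esub> b \<odot>\<^bsub>M\<^esub> x"
    and smult_r_distr: "\<lbrakk>a \<in> carrier R; x \<in> carrier M; y \<in> carrier M\<rbrakk>
      \<Longrightarrow> a \<odot>\<^bsub>M\<^esub> (x \<oplus>\<^bsub>M\<^esub> y) = a \<odot>\<^bsub>M\<^esub> x \<oplus>\<^bsub>M\<^esub> a \<odot>\<^bsub>M\<^esub> y"
    and smult_assoc1: "\<lbrakk>a \<in> carrier R; b \<in> carrier R; x \<in> carrier M\<rbrakk>
      \<Longrightarrow> (a \<otimes> b) \<odot>\<^bsub>M\<^esub> x = a \<odot>\<^bsub>M\<^esub> (b \<odot>\<^bsub>M\<^esub> x)"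
    and smult_one: "x \<in> carrier M \<Longrightarrow> \<one> \<odot>\<^bsub>M\<^esub> x = x"

definition simple_module :: "('r, 's) ring_scheme \<Rightarrow> ('r, 'v, 't) module_scheme \<Rightarrow> bool" where
  "simple_module R M \<longleftrightarrow> left_module R M \<and> carrier M \<noteq> {\<zero>\<^bsub>M\<^esub>} \<and>
     (\<forall>N. submodule N R M \<longrightarrow> N = {\<zero>\<^bsub>M\<^esub>} \<or> N = carrier M)"

definition semisimple_module :: "('r, 's) ring_scheme \<Rightarrow> ('r, 'v, 't) module_scheme \<Rightarrow> bool" where
  "semisimple_module R M \<longleftrightarrow> left_module R M \<and>
     (\<forall>N. submodule N R M \<longrightarrow>
        (\<exists>N'. submodule N' R M \<and> N \<inter> N' = {\<zero>\<^bsub>M\<^esub>} \<and> N <+>\<^bsub>M\<^esub> N' = carrier M))"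

definition regular_module :: "('r, 's) ring_scheme \<Rightarrow> ('r, 'r) module" where
  "regular_module R = \<lparr>carrier = carrier R, monoid.mult = undefined, one = undefined,
     ring.zero = \<zero>\<^bsub>R\<^esub>, add = add R, smult = monoid.mult R\<rparr>"

definition semisimple_ring :: "('r, 's) ring_scheme \<Rightarrow> bool" where
  "semisimple_ring R \<longleftrightarrow> ring R \<and> semisimple_module R (regular_module R)"

definition factors_through_quotient ::
    "('r, 's) ring_scheme \<Rightarrow> 'r set \<Rightarrow> ('r, 'v, 't) module_scheme \<Rightarrow> bool" where
  "factors_through_quotient R I M \<longleftrightarrow> left_module R M \<and>
     (\<exists>N :: ('r set, 'v) module. left_module (R Quot I) N \<and>
        carrier N = carrier M \<and> \<zero>\<^bsub>N\<^esub> = \<zero>\<^bsub>M\<^esub> \<and> add N = add M \<and>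
        (\<forall>r\<in>carrier R. \<forall>v\<in>carrier M. (I +>\<^bsub>R\<^esub> r) \<odot>\<^bsub>N\<^esub> v = r \<odot>\<^bsub>M\<^esub> v))"


section \<open>Tensor products\<close>

text \<open>
  The abelian group generated by \<open>S\<close> subject to the relations \<open>L\<close>, with \<open>a\<close> acting on the class
  of a generator \<open>x\<close> as \<open>\<phi> a x\<close>, extended additively. On a class \<open>Z\<close> (a coset of the relation
  subgroup) the action is written without choosing a representative; it is well-defined as soon
  as the extension of \<open>\<phi> a\<close> preserves the relation subgroup.
\<close>

definition presented_module ::
    "'x set \<Rightarrow> ('x \<Rightarrow>\<^sub>0 int) set \<Rightarrow> ('r \<Rightarrow> 'x \<Rightarrow> ('x \<Rightarrow>\<^sub>0 int)) \<Rightarrow> ('r, ('x \<Rightarrow>\<^sub>0 int) set) module" where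
  "presented_module S L \<phi> =
     (let F = free_Abelian_group S; H = generate F L; Q = F Mod H in
      \<lparr>carrier = carrier Q, monoid.mult = undefined, one = undefined,
       ring.zero = \<one>\<^bsub>Q\<^esub>, add = monoid.mult Q,
       smult = (\<lambda>a Z. \<Union>z\<in>Z. H #>\<^bsub>F\<^esub> frag_extend (\<phi> a) z)\<rparr>)"

text \<open>
  \<open>M \<otimes>\<^sub>R N\<close> for a left module \<open>N\<close> over \<open>R\<close> and a bimodule \<open>M\<close>, given as the record \<open>M\<close> carrying its
  left action together with its right \<open>R\<close>-action \<open>\<rho>\<close>. The left action on \<open>M\<close> is inherited.
\<close>

definition tensor_module ::
    "('r, 's) ring_scheme \<Rightarrow> ('p, 'x, 't) module_scheme \<Rightarrow> ('x \<Rightarrow> 'r \<Rightarrow> 'x) \<Rightarrow> ('r, 'v, 'u) module_scheme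
      \<Rightarrow> ('p, ('x \<times> 'v \<Rightarrow>\<^sub>0 int) set) module" where
  "tensor_module R M \<rho> N = presented_module (carrier M \<times> carrier N)
     ({frag_of (x \<oplus>\<^bsub>M\<^esub> y, v) - frag_of (x, v) - frag_of (y, v) | x y v.
         x \<in> carrier M \<and> y \<in> carrier M \<and> v \<in> carrier N} \<union>
      {frag_of (x, v \<oplus>\<^bsub>N\<^esub> w) - frag_of (x, v) - frag_of (x, w) | x v w.
         x \<in> carrier M \<and> v \<in> carrier N \<and> w \<in> carrier N} \<union>
      {frag_of (\<rho> x r, v) - frag_of (x, r \<odot>\<^bsub>N\<^esub> v) | x r v.
         x \<in> carrier M \<and> r \<in> carrier R \<and> v \<in> carrier N})
     (\<lambda>a (x, v). frag_of (a \<odot>\<^bsub>M\<^esub> x, v))"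

definition group_ring :: "('g, 'z) monoid_scheme \<Rightarrow> ('g \<Rightarrow> 'k :: {comm_ring, comm_monoid_mult}) ring" where
  "group_ring G = \<lparr>carrier = {f. finite {g. f g \<noteq> 0} \<and> {g. f g \<noteq> 0} \<subseteq> carrier G},
     monoid.mult = (\<lambda>f f' x. \<Sum>(g, h) \<in> {(g, h). f g \<noteq> 0 \<and> f' h \<noteq> 0 \<and> g \<otimes>\<^bsub>G\<^esub> h = x}. f g * f' h),
     one = (\<lambda>g. if g = \<one>\<^bsub>G\<^esub> then 1 else 0),
     ring.zero = (\<lambda>_. 0),
     add = (\<lambda>f f' g. f g + f' g)\<rparr>"

definition group_ring_single :: "'k :: zero \<Rightarrow> 'g \<Rightarrow> 'g \<Rightarrow> 'k" where
  "group_ring_single c g = (\<lambda>h. if h = g then c else 0)"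

text \<open>
  The outer tensor product \<open>V\<^sub>1 \<otimes>\<^sub>k \<dots> \<otimes>\<^sub>k V\<^sub>l\<close>, as a module over the group ring of
  \<open>G\<^sub>1 \<times> \<dots> \<times> G\<^sub>l\<close> (finite groups, \<open>l \<ge> 1\<close>), of modules \<open>V\<^sub>i\<close> over the group rings \<open>kG\<^sub>i\<close>.
  The relations are additivity in each slot and the possibility to move scalars between slots.
  An element \<open>\<Sum>\<sigma>. f \<sigma> \<cdot> \<sigma>\<close> acts by applying \<open>\<sigma> i\<close> in slot \<open>i\<close>; the scalar \<open>f \<sigma>\<close> is put into slot \<open>1\<close>,
  which is immaterial by the second kind of relations.
\<close>

definition outer_tensor_module ::
    "nat \<Rightarrow> (nat \<Rightarrow> 'g monoid) \<Rightarrow> (nat \<Rightarrow> ('g \<Rightarrow> 'k :: {comm_ring, comm_monoid_mult}, 'v) module)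
      \<Rightarrow> ((nat \<Rightarrow> 'g) \<Rightarrow> 'k, ((nat \<Rightarrow> 'v) \<Rightarrow>\<^sub>0 int) set) module" where
  "outer_tensor_module l G V = presented_module (\<Pi>\<^sub>E i\<in>{1..l}. carrier (V i))
     ({frag_of (x(i := u \<oplus>\<^bsub>V i\<^esub> v)) - frag_of (x(i := u)) - frag_of (x(i := v)) | x i u v.
         x \<in> (\<Pi>\<^sub>E i\<in>{1..l}. carrier (V i)) \<and> i \<in> {1..l} \<and> u \<in> carrier (V i) \<and> v \<in> carrier (V i)} \<union>
      {frag_of (x(i := group_ring_single c \<one>\<^bsub>G i\<^esub> \<odot>\<^bsub>V i\<^esub> x i)) -
       frag_of (x(j := group_ring_single c \<one>\<^bsub>G j\<^esub> \<odot>\<^bsub>V j\<^esub> x j)) | x i j c.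
         x \<in> (\<Pi>\<^sub>E i\<in>{1..l}. carrier (V i)) \<and> i \<in> {1..l} \<and> j \<in> {1..l}})
     (\<lambda>f x. \<Sum>\<sigma>\<in>carrier (product_group {1..l} G).
        frag_of (\<lambda>i\<in>{1..l}. group_ring_single (if i = 1 then f \<sigma> else 1) (\<sigma> i) \<odot>\<^bsub>V i\<^esub> x i))"


section \<open>Specht modules\<close>

text \<open>
  An integer partition of \<open>n\<close> is the weakly decreasing list of its (positive) parts.
  Specht modules follow James: the \<open>k\<close>-span of the polytabloids inside the
  permutation module on the tabloids of shape \<open>\<mu>\<close>. A tabloid is the list of the (unordered) rows of
  a tableau, and elements of the
  permutation module are \<open>k\<close>-valued functions of tabloids.
\<close>

definition integer_partition :: "nat \<Rightarrow> nat list \<Rightarrow> bool" where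
  "integer_partition n \<mu> \<longleftrightarrow> sorted_wrt (\<ge>) \<mu> \<and> 0 \<notin> set \<mu> \<and> sum_list \<mu> = n"

definition young_cells :: "nat list \<Rightarrow> (nat \<times> nat) set" where
  "young_cells \<mu> = {(a, b). a < length \<mu> \<and> b < \<mu> ! a}"

definition tableaux :: "nat list \<Rightarrow> (nat \<times> nat \<Rightarrow> nat) set" where
  "tableaux \<mu> = {t. bij_betw t (young_cells \<mu>) {1..sum_list \<mu>}}"

definition tabloid :: "nat list \<Rightarrow> (nat \<times> nat \<Rightarrow> nat) \<Rightarrow> nat set list" where
  "tabloid \<mu> t = map (\<lambda>a. {t (a, b) | b. (a, b) \<in> young_cells \<mu>}) [0..<length \<mu>]"

definition column_stabilizer :: "nat list \<Rightarrow> (nat \<times> nat \<Rightarrow> nat) \<Rightarrow> (nat \<Rightarrow> nat) set" where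
  "column_stabilizer \<mu> t = {\<pi>. \<pi> permutes {1..sum_list \<mu>} \<and>
     (\<forall>b. \<pi> ` {t (a, b) | a. (a, b) \<in> young_cells \<mu>} = {t (a, b) | a. (a, b) \<in> young_cells \<mu>})}"

definition polytabloid ::
    "nat list \<Rightarrow> (nat \<times> nat \<Rightarrow> nat) \<Rightarrow> nat set list \<Rightarrow> 'k :: {comm_ring, comm_monoid_mult}" where
  "polytabloid \<mu> t = (\<lambda>T. \<Sum>\<pi>\<in>column_stabilizer \<mu> t.
     if tabloid \<mu> (\<pi> \<circ> t) = T then (if evenperm \<pi> then 1 else - 1) else 0)"

definition specht ::
    "nat list \<Rightarrow> ((nat \<Rightarrow> nat) \<Rightarrow> 'k :: {comm_ring, comm_monoid_mult}, nat set list \<Rightarrow> 'k) module" where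
  "specht \<mu> = \<lparr>carrier = {(\<lambda>T. \<Sum>t\<in>A. c t * polytabloid \<mu> t T) | A c. finite A \<and> A \<subseteq> tableaux \<mu>},
     monoid.mult = undefined, one = undefined,
     ring.zero = (\<lambda>_. 0), add = (\<lambda>u v T. u T + v T),
     smult = (\<lambda>f v T. \<Sum>\<sigma>\<in>carrier (sym_group (sum_list \<mu>)). f \<sigma> * v (map ((`) (inv' \<sigma>)) T))\<rparr>"

definition sym_product :: "nat \<Rightarrow> (nat \<Rightarrow> nat) \<Rightarrow> (nat \<Rightarrow> nat \<Rightarrow> nat) monoid" where
  "sym_product l m = product_group {1..l} (\<lambda>i. sym_group (m i))"

definition specht_product ::
    "nat \<Rightarrow> (nat \<Rightarrow> nat) \<Rightarrow> (nat \<Rightarrow> nat list)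
      \<Rightarrow> ((nat \<Rightarrow> nat \<Rightarrow> nat) \<Rightarrow> 'k :: {comm_ring, comm_monoid_mult},
          ((nat \<Rightarrow> nat set list \<Rightarrow> 'k) \<Rightarrow>\<^sub>0 int) set) module" where
  "specht_product l m \<mu> = outer_tensor_module l (\<lambda>i. sym_group (m i)) (\<lambda>i. specht (\<mu> i))"


section \<open>Partition diagrams\<close>

text \<open>A point \<open>Inl i\<close> is the upper vertex \<open>i\<close>, a point \<open>Inr i\<close> is the lower vertex \<open>i'\<close>.\<close>

type_synonym diagram = "(nat + nat) set set"

definition diagrams :: "nat \<Rightarrow> nat \<Rightarrow> diagram set" where
  "diagrams n m = {p. partition_on (Sum_Type.Plus {1..n} {1..m}) p}"

definition finest_coarsening :: "'a set set \<Rightarrow> 'a set set" where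
  "finest_coarsening F = \<Union>F // (\<Union>s\<in>F. s \<times> s)\<^sup>+"

lemma equiv_common_part: "equiv (\<Union>F) ((\<Union>s\<in>F. s \<times> s)\<^sup>+)" (is "equiv ?A (?R\<^sup>+)")
proof (rule equivI)
  have "?R \<subseteq> ?A \<times> ?A" by blast
  then show "?R\<^sup>+ \<subseteq> ?A \<times> ?A" by (rule trancl_subset_Sigma)
  show "refl_on ?A (?R\<^sup>+)" by (auto intro!: refl_onI r_into_trancl)
  show "sym (?R\<^sup>+)" by (intro sym_trancl symI) auto
  show "trans (?R\<^sup>+)" by simp
qed

lemma finest_coarsening:
  shows "partition_on (\<Union>F) (finest_coarsening F)"
    and "\<And>s. s \<in> F \<Longrightarrow> s \<noteq> {} \<Longrightarrow> \<exists>u\<in>finest_coarsening F. s \<subseteq> u"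
    and "\<And>Q u. partition_on (\<Union>F) Q \<Longrightarrow> \<forall>s\<in>F. \<exists>v\<in>Q. s \<subseteq> v \<Longrightarrow>
      u \<in> finest_coarsening F \<Longrightarrow> \<exists>v\<in>Q. u \<subseteq> v"
proof -
  show "partition_on (\<Union>F) (finest_coarsening F)"
    unfolding finest_coarsening_def by (rule partition_on_quotient[OF equiv_common_part])
next
  fix s assume s: "s \<in> F" "s \<noteq> {}"
  then obtain x where x: "x \<in> s" by blast
  have "s \<subseteq> (\<Union>s\<in>F. s \<times> s)\<^sup>+ `` {x}" using s x by (auto intro!: r_into_trancl)
  moreover have "(\<Union>s\<in>F. s \<times> s)\<^sup>+ `` {x} \<in> finest_coarsening F"
    unfolding finest_coarsening_def using s x by (intro quotientI) blast
  ultimately show "\<exists>u\<in>finest_coarsening F. s \<subseteq> u" by blast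
next
  fix Q u assume Q: "partition_on (\<Union>F) Q" "\<forall>s\<in>F. \<exists>v\<in>Q. s \<subseteq> v" and "u \<in> finest_coarsening F"
  then obtain x where x: "x \<in> \<Union>F" "u = (\<Union>s\<in>F. s \<times> s)\<^sup>+ `` {x}"
    unfolding finest_coarsening_def by (elim quotientE)
  then obtain v where v: "v \<in> Q" "x \<in> v" using Q(1) unfolding partition_on_def by blast
  have closed: "z \<in> v" if "y \<in> v" and "s \<in> F" "y \<in> s" "z \<in> s" for s y z
  proof -
    obtain v' where v': "v' \<in> Q" "s \<subseteq> v'" using Q(2) \<open>s \<in> F\<close> by blast
    then have "v \<inter> v' \<noteq> {}" using that by blast
    then have "v' = v" using Q(1) v(1) v'(1) unfolding partition_on_def disjoint_def by metis
    then show ?thesis using v' that by blast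
  qed
  have "y \<in> v" if "(x, y) \<in> (\<Union>s\<in>F. s \<times> s)\<^sup>+" for y
    using that by induction (use closed v(2) in auto)
  then have "u \<subseteq> v" unfolding x(2) by blast
  then show "\<exists>v\<in>Q. u \<subseteq> v" using v(1) by blast
qed

text \<open>
  In the three-row picture \<open>Inl i\<close>, \<open>Inr (Inl i)\<close> and \<open>Inr (Inr i)\<close> are the upper vertex \<open>i\<close>, the
  middle vertex \<open>i''\<close> and the lower vertex \<open>i'\<close>.
\<close>

definition stack :: "diagram \<Rightarrow> diagram \<Rightarrow> (nat + nat + nat) set set" where
  "stack p p' = finest_coarsening ((`) (map_sum id Inl) ` p \<union> (`) Inr ` p')"

definition diagram_loops :: "diagram \<Rightarrow> diagram \<Rightarrow> nat" where
  "diagram_loops p p' = card {s \<in> stack p p'. s \<subseteq> range (Inr \<circ> Inl)}"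

definition diagram_comp :: "diagram \<Rightarrow> diagram \<Rightarrow> diagram" where
  "diagram_comp p p' = (\<lambda>s. map_sum id Inr -` s) ` stack p p' - {{}}"

definition diagram_id :: "nat \<Rightarrow> diagram" where
  "diagram_id n = (\<lambda>i. {Inl i, Inr i}) ` {1..n}"

text \<open>\<open>juxtapose n m p p'\<close> is \<open>p \<otimes> p'\<close> for \<open>p\<close> in \<^term>\<open>diagrams n m\<close>.\<close>

definition juxtapose :: "nat \<Rightarrow> nat \<Rightarrow> diagram \<Rightarrow> diagram \<Rightarrow> diagram" where
  "juxtapose n m p p' = p \<union> (`) (map_sum ((+) n) ((+) m)) ` p'"

text \<open>Juxtaposition of a list of diagrams \<open>p\<close> in \<open>diagrams n n\<close>, each paired with its \<open>n\<close>.\<close>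

fun juxtapose_list :: "(nat \<times> diagram) list \<Rightarrow> diagram" where
  "juxtapose_list [] = {}"
| "juxtapose_list ((n, p) # ps) = juxtapose n n p (juxtapose_list ps)"

definition upper_size :: "(nat + nat) set \<Rightarrow> nat" where
  "upper_size s = card (Inl -` s)"

definition lower_size :: "(nat + nat) set \<Rightarrow> nat" where
  "lower_size s = card (Inr -` s)"

definition propagating :: "(nat + nat) set \<Rightarrow> bool" where
  "propagating s \<longleftrightarrow> Inl -` s \<noteq> {} \<and> Inr -` s \<noteq> {}"

definition tonal :: "nat \<Rightarrow> nat \<Rightarrow> diagram set" where
  "tonal l n = {p \<in> diagrams n n. \<forall>s\<in>p. upper_size s mod l = lower_size s mod l}"

definition propagating_vector :: "nat \<Rightarrow> diagram \<Rightarrow> nat \<Rightarrow> nat" where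
  "propagating_vector l p i =
     (if i \<in> {1..l} then card {s \<in> p. propagating s \<and> upper_size s mod l = i mod l} else 0)"

definition block_diagram :: "nat \<Rightarrow> diagram" where
  "block_diagram i = {Inl ` {1..i} \<union> Inr ` {1..i}}"

definition cup_cap_diagram :: "nat \<Rightarrow> diagram" where
  "cup_cap_diagram l = diagram_comp {Inl ` {1..l}} {Inr ` {1..l}}"


section \<open>The tonal partition algebra\<close>

definition tonal_algebra ::
    "'k :: {comm_ring, comm_monoid_mult} \<Rightarrow> nat \<Rightarrow> nat \<Rightarrow> (diagram \<Rightarrow> 'k) ring" where
  "tonal_algebra \<delta> l n = \<lparr>carrier = {f. \<forall>p. p \<notin> tonal l n \<longrightarrow> f p = 0},
     monoid.mult = (\<lambda>f f' q. \<Sum>(p, p') \<in> {(p, p') \<in> tonal l n \<times> tonal l n. diagram_comp p p' = q}.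
        f p * f' p' * \<delta> ^ diagram_loops p p'),
     one = (\<lambda>p. if p = diagram_id n then 1 else 0),
     ring.zero = (\<lambda>_. 0),
     add = (\<lambda>f f' p. f p + f' p)\<rparr>"

definition diagram_elt :: "diagram \<Rightarrow> diagram \<Rightarrow> 'k :: {comm_ring, comm_monoid_mult}" where
  "diagram_elt p = (\<lambda>q. if q = p then 1 else 0)"

text \<open>
  Index vectors \<open>(m\<^sub>1, \<dots>, m\<^sub>l)\<close> are functions on \<^typ>\<open>nat\<close> vanishing outside \<open>{1..l}\<close>. The order is
  defined on integer vectors, as \<open>(n - l, 0, \<dots>, 0)\<close> may have a negative entry.
\<close>

definition index_weight :: "nat \<Rightarrow> (nat \<Rightarrow> nat) \<Rightarrow> nat" where
  "index_weight l m = (\<Sum>i\<in>{1..l}. i * m i)"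

definition index_set :: "nat \<Rightarrow> nat \<Rightarrow> (nat \<Rightarrow> nat) set" where
  "index_set l n = {m. (\<forall>i. i \<notin> {1..l} \<longrightarrow> m i = 0) \<and> (\<exists>t. n = index_weight l m + l * t)}"

definition fusion_vector :: "nat \<Rightarrow> nat \<Rightarrow> nat \<Rightarrow> nat \<Rightarrow> int" where
  "fusion_vector l i j = (\<lambda>h. of_bool (h = (i + j - 1) mod l + 1) - of_bool (h = i) - of_bool (h = j))"

definition index_le :: "nat \<Rightarrow> (nat \<Rightarrow> int) \<Rightarrow> (nat \<Rightarrow> int) \<Rightarrow> bool" where
  "index_le l x y \<longleftrightarrow> (\<exists>c :: nat \<Rightarrow> nat \<Rightarrow> nat. \<forall>h\<in>{1..l}.
     x h - y h = (\<Sum>i\<in>{1..l}. \<Sum>j\<in>{i..l}. int (c i j) * fusion_vector l i j h))"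

definition top_indices :: "nat \<Rightarrow> nat \<Rightarrow> (nat \<Rightarrow> nat) set" where
  "top_indices l n = {m \<in> index_set l n.
     \<not> index_le l (int \<circ> m) (\<lambda>i. if i = 1 then int n - int l else 0)}"

definition index_diagram :: "nat \<Rightarrow> nat \<Rightarrow> (nat \<Rightarrow> nat) \<Rightarrow> diagram" where
  "index_diagram l n m = juxtapose_list
     (concat (map (\<lambda>i. replicate (m i) (i, block_diagram i)) (rev [1..<Suc l])) @
      replicate ((n - index_weight l m) div l) (l, cup_cap_diagram l))"

definition lower_ideal ::
    "'k :: {comm_ring, comm_monoid_mult} \<Rightarrow> nat \<Rightarrow> nat \<Rightarrow> (nat \<Rightarrow> nat) \<Rightarrow> (diagram \<Rightarrow> 'k) set" where
  "lower_ideal \<delta> l n m = Idl\<^bsub>tonal_algebra \<delta> l n\<^esub>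
     {diagram_elt (index_diagram l n m') | m'.
        m' \<in> index_set l n \<and> index_le l (int \<circ> m') (int \<circ> m) \<and> m' \<noteq> m}"

text \<open>The ideal generated by \<open>W = (w w\<^sup>\<star>) \<otimes> 1\<close>, which is zero if \<open>n < l\<close>.\<close>

definition cap_ideal :: "'k :: {comm_ring, comm_monoid_mult} \<Rightarrow> nat \<Rightarrow> nat \<Rightarrow> (diagram \<Rightarrow> 'k) set" where
  "cap_ideal \<delta> l n = Idl\<^bsub>tonal_algebra \<delta> l n\<^esub>
     (if l \<le> n then {diagram_elt (juxtapose l l (cup_cap_diagram l) (diagram_id (n - l)))} else {})"

definition capless_algebra ::
    "'k :: {comm_ring, comm_monoid_mult} \<Rightarrow> nat \<Rightarrow> nat \<Rightarrow> (diagram \<Rightarrow> 'k) set ring" where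
  "capless_algebra \<delta> l n = tonal_algebra \<delta> l n Quot cap_ideal \<delta> l n"


section \<open>Standard modules\<close>

definition index_left_ideal :: "'k :: {comm_ring, comm_monoid_mult} \<Rightarrow> nat \<Rightarrow> nat \<Rightarrow> (nat \<Rightarrow> nat)
      \<Rightarrow> (diagram \<Rightarrow> 'k, (diagram \<Rightarrow> 'k) set) module" where
  "index_left_ideal \<delta> l n m =
     (let P = tonal_algebra \<delta> l n; I = lower_ideal \<delta> l n m; Q = P Quot I in
      \<lparr>carrier = {Z \<otimes>\<^bsub>Q\<^esub> (I +>\<^bsub>P\<^esub> diagram_elt (index_diagram l n m)) | Z. Z \<in> carrier Q},
       monoid.mult = undefined, one = undefined, ring.zero = \<zero>\<^bsub>Q\<^esub>, add = add Q,
       smult = (\<lambda>f Z. (I +>\<^bsub>P\<^esub> f) \<otimes>\<^bsub>Q\<^esub> Z)\<rparr>)"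

definition index_basis :: "nat \<Rightarrow> nat \<Rightarrow> (nat \<Rightarrow> nat) \<Rightarrow> diagram set" where
  "index_basis l n m = {p \<in> tonal l n. propagating_vector l p = m \<and>
     (\<lambda>s. Inr -` s) ` p - {{}} = (\<lambda>s. Inr -` s) ` index_diagram l n m - {{}} \<and>
     {s \<in> p. Inl -` s = {}} = {s \<in> index_diagram l n m. Inl -` s = {}}}"

text \<open>
  The set of lower vertices of the \<open>j\<close>-th tensor factor \<open>b\<^sup>i\<close> of \<open>a\<^sup>m\<close>, \<open>1 \<le> j \<le> m i\<close>; it is
  preceded by all the factors \<open>b\<^sup>h\<close> with \<open>h > i\<close>.
\<close>

definition lower_block :: "nat \<Rightarrow> (nat \<Rightarrow> nat) \<Rightarrow> nat \<Rightarrow> nat \<Rightarrow> nat set" where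
  "lower_block l m i j = {(\<Sum>h\<in>{i<..l}. h * m h) + (j - 1) * i + 1 .. (\<Sum>h\<in>{i<..l}. h * m h) + j * i}"

definition permute_blocks :: "nat \<Rightarrow> (nat \<Rightarrow> nat) \<Rightarrow> diagram \<Rightarrow> (nat \<Rightarrow> nat \<Rightarrow> nat) \<Rightarrow> diagram" where
  "permute_blocks l m p \<sigma> = {s \<in> p. \<not> propagating s} \<union>
     {Inl ` (Inl -` s) \<union> Inr ` lower_block l m i j | s i j. s \<in> p \<and> propagating s \<and>
        i \<in> {1..l} \<and> j \<in> {1..m i} \<and> Inr -` s = lower_block l m i (\<sigma> i j)}"

text \<open>
  The linear extension of \<^const>\<open>permute_blocks\<close> to a right action on \<^const>\<open>index_left_ideal\<close>: each
  element \<open>Z\<close> of the left ideal has a unique representative supported on \<^const>\<open>index_basis\<close>.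
\<close>

definition index_right_action :: "'k :: {comm_ring, comm_monoid_mult} \<Rightarrow> nat \<Rightarrow> nat \<Rightarrow> (nat \<Rightarrow> nat)
      \<Rightarrow> (diagram \<Rightarrow> 'k) set \<Rightarrow> ((nat \<Rightarrow> nat \<Rightarrow> nat) \<Rightarrow> 'k) \<Rightarrow> (diagram \<Rightarrow> 'k) set" where
  "index_right_action \<delta> l n m Z f =
     (let x = (THE x. x \<in> Z \<and> (\<forall>p. p \<notin> index_basis l n m \<longrightarrow> x p = 0)) in
      lower_ideal \<delta> l n m +>\<^bsub>tonal_algebra \<delta> l n\<^esub>
        (\<lambda>q. \<Sum>(p, \<sigma>) \<in> {(p, \<sigma>) \<in> index_basis l n m \<times> carrier (sym_product l m).
           permute_blocks l m p \<sigma> = q}. x p * f \<sigma>))"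

definition partition_tuples :: "nat \<Rightarrow> (nat \<Rightarrow> nat) \<Rightarrow> (nat \<Rightarrow> nat list) set" where
  "partition_tuples l m = {\<mu>. (\<forall>i\<in>{1..l}. integer_partition (m i) (\<mu> i)) \<and> (\<forall>i. i \<notin> {1..l} \<longrightarrow> \<mu> i = [])}"

type_synonym 'k standard_carrier =
  "((diagram \<Rightarrow> 'k) set \<times> ((nat \<Rightarrow> nat set list \<Rightarrow> 'k) \<Rightarrow>\<^sub>0 int) set \<Rightarrow>\<^sub>0 int) set"

definition standard_module ::
    "'k :: {comm_ring, comm_monoid_mult} \<Rightarrow> nat \<Rightarrow> nat \<Rightarrow> (nat \<Rightarrow> nat) \<Rightarrow> (nat \<Rightarrow> nat list)
      \<Rightarrow> (diagram \<Rightarrow> 'k, 'k standard_carrier) module" where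
  "standard_module \<delta> l n m \<mu> = tensor_module (group_ring (sym_product l m))
     (index_left_ideal \<delta> l n m) (index_right_action \<delta> l n m) (specht_product l m \<mu>)"

end

theory Submission
  imports Defs
begin

text \<open>
  A diagram \<open>p\<close> is encoded by the relation \<open>drel p\<close> of all pairs \<open>(A, B)\<close> of sets of upper and lower
  vertices such that \<open>A\<close> and \<open>B\<close> together form a union of parts. This relation determines \<open>p\<close>, and the
  product of diagrams becomes the composition of relations.

  A diagram is called uniform if each of its parts has as many upper as lower vertices, and at most
  \<open>l\<close> of each. Diagrams with the same propagating vector generate the same ideal of the tonal
  partition algebra, and therefore the cap ideal consists of the elements that vanish on the uniform
  diagrams. A vector \<open>m\<close> in \<open>h\<close> satisfies \<open>r\<^sub>m = n\<close>, so that the standard modules for \<open>m\<close> only involve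
  uniform diagrams and are annihilated by the cap ideal.

  The uniform diagrams act on themselves by partial injections. Over the complex numbers this
  representation of the quotient is faithful and closed under adjoints, so that left ideals have
  orthogonal complements. As a right module over the group algebra, the left ideal of \<open>a\<close> is free on
  the possible upper halves of diagrams, which reduces simplicity of the standard module to that of
  the Specht module. The latter holds because a group algebra element realizes the rank one operator
  \<open>v \<mapsto> \<langle>v, e\<^sub>s\<rangle> e\<^sub>r\<close> for any two polytabloids \<open>e\<^sub>r\<close> and \<open>e\<^sub>s\<close>, and some combination of these is the identity.
\<close>



section \<open>Diagrams as relations between subsets\<close>

text \<open>The parts of a product are classes of a transitive closure and awkward to compute.
  Unions of parts are not: a set is a union of parts of a finest coarsening exactly when it splits
  none of the given parts. In the stacked picture such a set is a triple of layers, so associativity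
  is inherited from relations, and each loop contributes a factor 2 to the number of possible middle
  layers.

  A uniform diagram relates the empty set only to itself. Hence no loop arises in a product with a
  uniform factor, \<delta> disappears from the quotient, and one argument covers all values of
  \<delta>. The remaining obstacle is that a product of uniform diagrams may be nonuniform or have
  fewer parts. Keeping only products that lose no part turns left multiplication into partial
  injections, with the flipped diagrams as adjoints; faithfulness follows from a diagram with the
  most parts in the support.

  Nonvanishing in tensor products is detected by functionals that kill the relations. Orthogonal
  bases serve twice: for complements of left ideals and for expanding the identity of a Specht
  module.\<close>

definition unions :: "'a set set \<Rightarrow> 'a set set" where
  "unions P = Union ` Pow P"

lemma mem_unions_iff:
  assumes "partition_on A P"
  shows "Z \<in> unions P \<longleftrightarrow> Z \<subseteq> A \<and> (\<forall>s\<in>P. s \<subseteq> Z \<or> s \<inter> Z = {})"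
proof
  assume "Z \<in> unions P"
  then obtain F where F: "F \<subseteq> P" "Z = \<Union>F" unfolding unions_def by auto
  have "s \<subseteq> Z \<or> s \<inter> Z = {}" if "s \<in> P" for s
    using partition_onD2[OF assms] that F unfolding disjoint_def by blast
  then show "Z \<subseteq> A \<and> (\<forall>s\<in>P. s \<subseteq> Z \<or> s \<inter> Z = {})"
    using partition_onD1[OF assms] F by auto
next
  assume Z: "Z \<subseteq> A \<and> (\<forall>s\<in>P. s \<subseteq> Z \<or> s \<inter> Z = {})"
  have "x \<in> \<Union>{s \<in> P. s \<subseteq> Z}" if x: "x \<in> Z" for x
  proof -
    obtain s where "s \<in> P" "x \<in> s" using x Z partition_onD1[OF assms] by (metis UnionE subsetD)
    then have "s \<subseteq> Z" using Z x by (metis IntI empty_iff)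
    then show ?thesis using \<open>s \<in> P\<close> \<open>x \<in> s\<close> by blast
  qed
  then have "Z = \<Union>{s \<in> P. s \<subseteq> Z}" by (intro subset_antisym subsetI) auto
  then show "Z \<in> unions P" unfolding unions_def by blast
qed

lemma part_in_unions: "s \<in> P \<Longrightarrow> s \<in> unions P"
  unfolding unions_def by (metis Pow_iff Sup_insert Sup_empty Un_empty_right empty_subsetI image_eqI insert_subset)

lemma empty_in_unions: "{} \<in> unions P"
  unfolding unions_def by (metis Pow_bottom Sup_empty image_eqI)

text \<open>Parts are the minimal nonempty unions of parts: some part \<open>u\<close> of
  \<open>Q\<close> lies inside \<open>s\<close>, and \<open>u\<close>, being a union of parts of
  \<open>P\<close> that meets \<open>s\<close>, contains \<open>s\<close>.\<close>

lemma unions_inj_aux: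
  assumes "partition_on A P" "partition_on B Q" "unions P = unions Q" "s \<in> P"
  shows "s \<in> Q"
proof -
  have ne: "s \<noteq> {}" using assms(1,4) partition_onD3 by auto
  obtain F where F: "F \<subseteq> Q" "s = \<Union>F"
    using part_in_unions[OF assms(4)] assms(3) unfolding unions_def by auto
  obtain u where u: "u \<in> F" "u \<noteq> {}" using ne F by blast
  have "u \<in> unions P" using u F assms(3) part_in_unions by blast
  then have "s \<subseteq> u \<or> s \<inter> u = {}" using mem_unions_iff[OF assms(1)] assms(4) by blast
  then have "s = u" using u F by blast
  then show ?thesis using u F by blast
qed

lemma unions_inj:
  assumes "partition_on A P" "partition_on B Q" "unions P = unions Q"
  shows "P = Q"
  using unions_inj_aux[OF assms] unions_inj_aux[OF assms(2,1) assms(3)[symmetric]] by blast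

lemma inj_on_Union_partition:
  assumes "partition_on A P"
  shows "inj_on Union (Pow P)"
proof (rule inj_onI)
  have *: "F \<subseteq> G" if h: "F \<subseteq> P" "G \<subseteq> P" "\<Union>F = \<Union>G" for F G
  proof
    fix s assume s: "s \<in> F"
    then have "s \<noteq> {}" using h partition_onD3[OF assms] by auto
    then obtain u where "u \<in> G" "s \<inter> u \<noteq> {}" using s h(3) by blast
    then have "s = u" using partition_onD2[OF assms] s h unfolding disjoint_def by blast
    then show "s \<in> G" using \<open>u \<in> G\<close> by simp
  qed
  fix F G assume "F \<in> Pow P" "G \<in> Pow P" "\<Union>F = \<Union>G"
  then show "F = G" using * by (metis Pow_iff subset_antisym)
qed

lemma card_unions:
  assumes "partition_on A P" "finite P"
  shows "card (unions P) = 2 ^ card P"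
  unfolding unions_def using card_image[OF inj_on_Union_partition[OF assms(1)]] card_Pow[OF assms(2)]
  by simp

lemma unions_vimage: "unions ((\<lambda>s. g -` s) ` S - {{}}) = (\<lambda>s. g -` s) ` unions S"
proof (intro subset_antisym subsetI)
  fix Z assume "Z \<in> unions ((\<lambda>s. g -` s) ` S - {{}})"
  then obtain F where F: "F \<subseteq> (\<lambda>s. g -` s) ` S" "Z = \<Union>F" unfolding unions_def by auto
  then obtain G where G: "G \<subseteq> S" "F = (\<lambda>s. g -` s) ` G" by (meson subset_imageE)
  have "Z = g -` \<Union>G" using F G by auto
  then show "Z \<in> (\<lambda>s. g -` s) ` unions S" using G unfolding unions_def by blast
next
  fix Z assume "Z \<in> (\<lambda>s. g -` s) ` unions S"
  then obtain G where G: "G \<subseteq> S" "Z = g -` \<Union>G" unfolding unions_def by auto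
  have "Z = \<Union>((\<lambda>s. g -` s) ` G - {{}})" using G by auto
  moreover have "(\<lambda>s. g -` s) ` G - {{}} \<subseteq> (\<lambda>s. g -` s) ` S - {{}}" using G by auto
  ultimately show "Z \<in> unions ((\<lambda>s. g -` s) ` S - {{}})" unfolding unions_def by blast
qed

lemma partition_on_vimage:
  assumes "partition_on A P"
  shows "partition_on (g -` A) ((\<lambda>s. g -` s) ` P - {{}})"
proof (rule partition_onI)
  show "\<Union>((\<lambda>s. g -` s) ` P - {{}}) = g -` A" using partition_onD1[OF assms] by auto
next
  fix p q assume "p \<in> (\<lambda>s. g -` s) ` P - {{}}" "q \<in> (\<lambda>s. g -` s) ` P - {{}}" "p \<noteq> q"
  then obtain s t where "s \<in> P" "t \<in> P" "p = g -` s" "q = g -` t" by blast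
  moreover from this have "s \<noteq> t" using \<open>p \<noteq> q\<close> by blast
  ultimately show "disjnt p q" using partition_onD2[OF assms] unfolding disjoint_def disjnt_def by blast
qed auto

text \<open>A nonempty proper subset \<open>Z\<close> that splits no member of \<open>F\<close>
  gives the partition into \<open>Z\<close> and its complement, which every part of the finest
  coarsening has to respect.\<close>

lemma unions_finest_coarsening:
  "unions (finest_coarsening F) = {Z. Z \<subseteq> \<Union>F \<and> (\<forall>s\<in>F. s \<subseteq> Z \<or> s \<inter> Z = {})}"
proof (intro subset_antisym subsetI)
  note fc = finest_coarsening[of F]
  fix Z assume Z: "Z \<in> unions (finest_coarsening F)"
  have "s \<subseteq> Z \<or> s \<inter> Z = {}" if s: "s \<in> F" for s
  proof (cases "s = {}")
    case False
    then obtain u where "u \<in> finest_coarsening F" "s \<subseteq> u" using finest_coarsening(2)[OF s] by metis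
    then show ?thesis using Z mem_unions_iff[OF fc(1), of Z] by blast
  qed simp
  then show "Z \<in> {Z. Z \<subseteq> \<Union>F \<and> (\<forall>s\<in>F. s \<subseteq> Z \<or> s \<inter> Z = {})}"
    using Z mem_unions_iff[OF fc(1), of Z] by blast
next
  note fc = finest_coarsening[of F]
  fix Z assume "Z \<in> {Z. Z \<subseteq> \<Union>F \<and> (\<forall>s\<in>F. s \<subseteq> Z \<or> s \<inter> Z = {})}"
  then have Z: "Z \<subseteq> \<Union>F" "\<And>s. s \<in> F \<Longrightarrow> s \<subseteq> Z \<or> s \<inter> Z = {}" by auto
  show "Z \<in> unions (finest_coarsening F)"
  proof (cases "Z = {} \<or> Z = \<Union>F")
    case True
    moreover have "\<Union>F \<in> unions (finest_coarsening F)"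
      using partition_onD1[OF fc(1)] unfolding unions_def by auto
    ultimately show ?thesis using empty_in_unions by auto
  next
    case False
    define Q where "Q = {Z, \<Union>F - Z}"
    have Q: "partition_on (\<Union>F) Q"
      by (rule partition_onI) (use Z(1) False in \<open>auto simp: Q_def disjnt_def\<close>)
    have "\<exists>v\<in>Q. s \<subseteq> v" if "s \<in> F" for s
      using Z(2)[OF that] Union_upper[OF that] unfolding Q_def by auto
    then have "\<forall>s\<in>F. \<exists>v\<in>Q. s \<subseteq> v" by metis
    then have "\<exists>v\<in>Q. u \<subseteq> v" if "u \<in> finest_coarsening F" for u using finest_coarsening(3)[OF Q _ that] by metis
    then have "u \<subseteq> Z \<or> u \<inter> Z = {}" if "u \<in> finest_coarsening F" for u
      using that unfolding Q_def by auto
    then show ?thesis using mem_unions_iff[OF fc(1), of Z] Z(1) by metis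
  qed
qed

section \<open>The relation of a diagram and its cardinality\<close>

definition drel :: "diagram \<Rightarrow> (nat set \<times> nat set) set" where
  "drel p = {(A, B). A <+> B \<in> unions p}"

lemma Plus_eq_iff: "(Z :: ('a + 'b) set) = A <+> B \<longleftrightarrow> Inl -` Z = A \<and> Inr -` Z = B"
proof
  assume "Inl -` Z = A \<and> Inr -` Z = B"
  then show "Z = A <+> B" by (auto simp: Plus_def image_iff) (metis sum.exhaust)
qed auto

lemma Plus_inject: "A <+> B = C <+> D \<longleftrightarrow> A = C \<and> B = D"
  by (metis Plus_eq_iff)

lemma Plus_vimages: "(Inl -` Z) <+> (Inr -` Z) = Z"
  by (metis Plus_eq_iff)

lemma diagrams_finite: "p \<in> diagrams n m \<Longrightarrow> finite p"
  unfolding diagrams_def using finite_elements[of "{1..n} <+> {1..m}" p] by auto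

lemma finite_diagrams: "finite (diagrams n m)"
proof (rule finite_subset)
  show "diagrams n m \<subseteq> Pow (Pow ({1..n} <+> {1..m}))"
    unfolding diagrams_def partition_on_def by auto
qed simp

lemma drel_iff:
  assumes "p \<in> diagrams n m"
  shows "(A, B) \<in> drel p \<longleftrightarrow> A \<subseteq> {1..n} \<and> B \<subseteq> {1..m} \<and>
    (\<forall>s\<in>p. s \<subseteq> A <+> B \<or> s \<inter> (A <+> B) = {})"
proof -
  have eq: "A <+> B \<subseteq> {1..n} <+> {1..m} \<longleftrightarrow> A \<subseteq> {1..n} \<and> B \<subseteq> {1..m}"
    unfolding Plus_def by blast
  have P: "partition_on ({1..n} <+> {1..m}) p" using assms unfolding diagrams_def by simp
  show ?thesis unfolding drel_def mem_Collect_eq prod.case mem_unions_iff[OF P] eq conj_assoc ..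
qed

lemma drel_subset: "p \<in> diagrams n m \<Longrightarrow> (A, B) \<in> drel p \<Longrightarrow> A \<subseteq> {1..n} \<and> B \<subseteq> {1..m}"
  by (simp add: drel_iff)

lemma drel_part:
  assumes "s \<in> p"
  shows "(Inl -` s, Inr -` s) \<in> drel p"
  using part_in_unions[OF assms] unfolding drel_def by (simp add: Plus_vimages)

lemma unions_eq_drel: "unions p = (\<lambda>(A, B). A <+> B) ` drel p"
proof -
  have "Z \<in> (\<lambda>(A, B). A <+> B) ` drel p" if "Z \<in> unions p" for Z
    by (rule rev_image_eqI[of "(Inl -` Z, Inr -` Z)"]) (use that in \<open>simp_all add: drel_def Plus_vimages\<close>)
  then show ?thesis unfolding drel_def by auto
qed

lemma drel_inj:
  assumes "p \<in> diagrams n m" "q \<in> diagrams n' m'" "drel p = drel q"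
  shows "p = q"
  using assms unions_inj[of _ p _ q] unfolding diagrams_def unions_eq_drel by auto

lemma finite_drel:
  assumes "p \<in> diagrams n m"
  shows "finite (drel p)"
  by (rule finite_subset[of _ "Pow {1..n} \<times> Pow {1..m}"]) (use drel_subset[OF assms] in auto)

text \<open>Turns the number of parts into a cardinality of relations, where it can be compared
  along composites.\<close>

lemma card_drel:
  assumes "p \<in> diagrams n m"
  shows "card (drel p) = 2 ^ card p"
proof -
  have "inj_on (\<lambda>(A, B). A <+> B) (drel p)"
    unfolding inj_on_def split_paired_Ball_Sigma split_paired_All Ball_def prod.case Plus_inject by simp
  then have "card (unions p) = card (drel p)" unfolding unions_eq_drel by (rule card_image)
  moreover have "partition_on ({1..n} <+> {1..m}) p" using assms unfolding diagrams_def by simp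
  ultimately show ?thesis using card_unions[OF _ diagrams_finite[OF assms]] by metis
qed

lemma drel_empty: "({}, {}) \<in> drel p"
  unfolding drel_def using empty_in_unions[of p] by (simp add: Plus_def)

text \<open>Closure under differences is what later turns triviality over the empty set into
  functionality of the relation of a uniform diagram.\<close>

lemma drel_Diff:
  assumes "p \<in> diagrams n m" "(A, B) \<in> drel p" "(A', B') \<in> drel p"
  shows "(A - A', B - B') \<in> drel p"
proof -
  have eq: "(A - A') <+> (B - B') = (A <+> B) - (A' <+> B')" by auto
  have "s \<subseteq> (A <+> B) - (A' <+> B') \<or> s \<inter> ((A <+> B) - (A' <+> B')) = {}" if "s \<in> p" for s
  proof -
    have "s \<subseteq> A <+> B \<or> s \<inter> (A <+> B) = {}" "s \<subseteq> A' <+> B' \<or> s \<inter> (A' <+> B') = {}"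
      using assms that drel_iff by blast+
    then show ?thesis by blast
  qed
  moreover have "A \<subseteq> {1..n}" "B \<subseteq> {1..m}" using drel_subset[OF assms(1,2)] by auto
  ultimately show ?thesis unfolding drel_iff[OF assms(1)] eq by (meson Diff_subset subset_trans)
qed

subsection \<open>Composition\<close>

lemma Union_stack:
  assumes "p \<in> diagrams n m" "p' \<in> diagrams m r"
  shows "\<Union>((`) (map_sum id Inl) ` p \<union> (`) Inr ` p') = {1..n} <+> ({1..m} <+> {1..r})"
proof -
  have "\<Union>p = {1..n} <+> {1..m}" "\<Union>p' = {1..m} <+> {1..r}"
    using assms partition_onD1 unfolding diagrams_def by auto
  then have "\<Union>((`) (map_sum id Inl) ` p \<union> (`) Inr ` p') =
    map_sum id Inl ` ({1..n} <+> {1..m}) \<union> Inr ` ({1..m} <+> {1..r})" by (metis Union_Un_distrib image_Union)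
  then show ?thesis by (auto simp: Plus_def image_Un image_image)
qed

lemma partition_on_stack:
  assumes "p \<in> diagrams n m" "p' \<in> diagrams m r"
  shows "partition_on ({1..n} <+> ({1..m} <+> {1..r})) (stack p p')"
  unfolding stack_def using finest_coarsening(1) Union_stack[OF assms] by metis

text \<open>The stack is generated by the images of the parts of both diagrams, so the condition not
  to split them separates into one on the upper two layers and one on the lower two.\<close>

lemma unions_stack:
  assumes "p \<in> diagrams n m" "p' \<in> diagrams m r"
  shows "A <+> (M <+> B) \<in> unions (stack p p') \<longleftrightarrow> (A, M) \<in> drel p \<and> (M, B) \<in> drel p'"
proof -
  let ?Z = "A <+> (M <+> B)"
  have v: "map_sum id Inl -` ?Z = A <+> M" unfolding Plus_eq_iff by (auto simp: Plus_def)
  have 1: "map_sum id Inl ` s \<subseteq> ?Z \<longleftrightarrow> s \<subseteq> A <+> M" for s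
    unfolding image_subset_iff_subset_vimage v ..
  have 2: "map_sum id Inl ` s \<inter> ?Z = {} \<longleftrightarrow> s \<inter> (A <+> M) = {}" for s
    unfolding v[symmetric] by (auto simp: disjoint_iff)
  have 3: "Inr ` s \<subseteq> ?Z \<longleftrightarrow> s \<subseteq> M <+> B" for s :: "(nat + nat) set" by (auto simp: Plus_def)
  have 4: "Inr ` s \<inter> ?Z = {} \<longleftrightarrow> s \<inter> (M <+> B) = {}" for s :: "(nat + nat) set" by (auto simp: Plus_def)
  have 5: "?Z \<subseteq> {1..n} <+> ({1..m} <+> {1..r}) \<longleftrightarrow> A \<subseteq> {1..n} \<and> M \<subseteq> {1..m} \<and> B \<subseteq> {1..r}"
    by (auto 0 3)
  show ?thesis
    unfolding stack_def unions_finest_coarsening mem_Collect_eq Union_stack[OF assms] drel_iff[OF assms(1)]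
      drel_iff[OF assms(2)] 5 ball_Un ball_simps 1 2 3 4
    by (simp only: conj_ac conj_absorb conj_left_absorb)
qed

lemma diagram_comp_in:
  assumes "p \<in> diagrams n m" "p' \<in> diagrams m r"
  shows "diagram_comp p p' \<in> diagrams n r"
proof -
  have "map_sum id Inr -` ({1..n} <+> ({1..m} <+> {1..r})) = {1..n} <+> {1..r}"
    unfolding Plus_eq_iff by (auto simp: Plus_def)
  then show ?thesis
    using partition_on_vimage[OF partition_on_stack[OF assms], of "map_sum id Inr"]
    unfolding diagrams_def diagram_comp_def by simp
qed

lemma drel_comp:
  assumes "p \<in> diagrams n m" "p' \<in> diagrams m r"
  shows "drel (diagram_comp p p') = drel p O drel p'"
proof -
  have v: "map_sum id Inr -` (A <+> (M <+> B)) = A <+> B" for A M B :: "nat set"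
    unfolding Plus_eq_iff by (auto simp: Plus_def)
  have "(A, B) \<in> drel (diagram_comp p p') \<longleftrightarrow> (\<exists>Z\<in>unions (stack p p'). A <+> B = map_sum id Inr -` Z)" for A B
    unfolding drel_def diagram_comp_def unions_vimage by auto
  also have "\<dots> A B \<longleftrightarrow> (\<exists>M. A <+> (M <+> B) \<in> unions (stack p p'))" for A B
  proof
    assume "\<exists>Z\<in>unions (stack p p'). A <+> B = map_sum id Inr -` Z"
    then obtain Z where Z: "Z \<in> unions (stack p p')" "A <+> B = map_sum id Inr -` Z" by blast
    obtain A' M B' where X': "Z = A' <+> (M <+> B')" by (metis Plus_vimages)
    then have "A' = A" "B' = B" using Z(2) unfolding X' v by (metis Plus_eq_iff)+
    then show "\<exists>M. A <+> (M <+> B) \<in> unions (stack p p')" using Z X' by blast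
  qed (use v in metis)
  finally show ?thesis using unions_stack[OF assms] by auto
qed

text \<open>Parts reaching outside \<open>K\<close> are determined by the trace outside
  \<open>K\<close>; those inside \<open>K\<close> can be chosen freely. For \<open>K\<close> the
  middle row, the free parts are the loops.\<close>

lemma card_unions_fibre:
  assumes P: "partition_on A P" "finite P" and X0: "X0 \<in> unions P"
  shows "card {Z \<in> unions P. Z - K = X0 - K} = 2 ^ card {s \<in> P. s \<subseteq> K}"
proof -
  obtain F0 where F0: "F0 \<subseteq> P" "X0 = \<Union>F0" using X0 unfolding unions_def by auto
  let ?L = "{s \<in> P. s \<subseteq> K}"
  define h where "h G = \<Union>((F0 - ?L) \<union> G)" for G
  have "inj_on h (Pow ?L)"
  proof (rule inj_onI)
    fix G G' assume GG: "G \<in> Pow ?L" "G' \<in> Pow ?L" "h G = h G'"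
    have "(F0 - ?L) \<union> G = (F0 - ?L) \<union> G'"
      by (rule inj_onD[OF inj_on_Union_partition[OF P(1)]]) (use GG F0 in \<open>auto simp: h_def\<close>)
    then show "G = G'" using GG by auto
  qed
  moreover have "h ` Pow ?L = {Z \<in> unions P. Z - K = X0 - K}"
  proof (intro subset_antisym subsetI)
    fix Z assume "Z \<in> h ` Pow ?L"
    then obtain G where G: "G \<subseteq> ?L" "Z = h G" by auto
    have "Z \<in> unions P" unfolding G(2) h_def unions_def using G(1) F0(1) by blast
    moreover have "Z - K = X0 - K" unfolding G(2) h_def F0(2) using G(1) F0(1) by blast
    ultimately show "Z \<in> {Z \<in> unions P. Z - K = X0 - K}" by simp
  next
    fix Z assume "Z \<in> {Z \<in> unions P. Z - K = X0 - K}"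
    then obtain F where F: "F \<subseteq> P" "Z = \<Union>F" "Z - K = X0 - K" unfolding unions_def by auto
    \<comment> \<open>A point of \<open>s\<close> outside \<open>K\<close> lies in both unions and
      singles out \<open>s\<close> among the parts.\<close>
    have sub: "s \<in> G'" if h: "s \<in> G" "\<not> s \<subseteq> K" "G \<subseteq> P" "G' \<subseteq> P" "\<Union>G - K = \<Union>G' - K" for s G G'
    proof -
      obtain x where x: "x \<in> s" "x \<notin> K" using h by blast
      then obtain u where "u \<in> G'" "x \<in> u" using h by blast
      then have "u = s" using h x partition_onD2[OF P(1)] unfolding disjoint_def by blast
      then show ?thesis using \<open>u \<in> G'\<close> by simp
    qed
    have "s \<in> F0 - ?L" if "s \<in> F - ?L" for s using sub[of s F F0] that F F0 by auto
    moreover have "s \<in> F - ?L" if "s \<in> F0 - ?L" for s using sub[of s F0 F] that F F0 by auto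
    ultimately have "F - ?L = F0 - ?L" by (intro subset_antisym subsetI)
    then have "F = (F0 - ?L) \<union> (F \<inter> ?L)" by blast
    then have "Z = h (F \<inter> ?L)" unfolding h_def F(2) by metis
    then show "Z \<in> h ` Pow ?L" by blast
  qed
  ultimately show ?thesis using card_image[of h "Pow ?L"] card_Pow[of ?L] P(2) by simp
qed

text \<open>For a fixed related pair the middle sets \<open>M\<close> correspond to the unions in
  the stack with a prescribed trace on the outer rows, and \<open>card_unions_fibre\<close> counts
  these.\<close>

lemma diagram_loops_card:
  assumes "p \<in> diagrams n m" "p' \<in> diagrams m r" "(A, B) \<in> drel (diagram_comp p p')"
  shows "card {M. (A, M) \<in> drel p \<and> (M, B) \<in> drel p'} = 2 ^ diagram_loops p p'"
proof -
  obtain M0 where M0: "(A, M0) \<in> drel p" "(M0, B) \<in> drel p'" using assms drel_comp by blast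
  let ?K = "range (Inr \<circ> Inl) :: (nat + nat + nat) set"
  let ?X0 = "A <+> (M0 <+> B)"
  have fin: "finite (stack p p')"
    using finite_elements[OF _ partition_on_stack[OF assms(1,2)]] by auto
  have X0: "?X0 \<in> unions (stack p p')" using unions_stack[OF assms(1,2)] M0 by blast
  have K: "(U <+> (M <+> V)) - ?K = ?X0 - ?K \<longleftrightarrow> U = A \<and> V = B" for U M V
    unfolding set_eq_iff by (auto simp: Plus_def image_iff)
  have "(\<lambda>M. A <+> (M <+> B)) ` {M. (A, M) \<in> drel p \<and> (M, B) \<in> drel p'} =
      {Z \<in> unions (stack p p'). Z - ?K = ?X0 - ?K}" (is "?f ` ?S = ?T")
  proof (intro subset_antisym subsetI)
    fix Z assume Z: "Z \<in> ?T"
    obtain U M V where X': "Z = U <+> (M <+> V)" by (metis Plus_vimages)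
    then have "U = A" "V = B" using Z K by auto
    then show "Z \<in> ?f ` ?S" using Z X' unions_stack[OF assms(1,2)] by auto
  qed (use unions_stack[OF assms(1,2)] in auto)
  moreover have "inj_on ?f ?S" by (intro inj_onI) (auto simp: Plus_inject)
  ultimately show ?thesis
    using card_unions_fibre[OF partition_on_stack[OF assms(1,2)] fin X0, of ?K] card_image[of ?f ?S]
    unfolding diagram_loops_def by simp
qed

text \<open>The pair of empty sets is always related, so its middle sets can be counted; if there is
  only one, no loop is possible.\<close>

lemma diagram_loops_eq_0:
  assumes "p \<in> diagrams n m" "p' \<in> diagrams m r"
    and "\<And>M. ({}, M) \<in> drel p \<Longrightarrow> (M, {}) \<in> drel p' \<Longrightarrow> M = {}"
  shows "diagram_loops p p' = 0"
proof -
  have "{M. ({}, M) \<in> drel p \<and> (M, {}) \<in> drel p'} = {{}}" using assms(3) drel_empty by blast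
  moreover have "({}, {}) \<in> drel (diagram_comp p p')" by (rule drel_empty)
  ultimately have "(1::nat) = 2 ^ diagram_loops p p'" using diagram_loops_card[OF assms(1,2)] by fastforce
  then show ?thesis by (metis One_nat_def nat_power_eq_Suc_0_iff numeral_2_eq_2 n_not_Suc_n)
qed

lemma diagram_comp_assoc:
  assumes "p \<in> diagrams n m" "q \<in> diagrams m r" "u \<in> diagrams r t"
  shows "diagram_comp (diagram_comp p q) u = diagram_comp p (diagram_comp q u)"
proof (rule drel_inj)
  show "diagram_comp (diagram_comp p q) u \<in> diagrams n t" "diagram_comp p (diagram_comp q u) \<in> diagrams n t"
    using assms diagram_comp_in by metis+
  show "drel (diagram_comp (diagram_comp p q) u) = drel (diagram_comp p (diagram_comp q u))"
    using drel_comp[OF assms(1,2)] drel_comp[OF assms(2,3)] drel_comp[OF diagram_comp_in[OF assms(1,2)] assms(3)]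
      drel_comp[OF assms(1) diagram_comp_in[OF assms(2,3)]] by (simp add: O_assoc)
qed

text \<open>Both sides are binary logarithms of the number of pairs of subsets of the two inner rows
  that are compatible with the empty set on the two outer rows.\<close>

lemma diagram_loops_assoc:
  assumes p: "p \<in> diagrams n m" and q: "q \<in> diagrams m r" and u: "u \<in> diagrams r t"
  shows "diagram_loops p q + diagram_loops (diagram_comp p q) u =
    diagram_loops q u + diagram_loops p (diagram_comp q u)"
proof -
  let ?c = diagram_comp
  let ?S = "{(M, M'). ({}, M) \<in> drel p \<and> (M, M') \<in> drel q \<and> (M', {}) \<in> drel u}"
  have e: "({}, {}) \<in> drel x" for x by (rule drel_empty)
  let ?A = "{M'. ({}, M') \<in> drel (?c p q) \<and> (M', {}) \<in> drel u}"
  let ?B = "{M. ({}, M) \<in> drel p \<and> (M, {}) \<in> drel (?c q u)}"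
  have finA: "finite ?A" using finite_subset[of ?A "Pow {1..r}"] drel_subset[OF u] by auto
  have finB: "finite ?B" using finite_subset[of ?B "Pow {1..m}"] drel_subset[OF p] by auto
  have fin1: "finite {M. ({}, M) \<in> drel p \<and> P M}" for P
    by (rule finite_subset[of _ "Pow {1..m}"]) (use drel_subset[OF p] in auto)
  have fin2: "finite {M'. P M' \<and> (M', {}) \<in> drel u}" for P
    by (rule finite_subset[of _ "Pow {1..r}"]) (use drel_subset[OF u] in auto)
  have "bij_betw (\<lambda>(M', M). (M, M')) (SIGMA M':?A. {M. ({}, M) \<in> drel p \<and> (M, M') \<in> drel q}) ?S"
    by (rule bij_betwI[of _ _ _ "\<lambda>(M, M'). (M', M)"]) (auto simp: drel_comp[OF p q])
  then have "card ?S = (\<Sum>M'\<in>?A. card {M. ({}, M) \<in> drel p \<and> (M, M') \<in> drel q})"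
    using finA fin1 by (simp add: bij_betw_same_card[symmetric])
  also have "\<dots> = (\<Sum>M'\<in>?A. 2 ^ diagram_loops p q)"
    by (intro sum.cong refl diagram_loops_card[OF p q]) auto
  also have "\<dots> = 2 ^ (diagram_loops p q + diagram_loops (?c p q) u)"
    using diagram_loops_card[OF diagram_comp_in[OF p q] u e] by (simp add: power_add)
  finally have 1: "card ?S = 2 ^ (diagram_loops p q + diagram_loops (?c p q) u)" .
  have "?S = (SIGMA M:?B. {M'. (M, M') \<in> drel q \<and> (M', {}) \<in> drel u})"
    by (auto simp: drel_comp[OF q u])
  then have "card ?S = (\<Sum>M\<in>?B. card {M'. (M, M') \<in> drel q \<and> (M', {}) \<in> drel u})"
    using finB fin2 by simp
  also have "\<dots> = (\<Sum>M\<in>?B. 2 ^ diagram_loops q u)"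
    by (intro sum.cong refl diagram_loops_card[OF q u]) auto
  also have "\<dots> = 2 ^ (diagram_loops q u + diagram_loops p (?c q u))"
    using diagram_loops_card[OF p diagram_comp_in[OF q u] e] by (simp add: power_add)
  finally show ?thesis using 1 by (metis power_inject_exp one_less_numeral_iff semiring_norm(76))
qed


subsection \<open>Diagrams given by labellings\<close>

text \<open>Diagrams given by labels are partitions by construction, and a union of parts is
  described by a set of labels. The connecting diagrams of \<open>same_vector_in_ideal\<close> are
  built this way.\<close>

definition label_diagram :: "nat \<Rightarrow> nat \<Rightarrow> (nat \<Rightarrow> 'c) \<Rightarrow> (nat \<Rightarrow> 'c) \<Rightarrow> diagram" where
  "label_diagram n m f g =
    range (\<lambda>c. {i \<in> {1..n}. f i = c} <+> {j \<in> {1..m}. g j = c}) - {{}}"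

lemma label_diagram_in: "label_diagram n m f g \<in> diagrams n m"
proof -
  define P where "P c = {i \<in> {1..n}. f i = c} <+> {j \<in> {1..m}. g j = c}" for c
  have "partition_on ({1..n} <+> {1..m}) (range P - {{}})"
  proof (rule partition_onI)
    have "x \<in> \<Union>(range P)" if h: "x \<in> {1..n} <+> {1..m}" for x
    proof -
      have "x \<in> P (case_sum f g x)" using h unfolding P_def by (cases x) auto
      then show ?thesis by blast
    qed
    moreover have "P c \<subseteq> {1..n} <+> {1..m}" for c unfolding P_def by auto
    ultimately have "\<Union>(range P) = {1..n} <+> {1..m}" by (intro subset_antisym subsetI) auto
    moreover have "\<Union>(range P - {{}}) = \<Union>(range P)" by blast
    ultimately show "\<Union>(range P - {{}}) = {1..n} <+> {1..m}" by metis
  next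
    fix p q assume "p \<in> range P - {{}}" "q \<in> range P - {{}}" "p \<noteq> q"
    then obtain c d where "p = P c" "q = P d" by blast
    moreover from this have "c \<noteq> d" using \<open>p \<noteq> q\<close> by blast
    ultimately show "disjnt p q" unfolding disjnt_def P_def by (auto simp: Plus_def)
  qed simp
  then show ?thesis unfolding diagrams_def label_diagram_def P_def by simp
qed

lemma drel_label_diagram:
  "drel (label_diagram n m f g) = range (\<lambda>S. ({i \<in> {1..n}. f i \<in> S}, {j \<in> {1..m}. g j \<in> S}))"
proof -
  have "(A, B) \<in> drel (label_diagram n m f g) \<longleftrightarrow> (A, B) \<in> range (\<lambda>S. ({i \<in> {1..n}. f i \<in> S}, {j \<in> {1..m}. g j \<in> S}))" for A B
  proof
    assume "(A, B) \<in> drel (label_diagram n m f g)"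
    then obtain F where F: "F \<subseteq> label_diagram n m f g" "A <+> B = \<Union>F"
      unfolding drel_def unions_def by auto
    let ?S = "{c. {i \<in> {1..n}. f i = c} <+> {j \<in> {1..m}. g j = c} \<in> F}"
    have Inl: "f i \<in> ?S" if h: "i \<in> A" for i
    proof -
      obtain s where "s \<in> F" "Inl i \<in> s" using InlI[OF h, of B] unfolding F(2) by (rule UnionE)
      then show ?thesis using F(1) unfolding label_diagram_def by auto
    qed
    have Inr: "g i \<in> ?S" if h: "i \<in> B" for i
    proof -
      obtain s where "s \<in> F" "Inr i \<in> s" using InrI[OF h, of A] unfolding F(2) by (rule UnionE)
      then show ?thesis using F(1) unfolding label_diagram_def by auto
    qed
    have sub: "A \<subseteq> {1..n} \<and> B \<subseteq> {1..m}"
      using \<open>(A, B) \<in> drel (label_diagram n m f g)\<close> drel_subset[OF label_diagram_in] by blast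
    have "i \<in> A" if "i \<in> {1..n}" "f i \<in> ?S" for i
    proof -
      have "Inl i \<in> \<Union>F" using that by blast
      then show ?thesis using F(2) by auto
    qed
    moreover have "i \<in> B" if "i \<in> {1..m}" "g i \<in> ?S" for i
    proof -
      have "Inr i \<in> \<Union>F" using that by blast
      then show ?thesis using F(2) by auto
    qed
    ultimately have "A = {i \<in> {1..n}. f i \<in> ?S}" "B = {j \<in> {1..m}. g j \<in> ?S}" using Inl Inr sub by blast+
    then show "(A, B) \<in> range (\<lambda>S. ({i \<in> {1..n}. f i \<in> S}, {j \<in> {1..m}. g j \<in> S}))" by blast
  next
    assume "(A, B) \<in> range (\<lambda>S. ({i \<in> {1..n}. f i \<in> S}, {j \<in> {1..m}. g j \<in> S}))"
    then obtain S where S: "A = {i \<in> {1..n}. f i \<in> S}" "B = {j \<in> {1..m}. g j \<in> S}" by auto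
    have "s \<subseteq> A <+> B \<or> s \<inter> (A <+> B) = {}" if "s \<in> label_diagram n m f g" for s
      using that unfolding label_diagram_def S by (auto simp: Plus_def)
    then show "(A, B) \<in> drel (label_diagram n m f g)" unfolding drel_iff[OF label_diagram_in] S by blast
  qed
  then show ?thesis by auto
qed

lemma card_vimage_label_part:
  "upper_size ({i \<in> {1..n}. f i = c} <+> {j \<in> {1..m}. g j = c}) = card {i \<in> {1..n}. f i = c}"
  "lower_size ({i \<in> {1..n}. f i = c} <+> {j \<in> {1..m}. g j = c}) = card {j \<in> {1..m}. g j = c}"
  unfolding upper_size_def lower_size_def by (metis Plus_eq_iff)+

lemma label_diagram_tonal:
  assumes "\<And>c. card {i \<in> {1..n}. f i = c} mod l = card {j \<in> {1..n}. g j = c} mod l"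
  shows "label_diagram n n f g \<in> tonal l n"
proof -
  have "upper_size s mod l = lower_size s mod l" if "s \<in> label_diagram n n f g" for s
  proof -
    obtain c where "s = {i \<in> {1..n}. f i = c} <+> {j \<in> {1..n}. g j = c}"
      using \<open>s \<in> _\<close> unfolding label_diagram_def by blast
    then show ?thesis using assms[of c] by (simp only: card_vimage_label_part)
  qed
  then show ?thesis unfolding tonal_def using label_diagram_in[of n n f g] by simp
qed


subsection \<open>Identity and flip\<close>

lemma diagram_id_eq: "diagram_id n = label_diagram n n id id"
proof -
  have 1: "{i \<in> {1..n}. id i = c} <+> {j \<in> {1..n}. id j = c} = (if c \<in> {1..n} then {Inl c, Inr c} else {})" for c
    by (auto simp: Plus_def)
  have "range (\<lambda>c. {i \<in> {1..n}. id i = c} <+> {j \<in> {1..n}. id j = c}) - {{}} = (\<lambda>i. {Inl i, Inr i}) ` {1..n}"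
    unfolding 1 by (auto split: if_splits)
  then show ?thesis unfolding label_diagram_def diagram_id_def by simp
qed

lemma diagram_id_in: "diagram_id n \<in> diagrams n n"
  unfolding diagram_id_eq by (rule label_diagram_in)

lemma diagram_id_tonal: "diagram_id n \<in> tonal l n"
  unfolding diagram_id_eq by (rule label_diagram_tonal) simp

lemma drel_id: "drel (diagram_id n) = Id_on (Pow {1..n})"
proof -
  have "(A, A) \<in> drel (diagram_id n)" if "A \<subseteq> {1..n}" for A
    unfolding diagram_id_eq drel_label_diagram by (rule range_eqI[of _ _ A]) (use that in auto)
  moreover have "drel (diagram_id n) \<subseteq> Id_on (Pow {1..n})"
    unfolding diagram_id_eq drel_label_diagram by (rule image_subsetI) (auto simp: Id_on_def)
  ultimately show ?thesis unfolding Id_on_def by blast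
qed

lemma Id_on_relcomp: "Domain R \<subseteq> S \<Longrightarrow> Id_on S O R = R"
  by (auto intro!: relcompI)

lemma relcomp_Id_on: "Range R \<subseteq> S \<Longrightarrow> R O Id_on S = R"
  by (auto intro!: relcompI)

lemma diagram_id_comp:
  assumes "p \<in> diagrams n m"
  shows "diagram_comp (diagram_id n) p = p" "diagram_comp p (diagram_id m) = p"
    "diagram_loops (diagram_id n) p = 0" "diagram_loops p (diagram_id m) = 0"
proof -
  note i = diagram_id_in
  show "diagram_comp (diagram_id n) p = p"
    by (rule drel_inj[OF diagram_comp_in[OF i assms] assms])
      (unfold drel_comp[OF i assms] drel_id, intro Id_on_relcomp, use drel_subset[OF assms] in blast)
  show "diagram_comp p (diagram_id m) = p"
    by (rule drel_inj[OF diagram_comp_in[OF assms i] assms])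
      (unfold drel_comp[OF assms i] drel_id, intro relcomp_Id_on, use drel_subset[OF assms] in blast)
  show "diagram_loops (diagram_id n) p = 0" by (rule diagram_loops_eq_0[OF i assms]) (auto simp: drel_id)
  show "diagram_loops p (diagram_id m) = 0" by (rule diagram_loops_eq_0[OF assms i]) (auto simp: drel_id)
qed

text \<open>Reflection in a horizontal line. On relations it is the converse, so it reverses
  products; it later provides the adjoints.\<close>

definition flip :: "diagram \<Rightarrow> diagram" where
  "flip p = (\<lambda>s. case_sum Inr Inl -` s) ` p"

lemma flip_flip [simp]: "flip (flip p) = p"
proof -
  have "case_sum Inr Inl -` (case_sum Inr Inl -` s) = s" for s :: "(nat + nat) set"
    by (auto split: sum.splits)
  then show ?thesis unfolding flip_def by (simp add: image_image)
qed

lemma case_sum_vimage_Plus: "case_sum Inr Inl -` (A <+> B) = B <+> A"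
  unfolding Plus_eq_iff by auto

lemma flip_in: "p \<in> diagrams n m \<Longrightarrow> flip p \<in> diagrams m n"
proof -
  assume "p \<in> diagrams n m"
  then have P: "partition_on ({1..n} <+> {1..m}) p" unfolding diagrams_def by simp
  have "{} \<notin> flip p" using partition_onD3[OF P] unfolding flip_def
    by (auto simp: vimage_def) (metis (no_types) ex_in_conv sum.exhaust sum.case)
  then have "flip p = (\<lambda>s. case_sum Inr Inl -` s) ` p - {{}}" unfolding flip_def by auto
  then show ?thesis using partition_on_vimage[OF P, of "case_sum Inr Inl"]
    unfolding diagrams_def by (simp add: case_sum_vimage_Plus)
qed

lemma drel_flip: "drel (flip p) = (drel p)\<inverse>"
proof -
  have sub: "(B, A) \<in> drel (flip p)" if "(A, B) \<in> drel p" for A B p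
  proof -
    obtain F where F: "F \<subseteq> p" "A <+> B = \<Union>F" using \<open>(A, B) \<in> drel p\<close> unfolding drel_def unions_def by auto
    have "B <+> A = case_sum Inr Inl -` (\<Union>F)" using F(2) case_sum_vimage_Plus by metis
    then have "B <+> A = \<Union>((\<lambda>s. case_sum Inr Inl -` s) ` F)" by auto
    then show ?thesis using F(1) unfolding drel_def unions_def flip_def by blast
  qed
  show ?thesis using sub[of _ _ p] sub[of _ _ "flip p"] by auto
qed

lemma sizes_flip:
  "upper_size (case_sum Inr Inl -` s) = lower_size s"
  "lower_size (case_sum Inr Inl -` s) = upper_size s"
  unfolding upper_size_def lower_size_def by (auto intro!: arg_cong[where f = card])

lemma flip_tonal: "p \<in> tonal l n \<Longrightarrow> flip p \<in> tonal l n"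
  unfolding tonal_def using flip_in by (fastforce simp: flip_def sizes_flip)

lemma flip_comp:
  assumes "p \<in> diagrams n m" "q \<in> diagrams m r"
  shows "flip (diagram_comp p q) = diagram_comp (flip q) (flip p)"
    "diagram_loops (flip q) (flip p) = diagram_loops p q"
proof -
  note f = flip_in[OF assms(1)] flip_in[OF assms(2)]
  show *: "flip (diagram_comp p q) = diagram_comp (flip q) (flip p)"
    by (rule drel_inj[OF flip_in[OF diagram_comp_in[OF assms]] diagram_comp_in[OF f(2,1)]])
      (simp add: drel_flip drel_comp[OF assms] drel_comp[OF f(2,1)] converse_relcomp)
  have "({}, {}) \<in> drel (diagram_comp (flip q) (flip p))" "({}, {}) \<in> drel (diagram_comp p q)"
    by (rule drel_empty)+
  then have "(2::nat) ^ diagram_loops (flip q) (flip p) = 2 ^ diagram_loops p q"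
    using diagram_loops_card[OF assms] diagram_loops_card[OF f(2,1)]
    by (fastforce simp: drel_flip conj_commute)
  then show "diagram_loops (flip q) (flip p) = diagram_loops p q" by simp
qed


subsection \<open>Tonal diagrams\<close>

lemma tonal_diagrams: "p \<in> tonal l n \<Longrightarrow> p \<in> diagrams n n"
  unfolding tonal_def by simp

lemma finite_tonal: "finite (tonal l n)"
  unfolding tonal_def using finite_diagrams by simp

lemma card_Union_parts:
  assumes "finite F" "disjoint F" "\<Union>F \<subseteq> A <+> B" "finite A" "finite B"
  shows "card (Inl -` \<Union>F) = (\<Sum>s\<in>F. upper_size s)" "card (Inr -` \<Union>F) = (\<Sum>s\<in>F. lower_size s)"
proof -
  have "card (\<Union>s\<in>F. Inl -` s) = (\<Sum>s\<in>F. card (Inl -` s))"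
  proof (rule card_UN_disjoint[OF assms(1)])
    have "Inl -` s \<subseteq> A" if "s \<in> F" for s using that assms(3) by auto
    then show "\<forall>i\<in>F. finite (Inl -` i)" using finite_subset[OF _ assms(4)] by auto
    show "\<forall>i\<in>F. \<forall>j\<in>F. i \<noteq> j \<longrightarrow> Inl -` i \<inter> Inl -` j = {}" using assms(2) unfolding disjoint_def by auto
  qed
  then show "card (Inl -` \<Union>F) = (\<Sum>s\<in>F. upper_size s)" by (simp add: vimage_Union upper_size_def)
  have "card (\<Union>s\<in>F. Inr -` s) = (\<Sum>s\<in>F. card (Inr -` s))"
  proof (rule card_UN_disjoint[OF assms(1)])
    have "Inr -` s \<subseteq> B" if "s \<in> F" for s using that assms(3) by auto
    then show "\<forall>i\<in>F. finite (Inr -` i)" using finite_subset[OF _ assms(5)] by auto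
    show "\<forall>i\<in>F. \<forall>j\<in>F. i \<noteq> j \<longrightarrow> Inr -` i \<inter> Inr -` j = {}" using assms(2) unfolding disjoint_def by auto
  qed
  then show "card (Inr -` \<Union>F) = (\<Sum>s\<in>F. lower_size s)" by (simp add: vimage_Union lower_size_def)
qed

lemma diagram_sum_sizes:
  assumes "p \<in> diagrams n m" "F \<subseteq> p"
  shows "card (Inl -` \<Union>F) = (\<Sum>s\<in>F. upper_size s)" "card (Inr -` \<Union>F) = (\<Sum>s\<in>F. lower_size s)"
proof -
  have P: "partition_on ({1..n} <+> {1..m}) p" using assms(1) unfolding diagrams_def by simp
  have "finite F" using finite_subset[OF assms(2) diagrams_finite[OF assms(1)]] .
  moreover have "disjoint F" using partition_onD2[OF P] assms(2) unfolding disjoint_def by blast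
  moreover have "\<Union>F \<subseteq> {1..n} <+> {1..m}" using partition_onD1[OF P] assms(2) by auto
  ultimately show "card (Inl -` \<Union>F) = (\<Sum>s\<in>F. upper_size s)" "card (Inr -` \<Union>F) = (\<Sum>s\<in>F. lower_size s)"
    using card_Union_parts[of F "{1..n}" "{1..m}"] by auto
qed

lemma drel_obtain_parts:
  assumes "(A, B) \<in> drel p"
  obtains F where "F \<subseteq> p" "A = Inl -` \<Union>F" "B = Inr -` \<Union>F"
proof -
  obtain F where "F \<subseteq> p" "A <+> B = \<Union>F" using assms unfolding drel_def unions_def by auto
  moreover have "A = Inl -` (A <+> B)" "B = Inr -` (A <+> B)" by auto
  ultimately show ?thesis using that by metis
qed

text \<open>The congruences for single parts add up over unions of parts. In this form the condition
  passes through a middle set, which gives closure under composition.\<close>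

lemma tonal_iff:
  "p \<in> tonal l n \<longleftrightarrow> p \<in> diagrams n n \<and> (\<forall>(A, B)\<in>drel p. card A mod l = card B mod l)"
proof (intro iffI conjI)
  assume p: "p \<in> tonal l n"
  then show d: "p \<in> diagrams n n" by (rule tonal_diagrams)
  have "card A mod l = card B mod l" if AB: "(A, B) \<in> drel p" for A B
  proof -
    obtain F where F: "F \<subseteq> p" "A = Inl -` \<Union>F" "B = Inr -` \<Union>F" using drel_obtain_parts[OF AB] by metis
    have "(\<Sum>s\<in>F. upper_size s) mod l = (\<Sum>s\<in>F. upper_size s mod l) mod l" by (simp add: mod_sum_eq)
    also have "\<dots> = (\<Sum>s\<in>F. lower_size s mod l) mod l"
    proof -
      have "upper_size s mod l = lower_size s mod l" if "s \<in> F" for s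
        using p F(1) that unfolding tonal_def by auto
      then show ?thesis by (simp cong: sum.cong)
    qed
    also have "\<dots> = (\<Sum>s\<in>F. lower_size s) mod l" by (simp add: mod_sum_eq)
    finally show ?thesis using diagram_sum_sizes[OF d F(1)] F by simp
  qed
  then show "\<forall>(A, B)\<in>drel p. card A mod l = card B mod l" by auto
next
  assume "p \<in> diagrams n n \<and> (\<forall>(A, B)\<in>drel p. card A mod l = card B mod l)"
  then show "p \<in> tonal l n"
    unfolding tonal_def upper_size_def lower_size_def using drel_part by fastforce
qed

lemma tonal_comp:
  assumes "p \<in> tonal l n" "q \<in> tonal l n"
  shows "diagram_comp p q \<in> tonal l n"
  using assms diagram_comp_in[of p n n q n] unfolding tonal_iff
  by (fastforce simp: drel_comp[of p n n q n])


section \<open>The tonal partition algebra as a ring\<close>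

abbreviation dterm :: "'k \<Rightarrow> diagram \<Rightarrow> diagram \<Rightarrow> 'k :: zero" where
  "dterm \<equiv> group_ring_single"

lemma diagram_elt_dterm: "diagram_elt p = dterm 1 p"
  unfolding diagram_elt_def group_ring_single_def ..

locale tonal_alg =
  fixes l n :: nat and \<delta> :: "'k :: {comm_ring, comm_monoid_mult}"
begin

abbreviation "T \<equiv> tonal l n"
abbreviation "P \<equiv> tonal_algebra \<delta> l n"
abbreviation pmult (infixl "\<bullet>" 70) where "x \<bullet> y \<equiv> x \<otimes>\<^bsub>P\<^esub> y"
abbreviation "vanishing S \<equiv> {x \<in> carrier P. \<forall>p\<in>S. x p = 0}"

lemma carrier_iff: "x \<in> carrier P \<longleftrightarrow> (\<forall>p. p \<notin> T \<longrightarrow> x p = 0)"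
  unfolding tonal_algebra_def by simp

lemma carrier_eq_0: "x \<in> carrier P \<Longrightarrow> p \<notin> T \<Longrightarrow> x p = 0"
  by (simp add: carrier_iff)

lemma add_P: "x \<oplus>\<^bsub>P\<^esub> y = (\<lambda>p. x p + y p)"
  unfolding tonal_algebra_def by simp

lemma zero_P: "\<zero>\<^bsub>P\<^esub> = (\<lambda>p. 0)"
  unfolding tonal_algebra_def by simp

lemma one_P: "\<one>\<^bsub>P\<^esub> = diagram_elt (diagram_id n)"
  unfolding tonal_algebra_def diagram_elt_def by simp

lemma mult_P:
  "(x \<bullet> y) q = (\<Sum>p\<in>T. \<Sum>p'\<in>T. if diagram_comp p p' = q then x p * y p' * \<delta> ^ diagram_loops p p' else 0)"
proof -
  have "(x \<bullet> y) q = (\<Sum>i\<in>{i \<in> T \<times> T. diagram_comp (fst i) (snd i) = q}.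
      x (fst i) * y (snd i) * \<delta> ^ diagram_loops (fst i) (snd i))"
    unfolding tonal_algebra_def by (auto intro!: sum.cong)
  also have "\<dots> = (\<Sum>i\<in>T \<times> T. if diagram_comp (fst i) (snd i) = q
      then x (fst i) * y (snd i) * \<delta> ^ diagram_loops (fst i) (snd i) else 0)"
    using finite_tonal by (intro sum.inter_filter) auto
  also have "\<dots> = (\<Sum>p\<in>T. \<Sum>p'\<in>T. if diagram_comp p p' = q then x p * y p' * \<delta> ^ diagram_loops p p' else 0)"
    by (simp add: sum.cartesian_product case_prod_beta)
  finally show ?thesis .
qed

text \<open>Pairs a product with an arbitrary weight \<open>K\<close> on diagrams. Associativity and
  the multiplicativity of \<open>rep\<close> both follow this pattern.\<close>

lemma sum_mult_P:
  "(\<Sum>r\<in>T. (x \<bullet> y) r * K r) =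
    (\<Sum>p\<in>T. \<Sum>p'\<in>T. x p * y p' * \<delta> ^ diagram_loops p p' * K (diagram_comp p p'))"
proof -
  have "(\<Sum>r\<in>T. (x \<bullet> y) r * K r) = (\<Sum>r\<in>T. \<Sum>p\<in>T. \<Sum>p'\<in>T.
      if diagram_comp p p' = r then x p * y p' * \<delta> ^ diagram_loops p p' * K r else 0)"
    unfolding mult_P sum_distrib_right by (intro sum.cong refl) simp
  also have "\<dots> = (\<Sum>p\<in>T. \<Sum>p'\<in>T. \<Sum>r\<in>T.
      if diagram_comp p p' = r then x p * y p' * \<delta> ^ diagram_loops p p' * K r else 0)"
    by (rule trans[OF sum.swap], rule sum.cong[OF refl], rule sum.swap)
  also have "\<dots> = (\<Sum>p\<in>T. \<Sum>p'\<in>T. x p * y p' * \<delta> ^ diagram_loops p p' * K (diagram_comp p p'))"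
    using tonal_comp finite_tonal by (intro sum.cong refl) (simp add: sum.delta')
  finally show ?thesis .
qed

lemma mult_closed: "x \<bullet> y \<in> carrier P"
proof -
  have "(x \<bullet> y) q = 0" if "q \<notin> T" for q
    unfolding mult_P using tonal_comp that by (intro sum.neutral ballI) auto
  then show ?thesis unfolding carrier_iff by blast
qed

lemma mult_assoc_P: "(x \<bullet> y) \<bullet> z = x \<bullet> (y \<bullet> z)"
proof
  fix q
  let ?c = diagram_comp and ?L = diagram_loops
  have "((x \<bullet> y) \<bullet> z) q =
      (\<Sum>r\<in>T. (x \<bullet> y) r * (\<Sum>u\<in>T. if ?c r u = q then z u * \<delta> ^ ?L r u else 0))"
    unfolding mult_P[of "x \<bullet> y"] sum_distrib_left by (intro sum.cong refl) (simp add: mult.assoc)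
  also have "\<dots> = (\<Sum>p\<in>T. \<Sum>p'\<in>T. x p * y p' * \<delta> ^ ?L p p' *
      (\<Sum>u\<in>T. if ?c (?c p p') u = q then z u * \<delta> ^ ?L (?c p p') u else 0))"
    by (rule sum_mult_P)
  also have "\<dots> = (\<Sum>p\<in>T. \<Sum>p'\<in>T. \<Sum>u\<in>T.
      if ?c (?c p p') u = q then x p * y p' * z u * \<delta> ^ (?L p p' + ?L (?c p p') u) else 0)"
    unfolding sum_distrib_left by (intro sum.cong refl) (simp add: power_add ac_simps)
  also have "\<dots> = (\<Sum>p\<in>T. \<Sum>p'\<in>T. \<Sum>u\<in>T.
      if ?c p (?c p' u) = q then x p * y p' * z u * \<delta> ^ (?L p' u + ?L p (?c p' u)) else 0)"
  proof (intro sum.cong refl)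
    fix p p' u assume "p \<in> T" "p' \<in> T" "u \<in> T"
    note d = this[THEN tonal_diagrams]
    show "(if ?c (?c p p') u = q then x p * y p' * z u * \<delta> ^ (?L p p' + ?L (?c p p') u) else 0) =
        (if ?c p (?c p' u) = q then x p * y p' * z u * \<delta> ^ (?L p' u + ?L p (?c p' u)) else 0)"
      by (simp only: diagram_comp_assoc[OF d] diagram_loops_assoc[OF d])
  qed
  also have "\<dots> = (\<Sum>p\<in>T. \<Sum>r\<in>T. (y \<bullet> z) r * (if ?c p r = q then x p * \<delta> ^ ?L p r else 0))"
    unfolding sum_mult_P sum_distrib_left by (intro sum.cong refl) (simp add: power_add ac_simps)
  also have "\<dots> = (x \<bullet> (y \<bullet> z)) q"
    unfolding mult_P[of x] by (intro sum.cong refl) (simp add: ac_simps)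
  finally show "((x \<bullet> y) \<bullet> z) q = (x \<bullet> (y \<bullet> z)) q" .
qed

lemma dterm_in: "p \<in> T \<Longrightarrow> dterm c p \<in> carrier P"
  unfolding carrier_iff group_ring_single_def by auto

lemma diagram_elt_in: "p \<in> T \<Longrightarrow> diagram_elt p \<in> carrier P"
  unfolding diagram_elt_dterm by (rule dterm_in)

lemma mult_dterm_left:
  assumes "p \<in> T"
  shows "(dterm c p \<bullet> y) q =
    (\<Sum>p'\<in>T. if diagram_comp p p' = q then c * y p' * \<delta> ^ diagram_loops p p' else 0)"
proof -
  have "(dterm c p \<bullet> y) q = (\<Sum>r\<in>T. if r = p then (\<Sum>p'\<in>T. if diagram_comp p p' = q
      then c * y p' * \<delta> ^ diagram_loops p p' else 0) else 0)"
    unfolding mult_P by (intro sum.cong refl) (auto simp: group_ring_single_def cong: if_cong)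
  then show ?thesis using assms finite_tonal by simp
qed

lemma mult_dterm_right:
  assumes "p' \<in> T"
  shows "(x \<bullet> dterm c p') q =
    (\<Sum>p\<in>T. if diagram_comp p p' = q then x p * c * \<delta> ^ diagram_loops p p' else 0)"
proof -
  have "(\<Sum>r\<in>T. if diagram_comp p r = q then x p * dterm c p' r * \<delta> ^ diagram_loops p r else 0) =
      (\<Sum>r\<in>T. if r = p' then (if diagram_comp p p' = q then x p * c * \<delta> ^ diagram_loops p p' else 0) else 0)" for p
    by (intro sum.cong refl) (auto simp: group_ring_single_def)
  then show ?thesis using assms finite_tonal unfolding mult_P by simp
qed

lemma mult_dterms:
  assumes "p \<in> T" "p' \<in> T"
  shows "dterm c p \<bullet> dterm d p' = dterm (c * d * \<delta> ^ diagram_loops p p') (diagram_comp p p')"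
proof
  fix q
  have "(dterm c p \<bullet> dterm d p') q =
      (\<Sum>r\<in>T. if r = p' then (if diagram_comp p p' = q then c * d * \<delta> ^ diagram_loops p p' else 0) else 0)"
    unfolding mult_dterm_left[OF assms(1)] by (intro sum.cong refl) (auto simp: group_ring_single_def)
  then show "(dterm c p \<bullet> dterm d p') q =
      dterm (c * d * \<delta> ^ diagram_loops p p') (diagram_comp p p') q"
    using assms finite_tonal by (auto simp: group_ring_single_def)
qed

lemma mult_elts:
  assumes "p \<in> T" "p' \<in> T" "diagram_loops p p' = 0"
  shows "diagram_elt p \<bullet> diagram_elt p' = diagram_elt (diagram_comp p p')"
  unfolding diagram_elt_dterm mult_dterms[OF assms(1,2)] assms(3) by simp

lemma mult_one_left: "x \<in> carrier P \<Longrightarrow> dterm c (diagram_id n) \<bullet> x = (\<lambda>p. c * x p)"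
proof
  fix q assume x: "x \<in> carrier P"
  have "(dterm c (diagram_id n) \<bullet> x) q = (\<Sum>p'\<in>T. if p' = q then c * x p' else 0)"
    unfolding mult_dterm_left[OF diagram_id_tonal]
    by (intro sum.cong refl) (auto simp: diagram_id_comp[OF tonal_diagrams[of _ l n]])
  then show "(dterm c (diagram_id n) \<bullet> x) q = c * x q"
    using finite_tonal carrier_eq_0[OF x] by auto
qed

lemma mult_one_right: "x \<in> carrier P \<Longrightarrow> x \<bullet> dterm c (diagram_id n) = (\<lambda>p. x p * c)"
proof
  fix q assume x: "x \<in> carrier P"
  have "(x \<bullet> dterm c (diagram_id n)) q = (\<Sum>p'\<in>T. if p' = q then x p' * c else 0)"
    unfolding mult_dterm_right[OF diagram_id_tonal]
    by (intro sum.cong refl) (auto simp: diagram_id_comp[OF tonal_diagrams[of _ l n]])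
  then show "(x \<bullet> dterm c (diagram_id n)) q = x q * c"
    using finite_tonal carrier_eq_0[OF x] by auto
qed

lemma mult_sum_left:
  "(\<lambda>q. \<Sum>j\<in>J. f j q) \<bullet> y = (\<lambda>q. \<Sum>j\<in>J. (f j \<bullet> y) q)"
proof
  fix q
  have "((\<lambda>q. \<Sum>j\<in>J. f j q) \<bullet> y) q = (\<Sum>p\<in>T. \<Sum>p'\<in>T. \<Sum>j\<in>J.
      if diagram_comp p p' = q then f j p * y p' * \<delta> ^ diagram_loops p p' else 0)"
    unfolding mult_P by (intro sum.cong refl) (simp add: sum_distrib_right)
  also have "\<dots> = (\<Sum>p\<in>T. \<Sum>j\<in>J. \<Sum>p'\<in>T.
      if diagram_comp p p' = q then f j p * y p' * \<delta> ^ diagram_loops p p' else 0)"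
    by (intro sum.cong refl sum.swap)
  also have "\<dots> = (\<Sum>j\<in>J. (f j \<bullet> y) q)" unfolding mult_P by (rule sum.swap)
  finally show "((\<lambda>q. \<Sum>j\<in>J. f j q) \<bullet> y) q = (\<Sum>j\<in>J. (f j \<bullet> y) q)" .
qed

lemma mult_sum_right:
  "y \<bullet> (\<lambda>q. \<Sum>j\<in>J. f j q) = (\<lambda>q. \<Sum>j\<in>J. (y \<bullet> f j) q)"
proof
  fix q
  have "(y \<bullet> (\<lambda>q. \<Sum>j\<in>J. f j q)) q = (\<Sum>p\<in>T. \<Sum>p'\<in>T. \<Sum>j\<in>J.
      if diagram_comp p p' = q then y p * f j p' * \<delta> ^ diagram_loops p p' else 0)"
    unfolding mult_P by (intro sum.cong refl) (simp add: sum_distrib_right sum_distrib_left)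
  also have "\<dots> = (\<Sum>p\<in>T. \<Sum>j\<in>J. \<Sum>p'\<in>T.
      if diagram_comp p p' = q then y p * f j p' * \<delta> ^ diagram_loops p p' else 0)"
    by (intro sum.cong refl sum.swap)
  also have "\<dots> = (\<Sum>j\<in>J. (y \<bullet> f j) q)" unfolding mult_P by (rule sum.swap)
  finally show "(y \<bullet> (\<lambda>q. \<Sum>j\<in>J. f j q)) q = (\<Sum>j\<in>J. (y \<bullet> f j) q)" .
qed

lemma mult_add_left: "(\<lambda>p. x p + y p) \<bullet> z = (\<lambda>p. (x \<bullet> z) p + (y \<bullet> z) p)"
  using mult_sum_left[of "\<lambda>b. if b then x else y" UNIV z] by (simp add: UNIV_bool add.commute)

lemma mult_add_right: "z \<bullet> (\<lambda>p. x p + y p) = (\<lambda>p. (z \<bullet> x) p + (z \<bullet> y) p)"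
  using mult_sum_right[of z "\<lambda>b. if b then x else y" UNIV] by (simp add: UNIV_bool add.commute)

lemma ring_P: "ring P"
proof (rule ringI)
  show "abelian_group P"
  proof (rule abelian_groupI)
    fix x assume x: "x \<in> carrier P"
    show "\<exists>y\<in>carrier P. y \<oplus>\<^bsub>P\<^esub> x = \<zero>\<^bsub>P\<^esub>"
      by (rule bexI[of _ "\<lambda>p. - x p"]) (use x in \<open>auto simp: carrier_iff add_P zero_P\<close>)
  qed (auto simp: carrier_iff add_P zero_P ac_simps)
  show "monoid P"
  proof (rule monoidI)
    show "\<one>\<^bsub>P\<^esub> \<in> carrier P" unfolding one_P by (rule diagram_elt_in[OF diagram_id_tonal])
    fix x assume "x \<in> carrier P"
    then show "\<one>\<^bsub>P\<^esub> \<bullet> x = x" "x \<bullet> \<one>\<^bsub>P\<^esub> = x"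
      unfolding one_P diagram_elt_dterm by (simp_all add: mult_one_left mult_one_right)
  qed (simp_all only: mult_closed mult_assoc_P)
qed (simp_all only: add_P mult_add_left mult_add_right)

lemma minus_P:
  assumes "x \<in> carrier P"
  shows "\<ominus>\<^bsub>P\<^esub> x = (\<lambda>p. - x p)"
proof -
  interpret ring P by (rule ring_P)
  show ?thesis
    by (rule minus_equality) (use assms in \<open>auto simp: carrier_iff add_P zero_P\<close>)
qed

lemma ideal_zero: "ideal I P \<Longrightarrow> (\<lambda>p. 0) \<in> I"
  using additive_subgroup.zero_closed[OF ideal.axioms(1), of I P] by (simp add: zero_P)

lemma ideal_add: "ideal I P \<Longrightarrow> x \<in> I \<Longrightarrow> y \<in> I \<Longrightarrow> (\<lambda>p. x p + y p) \<in> I"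
  using additive_subgroup.a_closed[OF ideal.axioms(1), of I P x y] by (simp add: add_P)

lemma ideal_sum:
  assumes "ideal I P" "\<And>j. j \<in> J \<Longrightarrow> f j \<in> I"
  shows "(\<lambda>q. \<Sum>j\<in>J. f j q) \<in> I"
  using assms(2)
proof (induction J rule: infinite_finite_induct)
  case (insert j J)
  then show ?case using ideal_add[OF assms(1), of "f j" "\<lambda>q. \<Sum>j\<in>J. f j q"] by simp
qed (simp_all add: ideal_zero[OF assms(1)])

lemma ideal_subset: "ideal I P \<Longrightarrow> x \<in> I \<Longrightarrow> x \<in> carrier P"
  by (rule additive_subgroup.a_Hcarr[OF ideal.axioms(1)])

lemma carrier_sum: "(\<And>j. j \<in> J \<Longrightarrow> f j \<in> carrier P) \<Longrightarrow> (\<lambda>q. \<Sum>j\<in>J. f j q) \<in> carrier P"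
  by (simp add: carrier_iff)

lemma dterm_expansion:
  assumes "x \<in> carrier P"
  shows "x = (\<lambda>q. \<Sum>p\<in>T. dterm (x p) p q)"
proof
  fix q
  have "(\<Sum>p\<in>T. dterm (x p) p q) = (\<Sum>p\<in>T. if p = q then x p else 0)"
    by (intro sum.cong refl) (simp add: group_ring_single_def)
  then show "x q = (\<Sum>p\<in>T. dterm (x p) p q)" using finite_tonal carrier_eq_0[OF assms] by auto
qed

text \<open>Scalars act through multiples of the identity diagram, so ideals of the ring are closed
  under scalars automatically.\<close>

lemma ideal_dterm:
  assumes "ideal I P" "p \<in> T" "diagram_elt p \<in> I"
  shows "dterm c p \<in> I"
proof -
  have "dterm c (diagram_id n) \<bullet> diagram_elt p = dterm c p"
    unfolding mult_one_left[OF diagram_elt_in[OF assms(2)]] by (auto simp: group_ring_single_def diagram_elt_def)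
  then show ?thesis
    using ideal.I_l_closed[OF assms(1,3) dterm_in[OF diagram_id_tonal]] by metis
qed

lemma ideal_supported:
  assumes "ideal I P" "x \<in> carrier P" "\<And>p. p \<in> T \<Longrightarrow> x p \<noteq> 0 \<Longrightarrow> diagram_elt p \<in> I"
  shows "x \<in> I"
proof -
  have "dterm (x p) p \<in> I" if p: "p \<in> T" for p
  proof (cases "x p = 0")
    case True
    then have "dterm (x p) p = (\<lambda>p. 0)" by (auto simp: group_ring_single_def)
    then show ?thesis using ideal_zero[OF assms(1)] by simp
  qed (use ideal_dterm assms p in blast)
  then have "(\<lambda>q. \<Sum>p\<in>T. dterm (x p) p q) \<in> I" by (rule ideal_sum[OF assms(1)])
  then show ?thesis using dterm_expansion[OF assms(2)] by simp
qed

text \<open>If membership in \<open>S\<close> passes from a product of diagrams to both factors,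
  then the coefficients of a product at \<open>S\<close> only use the coefficients of each factor at
  \<open>S\<close>.\<close>

lemma ideal_vanishing:
  assumes "\<And>p q. p \<in> T \<Longrightarrow> q \<in> T \<Longrightarrow> diagram_comp p q \<in> S \<Longrightarrow> p \<in> S \<and> q \<in> S"
  shows "ideal (vanishing S) P"
proof (rule idealI[OF ring_P])
  interpret ring P by (rule ring_P)
  show "subgroup (vanishing S) (add_monoid P)"
  proof
    show "vanishing S \<subseteq> carrier (add_monoid P)" by auto
  next
    fix x y assume "x \<in> vanishing S" "y \<in> vanishing S"
    then show "x \<otimes>\<^bsub>add_monoid P\<^esub> y \<in> vanishing S"
      by (simp add: add_P carrier_iff)
  next
    show "\<one>\<^bsub>add_monoid P\<^esub> \<in> vanishing S" by (simp add: zero_P carrier_iff)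
  next
    fix x assume x: "x \<in> vanishing S"
    then have "inv\<^bsub>add_monoid P\<^esub> x = (\<lambda>p. - x p)" using minus_P[of x] unfolding a_inv_def by simp
    then show "inv\<^bsub>add_monoid P\<^esub> x \<in> vanishing S"
      using x by (simp add: carrier_iff)
  qed
next
  fix a x assume a: "a \<in> vanishing S"
  have "(x \<bullet> a) q = 0" "(a \<bullet> x) q = 0" if "q \<in> S" for q
  proof -
    have "a p = 0" if "p \<in> T" "p' \<in> T" "diagram_comp p p' = q \<or> diagram_comp p' p = q" for p p'
      using that assms[of p p'] assms[of p' p] a \<open>q \<in> S\<close> by blast
    then show "(x \<bullet> a) q = 0" "(a \<bullet> x) q = 0"
      unfolding mult_P by (intro sum.neutral ballI, simp)+
  qed
  then show "x \<bullet> a \<in> vanishing S"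
    "a \<bullet> x \<in> vanishing S"
    using mult_closed by auto
qed

end


section \<open>Uniform diagrams\<close>

lemma rel_eqI: "(\<And>A B. (A, B) \<in> R \<longleftrightarrow> (A, B) \<in> S) \<Longrightarrow> R = S"
  by auto

definition uniform :: "nat \<Rightarrow> nat \<Rightarrow> diagram set" where
  "uniform l n = {p \<in> diagrams n n. \<forall>s\<in>p. upper_size s = lower_size s \<and> upper_size s \<le> l}"

lemma uniform_diagrams: "p \<in> uniform l n \<Longrightarrow> p \<in> diagrams n n"
  unfolding uniform_def by simp

lemma uniform_tonal: "p \<in> uniform l n \<Longrightarrow> p \<in> tonal l n"
  unfolding uniform_def tonal_def by simp

lemma uniform_card:
  assumes "p \<in> uniform l n" "(A, B) \<in> drel p"
  shows "card A = card B"
proof -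
  obtain F where F: "F \<subseteq> p" "A = Inl -` \<Union>F" "B = Inr -` \<Union>F" using drel_obtain_parts[OF assms(2)] by metis
  have "upper_size s = lower_size s" if "s \<in> F" for s using assms(1) F(1) that unfolding uniform_def by auto
  then show ?thesis
    unfolding F(2,3) diagram_sum_sizes[OF uniform_diagrams[OF assms(1)] F(1)] by simp
qed

lemma diagram_part_finite:
  assumes "p \<in> diagrams n m" "s \<in> p"
  shows "finite (Inl -` s)" "finite (Inr -` s)"
  using drel_subset[OF assms(1) drel_part[OF assms(2)]] finite_subset by auto

lemma diagram_part_exists:
  assumes "p \<in> diagrams n m"
  shows "x \<in> {1..n} \<Longrightarrow> \<exists>s\<in>p. Inl x \<in> s" "y \<in> {1..m} \<Longrightarrow> \<exists>s\<in>p. Inr y \<in> s"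
proof -
  have U: "\<Union>p = {1..n} <+> {1..m}" using assms partition_onD1 unfolding diagrams_def by auto
  show "x \<in> {1..n} \<Longrightarrow> \<exists>s\<in>p. Inl x \<in> s" using InlI[of x "{1..n}" "{1..m}"] unfolding U[symmetric] by blast
  show "y \<in> {1..m} \<Longrightarrow> \<exists>s\<in>p. Inr y \<in> s" using InrI[of y "{1..m}" "{1..n}"] unfolding U[symmetric] by blast
qed

lemma diagram_full_vimages:
  assumes "p \<in> diagrams n m"
  shows "Inl -` \<Union>p = {1..n}" "Inr -` \<Union>p = {1..m}"
proof -
  have U: "\<Union>p = {1..n} <+> {1..m}" using assms partition_onD1 unfolding diagrams_def by auto
  show "Inl -` \<Union>p = {1..n}" "Inr -` \<Union>p = {1..m}" unfolding U by auto
qed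

text \<open>Tonality forces \<open>upper_size s \<le> lower_size s\<close>: otherwise the excess
  would be a positive multiple of \<open>l\<close>, yet smaller than
  \<open>upper_size s \<le> l\<close> because the lower half is not empty. As both rows have
  \<open>n\<close> vertices, equality holds for every part.\<close>

lemma uniformI_parts:
  assumes p: "p \<in> tonal l n"
    and parts: "\<And>s. s \<in> p \<Longrightarrow> Inl -` s \<noteq> {} \<Longrightarrow> Inr -` s \<noteq> {} \<and> upper_size s \<le> l"
  shows "p \<in> uniform l n"
proof -
  note d = tonal_diagrams[OF p]
  have le: "upper_size s \<le> lower_size s" if s: "s \<in> p" for s
  proof (cases "Inl -` s = {}")
    case False
    then have u: "upper_size s > 0" "lower_size s > 0" "upper_size s \<le> l"
      using parts[OF s] diagram_part_finite[OF d s] unfolding upper_size_def lower_size_def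
      by (auto simp: card_gt_0_iff)
    have e: "upper_size s mod l = lower_size s mod l" using p s unfolding tonal_def by simp
    show ?thesis
    proof (rule ccontr)
      assume nle: "\<not> upper_size s \<le> lower_size s"
      then have "l dvd upper_size s - lower_size s" using e by (metis mod_eq_dvd_iff_nat nat_le_linear)
      then show False using u nle by (auto dest!: dvd_imp_le)
    qed
  qed (simp add: upper_size_def)
  have "(\<Sum>s\<in>p. upper_size s) = n" "(\<Sum>s\<in>p. lower_size s) = n"
    using diagram_sum_sizes[OF d order_refl] diagram_full_vimages[OF d] by simp_all
  then have "upper_size s = lower_size s" if "s \<in> p" for s
    using sum_mono_inv[of upper_size p lower_size s] le diagrams_finite[OF d] that by simp
  moreover have "upper_size s \<le> l" if "s \<in> p" for s
    using parts[OF that] by (cases "Inl -` s = {}") (auto simp: upper_size_def)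
  ultimately show ?thesis using d unfolding uniform_def by simp
qed

text \<open>A criterion in terms of the relation alone, hence applicable to composites: related sets
  with at most \<open>l\<close> upper vertices that cover the upper row bound the parts inside
  them.\<close>

lemma uniformI_upper:
  assumes p: "p \<in> tonal l n"
    and cover: "\<And>x. x \<in> {1..n} \<Longrightarrow> \<exists>A B. (A, B) \<in> drel p \<and> x \<in> A \<and> card A \<le> l"
    and ne: "\<And>A. (A, {}) \<in> drel p \<Longrightarrow> A = {}"
  shows "p \<in> uniform l n"
proof (rule uniformI_parts[OF p], intro conjI)
  fix s assume s: "s \<in> p" "Inl -` s \<noteq> {}"
  note d = tonal_diagrams[OF p]
  show "Inr -` s \<noteq> {}" using ne[of "Inl -` s"] drel_part[OF s(1)] s(2) by auto
  obtain x where x: "Inl x \<in> s" using s(2) by blast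
  then have "x \<in> {1..n}" using drel_subset[OF d drel_part[OF s(1)]] by blast
  then obtain A B where AB: "(A, B) \<in> drel p" "x \<in> A" "card A \<le> l" using cover by blast
  then have "s \<subseteq> A <+> B" using drel_iff[OF d] s(1) x by blast
  then have "Inl -` s \<subseteq> A" by auto
  moreover have "finite A" using drel_subset[OF d AB(1)] finite_subset by blast
  ultimately show "upper_size s \<le> l" using AB(3) card_mono unfolding upper_size_def by (meson order_trans)
qed

lemma flip_uniform: "p \<in> uniform l n \<Longrightarrow> flip p \<in> uniform l n"
  unfolding uniform_def using flip_in[of p n n] by (auto simp: flip_def sizes_flip)

lemma uniformI_lower:
  assumes p: "p \<in> tonal l n"
    and cover: "\<And>x. x \<in> {1..n} \<Longrightarrow> \<exists>A B. (A, B) \<in> drel p \<and> x \<in> B \<and> card B \<le> l"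
    and ne: "\<And>B. ({}, B) \<in> drel p \<Longrightarrow> B = {}"
  shows "p \<in> uniform l n"
proof -
  have "flip p \<in> uniform l n"
    by (rule uniformI_upper[OF flip_tonal[OF p]]) (use cover ne in \<open>fastforce simp: drel_flip\<close>)+
  then show ?thesis using flip_uniform by force
qed

lemma uniform_empty:
  assumes "p \<in> uniform l n"
  shows "({}, B) \<in> drel p \<Longrightarrow> B = {}" "(A, {}) \<in> drel p \<Longrightarrow> A = {}"
proof -
  note d = uniform_diagrams[OF assms]
  show "B = {}" if h: "({}, B) \<in> drel p"
  proof -
    have "finite B" using drel_subset[OF d h] finite_subset by blast
    then show ?thesis using uniform_card[OF assms h] by simp
  qed
  show "A = {}" if h: "(A, {}) \<in> drel p"
  proof -
    have "finite A" using drel_subset[OF d h] finite_subset by blast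
    then show ?thesis using uniform_card[OF assms h] by simp
  qed
qed

text \<open>Two images of the same set differ by sets related to the empty set, which are empty. So
  the relation of a uniform diagram is a partial bijection between sets of vertices, the source of
  the inverse monoid behaviour.\<close>

lemma uniform_functional:
  assumes "p \<in> uniform l n" "(A, B) \<in> drel p"
  shows "(A, B') \<in> drel p \<Longrightarrow> B = B'" "(A', B) \<in> drel p \<Longrightarrow> A = A'"
proof -
  note d = uniform_diagrams[OF assms(1)]
  show "B = B'" if h: "(A, B') \<in> drel p"
    using uniform_empty(1)[OF assms(1)] drel_Diff[OF d assms(2) h] drel_Diff[OF d h assms(2)] by auto
  show "A = A'" if h: "(A', B) \<in> drel p"
    using uniform_empty(2)[OF assms(1)] drel_Diff[OF d assms(2) h] drel_Diff[OF d h assms(2)] by auto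
qed

lemma uniform_cover:
  assumes "p \<in> uniform l n" "x \<in> {1..n}"
  shows "\<exists>A B. (A, B) \<in> drel p \<and> x \<in> A \<and> card A \<le> l" "\<exists>A B. (A, B) \<in> drel p \<and> x \<in> B \<and> card B \<le> l"
proof -
  note d = uniform_diagrams[OF assms(1)]
  obtain s where s: "s \<in> p" "Inl x \<in> s" using diagram_part_exists(1)[OF d assms(2)] by blast
  show "\<exists>A B. (A, B) \<in> drel p \<and> x \<in> A \<and> card A \<le> l"
    using drel_part[OF s(1)] s assms(1) unfolding uniform_def upper_size_def by blast
  obtain s where s: "s \<in> p" "Inr x \<in> s" using diagram_part_exists(2)[OF d assms(2)] by blast
  have "lower_size s \<le> l" using s(1) assms(1) unfolding uniform_def by auto
  then show "\<exists>A B. (A, B) \<in> drel p \<and> x \<in> B \<and> card B \<le> l"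
    using drel_part[OF s(1)] s unfolding lower_size_def by blast
qed

lemma uniform_loops:
  assumes "p \<in> diagrams n n" "q \<in> diagrams n n" "p \<in> uniform l n \<or> q \<in> uniform l n"
  shows "diagram_loops p q = 0"
  using assms uniform_empty by (intro diagram_loops_eq_0[OF assms(1,2)]) blast

text \<open>Both conditions of \<open>uniformI_upper\<close> restrict from a product to its left
  factor, the second one because the empty sets are always related. With the mirror image in
  \<open>uniform_factors\<close> this makes the nonuniform diagrams span an ideal.\<close>

lemma uniform_factor_left:
  assumes p: "p \<in> tonal l n" and q: "q \<in> tonal l n" and pq: "diagram_comp p q \<in> uniform l n"
  shows "p \<in> uniform l n"
proof (rule uniformI_upper[OF p])
  note c = drel_comp[OF tonal_diagrams[OF p] tonal_diagrams[OF q]]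
  fix x assume "x \<in> {1..n}"
  then show "\<exists>A B. (A, B) \<in> drel p \<and> x \<in> A \<and> card A \<le> l" using uniform_cover(1)[OF pq] unfolding c by blast
next
  note c = drel_comp[OF tonal_diagrams[OF p] tonal_diagrams[OF q]]
  fix A assume "(A, {}) \<in> drel p"
  then have "(A, {}) \<in> drel (diagram_comp p q)" unfolding c using drel_empty by blast
  then show "A = {}" using uniform_empty(2)[OF pq] by blast
qed

lemma uniform_factors:
  assumes "p \<in> tonal l n" "q \<in> tonal l n" "diagram_comp p q \<in> uniform l n"
  shows "p \<in> uniform l n" "q \<in> uniform l n"
proof -
  show "p \<in> uniform l n" using uniform_factor_left[OF assms] .
  have "diagram_comp (flip q) (flip p) \<in> uniform l n"
    using flip_uniform[OF assms(3)] flip_comp(1)[OF assms(1,2)[THEN tonal_diagrams]] by simp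
  then have "flip q \<in> uniform l n" using uniform_factor_left flip_tonal assms by blast
  then show "q \<in> uniform l n" using flip_uniform by force
qed

text \<open>For uniform factors triviality over the empty set is automatic; the product can fail to
  be uniform only by having parts that are too large.\<close>

lemma uniform_compI:
  assumes "p \<in> uniform l n" "q \<in> uniform l n"
    and "\<And>y. y \<in> {1..n} \<Longrightarrow> \<exists>A B. (A, B) \<in> drel p O drel q \<and> y \<in> B \<and> card B \<le> l"
  shows "diagram_comp p q \<in> uniform l n"
proof (rule uniformI_lower)
  note c = drel_comp[OF uniform_diagrams[OF assms(1)] uniform_diagrams[OF assms(2)]]
  show "diagram_comp p q \<in> tonal l n" using tonal_comp uniform_tonal assms by blast
  show "\<exists>A B. (A, B) \<in> drel (diagram_comp p q) \<and> y \<in> B \<and> card B \<le> l" if "y \<in> {1..n}" for y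
    using assms(3)[OF that] unfolding c .
  show "B = {}" if "({}, B) \<in> drel (diagram_comp p q)" for B
    using that uniform_empty(1)[OF assms(1)] uniform_empty(1)[OF assms(2)] unfolding c by blast
qed

lemma diagramsI: "{} \<notin> p \<Longrightarrow> \<Union>p = {1..n} <+> {1..m} \<Longrightarrow> disjoint p \<Longrightarrow> p \<in> diagrams n m"
  unfolding diagrams_def partition_on_def by blast

lemma cup_cap_diagram_eq:
  assumes "1 \<le> l"
  shows "cup_cap_diagram l = {Inl ` {1..l}, Inr ` {1..l}}"
proof -
  have 1: "{Inl ` {1..l}} \<in> diagrams l 0" "{Inr ` {1..l}} \<in> diagrams 0 l"
    by (rule diagramsI; use assms in \<open>simp add: Plus_def disjoint_def\<close>)+
  have 2: "{Inl ` {1..l}, Inr ` {1..l}} \<in> diagrams l l"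
    by (rule diagramsI) (use assms in \<open>auto simp: Plus_def disjoint_def\<close>)
  \<comment> \<open>The middle row has no vertices, so the only middle set is the empty one.\<close>
  have c: "(A, B) \<in> drel {Inl ` {1..l}} O drel {Inr ` {1..l}} \<longleftrightarrow> (A, {}) \<in> drel {Inl ` {1..l}} \<and> ({}, B) \<in> drel {Inr ` {1..l}}"
    for A B using drel_subset[OF 1(1)] by fastforce
  have "(A, B) \<in> drel (diagram_comp {Inl ` {1..l}} {Inr ` {1..l}}) \<longleftrightarrow> (A, B) \<in> drel {Inl ` {1..l}, Inr ` {1..l}}" for A B
    unfolding drel_comp[OF 1] c drel_iff[OF 1(1)] drel_iff[OF 1(2)] drel_iff[OF 2] Plus_def by auto
  then show ?thesis unfolding cup_cap_diagram_def
    by (intro drel_inj[OF diagram_comp_in[OF 1] 2] rel_eqI)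
qed

subsection \<open>Merging parts\<close>

definition part_of :: "'a set set \<Rightarrow> 'a \<Rightarrow> 'a set" where
  "part_of p x = (THE s. s \<in> p \<and> x \<in> s)"

lemma part_of_eq:
  assumes "p \<in> diagrams n m" "s \<in> p" "x \<in> s"
  shows "part_of p x = s"
  unfolding part_of_def
proof (rule the_equality)
  fix u assume "u \<in> p \<and> x \<in> u"
  moreover have "disjoint p" using assms(1) partition_onD2 unfolding diagrams_def by auto
  ultimately show "u = s" using assms(2,3) unfolding disjoint_def by blast
qed (use assms in simp)

lemma part_of_vimages:
  assumes "p \<in> diagrams n m"
  shows "{i \<in> {1..n}. part_of p (Inl i) \<in> F} = Inl -` \<Union>(p \<inter> F)"
    "{j \<in> {1..m}. part_of p (Inr j) \<in> F} = Inr -` \<Union>(p \<inter> F)"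
proof -
  have "i \<in> {1..n} \<and> part_of p (Inl i) \<in> F \<longleftrightarrow> Inl i \<in> \<Union>(p \<inter> F)" for i
  proof
    assume h: "i \<in> {1..n} \<and> part_of p (Inl i) \<in> F"
    then obtain s where "s \<in> p" "Inl i \<in> s" using diagram_part_exists(1)[OF assms] by blast
    then show "Inl i \<in> \<Union>(p \<inter> F)" using h part_of_eq[OF assms, of s "Inl i"] by auto
  next
    assume "Inl i \<in> \<Union>(p \<inter> F)"
    then obtain s where s: "s \<in> p" "s \<in> F" "Inl i \<in> s" by blast
    moreover have "i \<in> {1..n}" using s drel_subset[OF assms drel_part[OF s(1)]] by blast
    ultimately show "i \<in> {1..n} \<and> part_of p (Inl i) \<in> F" using part_of_eq[OF assms s(1,3)] by simp
  qed
  then show "{i \<in> {1..n}. part_of p (Inl i) \<in> F} = Inl -` \<Union>(p \<inter> F)" by auto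
  have "j \<in> {1..m} \<and> part_of p (Inr j) \<in> F \<longleftrightarrow> Inr j \<in> \<Union>(p \<inter> F)" for j
  proof
    assume h: "j \<in> {1..m} \<and> part_of p (Inr j) \<in> F"
    then obtain s where "s \<in> p" "Inr j \<in> s" using diagram_part_exists(2)[OF assms] by blast
    then show "Inr j \<in> \<Union>(p \<inter> F)" using h part_of_eq[OF assms, of s "Inr j"] by auto
  next
    assume "Inr j \<in> \<Union>(p \<inter> F)"
    then obtain s where s: "s \<in> p" "s \<in> F" "Inr j \<in> s" by blast
    moreover have "j \<in> {1..m}" using s drel_subset[OF assms drel_part[OF s(1)]] by blast
    ultimately show "j \<in> {1..m} \<and> part_of p (Inr j) \<in> F" using part_of_eq[OF assms s(1,3)] by simp
  qed
  then show "{j \<in> {1..m}. part_of p (Inr j) \<in> F} = Inr -` \<Union>(p \<inter> F)" by auto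
qed

lemma drel_vimagesI: "F \<subseteq> p \<Longrightarrow> (Inl -` \<Union>F, Inr -` \<Union>F) \<in> drel p"
  unfolding drel_def unions_def by (simp add: Plus_vimages)

locale tonal_alg_pos = tonal_alg l n \<delta> for l n :: nat and \<delta> :: "'k :: {comm_ring, comm_monoid_mult}" +
  assumes l: "1 \<le> l"
begin

abbreviation "U \<equiv> uniform l n"

lemma mult_elts_uniform:
  assumes "p \<in> T" "q \<in> T" "p \<in> U \<or> q \<in> U"
  shows "diagram_elt p \<bullet> diagram_elt q = diagram_elt (diagram_comp p q)"
  using mult_elts[OF assms(1,2) uniform_loops[OF assms(1,2)[THEN tonal_diagrams] assms(3)]] .

end


section \<open>The index order\<close>

text \<open>The representative in \<open>{1..l}\<close> of a residue class. Adding
  \<open>l - 1\<close> instead of subtracting \<open>1\<close> avoids truncation at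
  \<open>x = 0\<close>, which has tone \<open>l\<close>.\<close>

definition tone :: "nat \<Rightarrow> nat \<Rightarrow> nat" where
  "tone l x = (x + l - 1) mod l + 1"

lemma tone_in: "1 \<le> l \<Longrightarrow> tone l x \<in> {1..l}"
  unfolding tone_def using mod_less_divisor[of l "x + l - 1"] by (auto simp: Suc_le_eq)

lemma tone_mod: "1 \<le> l \<Longrightarrow> tone l x mod l = x mod l"
proof -
  assume l: "1 \<le> l"
  have "tone l x mod l = (x + l - 1 + 1) mod l" unfolding tone_def by (rule mod_add_left_eq)
  then show ?thesis using l by simp
qed

lemma tone_eq_iff:
  assumes "1 \<le> l" "i \<in> {1..l}"
  shows "tone l x = i \<longleftrightarrow> x mod l = i mod l"
proof
  assume "x mod l = i mod l"
  then have "tone l x mod l = i mod l" using tone_mod[OF assms(1)] by simp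
  moreover have "tone l x \<in> {1..l}" by (rule tone_in[OF assms(1)])
  ultimately show "tone l x = i"
    using assms by (cases "tone l x = l"; cases "i = l") auto
qed (use tone_mod[OF assms(1), of x] in auto)

lemma tone_cong: "1 \<le> l \<Longrightarrow> x mod l = y mod l \<Longrightarrow> tone l x = tone l y"
  using tone_eq_iff[OF _ tone_in[of l y], of x] tone_mod[of l y] by simp

lemma tone_self: "i \<in> {1..l} \<Longrightarrow> tone l i = i"
  using tone_eq_iff[of l i i] by auto

lemma tone_le:
  assumes "1 \<le> l" "1 \<le> x"
  shows "tone l x \<le> x"
proof -
  have "x + l - 1 = x - 1 + l" using assms by simp
  then have "tone l x = (x - 1) mod l + 1" unfolding tone_def by simp
  then show ?thesis using mod_less_eq_dividend[of "x - 1" l] assms by linarith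
qed

section \<open>The cone of fusion vectors\<close>

definition fusion_cone :: "nat \<Rightarrow> (nat \<Rightarrow> int) \<Rightarrow> bool" where
  "fusion_cone l d \<longleftrightarrow> (\<exists>c :: nat \<Rightarrow> nat \<Rightarrow> nat. \<forall>h\<in>{1..l}.
     d h = (\<Sum>i\<in>{1..l}. \<Sum>j\<in>{i..l}. int (c i j) * fusion_vector l i j h))"

lemma index_le_cone: "index_le l x y \<longleftrightarrow> fusion_cone l (\<lambda>h. x h - y h)"
  unfolding index_le_def fusion_cone_def ..

lemma cone_cong: "fusion_cone l d \<Longrightarrow> (\<And>h. h \<in> {1..l} \<Longrightarrow> d h = e h) \<Longrightarrow> fusion_cone l e"
  unfolding fusion_cone_def by simp

lemma cone_zero: "fusion_cone l (\<lambda>h. 0)"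
  unfolding fusion_cone_def by (rule exI[of _ "\<lambda>_ _. 0"]) simp

lemma cone_add:
  assumes "fusion_cone l d" "fusion_cone l e"
  shows "fusion_cone l (\<lambda>h. d h + e h)"
proof -
  obtain b c where "\<forall>h\<in>{1..l}. d h = (\<Sum>i\<in>{1..l}. \<Sum>j\<in>{i..l}. int (b i j) * fusion_vector l i j h)"
    "\<forall>h\<in>{1..l}. e h = (\<Sum>i\<in>{1..l}. \<Sum>j\<in>{i..l}. int (c i j) * fusion_vector l i j h)"
    using assms unfolding fusion_cone_def by blast
  then have "\<forall>h\<in>{1..l}. d h + e h = (\<Sum>i\<in>{1..l}. \<Sum>j\<in>{i..l}. int (b i j + c i j) * fusion_vector l i j h)"
    by (simp add: distrib_right sum.distrib)
  then show ?thesis unfolding fusion_cone_def by (intro exI[of _ "\<lambda>i j. b i j + c i j"])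
qed

lemma cone_sum:
  assumes "\<And>s. s \<in> S \<Longrightarrow> fusion_cone l (d s)"
  shows "fusion_cone l (\<lambda>h. \<Sum>s\<in>S. d s h)"
  using assms
proof (induction S rule: infinite_finite_induct)
  case (insert s S)
  then show ?case using cone_add[of l "d s" "\<lambda>h. \<Sum>s\<in>S. d s h"] by simp
qed (simp_all add: cone_zero)

lemma cone_fusion_le:
  assumes "i \<in> {1..l}" "j \<in> {i..l}"
  shows "fusion_cone l (fusion_vector l i j)"
proof -
  let ?c = "\<lambda>i' j'. of_bool (i' = i \<and> j' = j) :: nat"
  have "fusion_vector l i j h = (\<Sum>i'\<in>{1..l}. \<Sum>j'\<in>{i'..l}. int (?c i' j') * fusion_vector l i' j' h)" for h
  proof -
    have "(\<Sum>i'\<in>{1..l}. \<Sum>j'\<in>{i'..l}. int (?c i' j') * fusion_vector l i' j' h) =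
        (\<Sum>i'\<in>{1..l}. if i' = i then (\<Sum>j'\<in>{i..l}. if j' = j then fusion_vector l i j h else 0) else 0)"
      by (intro sum.cong refl) (auto intro!: sum.cong)
    then show ?thesis using assms by simp
  qed
  then show ?thesis unfolding fusion_cone_def by (intro exI[of _ ?c]) blast
qed

lemma cone_fusion:
  assumes "i \<in> {1..l}" "j \<in> {1..l}"
  shows "fusion_cone l (\<lambda>h. of_bool (h = tone l (i + j)) - of_bool (h = i) - of_bool (h = j))"
proof -
  have *: "fusion_vector l i j = (\<lambda>h. of_bool (h = tone l (i + j)) - of_bool (h = i) - of_bool (h = j))"
    if "i \<in> {1..l}" "j \<in> {1..l}" for i j
  proof -
    have "i + j + l - 1 = i + j - 1 + l" using that by auto
    then have "tone l (i + j) = (i + j - 1) mod l + 1" unfolding tone_def by simp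
    then show ?thesis unfolding fusion_vector_def by simp
  qed
  show ?thesis
  proof (cases "i \<le> j")
    case True
    then show ?thesis using cone_fusion_le[of i l j] assms *[OF assms] by auto
  next
    case False
    then show ?thesis
      using cone_fusion_le[of j l i] assms *[OF assms(2,1)] by (auto simp: add.commute algebra_simps)
  qed
qed

text \<open>Fusing the members of a family one after the other costs one generator of the cone per
  step and leaves a single entry, whose tone is that of the total.\<close>

lemma cone_fuse_all:
  assumes "1 \<le> l" "finite F" "F \<noteq> {}" "\<And>x. x \<in> F \<Longrightarrow> f x \<in> {1..l}"
  shows "fusion_cone l (\<lambda>h. of_bool (h = tone l (\<Sum>x\<in>F. f x)) - (\<Sum>x\<in>F. of_bool (h = f x)))"
  using assms(2-)
proof (induction F rule: finite_ne_induct)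
  case (singleton x)
  then show ?case
    by (intro cone_cong[OF cone_zero]) (use tone_self[of "f x" l] in \<open>simp del: sum_of_bool_eq\<close>)
next
  case (insert x F)
  let ?S = "\<Sum>x\<in>F. f x"
  have "tone l (f x + ?S) = tone l (f x + tone l ?S)"
    by (rule tone_cong[OF assms(1)]) (metis mod_add_right_eq tone_mod[OF assms(1)])
  then have "fusion_cone l (\<lambda>h. of_bool (h = tone l (f x + ?S)) - of_bool (h = f x) - of_bool (h = tone l ?S))"
    using cone_fusion[of "f x" l "tone l ?S"] insert.prems tone_in[OF assms(1)] by simp
  moreover have "fusion_cone l (\<lambda>h. of_bool (h = tone l ?S) - (\<Sum>x\<in>F. of_bool (h = f x)))"
    using insert by simp
  ultimately show ?case using insert.hyps by (auto intro: cone_cong[OF cone_add])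
qed

text \<open>Two entries of tone \<open>l\<close> fuse to one, since \<open>l + l\<close> is
  congruent to \<open>l\<close>; the generator with both indices \<open>l\<close> therefore deletes
  an entry.\<close>

lemma cone_remove: "1 \<le> l \<Longrightarrow> fusion_cone l (\<lambda>h. - of_bool (h = l))"
  using cone_fusion[of l l l] tone_cong[of l "l + l" l] tone_self[of l l] by simp

text \<open>Every fusion lowers the sum of the entries by one, whence antisymmetry of the order.\<close>

lemma cone_sum_le:
  assumes "fusion_cone l d"
  shows "(\<Sum>h\<in>{1..l}. d h) \<le> 0" "(\<Sum>h\<in>{1..l}. d h) = 0 \<Longrightarrow> h \<in> {1..l} \<Longrightarrow> d h = 0"
proof -
  obtain c :: "nat \<Rightarrow> nat \<Rightarrow> nat" where c: "\<And>h. h \<in> {1..l} \<Longrightarrow>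
      d h = (\<Sum>i\<in>{1..l}. \<Sum>j\<in>{i..l}. int (c i j) * fusion_vector l i j h)"
    using assms unfolding fusion_cone_def by blast
  have v: "(\<Sum>h\<in>{1..l}. fusion_vector l i j h) = -1" if "i \<in> {1..l}" "j \<in> {i..l}" for i j
  proof -
    have "(i + j - 1) mod l + 1 \<in> {1..l}" using that mod_less_divisor[of l "i + j - 1"] by (auto simp: Suc_le_eq)
    moreover have "(\<Sum>h\<in>{1..l}. of_bool (h = x) :: int) = 1" if "x \<in> {1..l}" for x
      using that by (simp add: of_bool_def)
    moreover have "j \<in> {1..l}" using that by auto
    ultimately show ?thesis using that(1) unfolding fusion_vector_def sum_subtractf by simp
  qed
  have "(\<Sum>h\<in>{1..l}. d h) = (\<Sum>h\<in>{1..l}. \<Sum>i\<in>{1..l}. \<Sum>j\<in>{i..l}. int (c i j) * fusion_vector l i j h)"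
    using c by simp
  also have "\<dots> = (\<Sum>i\<in>{1..l}. \<Sum>h\<in>{1..l}. \<Sum>j\<in>{i..l}. int (c i j) * fusion_vector l i j h)"
    by (rule sum.swap)
  also have "\<dots> = (\<Sum>i\<in>{1..l}. \<Sum>j\<in>{i..l}. \<Sum>h\<in>{1..l}. int (c i j) * fusion_vector l i j h)"
    by (rule sum.cong[OF refl], rule sum.swap)
  also have "\<dots> = (\<Sum>i\<in>{1..l}. \<Sum>j\<in>{i..l}. - int (c i j))"
    unfolding sum_distrib_left[symmetric] using v by (intro sum.cong refl) simp
  finally have s: "(\<Sum>h\<in>{1..l}. d h) = - (\<Sum>i\<in>{1..l}. \<Sum>j\<in>{i..l}. int (c i j))" by (simp add: sum_negf)
  then show "(\<Sum>h\<in>{1..l}. d h) \<le> 0" by (simp add: sum_nonneg)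
  assume "(\<Sum>h\<in>{1..l}. d h) = 0" "h \<in> {1..l}"
  then have "\<forall>i\<in>{1..l}. (\<Sum>j\<in>{i..l}. int (c i j)) = 0"
    using s by (simp add: sum_nonneg_eq_0_iff sum_nonneg)
  then have "int (c i j) = 0" if "i \<in> {1..l}" "j \<in> {i..l}" for i j
    using that by (simp add: sum_nonneg_eq_0_iff)
  then show "d h = 0" using c[OF \<open>h \<in> {1..l}\<close>] by simp
qed

text \<open>If \<open>t \<ge> 1\<close>, then \<open>m\<close> arises from \<open>n - l\<close>
  entries of tone 1: fuse \<open>i\<close> of them for each entry of tone \<open>i\<close> in
  \<open>m\<close>, fuse the remaining \<open>l * (t - 1)\<close>, if there are any, to one entry of
  tone \<open>l\<close>, and delete that entry. So \<open>m\<close> would lie below the vector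
  \<open>(n - l, 0, ..., 0)\<close>, which \<open>top_indices\<close> forbids.\<close>

lemma top_indices_weight:
  assumes l: "1 \<le> l" and m: "m \<in> top_indices l n"
  shows "index_weight l m = n"
proof -
  obtain t where t: "n = index_weight l m + l * t" using m unfolding top_indices_def index_set_def by blast
  have "fusion_cone l (\<lambda>h. int (m h) - (if h = 1 then int n - int l else 0))" if "t \<ge> 1"
  proof -
    let ?w = "index_weight l m"
    have one: "fusion_cone l (\<lambda>h. of_bool (h = i) - int i * of_bool (h = 1))" if "i \<in> {1..l}" for i
    proof -
      have "{..<i} \<noteq> {}" using that by (auto simp: lessThan_empty_iff)
      then show ?thesis using cone_fuse_all[OF l, of "{..<i}" "\<lambda>_. 1"] that l tone_self[OF that] by simp
    qed
    have "fusion_cone l (\<lambda>h. \<Sum>i\<in>{1..l}. \<Sum>k\<in>{..<m i}. of_bool (h = i) - int i * of_bool (h = 1))"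
      by (intro cone_sum one)
    moreover have "(\<Sum>i\<in>{1..l}. \<Sum>k\<in>{..<m i}. of_bool (h = i) - int i * of_bool (h = 1)) =
        int (m h) - int ?w * of_bool (h = 1)" if "h \<in> {1..l}" for h
    proof -
      have "(\<Sum>i\<in>{1..l}. \<Sum>k\<in>{..<m i}. of_bool (h = i) - int i * of_bool (h = 1)) =
          (\<Sum>i\<in>{1..l}. (if i = h then int (m h) else 0) - int (i * m i) * of_bool (h = 1))"
        by (intro sum.cong refl) (auto simp: algebra_simps)
      also have "\<dots> = int (m h) - int ?w * of_bool (h = 1)"
        using that by (simp add: sum_subtractf index_weight_def sum_distrib_right)
      finally show ?thesis .
    qed
    ultimately have 1: "fusion_cone l (\<lambda>h. int (m h) - int ?w * of_bool (h = 1))" by (rule cone_cong)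
    have 2: "fusion_cone l (\<lambda>h. - (int (l * (t - 1)) * of_bool (h = 1)))"
    proof (cases "t = 1")
      case False
      let ?F = "{..<l * (t - 1)}"
      have "0 < l * (t - 1)" using l \<open>t \<ge> 1\<close> False by simp
      then have "?F \<noteq> {}" by blast
      moreover have "tone l (l * (t - 1)) = l" using tone_eq_iff[OF l, of l "l * (t - 1)"] l by simp
      ultimately have "fusion_cone l (\<lambda>h. of_bool (h = l) - int (l * (t - 1)) * of_bool (h = 1))"
        using cone_fuse_all[OF l, of ?F "\<lambda>_. 1"] l by simp
      from cone_add[OF this cone_remove[OF l]] show ?thesis by (rule cone_cong) simp
    qed (simp add: cone_zero)
    have "int n - int l = int ?w + int (l * (t - 1))" using t \<open>t \<ge> 1\<close> by (simp add: algebra_simps)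
    then show ?thesis by (intro cone_cong[OF cone_add[OF 1 2]]) (auto simp: algebra_simps)
  qed
  then have "\<not> t \<ge> 1" using m unfolding top_indices_def index_le_cone by auto
  then show ?thesis using t by simp
qed


section \<open>Propagating vectors\<close>

lemma propagating_vector_tone:
  assumes "1 \<le> l" "i \<in> {1..l}"
  shows "propagating_vector l p i = card {s \<in> p. propagating s \<and> tone l (upper_size s) = i}"
  unfolding propagating_vector_def tone_eq_iff[OF assms] using assms(2) by simp

lemma propagating_vector_outside: "i \<notin> {1..l} \<Longrightarrow> propagating_vector l p i = 0"
  unfolding propagating_vector_def by (rule if_not_P)

lemma propagating_vector_sum:
  assumes "1 \<le> l" "finite p"
  shows "(\<Sum>i\<in>{1..l}. f i * propagating_vector l p i) = (\<Sum>s\<in>{s \<in> p. propagating s}. f (tone l (upper_size s)))"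
proof -
  have "(\<Sum>i\<in>{1..l}. f i * propagating_vector l p i) =
      (\<Sum>i\<in>{1..l}. \<Sum>s\<in>{s \<in> {s \<in> p. propagating s}. tone l (upper_size s) = i}. f (tone l (upper_size s)))"
    by (intro sum.cong refl) (simp add: propagating_vector_tone[OF assms(1)] conj_assoc)
  also have "\<dots> = (\<Sum>s\<in>{s \<in> p. propagating s}. f (tone l (upper_size s)))"
    by (rule sum.group) (use tone_in[OF assms(1)] assms(2) in auto)
  finally show ?thesis .
qed

lemma upper_size_pos: "p \<in> diagrams n m \<Longrightarrow> s \<in> p \<Longrightarrow> Inl -` s \<noteq> {} \<Longrightarrow> 0 < upper_size s"
  using diagram_part_finite(1) unfolding upper_size_def by (simp add: card_gt_0_iff)

text \<open>The contribution of a part to the weight of the propagating vector.\<close>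

abbreviation part_tone :: "nat \<Rightarrow> (nat + nat) set \<Rightarrow> nat" where
  "part_tone l s \<equiv> if propagating s then tone l (upper_size s) else 0"

text \<open>Divides the \<open>n\<close> upper vertices into the weight of the propagating vector
  and the excess of each part over its tone. The excesses are multiples of \<open>l\<close>, which
  yields membership in \<open>index_set\<close>, and they all vanish at full weight.\<close>

lemma propagating_excess:
  assumes l: "1 \<le> l" and q: "q \<in> tonal l n"
  shows "index_weight l (propagating_vector l q) +
    (\<Sum>s\<in>q. upper_size s - part_tone l s) = n"
    and "s \<in> q \<Longrightarrow> l dvd upper_size s - part_tone l s"
    and "s \<in> q \<Longrightarrow> part_tone l s \<le> upper_size s"
proof -
  note d = tonal_diagrams[OF q]
  have le: "part_tone l s \<le> upper_size s" if "s \<in> q" for s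
    using tone_le[OF l, of "upper_size s"] upper_size_pos[OF d that] by (simp add: propagating_def Suc_le_eq)
  then show "s \<in> q \<Longrightarrow> part_tone l s \<le> upper_size s" .
  have "index_weight l (propagating_vector l q) = (\<Sum>s\<in>q. if propagating s then tone l (upper_size s) else 0)"
    unfolding index_weight_def
    using propagating_vector_sum[OF l diagrams_finite[OF d], of "\<lambda>i. i"]
      sum.inter_filter[OF diagrams_finite[OF d], of "\<lambda>s. tone l (upper_size s)" propagating] by simp
  then have "index_weight l (propagating_vector l q) +
    (\<Sum>s\<in>q. upper_size s - part_tone l s) = (\<Sum>s\<in>q. upper_size s)"
    using le by (simp add: sum.distrib[symmetric])
  also have "\<dots> = n" using diagram_sum_sizes(1)[OF d order_refl] diagram_full_vimages(1)[OF d] by simp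
  finally show "index_weight l (propagating_vector l q) +
    (\<Sum>s\<in>q. upper_size s - part_tone l s) = n" .
  show "l dvd upper_size s - part_tone l s" if s: "s \<in> q"
  proof (cases "propagating s")
    case True
    then show ?thesis
      using le[OF s] tone_mod[OF l, of "upper_size s"] by simp (metis mod_eq_dvd_iff_nat)
  next
    case False
    have "upper_size s mod l = lower_size s mod l" using q s unfolding tonal_def by simp
    then have "upper_size s mod l = 0"
      using False unfolding propagating_def upper_size_def lower_size_def by auto
    then show ?thesis using False by auto
  qed
qed

lemma propagating_vector_index_set:
  assumes l: "1 \<le> l" and q: "q \<in> tonal l n"
  shows "propagating_vector l q \<in> index_set l n"
proof -
  have "l dvd (\<Sum>s\<in>q. upper_size s - part_tone l s)"
    using propagating_excess(2)[OF l q] by (rule dvd_sum)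
  then obtain t where "(\<Sum>s\<in>q. upper_size s - part_tone l s) = l * t"
    by (elim dvdE)
  then show ?thesis
    using propagating_excess(1)[OF l q] propagating_vector_outside unfolding index_set_def by auto
qed

text \<open>Full weight leaves no excess, so a part with an upper vertex propagates and has no more
  upper vertices than its tone, hence at most \<open>l\<close>.\<close>

lemma full_weight_uniform:
  assumes l: "1 \<le> l" and q: "q \<in> tonal l n" and w: "index_weight l (propagating_vector l q) = n"
  shows "q \<in> uniform l n"
proof (rule uniformI_parts[OF q])
  note d = tonal_diagrams[OF q]
  fix s assume s: "s \<in> q" "Inl -` s \<noteq> {}"
  have "(\<Sum>s\<in>q. upper_size s - part_tone l s) = 0"
    using propagating_excess(1)[OF l q] w by linarith
  then have "upper_size s \<le> part_tone l s"
    using s(1) diagrams_finite[OF d] by simp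
  moreover have "0 < upper_size s" using upper_size_pos[OF d s] .
  ultimately have "propagating s" "upper_size s \<le> tone l (upper_size s)" by (auto split: if_splits)
  then show "Inr -` s \<noteq> {} \<and> upper_size s \<le> l"
    using tone_in[OF l, of "upper_size s"] unfolding propagating_def by auto
qed

lemma uniform_propagating:
  assumes "p \<in> uniform l n" "s \<in> p"
  shows "propagating s" "Inl -` s \<noteq> {}" "Inr -` s \<noteq> {}"
proof -
  note d = uniform_diagrams[OF assms(1)]
  have "s \<noteq> {}" using d assms(2) partition_onD3 unfolding diagrams_def by auto
  then have "Inl -` s \<noteq> {} \<or> Inr -` s \<noteq> {}" using Plus_vimages[of s] by fastforce
  moreover have "card (Inl -` s) = card (Inr -` s)"
    using assms unfolding uniform_def upper_size_def lower_size_def by auto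
  ultimately show "Inl -` s \<noteq> {}" "Inr -` s \<noteq> {}"
    using diagram_part_finite[OF d assms(2)] by (metis card_0_eq card.empty)+
  then show "propagating s" unfolding propagating_def by simp
qed

lemma uniform_card_parts:
  assumes "1 \<le> l" "p \<in> uniform l n"
  shows "card p = (\<Sum>i\<in>{1..l}. propagating_vector l p i)"
proof -
  have "{s \<in> p. propagating s} = p" using uniform_propagating(1)[OF assms(2)] by blast
  then show ?thesis
    using propagating_vector_sum[OF assms(1) diagrams_finite[OF uniform_diagrams[OF assms(2)]], of "\<lambda>_. 1"] by simp
qed


section \<open>The diagrams of the index vectors\<close>

definition shift :: "nat \<Rightarrow> diagram \<Rightarrow> diagram" where
  "shift k p = (`) (map_sum ((+) k) ((+) k)) ` p"

lemma juxtapose_shift: "juxtapose k k p q = p \<union> shift k q"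
  unfolding juxtapose_def shift_def ..

lemma shift_shift: "shift k (shift j p) = shift (k + j) p"
proof -
  have "map_sum ((+) k) ((+) k) (map_sum ((+) j) ((+) j) x) = map_sum ((+) (k + j)) ((+) (k + j)) x" for x :: "nat + nat"
    by (cases x) (simp_all add: add.assoc)
  then show ?thesis unfolding shift_def image_image by simp
qed

lemma shift_Un: "shift k (p \<union> q) = shift k p \<union> shift k q"
  unfolding shift_def by (rule image_Un)

lemma shift_0: "shift 0 p = p"
proof -
  have "map_sum ((+) 0) ((+) 0) x = x" for x :: "nat + nat" by (cases x) simp_all
  then show ?thesis unfolding shift_def by simp
qed

lemma vimage_Plus: "Inl -` (A <+> B) = A" "Inr -` (A <+> B) = B"
  by auto

lemma shift_image_double: "shift k ((\<lambda>x. f x <+> f x) ` A) = (\<lambda>x. ((+) k ` f x) <+> ((+) k ` f x)) ` A"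
  unfolding shift_def image_image Plus_def image_Un by simp

lemma vimage_shift:
  "Inl -` (map_sum ((+) k) ((+) k) ` s) = (+) k ` (Inl -` s)"
  "Inr -` (map_sum ((+) k) ((+) k) ` s) = (+) k ` (Inr -` s)"
proof -
  have "map_sum ((+) k) ((+) k) ` s = map_sum ((+) k) ((+) k) ` ((Inl -` s) <+> (Inr -` s))"
    by (simp only: Plus_vimages)
  also have "\<dots> = ((+) k ` (Inl -` s)) <+> ((+) k ` (Inr -` s))"
    by (simp only: Plus_def image_Un image_image map_sum.simps)
  finally have "map_sum ((+) k) ((+) k) ` s = ((+) k ` (Inl -` s)) <+> ((+) k ` (Inr -` s))" .
  then show "Inl -` (map_sum ((+) k) ((+) k) ` s) = (+) k ` (Inl -` s)"
    "Inr -` (map_sum ((+) k) ((+) k) ` s) = (+) k ` (Inr -` s)" unfolding Plus_eq_iff by auto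
qed

lemma shift_sizes:
  "upper_size (map_sum ((+) k) ((+) k) ` s) = upper_size s"
  "lower_size (map_sum ((+) k) ((+) k) ` s) = lower_size s"
  "propagating (map_sum ((+) k) ((+) k) ` s) = propagating s"
  unfolding upper_size_def lower_size_def propagating_def vimage_shift by (simp_all add: card_image)

lemma juxtapose_diagrams:
  assumes p: "p \<in> diagrams k k" and q: "q \<in> diagrams j j"
  shows "juxtapose k k p q \<in> diagrams (k + j) (k + j)"
proof (rule diagramsI)
  let ?m = "map_sum ((+) k) ((+) k)"
  have P: "partition_on ({1..k} <+> {1..k}) p" and Q: "partition_on ({1..j} <+> {1..j}) q"
    using p q unfolding diagrams_def by auto
  show "{} \<notin> juxtapose k k p q"
    using partition_onD3[OF P] partition_onD3[OF Q] unfolding juxtapose_def by auto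
  have "\<Union>(shift k q) = ?m ` ({1..j} <+> {1..j})" unfolding shift_def using partition_onD1[OF Q] by (simp add: image_Union[symmetric])
  also have "\<dots> = {k<..k + j} <+> {k<..k + j}"
  proof -
    have "(+) k ` {1..j} = {k<..k + j}" by (metis add.commute atLeastSucAtMost_greaterThanAtMost image_add_atLeastAtMost One_nat_def add_Suc_right plus_nat.add_0 add_0_right)
    then show ?thesis using vimage_shift[of k "{1..j} <+> {1..j}"] by (simp add: Plus_eq_iff vimage_Plus)
  qed
  finally have sh: "\<Union>(shift k q) = {k<..k + j} <+> {k<..k + j}" .
  have "{1..k} \<union> {k<..k + j} = {1..k + j}" by auto
  then show "\<Union>(juxtapose k k p q) = {1..k + j} <+> {1..k + j}"
    unfolding juxtapose_shift Union_Un_distrib sh partition_onD1[OF P, symmetric] by (auto simp: Plus_def image_Un)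
  have inj: "inj ?m" by (rule sum.inj_map) simp_all
  have "disjoint (shift k q)"
    unfolding disjoint_def shift_def
  proof (intro ballI impI)
    fix a b assume "a \<in> (`) ?m ` q" "b \<in> (`) ?m ` q" "a \<noteq> b"
    then obtain s t where "s \<in> q" "t \<in> q" "a = ?m ` s" "b = ?m ` t" "s \<noteq> t" by blast
    then show "a \<inter> b = {}" using partition_onD2[OF Q] image_Int[OF inj] unfolding disjoint_def by (metis image_empty)
  qed
  moreover have "a \<inter> b = {}" if "a \<in> p" "b \<in> shift k q" for a b
  proof -
    have "a \<subseteq> {1..k} <+> {1..k}" "b \<subseteq> {k<..k + j} <+> {k<..k + j}" using that sh partition_onD1[OF P] by auto
    moreover have "({1..k} <+> {1..k}) \<inter> ({k<..k + j} <+> {k<..k + j}) = {}" by auto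
    ultimately show ?thesis by blast
  qed
  ultimately show "disjoint (juxtapose k k p q)"
    unfolding juxtapose_shift using partition_onD2[OF P] unfolding disjoint_def by (metis Int_commute Un_iff)
qed

lemma juxtapose_list_diagrams:
  assumes "\<And>k p. (k, p) \<in> set ps \<Longrightarrow> p \<in> diagrams k k"
  shows "juxtapose_list ps \<in> diagrams (sum_list (map fst ps)) (sum_list (map fst ps))"
  using assms
proof (induction ps rule: juxtapose_list.induct)
  case 1
  then show ?case by (auto simp: diagrams_def partition_on_def disjoint_def)
next
  case (2 k p ps)
  then show ?case using juxtapose_diagrams[of p k "juxtapose_list ps"] by auto
qed

lemma block_diagram_eq: "block_diagram i = {{1..i} <+> {1..i}}"
  unfolding block_diagram_def Plus_def ..

lemma block_diagram_in: "1 \<le> i \<Longrightarrow> block_diagram i \<in> diagrams i i"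
  unfolding block_diagram_eq by (rule diagramsI) (auto simp: disjoint_def Plus_def)

lemma juxtapose_list_blocks:
  "juxtapose_list (replicate k (i, block_diagram i) @ ps) =
    (\<lambda>j. {(j - 1) * i + 1..j * i} <+> {(j - 1) * i + 1..j * i}) ` {1..k} \<union> shift (k * i) (juxtapose_list ps)"
proof (induction k)
  case 0
  show ?case by (simp add: shift_0)
next
  case (Suc k)
  let ?f = "\<lambda>j. {(j - 1) * i + 1..j * i}"
  have f: "(+) i ` ?f j = ?f (Suc j)" if "j \<in> {1..k}" for j
  proof -
    have "i + ((j - 1) * i + 1) = (Suc j - 1) * i + 1" using that by (cases j) auto
    then show ?thesis by (simp add: image_add_atLeastAtMost)
  qed
  have "shift i ((\<lambda>j. ?f j <+> ?f j) ` {1..k}) = (\<lambda>j. ?f (Suc j) <+> ?f (Suc j)) ` {1..k}"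
    unfolding shift_image_double by (intro image_cong refl) (simp only: f)
  also have "\<dots> = (\<lambda>j. ?f j <+> ?f j) ` Suc ` {1..k}" by (simp only: image_image)
  finally have 1: "shift i ((\<lambda>j. ?f j <+> ?f j) ` {1..k}) = (\<lambda>j. ?f j <+> ?f j) ` Suc ` {1..k}" .
  have 2: "{1..Suc k} = insert 1 (Suc ` {1..k})" by (auto simp: image_iff)
  have "juxtapose_list (replicate (Suc k) (i, block_diagram i) @ ps) =
      {{1..i} <+> {1..i}} \<union> shift i (juxtapose_list (replicate k (i, block_diagram i) @ ps))"
    by (simp add: juxtapose_shift block_diagram_eq)
  also have "\<dots> = (\<lambda>j. ?f j <+> ?f j) ` {1..Suc k} \<union> shift (Suc k * i) (juxtapose_list ps)"
    unfolding Suc shift_Un shift_shift 1 2 by simp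
  finally show ?case .
qed

text \<open>The largest blocks come first in the index diagram, so passing to \<open>Suc L\<close>
  puts new blocks in front and shifts all others by their total length.\<close>

lemma lower_block_Suc:
  "lower_block (Suc L) m (Suc L) j = {(j - 1) * Suc L + 1..j * Suc L}"
  "i \<le> L \<Longrightarrow> lower_block (Suc L) m i j = (+) (m (Suc L) * Suc L) ` lower_block L m i j"
proof -
  show "lower_block (Suc L) m (Suc L) j = {(j - 1) * Suc L + 1..j * Suc L}" unfolding lower_block_def by simp
  assume "i \<le> L"
  then have "(\<Sum>h\<in>{i<..Suc L}. h * m h) = m (Suc L) * Suc L + (\<Sum>h\<in>{i<..L}. h * m h)"
    by (simp add: atLeastSucAtMost_greaterThanAtMost[symmetric])
  then show "lower_block (Suc L) m i j = (+) (m (Suc L) * Suc L) ` lower_block L m i j"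
    unfolding lower_block_def image_add_atLeastAtMost by (simp only: ac_simps)
qed

lemma juxtapose_list_all_blocks:
  "juxtapose_list (concat (map (\<lambda>i. replicate (m i) (i, block_diagram i)) (rev [1..<Suc L])) @ ps) =
    (\<lambda>(i, j). lower_block L m i j <+> lower_block L m i j) ` (SIGMA i:{1..L}. {1..m i}) \<union>
    shift (index_weight L m) (juxtapose_list ps)"
proof (induction L)
  case 0
  show ?case by (simp add: shift_0 index_weight_def)
next
  case (Suc L)
  let ?b = "\<lambda>L (i, j). lower_block L m i j <+> lower_block L m i j"
  let ?k = "m (Suc L) * Suc L"
  have S: "(SIGMA i:{1..Suc L}. {1..m i}) = Pair (Suc L) ` {1..m (Suc L)} \<union> (SIGMA i:{1..L}. {1..m i})"
    by (auto simp: image_iff le_Suc_eq)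
  have 1: "shift ?k (?b L ` (SIGMA i:{1..L}. {1..m i})) = ?b (Suc L) ` (SIGMA i:{1..L}. {1..m i})"
  proof -
    have "shift ?k (?b L ` (SIGMA i:{1..L}. {1..m i})) =
        (\<lambda>x. ((+) ?k ` lower_block L m (fst x) (snd x)) <+> ((+) ?k ` lower_block L m (fst x) (snd x))) ` (SIGMA i:{1..L}. {1..m i})"
      unfolding case_prod_beta by (rule shift_image_double)
    also have "\<dots> = ?b (Suc L) ` (SIGMA i:{1..L}. {1..m i})"
      by (intro image_cong refl) (auto simp: lower_block_Suc(2))
    finally show ?thesis .
  qed
  have 2: "?b (Suc L) ` Pair (Suc L) ` {1..m (Suc L)} =
      (\<lambda>j. {(j - 1) * Suc L + 1..j * Suc L} <+> {(j - 1) * Suc L + 1..j * Suc L}) ` {1..m (Suc L)}"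
    unfolding image_image prod.case lower_block_Suc(1) ..
  have 3: "?k + index_weight L m = index_weight (Suc L) m" unfolding index_weight_def by simp
  have "rev [1..<Suc (Suc L)] = Suc L # rev [1..<Suc L]" by simp
  then have "juxtapose_list (concat (map (\<lambda>i. replicate (m i) (i, block_diagram i)) (rev [1..<Suc (Suc L)])) @ ps) =
    juxtapose_list (replicate (m (Suc L)) (Suc L, block_diagram (Suc L)) @
      (concat (map (\<lambda>i. replicate (m i) (i, block_diagram i)) (rev [1..<Suc L])) @ ps))"
    by (simp only: list.map concat.simps append_assoc)
  also have "\<dots> = ?b (Suc L) ` Pair (Suc L) ` {1..m (Suc L)} \<union> shift ?k
      (?b L ` (SIGMA i:{1..L}. {1..m i}) \<union> shift (index_weight L m) (juxtapose_list ps))"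
    unfolding juxtapose_list_blocks Suc.IH 2 ..
  also have "\<dots> = ?b (Suc L) ` (SIGMA i:{1..Suc L}. {1..m i}) \<union> shift (index_weight (Suc L) m) (juxtapose_list ps)"
    unfolding shift_Un shift_shift 1 3 S image_Un Un_assoc ..
  finally show ?case .
qed

lemma cup_cap_list:
  assumes "1 \<le> l" "s \<in> juxtapose_list (replicate t (l, cup_cap_diagram l))"
  shows "upper_size s mod l = lower_size s mod l" "\<not> propagating s"
proof -
  have c: "upper_size s mod l = lower_size s mod l \<and> \<not> propagating s" if "s \<in> cup_cap_diagram l" for s
  proof -
    have v: "Inl -` Inl ` Z = Z" "Inr -` Inr ` Y = Y" "Inl -` Inr ` Y = {}" "Inr -` Inl ` Z = {}"
      for Z Y :: "nat set" by auto
    show ?thesis using that unfolding cup_cap_diagram_eq[OF assms(1)] upper_size_def lower_size_def propagating_def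
      by (auto simp: v)
  qed
  have "upper_size s mod l = lower_size s mod l \<and> \<not> propagating s"
    using assms(2)
  proof (induction t arbitrary: s)
    case (Suc t)
    then show ?case using c by (auto simp: juxtapose_def shift_sizes)
  qed simp
  then show "upper_size s mod l = lower_size s mod l" "\<not> propagating s" by auto
qed

lemma card_lower_block: "1 \<le> j \<Longrightarrow> card (lower_block l m i j) = i"
proof -
  assume "1 \<le> j"
  then have "j * i = (j - 1) * i + i" by (cases j) auto
  then show ?thesis unfolding lower_block_def by simp
qed

lemma lower_block_inj:
  assumes "1 \<le> i" "1 \<le> i'" "1 \<le> j" "1 \<le> j'" "lower_block l m i j = lower_block l m i' j'"
  shows "i = i'" "j = j'"
proof -
  show i: "i = i'" using card_lower_block[OF assms(3)] card_lower_block[OF assms(4)] assms(5) by metis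
  have e: "x + j * i = x + (j - 1) * i + i" for x using assms(3) by (cases j) auto
  have e': "x + j' * i = x + (j' - 1) * i + i" for x using assms(4) by (cases j') auto
  have "(j - 1) * i = (j' - 1) * i"
    using assms(1,5) unfolding i[symmetric] lower_block_def e e' by (simp add: Icc_eq_Icc)
  then show "j = j'" using assms by auto
qed

definition blocks :: "nat \<Rightarrow> (nat \<Rightarrow> nat) \<Rightarrow> nat set set" where
  "blocks l m = (\<lambda>(i, j). lower_block l m i j) ` (SIGMA i:{1..l}. {1..m i})"

lemma index_diagram_eq:
  "index_diagram l n m = (\<lambda>B. B <+> B) ` blocks l m \<union>
    shift (index_weight l m) (juxtapose_list (replicate ((n - index_weight l m) div l) (l, cup_cap_diagram l)))"
  unfolding index_diagram_def juxtapose_list_all_blocks blocks_def image_image case_prod_beta ..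

lemma upper_size_Plus: "upper_size (A <+> B) = card A" "lower_size (A <+> B) = card B"
  unfolding upper_size_def lower_size_def by (auto intro!: arg_cong[where f = card])

lemma index_diagram_diagrams:
  assumes l: "1 \<le> l" and m: "m \<in> index_set l n"
  shows "index_diagram l n m \<in> diagrams n n"
proof -
  obtain t where t: "n = index_weight l m + l * t" using m unfolding index_set_def by blast
  let ?c = "concat (map (\<lambda>i. replicate (m i) (i, block_diagram i)) (rev [1..<Suc l]))"
  let ?ps = "?c @ replicate ((n - index_weight l m) div l) (l, cup_cap_diagram l)"
  have "p \<in> diagrams k k" if "(k, p) \<in> set ?ps" for k p
  proof -
    have "cup_cap_diagram l \<in> diagrams l l"
      unfolding cup_cap_diagram_def
      by (rule diagram_comp_in[of _ l 0]; rule diagramsI; use l in \<open>simp add: Plus_def disjoint_def\<close>)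
    then show ?thesis using that block_diagram_in[of k] by (auto split: if_splits)
  qed
  then have "juxtapose_list ?ps \<in> diagrams (sum_list (map fst ?ps)) (sum_list (map fst ?ps))"
    by (rule juxtapose_list_diagrams)
  moreover have "sum_list (map fst ?c) = index_weight l m"
  proof -
    have "sum_list (map fst (concat (map (\<lambda>i. replicate (m i) (i, block_diagram i)) (rev [1..<Suc L])))) = index_weight L m" for L
      by (induction L) (simp_all add: index_weight_def sum_list_replicate mult.commute)
    then show ?thesis .
  qed
  then have "sum_list (map fst ?ps) = n" using t l by (simp add: sum_list_replicate mult.commute)
  ultimately show ?thesis unfolding index_diagram_def by simp
qed

lemma index_diagram_tonal:
  assumes l: "1 \<le> l" and m: "m \<in> index_set l n"
  shows "index_diagram l n m \<in> tonal l n"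
proof -
  have "upper_size s mod l = lower_size s mod l" if "s \<in> index_diagram l n m" for s
    using that cup_cap_list(1)[OF l] unfolding index_diagram_eq shift_def by (auto simp: upper_size_Plus shift_sizes)
  then show ?thesis using index_diagram_diagrams[OF assms] unfolding tonal_def by simp
qed

lemma propagating_vector_index_diagram:
  assumes l: "1 \<le> l" and m: "m \<in> index_set l n"
  shows "propagating_vector l (index_diagram l n m) = m"
proof
  fix i
  show "propagating_vector l (index_diagram l n m) i = m i"
  proof (cases "i \<in> {1..l}")
    case True
    have v: "Inl -` (A <+> A) = A" "Inr -` (A <+> A) = A" for A :: "nat set" by auto
    have "{s \<in> index_diagram l n m. propagating s \<and> tone l (upper_size s) = i} =
        (\<lambda>j. lower_block l m i j <+> lower_block l m i j) ` {1..m i}" (is "?L = ?R")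
    proof (intro subset_antisym subsetI)
      fix s assume "s \<in> ?L"
      then obtain B where B: "B \<in> blocks l m" "s = B <+> B" "tone l (card B) = i"
        using cup_cap_list(2)[OF l] unfolding index_diagram_eq shift_def
        by (auto simp: shift_sizes upper_size_Plus)
      then obtain i' j where ij: "i' \<in> {1..l}" "j \<in> {1..m i'}" "B = lower_block l m i' j" unfolding blocks_def by auto
      then have "i' = i" using B(3) tone_self[OF ij(1)] card_lower_block[of j l m i'] by simp
      then show "s \<in> ?R" using ij B(2) by blast
    next
      fix s assume "s \<in> ?R"
      then obtain j where j: "j \<in> {1..m i}" "s = lower_block l m i j <+> lower_block l m i j" by blast
      have c: "card (lower_block l m i j) = i" using card_lower_block j(1) by simp
      then have "lower_block l m i j \<noteq> {}" using True by auto
      then have "propagating s" unfolding propagating_def j(2) v by simp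
      moreover have "s \<in> index_diagram l n m" unfolding index_diagram_eq blocks_def using True j by blast
      ultimately show "s \<in> ?L" using c tone_self[OF True] unfolding j(2) by (simp add: upper_size_Plus)
    qed
    moreover have "inj_on (\<lambda>j. lower_block l m i j <+> lower_block l m i j) {1..m i}"
      by (rule inj_onI) (use lower_block_inj(2)[of i i] True in \<open>auto simp: Plus_inject\<close>)
    ultimately show ?thesis unfolding propagating_vector_tone[OF l True] by (simp add: card_image)
  next
    case False
    then show ?thesis using m propagating_vector_outside[OF False] unfolding index_set_def by simp
  qed
qed


section \<open>The ideal generated by a tonal diagram\<close>

text \<open>
  Counting lemma for the connecting diagrams below: \<open>Pq\<close> and \<open>Pa\<close> are the propagating parts of two
  diagrams matched by \<open>\<beta>\<close>, and every other part of the second one is attached to \<open>s0\<close>.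
\<close>

lemma fibre_sum_mod:
  fixes f0 f :: "'a \<Rightarrow> nat"
  assumes fin: "finite a" and Pa: "Pa \<subseteq> a" and \<beta>: "bij_betw \<beta> Pq Pa"
    and f: "\<And>v. v \<in> a \<Longrightarrow> v \<notin> Pa \<Longrightarrow> f v mod l = 0"
    and f\<beta>: "\<And>s. s \<in> Pq \<Longrightarrow> f (\<beta> s) mod l = f0 s mod l"
    and f0: "\<And>s. s \<in> q \<Longrightarrow> s \<notin> Pq \<Longrightarrow> f0 s mod l = 0" and c: "c \<in> q"
    and g: "\<And>v. v \<in> Pa \<Longrightarrow> g v = inv_into Pq \<beta> v" "\<And>v. v \<in> a \<Longrightarrow> v \<notin> Pa \<Longrightarrow> g v = s0"
  shows "(\<Sum>v\<in>{v \<in> a. g v = c}. f v) mod l = f0 c mod l"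
proof -
  have inj: "inj_on \<beta> Pq" and surj: "\<beta> ` Pq = Pa" using \<beta> unfolding bij_betw_def by auto
  have "(\<Sum>v\<in>{v \<in> a. g v = c}. f v) mod l = (\<Sum>v\<in>{v \<in> a. g v = c}. f v mod l) mod l"
    by (simp add: mod_sum_eq)
  also have "(\<Sum>v\<in>{v \<in> a. g v = c}. f v mod l) = (\<Sum>v\<in>{v \<in> Pa. g v = c}. f v mod l)"
  proof (rule sum.mono_neutral_right)
    have "v \<in> Pa" if "v \<in> a" "f v mod l \<noteq> 0" for v using f[of v] that by metis
    then show "\<forall>i\<in>{v \<in> a. g v = c} - {v \<in> Pa. g v = c}. f i mod l = 0" by blast
  qed (use fin Pa in auto)
  also have "\<dots> mod l = f0 c mod l"
  proof (cases "c \<in> Pq")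
    case True
    have "{v \<in> Pa. g v = c} = {\<beta> c}"
    proof (intro subset_antisym subsetI)
      fix v assume "v \<in> {v \<in> Pa. g v = c}"
      then have "v \<in> Pa" "inv_into Pq \<beta> v = c" using g(1) by auto
      then show "v \<in> {\<beta> c}" using f_inv_into_f[of v \<beta> Pq] surj by auto
    next
      fix v assume "v \<in> {\<beta> c}"
      then show "v \<in> {v \<in> Pa. g v = c}" using True surj inv_into_f_f[OF inj True] g(1)[of "\<beta> c"] by auto
    qed
    then show ?thesis using f\<beta>[OF True] by simp
  next
    case False
    have "g v \<in> Pq" if "v \<in> Pa" for v using that g(1) inv_into_into[of v \<beta> Pq] surj by auto
    then have "{v \<in> Pa. g v = c} = {}" using False by auto
    then show ?thesis using f0[OF c False] by (simp only: sum.empty mod_0)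
  qed
  finally show ?thesis .
qed

text \<open>Used to match the propagating parts of two diagrams tone by tone.\<close>

lemma bij_betw_fibres:
  assumes "finite A" "finite B" "\<And>i. card {x \<in> A. f x = i} = card {y \<in> B. g y = i}"
  obtains \<beta> where "bij_betw \<beta> A B" "\<And>x. x \<in> A \<Longrightarrow> g (\<beta> x) = f x"
proof -
  have "\<exists>h. bij_betw h {x \<in> A. f x = i} {y \<in> B. g y = i}" for i
    using finite_same_card_bij[OF _ _ assms(3)[of i]] assms(1,2) by simp
  then obtain h where h: "\<And>i. bij_betw (h i) {x \<in> A. f x = i} {y \<in> B. g y = i}" by metis
  define \<beta> where "\<beta> x = h (f x) x" for x
  have b: "\<beta> x \<in> B" "g (\<beta> x) = f x" if "x \<in> A" for x
    using bij_betwE[OF h[of "f x"]] that unfolding \<beta>_def by auto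
  have "inj_on \<beta> A"
  proof (rule inj_onI)
    fix x y assume xy: "x \<in> A" "y \<in> A" "\<beta> x = \<beta> y"
    then have "f x = f y" using b by metis
    then show "x = y" using inj_onD[OF bij_betw_imp_inj_on[OF h[of "f x"]], of x y] xy unfolding \<beta>_def by auto
  qed
  moreover have "y \<in> \<beta> ` A" if "y \<in> B" for y
  proof -
    have "y \<in> h (g y) ` {x \<in> A. f x = g y}" using bij_betw_imp_surj_on[OF h[of "g y"]] that by auto
    then obtain x where x: "x \<in> A" "f x = g y" "y = h (g y) x" by auto
    then have "y = \<beta> x" unfolding \<beta>_def by simp
    then show ?thesis using x(1) by blast
  qed
  ultimately have "bij_betw \<beta> A B" using b(1) unfolding bij_betw_def by auto
  then show ?thesis using b(2) that by blast
qed

lemma count_part_of_upper: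
  assumes d: "a \<in> diagrams n n"
  shows "card {k \<in> {1..n}. g (part_of a (Inl k)) = c} = (\<Sum>v\<in>{v \<in> a. g v = c}. upper_size v)"
    "card {k \<in> {1..n}. g (part_of a (Inr k)) = c} = (\<Sum>v\<in>{v \<in> a. g v = c}. lower_size v)"
  using part_of_vimages[OF d, of "g -` {c}"] diagram_sum_sizes[OF d, of "{v \<in> a. g v = c}"]
  by (simp_all add: Int_def)

context tonal_alg_pos
begin

lemma nonpropagating_size:
  assumes "q \<in> T" "s \<in> q" "\<not> propagating s"
  shows "upper_size s mod l = 0" "lower_size s mod l = 0"
proof -
  have "upper_size s mod l = lower_size s mod l" using assms(1,2) unfolding tonal_def by simp
  moreover have "upper_size s = 0 \<or> lower_size s = 0"
    using assms(3) unfolding propagating_def upper_size_def lower_size_def by auto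
  ultimately show "upper_size s mod l = 0" "lower_size s mod l = 0" by auto
qed

text \<open>
  If \<open>q\<close> and \<open>a\<close> have the same propagating vector then \<open>q = x a y\<close> without loops: \<open>x\<close> joins the upper
  half of each propagating part of \<open>q\<close> to that of a propagating part of \<open>a\<close> of the same tone, and
  all remaining upper vertices of \<open>a\<close> to one fixed part of \<open>q\<close>; similarly for \<open>y\<close>.
\<close>

lemma same_vector_in_ideal:
  assumes I: "ideal I P" "diagram_elt a \<in> I" and q: "q \<in> T" and a: "a \<in> T"
    and pv: "propagating_vector l q = propagating_vector l a"
  shows "diagram_elt q \<in> I"
\<comment> \<open>Without vertices there would be no part to which the remaining vertices could be
  attached.\<close>
proof (cases "n = 0")
  case True
  have "p = {}" if "p \<in> diagrams 0 0" for p using that unfolding diagrams_def partition_on_def by (auto simp: Plus_def)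
  then have "q = a" using tonal_diagrams q a True by metis
  then show ?thesis using I(2) by simp
next
  case False
  note qd = tonal_diagrams[OF q] and ad = tonal_diagrams[OF a]
  let ?Pq = "{s \<in> q. propagating s}" and ?Pa = "{s \<in> a. propagating s}"
  have fin: "finite q" "finite a" using diagrams_finite qd ad by blast+
  have cards: "card {s \<in> ?Pq. tone l (upper_size s) = i} = card {s \<in> ?Pa. tone l (upper_size s) = i}" for i
  proof (cases "i \<in> {1..l}")
    case True
    then show ?thesis using fun_cong[OF pv, of i] by (simp add: propagating_vector_tone[OF l True] conj_assoc)
  next
    case False
    then have "tone l x \<noteq> i" for x using tone_in[OF l, of x] by auto
    then show ?thesis by simp
  qed
  obtain \<beta> where \<beta>: "bij_betw \<beta> ?Pq ?Pa" "\<And>s. s \<in> ?Pq \<Longrightarrow> tone l (upper_size (\<beta> s)) = tone l (upper_size s)"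
    by (rule bij_betw_fibres[OF _ _ cards]) (use fin in auto)
  have \<beta>u: "upper_size (\<beta> s) mod l = upper_size s mod l" if "s \<in> ?Pq" for s
    using \<beta>(2)[OF that] tone_mod[OF l] by metis
  have \<beta>a: "\<beta> s \<in> ?Pa" if "s \<in> ?Pq" for s using bij_betwE[OF \<beta>(1)] that by blast
  have \<beta>l: "lower_size (\<beta> s) mod l = lower_size s mod l" if "s \<in> ?Pq" for s
    using \<beta>u[OF that] \<beta>a[OF that] that q a unfolding tonal_def by auto
  have inv: "inv_into ?Pq \<beta> v \<in> ?Pq" if "v \<in> ?Pa" for v
    using inv_into_into[of v \<beta> ?Pq] that bij_betw_imp_surj_on[OF \<beta>(1)] by blast
  have inv\<beta>: "inv_into ?Pq \<beta> (\<beta> s) = s" if "s \<in> ?Pq" for s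
    by (rule inv_into_f_f[OF bij_betw_imp_inj_on[OF \<beta>(1)] that])
  obtain s0 where s0: "s0 \<in> q" "Inl 1 \<in> s0" using diagram_part_exists(1)[OF qd, of 1] False by auto
  obtain s1 where s1: "s1 \<in> q" "Inr 1 \<in> s1" using diagram_part_exists(2)[OF qd, of 1] False by auto
  define g0 where "g0 v = (if propagating v then inv_into ?Pq \<beta> v else s0)" for v
  define g1 where "g1 v = (if propagating v then inv_into ?Pq \<beta> v else s1)" for v
  have g0: "g0 v \<in> q" "Inl -` g0 v \<noteq> {}" if "v \<in> a" for v
    using inv[of v] that s0 unfolding g0_def propagating_def by auto
  have g1: "g1 v \<in> q" "Inr -` g1 v \<noteq> {}" if "v \<in> a" for v
    using inv[of v] that s1 unfolding g1_def propagating_def by auto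
  have g01: "g0 v = g1 v" if "propagating v" for v using that unfolding g0_def g1_def by simp
  define x where "x = label_diagram n n (\<lambda>i. part_of q (Inl i)) (\<lambda>k. g0 (part_of a (Inl k)))"
  define y where "y = label_diagram n n (\<lambda>k. g1 (part_of a (Inr k))) (\<lambda>j. part_of q (Inr j))"
  have xd: "x \<in> diagrams n n" and yd: "y \<in> diagrams n n" unfolding x_def y_def by (rule label_diagram_in)+
  have drx: "drel x = range (\<lambda>S. (Inl -` \<Union>(q \<inter> S), Inl -` \<Union>(a \<inter> g0 -` S)))"
    unfolding x_def drel_label_diagram using part_of_vimages(1)[OF qd] part_of_vimages(1)[OF ad, of "g0 -` _"] by simp
  have dry: "drel y = range (\<lambda>S. (Inr -` \<Union>(a \<inter> g1 -` S), Inr -` \<Union>(q \<inter> S)))"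
    unfolding y_def drel_label_diagram using part_of_vimages(2)[OF qd] part_of_vimages(2)[OF ad, of "g1 -` _"] by simp
  \<comment> \<open>Compares, modulo \<open>l\<close>, the vertices that the two rows of a
    connecting diagram contribute to the label \<open>c\<close>. One statement serves the upper
    sizes for \<open>x\<close> and the lower sizes for \<open>y\<close>.\<close>
  have fibre: "(\<Sum>v\<in>{v \<in> q. v = c}. f v) mod l = (\<Sum>v\<in>{v \<in> a. h v = c}. f v) mod l"
    if h: "\<And>v. h v = (if propagating v then inv_into ?Pq \<beta> v else s)" "\<And>v. v \<in> a \<Longrightarrow> h v \<in> q"
      and f: "\<And>s. s \<in> ?Pq \<Longrightarrow> f (\<beta> s) mod l = f s mod l" "\<And>p s. p \<in> T \<Longrightarrow> s \<in> p \<Longrightarrow> \<not> propagating s \<Longrightarrow> f s mod l = 0"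
    for h f s c
  proof (cases "c \<in> q")
    case True
    have "(\<Sum>v\<in>{v \<in> a. h v = c}. f v) mod l = f c mod l"
    proof (rule fibre_sum_mod[where f = f and ?f0.0 = f and q = q and Pq = ?Pq and Pa = ?Pa and ?s0.0 = s and \<beta> = \<beta>])
      show "bij_betw \<beta> ?Pq ?Pa" "c \<in> q" "finite a" by (fact \<beta>(1) True fin(2))+
    qed (use f q a in \<open>auto simp: h(1)\<close>)
    moreover have "{v \<in> q. v = c} = {c}" using True by auto
    ultimately show ?thesis by simp
  next
    case False
    then have "{v \<in> q. v = c} = {}" "{v \<in> a. h v = c} = {}" using h(2) by auto
    then show ?thesis by (simp only: sum.empty)
  qed
  have xT: "x \<in> T"
    unfolding x_def
    by (rule label_diagram_tonal, unfold count_part_of_upper(1)[OF ad] count_part_of_upper(1)[OF qd, of "\<lambda>v. v"],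
      rule fibre[where h = g0 and f = upper_size, OF g0_def g0(1) \<beta>u nonpropagating_size(1)])
  have yT: "y \<in> T"
    unfolding y_def
    by (rule label_diagram_tonal, unfold count_part_of_upper(2)[OF ad] count_part_of_upper(2)[OF qd, of "\<lambda>v. v"],
      rule fibre[where h = g1 and f = lower_size, OF g1_def g1(1) \<beta>l nonpropagating_size(2), symmetric])
  have cong_upper: "Inl -` \<Union>F = Inl -` \<Union>G"
    if "\<And>v. Inl -` v \<noteq> {} \<Longrightarrow> v \<in> F \<longleftrightarrow> v \<in> G" for F G :: diagram
    using that by (auto simp: vimage_Union)
  have cong_lower: "Inr -` \<Union>F = Inr -` \<Union>G"
    if "\<And>v. Inr -` v \<noteq> {} \<Longrightarrow> v \<in> F \<longleftrightarrow> v \<in> G" for F G :: diagram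
    using that by (auto simp: vimage_Union)
  have dj: "u = v" if "p \<in> diagrams n n" "u \<in> p" "v \<in> p" "z \<in> u" "z \<in> v" for p u v z
    using part_of_eq[OF that(1,2,4)] part_of_eq[OF that(1,3,5)] by simp
  have eq_upper: "v \<in> F \<longleftrightarrow> v \<in> G"
    if "F \<subseteq> a" "G \<subseteq> a" "Inl -` \<Union>F = Inl -` \<Union>G" "v \<in> a" "Inl -` v \<noteq> {}" for F G v
  proof -
    obtain i where i: "Inl i \<in> v" using \<open>Inl -` v \<noteq> {}\<close> by blast
    have *: "v \<in> H \<longleftrightarrow> i \<in> Inl -` \<Union>H" if "H \<subseteq> a" for H
      using dj[OF ad _ \<open>v \<in> a\<close> _ i] that i by blast
    show ?thesis using *[OF that(1)] *[OF that(2)] that(3) by simp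
  qed
  have eq_lower: "v \<in> F \<longleftrightarrow> v \<in> G"
    if "F \<subseteq> a" "G \<subseteq> a" "Inr -` \<Union>F = Inr -` \<Union>G" "v \<in> a" "Inr -` v \<noteq> {}" for F G v
  proof -
    obtain i where i: "Inr i \<in> v" using \<open>Inr -` v \<noteq> {}\<close> by blast
    have *: "v \<in> H \<longleftrightarrow> i \<in> Inr -` \<Union>H" if "H \<subseteq> a" for H
      using dj[OF ad _ \<open>v \<in> a\<close> _ i] that i by blast
    show ?thesis using *[OF that(1)] *[OF that(2)] that(3) by simp
  qed
  have "(A, B) \<in> drel x O drel a O drel y \<longleftrightarrow> (A, B) \<in> drel q" for A B
  proof
    assume "(A, B) \<in> drel x O drel a O drel y"
    then obtain M N where MN: "(A, M) \<in> drel x" "(M, N) \<in> drel a" "(N, B) \<in> drel y" by blast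
    obtain S where S: "A = Inl -` \<Union>(q \<inter> S)" "M = Inl -` \<Union>(a \<inter> g0 -` S)" using MN(1) unfolding drx by blast
    obtain S' where S': "N = Inr -` \<Union>(a \<inter> g1 -` S')" "B = Inr -` \<Union>(q \<inter> S')" using MN(3) unfolding dry by blast
    obtain F where F: "F \<subseteq> a" "M = Inl -` \<Union>F" "N = Inr -` \<Union>F" using drel_obtain_parts[OF MN(2)] by metis
    \<comment> \<open>A propagating part of \<open>a\<close> is selected on top and bottom at once,
      so the selections made through \<open>x\<close> and through \<open>y\<close> agree on the
      propagating parts of \<open>q\<close>.\<close>
    have SS: "s \<in> S \<longleftrightarrow> s \<in> S'" if s: "s \<in> ?Pq" for s
    proof -
      have b: "\<beta> s \<in> a" "Inl -` \<beta> s \<noteq> {}" "Inr -` \<beta> s \<noteq> {}" "g0 (\<beta> s) = s" "g1 (\<beta> s) = s"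
        using \<beta>a[OF s] inv\<beta>[OF s] unfolding g0_def g1_def propagating_def by auto
      have "\<beta> s \<in> F \<longleftrightarrow> \<beta> s \<in> a \<inter> g0 -` S" by (rule eq_upper) (use F S b in auto)
      moreover have "\<beta> s \<in> F \<longleftrightarrow> \<beta> s \<in> a \<inter> g1 -` S'" by (rule eq_lower) (use F S' b in auto)
      ultimately show ?thesis using b by auto
    qed
    \<comment> \<open>A part of \<open>q\<close> without upper vertices is visible only through
      \<open>y\<close>, one without lower vertices only through \<open>x\<close>; on propagating
      parts both selections agree.\<close>
    define G where "G = {s \<in> q. if Inl -` s \<noteq> {} then s \<in> S else s \<in> S'}"
    have "A = Inl -` \<Union>G" unfolding S by (rule cong_upper) (auto simp: G_def)
    moreover have "B = Inr -` \<Union>G" unfolding S'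
      by (rule cong_lower) (use SS in \<open>auto simp: G_def propagating_def\<close>)
    ultimately show "(A, B) \<in> drel q" using drel_vimagesI[of G q] unfolding G_def by auto
  next
    assume "(A, B) \<in> drel q"
    then obtain G where G: "G \<subseteq> q" "A = Inl -` \<Union>G" "B = Inr -` \<Union>G" using drel_obtain_parts by metis
    define F where "F = {v \<in> a. if Inl -` v \<noteq> {} then g0 v \<in> G else g1 v \<in> G}"
    have qG: "q \<inter> G = G" using G(1) by blast
    have "Inl -` \<Union>(a \<inter> g0 -` G) = Inl -` \<Union>F" by (rule cong_upper) (auto simp: F_def)
    then have 1: "(A, Inl -` \<Union>F) \<in> drel x" unfolding drx G(2) by (intro range_eqI[of _ _ G]) (simp add: qG)
    have "Inr -` \<Union>(a \<inter> g1 -` G) = Inr -` \<Union>F"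
      by (rule cong_lower) (use g01 in \<open>auto simp: F_def propagating_def\<close>)
    then have 2: "(Inr -` \<Union>F, B) \<in> drel y" unfolding dry G(3) by (intro range_eqI[of _ _ G]) (simp add: qG)
    have "(Inl -` \<Union>F, Inr -` \<Union>F) \<in> drel a" using drel_vimagesI[of F a] unfolding F_def by auto
    then show "(A, B) \<in> drel x O drel a O drel y" using 1 2 by blast
  qed
  then have "drel x O drel a O drel y = drel q" by (rule rel_eqI)
  then have comp: "diagram_comp (diagram_comp x a) y = q"
    by (intro drel_inj[OF diagram_comp_in[OF diagram_comp_in[OF xd ad] yd] qd])
      (simp add: drel_comp[OF diagram_comp_in[OF xd ad] yd] drel_comp[OF xd ad] O_assoc)
  \<comment> \<open>Every label used in the lower row of \<open>x\<close> is a part of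
    \<open>q\<close> with an upper vertex, so no union of parts of \<open>x\<close> lies in the
    lower row alone.\<close>
  have L1: "diagram_loops x a = 0"
  proof (rule diagram_loops_eq_0[OF xd ad])
    fix M assume "({}, M) \<in> drel x"
    then obtain S where S: "{} = Inl -` \<Union>(q \<inter> S)" "M = Inl -` \<Union>(a \<inter> g0 -` S)" unfolding drx by auto
    then show "M = {}" using g0 by blast
  qed
  have L2: "diagram_loops (diagram_comp x a) y = 0"
  proof (rule diagram_loops_eq_0[OF diagram_comp_in[OF xd ad] yd])
    fix M assume "(M, {}) \<in> drel y"
    then obtain S where S: "{} = Inr -` \<Union>(q \<inter> S)" "M = Inr -` \<Union>(a \<inter> g1 -` S)" unfolding dry by auto
    then show "M = {}" using g1 by blast
  qed
  have "diagram_elt q = (diagram_elt x \<bullet> diagram_elt a) \<bullet> diagram_elt y"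
    using mult_elts[OF xT a L1] mult_elts[OF tonal_comp[OF xT a] yT L2] comp by simp
  then show ?thesis
    using ideal.I_r_closed[OF I(1) ideal.I_l_closed[OF I diagram_elt_in[OF xT]] diagram_elt_in[OF yT]] by simp
qed


subsection \<open>Index diagrams of full weight\<close>

definition lower_traces :: "diagram \<Rightarrow> nat set set" where
  "lower_traces p = (\<lambda>s. Inr -` s) ` p - {{}}"

lemma Range_drel: "Range (drel p) = unions (lower_traces p)"
proof -
  have "Range (drel p) = (\<lambda>s. Inr -` s) ` unions p"
    unfolding unions_eq_drel image_image case_prod_beta vimage_Plus by (simp add: Range_snd)
  then show ?thesis unfolding lower_traces_def unions_vimage .
qed

lemma partition_on_lower_traces: "p \<in> diagrams n m \<Longrightarrow> partition_on {1..m} (lower_traces p)"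
  using partition_on_vimage[of "{1..n} <+> {1..m}" p Inr]
  unfolding lower_traces_def diagrams_def by (simp add: vimage_Plus)

lemma uniform_lower_traces: "p \<in> U \<Longrightarrow> lower_traces p = (\<lambda>s. Inr -` s) ` p"
  unfolding lower_traces_def using uniform_propagating(3) by blast

text \<open>A uniform part has between 1 and \<open>l\<close> vertices in each row, so its tone is
  its size; moreover a part is determined by its lower trace.\<close>

lemma uniform_propagating_vector:
  assumes "p \<in> U" "i \<in> {1..l}"
  shows "propagating_vector l p i = card {B \<in> lower_traces p. card B = i}"
proof -
  note d = uniform_diagrams[OF assms(1)]
  have inj: "inj_on (\<lambda>s. Inr -` s) p"
  proof (rule inj_onI)
    fix s u assume su: "s \<in> p" "u \<in> p" "Inr -` s = Inr -` u"
    then obtain y where y: "Inr y \<in> s" "Inr y \<in> u" using uniform_propagating(3)[OF assms(1)] by blast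
    then show "s = u" using part_of_eq[OF d su(1) y(1)] part_of_eq[OF d su(2) y(2)] by simp
  qed
  have "tone l (upper_size s) = card (Inr -` s)" if "s \<in> p" for s
  proof -
    have "upper_size s = card (Inr -` s)" "upper_size s \<le> l" "0 < upper_size s"
      using assms(1) that upper_size_pos[OF d that uniform_propagating(2)[OF assms(1) that]]
      unfolding uniform_def lower_size_def by auto
    then show ?thesis using tone_self[of "upper_size s" l] by auto
  qed
  then have "{s \<in> p. propagating s \<and> tone l (upper_size s) = i} = {s \<in> p. card (Inr -` s) = i}"
    using uniform_propagating(1)[OF assms(1)] by auto
  moreover have "{B \<in> lower_traces p. card B = i} = (\<lambda>s. Inr -` s) ` {s \<in> p. card (Inr -` s) = i}"
    unfolding uniform_lower_traces[OF assms(1)] by auto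
  ultimately show ?thesis
    unfolding propagating_vector_tone[OF l assms(2)] using card_image[OF inj_on_subset[OF inj]] by simp
qed


end


section \<open>The cap ideal\<close>

lemma unions_Un: "unions (P \<union> Q) = {Y \<union> Z | Y Z. Y \<in> unions P \<and> Z \<in> unions Q}"
proof (intro subset_antisym subsetI)
  fix Z assume "Z \<in> unions (P \<union> Q)"
  then obtain F where "F \<subseteq> P \<union> Q" "Z = \<Union>F" unfolding unions_def by auto
  then have "Z = \<Union>(F \<inter> P) \<union> \<Union>(F \<inter> Q)" by blast
  then show "Z \<in> {Y \<union> Z | Y Z. Y \<in> unions P \<and> Z \<in> unions Q}" unfolding unions_def by blast
next
  fix Z assume "Z \<in> {Y \<union> Z | Y Z. Y \<in> unions P \<and> Z \<in> unions Q}"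
  then obtain F G where "F \<subseteq> P" "G \<subseteq> Q" "Z = \<Union>(F \<union> G)" unfolding unions_def by auto
  then show "Z \<in> unions (P \<union> Q)" unfolding unions_def by blast
qed

lemma drel_juxtapose:
  "(A, B) \<in> drel (juxtapose k k p q) \<longleftrightarrow> (\<exists>A1 B1 A2 B2. (A1, B1) \<in> drel p \<and> (A2, B2) \<in> drel q \<and>
     A = A1 \<union> (+) k ` A2 \<and> B = B1 \<union> (+) k ` B2)"
proof -
  let ?m = "map_sum ((+) k) ((+) k) :: nat + nat \<Rightarrow> nat + nat"
  have "unions (shift k q) = (`) ?m ` unions q"
    unfolding unions_def shift_def image_Pow_surj[OF refl, symmetric] image_image image_Union ..
  then have "A <+> B \<in> unions (juxtapose k k p q) \<longleftrightarrow> (\<exists>Y\<in>unions p. \<exists>Z\<in>unions q. A <+> B = Y \<union> ?m ` Z)"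
    unfolding juxtapose_shift unions_Un by auto
  moreover have "(A1 <+> B1) \<union> ?m ` (A2 <+> B2) = (A1 \<union> (+) k ` A2) <+> (B1 \<union> (+) k ` B2)" for A1 B1 A2 B2
    by (auto simp: Plus_def image_Un image_image)
  ultimately show ?thesis
    unfolding drel_def[of "juxtapose k k p q"] unions_eq_drel[of p] unions_eq_drel[of q]
    by (simp add: Plus_inject case_prod_unfold Bex_def split_paired_Ex)
qed

lemma juxtapose_split:
  fixes k :: nat
  assumes "M \<union> (+) k ` A = N \<union> (+) k ` B" "M \<subseteq> {1..k}" "N \<subseteq> {1..k}" "A \<subseteq> {1..r}" "B \<subseteq> {1..r}"
  shows "M = N" "A = B"
proof -
  have "0 \<notin> A" "0 \<notin> B" using assms(4,5) by auto
  then have d: "(+) k ` A \<inter> {1..k} = {}" "(+) k ` B \<inter> {1..k} = {}" by auto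
  have "M = (M \<union> (+) k ` A) \<inter> {1..k}" "N = (N \<union> (+) k ` B) \<inter> {1..k}"
    unfolding Int_Un_distrib2 d using assms(2,3) by (simp_all add: Int_absorb2)
  then show "M = N" unfolding assms(1) by simp
  have "(+) k ` A = (M \<union> (+) k ` A) - {1..k}" "(+) k ` B = (N \<union> (+) k ` B) - {1..k}"
    using assms(2,3) d by (simp_all add: Un_Diff Diff_triv Diff_eq_empty_iff[THEN iffD2])
  then have "(+) k ` A = (+) k ` B" unfolding assms(1) by simp
  then show "A = B" by (simp add: inj_image_eq_iff)
qed

lemma cup_cap_in: "1 \<le> l \<Longrightarrow> cup_cap_diagram l \<in> diagrams l l"
  unfolding cup_cap_diagram_eq by (rule diagramsI) (auto simp: Plus_def disjoint_def)

lemma cup_cap_parts: "1 \<le> l \<Longrightarrow> s \<in> cup_cap_diagram l \<Longrightarrow> upper_size s mod l = lower_size s mod l \<and> \<not> propagating s"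
  using cup_cap_list[of l s 1] by (simp add: juxtapose_def)

lemma propagating_vector_juxtapose:
  assumes "1 \<le> l"
  shows "propagating_vector l (juxtapose l l (cup_cap_diagram l) q) = propagating_vector l q"
proof
  fix i
  let ?m = "map_sum ((+) l) ((+) l) :: nat + nat \<Rightarrow> nat + nat"
  have "{s \<in> juxtapose l l (cup_cap_diagram l) q. propagating s \<and> upper_size s mod l = i mod l} =
      (`) ?m ` {s \<in> q. propagating s \<and> upper_size s mod l = i mod l}"
    unfolding juxtapose_def using cup_cap_parts[OF assms] by (auto simp: shift_sizes)
  moreover have "inj ?m" by (rule sum.inj_map) simp_all
  then have "inj_on ((`) ?m) S" for S by (auto intro!: inj_onI simp: inj_image_eq_iff)
  ultimately show "propagating_vector l (juxtapose l l (cup_cap_diagram l) q) i = propagating_vector l q i"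
    unfolding propagating_vector_def by (simp add: card_image)
qed

context tonal_alg_pos
begin

lemma juxtapose_tonal:
  assumes "l \<le> n" "p \<in> tonal l l" "q \<in> tonal l (n - l)"
  shows "juxtapose l l p q \<in> T"
proof -
  have "juxtapose l l p q \<in> diagrams n n"
    using juxtapose_diagrams[OF assms(2,3)[THEN tonal_diagrams]] assms(1) by simp
  then show ?thesis using assms(2,3) unfolding tonal_def juxtapose_def by (auto simp: shift_sizes)
qed

lemma cup_cap_tonal: "cup_cap_diagram l \<in> tonal l l"
  unfolding tonal_def using cup_cap_in[OF l] cup_cap_parts[OF l] by blast

text \<open>\<open>(w w\<^sup>\<star>) \<otimes> d\<close> is the loopless product of \<open>(w w\<^sup>\<star>) \<otimes> 1\<close> and \<open>1 \<otimes> d\<close>.\<close>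

lemma cup_cap_juxtapose_in_ideal:
  assumes I: "ideal J P" "diagram_elt (juxtapose l l (cup_cap_diagram l) (diagram_id (n - l))) \<in> J"
    and n: "l \<le> n" and d: "d \<in> tonal l (n - l)"
  shows "diagram_elt (juxtapose l l (cup_cap_diagram l) d) \<in> J"
proof -
  let ?w = "juxtapose l l (cup_cap_diagram l) (diagram_id (n - l))" and ?y = "juxtapose l l (diagram_id l) d"
  let ?z = "juxtapose l l (cup_cap_diagram l) d"
  have T: "?w \<in> T" "?y \<in> T" "?z \<in> T" using juxtapose_tonal[OF n] cup_cap_tonal diagram_id_tonal d by blast+
  note D = T[THEN tonal_diagrams] and sub = drel_subset[OF cup_cap_in[OF l]] drel_subset[OF tonal_diagrams[OF d]]
  \<comment> \<open>Seen from above, \<open>M\<close> lies in the first \<open>l\<close> middle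
    vertices; seen from below, it lies in the remaining ones.\<close>
  have "M = {}" if M: "({}, M) \<in> drel ?w" "(M, {}) \<in> drel ?y" for M
  proof -
    obtain M1 where "({}, M1) \<in> drel (cup_cap_diagram l)" "M = M1" using M(1) unfolding drel_juxtapose drel_id by auto
    moreover obtain N2 where "(N2, {}) \<in> drel d" "M = (+) l ` N2" using M(2) unfolding drel_juxtapose drel_id by auto
    ultimately show ?thesis using juxtapose_split(1)[of M l "{}" "{}" N2 "n - l"] sub(1)[of "{}" M1] sub(2)[of N2 "{}"] by auto
  qed
  then have loops: "diagram_loops ?w ?y = 0" by (rule diagram_loops_eq_0[OF D(1,2)])
  have "(A, B) \<in> drel ?w O drel ?y \<longleftrightarrow> (A, B) \<in> drel ?z" for A B
  proof
    assume "(A, B) \<in> drel ?w O drel ?y"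
    then obtain M where "(A, M) \<in> drel ?w" "(M, B) \<in> drel ?y" by blast
    then obtain A1 M1 A2 N B2 N2 where h: "(A1, M1) \<in> drel (cup_cap_diagram l)" "A2 \<subseteq> {1..n - l}" "A = A1 \<union> (+) l ` A2"
      "M1 \<union> (+) l ` A2 = N \<union> (+) l ` N2" "N \<subseteq> {1..l}" "(N2, B2) \<in> drel d" "B = N \<union> (+) l ` B2"
      unfolding drel_juxtapose drel_id by auto
    have "M1 = N" "A2 = N2" using juxtapose_split[OF h(4) _ h(5,2)] sub(1)[OF h(1)] sub(2)[OF h(6)] by auto
    then show "(A, B) \<in> drel ?z" unfolding drel_juxtapose using h by blast
  next
    assume "(A, B) \<in> drel ?z"
    then obtain A1 B1 A2 B2 where h: "(A1, B1) \<in> drel (cup_cap_diagram l)" "(A2, B2) \<in> drel d"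
      "A = A1 \<union> (+) l ` A2" "B = B1 \<union> (+) l ` B2" unfolding drel_juxtapose by blast
    moreover have "(B1, B1) \<in> drel (diagram_id l)" "(A2, A2) \<in> drel (diagram_id (n - l))"
      unfolding drel_id using sub(1)[OF h(1)] sub(2)[OF h(2)] by auto
    ultimately have "(A, B1 \<union> (+) l ` A2) \<in> drel ?w" "(B1 \<union> (+) l ` A2, B) \<in> drel ?y"
      unfolding drel_juxtapose by blast+
    then show "(A, B) \<in> drel ?w O drel ?y" by blast
  qed
  then have "diagram_comp ?w ?y = ?z"
    by (intro drel_inj[OF diagram_comp_in[OF D(1,2)] D(3)]) (simp only: drel_comp[OF D(1,2)], rule rel_eqI)
  then show ?thesis
    using mult_elts[OF T(1,2) loops] ideal.I_r_closed[OF I] diagram_elt_in[OF T(2)] by metis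
qed

text \<open>By \<open>full_weight_uniform\<close> the weight falls short of \<open>n\<close>, and it
  does so by a positive multiple of \<open>l\<close>. The propagating vector therefore already
  occurs for \<open>n - l\<close>.\<close>

lemma nonuniform_weight:
  assumes "q \<in> T" "q \<notin> U"
  shows "l \<le> n" "propagating_vector l q \<in> index_set l (n - l)"
proof -
  obtain t where t: "n = index_weight l (propagating_vector l q) + l * t"
    using propagating_vector_index_set[OF l assms(1)] unfolding index_set_def by blast
  then have "t \<noteq> 0" using full_weight_uniform[OF l assms(1)] assms(2) by auto
  then obtain s where s: "t = Suc s" by (cases t) auto
  then show "l \<le> n" using t by simp
  have "n - l = index_weight l (propagating_vector l q) + l * s" using t s by simp
  then show "propagating_vector l q \<in> index_set l (n - l)"
    using propagating_vector_outside unfolding index_set_def by blast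
qed

lemma uniform_vanishing_ideal: "ideal (vanishing U) P"
  by (rule ideal_vanishing) (use uniform_factors in blast)

text \<open>For the inclusion that is not immediate, let \<open>p\<close> be nonuniform. Its
  propagating vector is that of an index diagram on \<open>n - l\<close> points; juxtaposed with the
  cup-cap diagram this lies in the cap ideal, and equal propagating vectors put \<open>p\<close>
  there as well.\<close>

lemma cap_ideal_eq: "cap_ideal \<delta> l n = vanishing U" (is "_ = ?J")
proof
  interpret ring P by (rule ring_P)
  let ?w = "juxtapose l l (cup_cap_diagram l) (diagram_id (n - l))"
  define G where "G = (if l \<le> n then {diagram_elt ?w :: diagram \<Rightarrow> 'k} else {})"
  have cap: "cap_ideal \<delta> l n = Idl\<^bsub>P\<^esub> G" unfolding cap_ideal_def G_def ..
  have wT: "?w \<in> T" if "l \<le> n" by (rule juxtapose_tonal[OF that cup_cap_tonal diagram_id_tonal])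
  \<comment> \<open>This part has \<open>l\<close> upper and no lower vertices, so the generator is
    not uniform.\<close>
  have "Inl ` {1..l} \<in> ?w" unfolding juxtapose_def cup_cap_diagram_eq[OF l] by simp
  moreover have "Inl ` {1..l} = {1..l} <+> ({} :: nat set)" by (auto simp: Plus_def)
  then have "upper_size (Inl ` {1..l}) = l" "lower_size (Inl ` {1..l}) = 0" by (simp_all only: upper_size_Plus) simp_all
  ultimately have wU: "?w \<notin> U" using l unfolding uniform_def by force
  have GJ: "G \<subseteq> ?J" unfolding G_def using wT wU diagram_elt_in by (auto simp: diagram_elt_def)
  show "cap_ideal \<delta> l n \<subseteq> ?J" unfolding cap by (rule genideal_minimal[OF uniform_vanishing_ideal GJ])
  have Gc: "G \<subseteq> carrier P" using GJ by blast
  have I: "ideal (cap_ideal \<delta> l n) P" unfolding cap by (rule genideal_ideal[OF Gc])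
  show "?J \<subseteq> cap_ideal \<delta> l n"
  proof
    fix x assume x: "x \<in> ?J"
    show "x \<in> cap_ideal \<delta> l n"
    proof (rule ideal_supported[OF I])
      fix p assume p: "p \<in> T" "x p \<noteq> 0"
      then have "p \<notin> U" using x by auto
      note nu = nonuniform_weight[OF p(1) this]
      let ?d = "index_diagram l (n - l) (propagating_vector l p)"
      have d: "?d \<in> tonal l (n - l)" by (rule index_diagram_tonal[OF l nu(2)])
      have "diagram_elt ?w \<in> cap_ideal \<delta> l n" using genideal_self[OF Gc] nu(1) unfolding cap G_def by auto
      then have "diagram_elt (juxtapose l l (cup_cap_diagram l) ?d) \<in> cap_ideal \<delta> l n"
        by (rule cup_cap_juxtapose_in_ideal[OF I _ nu(1) d])
      then show "diagram_elt p \<in> cap_ideal \<delta> l n"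
        by (rule same_vector_in_ideal[OF I _ p(1) juxtapose_tonal[OF nu(1) cup_cap_tonal d]])
          (simp add: propagating_vector_juxtapose[OF l] propagating_vector_index_diagram[OF l nu(2)])
    qed (use x in auto)
  qed
qed

lemma cap_ideal: "ideal (cap_ideal \<delta> l n) P"
  unfolding cap_ideal_eq by (rule uniform_vanishing_ideal)

end


section \<open>Semisimplicity of the quotient by the cap ideal\<close>

definition hermitian :: "'a set \<Rightarrow> ('a \<Rightarrow> complex) \<Rightarrow> ('a \<Rightarrow> complex) \<Rightarrow> complex" where
  "hermitian D f g = (\<Sum>x\<in>D. f x * cnj (g x))"

lemma hermitian_add: "hermitian D (\<lambda>x. f x + a * g x) h = hermitian D f h + a * hermitian D g h"
  unfolding hermitian_def by (simp add: distrib_right sum.distrib sum_distrib_left mult.assoc)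

lemma hermitian_sum: "hermitian D (\<lambda>x. \<Sum>e\<in>E. c e * w e x) h = (\<Sum>e\<in>E. c e * hermitian D (w e) h)"
  unfolding hermitian_def sum_distrib_left sum_distrib_right mult.assoc by (rule sum.swap)

lemma cnj_hermitian: "cnj (hermitian D f g) = hermitian D g f"
  unfolding hermitian_def by (simp add: mult.commute)

lemma hermitian_sum_right: "hermitian D h (\<lambda>x. \<Sum>e\<in>E. c e * w e x) = (\<Sum>e\<in>E. cnj (c e) * hermitian D h (w e))"
  using arg_cong[OF hermitian_sum[where D = D and E = E and c = c and w = w and h = h], of cnj] by (simp add: cnj_hermitian)

lemma hermitian_self:
  assumes "finite D" "hermitian D f f = 0" "x \<in> D"
  shows "f x = 0"
proof -
  have "(\<Sum>x\<in>D. (cmod (f x))\<^sup>2) = 0"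
    using assms(2) unfolding hermitian_def
    by (simp add: complex_norm_square[symmetric] del: of_real_power flip: of_real_sum)
  then show ?thesis using assms(1,3) by (simp add: sum_nonneg_eq_0_iff)
qed

lemma closed_under_sums:
  fixes J :: "('a \<Rightarrow> complex) set"
  assumes "\<And>f g a. f \<in> J \<Longrightarrow> g \<in> J \<Longrightarrow> (\<lambda>x. f x + a * g x) \<in> J" "finite E" "E \<subseteq> J" "g \<in> J"
  shows "(\<lambda>x. g x + (\<Sum>e\<in>E. c e * e x)) \<in> J"
  using assms(2,3)
proof (induction E)
  case (insert e E)
  then show ?case using assms(1)[of "\<lambda>x. g x + (\<Sum>e\<in>E. c e * e x)" e "c e"] by (simp add: algebra_simps)
qed (simp add: assms(4))

text \<open>The equivalence says both that distinct members are orthogonal and that no member is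
  orthogonal to itself.\<close>

definition orthogonal_basis :: "'a set \<Rightarrow> ('a \<Rightarrow> complex) set \<Rightarrow> ('a \<Rightarrow> complex) set \<Rightarrow> bool" where
  "orthogonal_basis D E J \<longleftrightarrow> finite E \<and> E \<subseteq> J \<and> (\<forall>e\<in>E. \<forall>e'\<in>E. hermitian D e e' = 0 \<longleftrightarrow> e \<noteq> e') \<and>
    (\<forall>f\<in>J. \<exists>c. f = (\<lambda>x. \<Sum>e\<in>E. c e * e x))"

lemma orthogonal_basisD:
  assumes "orthogonal_basis D E J"
  shows "finite E" "E \<subseteq> J" "e \<in> E \<Longrightarrow> e' \<in> E \<Longrightarrow> hermitian D e e' = 0 \<longleftrightarrow> e \<noteq> e'"
    "f \<in> J \<Longrightarrow> \<exists>c. f = (\<lambda>x. \<Sum>e\<in>E. c e * e x)"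
  using assms unfolding orthogonal_basis_def by simp_all

text \<open>Gram-Schmidt by induction on the support instead of the dimension: the functions
  vanishing at \<open>s\<close> have smaller support, and at most one further vector is required.
  The form keeps summing over the fixed set \<open>D\<close>, where it is positive definite.\<close>

lemma orthogonal_basis_exists:
  fixes J :: "('a \<Rightarrow> complex) set"
  assumes "finite S" "finite D" "S \<subseteq> D" "\<And>f x. f \<in> J \<Longrightarrow> x \<notin> S \<Longrightarrow> f x = 0"
    and "\<And>f g a. f \<in> J \<Longrightarrow> g \<in> J \<Longrightarrow> (\<lambda>x. f x + a * g x) \<in> J"
  shows "\<exists>E. orthogonal_basis D E J"
  using assms(1,3-)
proof (induction S arbitrary: J)
  case empty
  have "f = (\<lambda>x. \<Sum>b\<in>{}. 0 * b x)" if "f \<in> J" for f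
    using empty.prems(2)[OF that] by auto
  then show ?case unfolding orthogonal_basis_def by (intro exI[of _ "{}"] conjI ballI exI[of _ "\<lambda>_. 0"]) auto
next
  case (insert s S)
  define K where "K = {f \<in> J. f s = 0}"
  have "\<exists>E. orthogonal_basis D E K"
  proof (rule insert.IH)
    show "f x = 0" if "f \<in> K" "x \<notin> S" for f x
      using that insert.prems(2)[of f x] unfolding K_def by (cases "x = s") auto
    show "(\<lambda>x. f x + a * g x) \<in> K" if "f \<in> K" "g \<in> K" for f g a
      using that insert.prems(3)[of f g a] unfolding K_def by auto
  qed (use insert.prems in simp)
  then obtain E where EK: "orthogonal_basis D E K" ..
  note E = orthogonal_basisD[OF EK]
  have EJ: "E \<subseteq> J" and Es: "\<And>e. e \<in> E \<Longrightarrow> e s = 0" using E(2) unfolding K_def by auto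
  show ?case
  proof (cases "\<exists>g\<in>J. g s \<noteq> 0")
    case False
    then have "K = J" unfolding K_def by auto
    then show ?thesis using EK by blast
  next
    case True
    then obtain h where h: "h \<in> J" "h s \<noteq> 0" by blast
    \<comment> \<open>Subtracts the projection to the span of \<open>E\<close>. All of
      \<open>E\<close> vanishes at \<open>s\<close>, so the value at \<open>s\<close> is unchanged
      and \<open>g\<close> lies outside that span.\<close>
    define g where "g = (\<lambda>x. h x + (\<Sum>e\<in>E. - (hermitian D h e / hermitian D e e) * e x))"
    have g: "g \<in> J" unfolding g_def by (rule closed_under_sums[OF insert.prems(3) E(1) EJ h(1)])
    have gs: "g s \<noteq> 0" unfolding g_def using h(2) sum.neutral[of E "\<lambda>e. - (hermitian D h e / hermitian D e e) * e s"] Es by simp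
    have ge: "hermitian D g e = 0" if e: "e \<in> E" for e
    proof -
      have "hermitian D g e = hermitian D h e + 1 * (\<Sum>e'\<in>E. - (hermitian D h e' / hermitian D e' e') * hermitian D e' e)"
        unfolding g_def hermitian_sum[symmetric] hermitian_add[symmetric] by simp
      also have "(\<Sum>e'\<in>E. - (hermitian D h e' / hermitian D e' e') * hermitian D e' e) = (\<Sum>e'\<in>E. if e' = e then - hermitian D h e else 0)"
        using E(3)[OF _ e] by (intro sum.cong refl) auto
      finally show ?thesis using E(1) e by simp
    qed
    have gg: "hermitian D g g \<noteq> 0" using hermitian_self[OF assms(2), of g s] gs insert.prems(1) by auto
    have gE: "g \<notin> E" using gs Es by blast
    have "\<exists>c. f = (\<lambda>x. \<Sum>e\<in>insert g E. c e * e x)" if f: "f \<in> J" for f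
    proof -
      define a where "a = f s / g s"
      have "(\<lambda>x. f x + (- a) * g x) \<in> K"
        using insert.prems(3)[OF f g, of "- a"] gs unfolding K_def by (simp add: a_def)
      then obtain c where c: "(\<lambda>x. f x + (- a) * g x) = (\<lambda>x. \<Sum>e\<in>E. c e * e x)" using E(4) by blast
      have "f x = (\<Sum>e\<in>insert g E. (c(g := a)) e * e x)" for x
      proof -
        have "(\<Sum>e\<in>E. (c(g := a)) e * e x) = (\<Sum>e\<in>E. c e * e x)" using gE by (intro sum.cong) auto
        then show ?thesis using fun_cong[OF c, of x] gE E(1) by (simp add: diff_eq_eq add.commute)
      qed
      then show ?thesis by blast
    qed
    moreover have "hermitian D e e' = 0 \<longleftrightarrow> e \<noteq> e'" if "e \<in> insert g E" "e' \<in> insert g E" for e e'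
      using that E(3) ge gg gE cnj_hermitian[of D g] by (metis complex_cnj_zero insert_iff)
    ultimately show ?thesis using E(1) EJ g unfolding orthogonal_basis_def by (intro exI[of _ "insert g E"] conjI ballI) auto
  qed
qed

text \<open>The coefficients are kept explicit as multiples of inner products: the same formula
  projects arbitrary functions, and for Specht modules it exhibits the identity as a sum of rank one
  operators.\<close>

lemma orthogonal_expansion:
  fixes J :: "('a \<Rightarrow> complex) set"
  assumes S: "finite S" "\<And>f x. f \<in> J \<Longrightarrow> x \<notin> S \<Longrightarrow> f x = 0"
    and lin: "\<And>f g a. f \<in> J \<Longrightarrow> g \<in> J \<Longrightarrow> (\<lambda>x. f x + a * g x) \<in> J"
  shows "\<exists>E N. finite E \<and> E \<subseteq> J \<and> (\<forall>f\<in>J. f = (\<lambda>x. \<Sum>e\<in>E. N e * hermitian S f e * e x)) \<and>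
    (\<forall>g. \<forall>z\<in>J. hermitian S (\<lambda>x. g x - (\<Sum>e\<in>E. N e * hermitian S g e * e x)) z = 0)"
proof -
  have "\<exists>E. orthogonal_basis S E J"
    by (rule orthogonal_basis_exists[OF S(1) S(1) subset_refl]) (use S(2) lin in blast)+
  then obtain E where "orthogonal_basis S E J" ..
  note E = orthogonal_basisD[OF this]
  define N where "N e = inverse (hermitian S e e)" for e
  have coeff: "hermitian S (\<lambda>x. \<Sum>e\<in>E. c e * e x) e = c e * hermitian S e e" if e: "e \<in> E" for c e
  proof -
    have "hermitian S (\<lambda>x. \<Sum>e\<in>E. c e * e x) e = (\<Sum>e'\<in>E. if e' = e then c e * hermitian S e e else 0)"
      unfolding hermitian_sum using E(3)[OF _ e] by (intro sum.cong refl) auto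
    then show ?thesis using E(1) e by simp
  qed
  have N: "N e * hermitian S e e = 1" if "e \<in> E" for e using E(3)[OF that that] unfolding N_def by simp
  have "f = (\<lambda>x. \<Sum>e\<in>E. N e * hermitian S f e * e x)" if "f \<in> J" for f
  proof -
    obtain c where c: "f = (\<lambda>x. \<Sum>e\<in>E. c e * e x)" using E(4)[OF \<open>f \<in> J\<close>] by blast
    have "N e * hermitian S f e = c e" if "e \<in> E" for e
      using coeff[OF that, of c] N[OF that] unfolding c by (simp add: mult.left_commute)
    then show ?thesis using c by simp
  qed
  moreover have "hermitian S (\<lambda>x. g x - (\<Sum>e\<in>E. N e * hermitian S g e * e x)) z = 0" if "z \<in> J" for g z
  proof -
    let ?p = "\<lambda>x. \<Sum>e\<in>E. N e * hermitian S g e * e x"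
    have "hermitian S (\<lambda>x. g x - ?p x) e = 0" if "e \<in> E" for e
      using hermitian_add[of S g "- 1" ?p e] coeff[OF that, of "\<lambda>e. N e * hermitian S g e"] N[OF that]
      by (simp add: mult.commute mult.left_commute)
    moreover obtain d where d: "z = (\<lambda>x. \<Sum>e\<in>E. d e * e x)" using E(4)[OF \<open>z \<in> J\<close>] by blast
    ultimately show ?thesis unfolding d hermitian_sum_right by simp
  qed
  ultimately show ?thesis using E(1,2) by (intro exI[of _ E] exI[of _ N]) blast
qed

lemma orthogonal_projection:
  fixes J :: "('a \<Rightarrow> complex) set"
  assumes S: "finite S" and supp: "\<And>f x. f \<in> J \<Longrightarrow> x \<notin> S \<Longrightarrow> f x = 0"
    and lin: "\<And>f g a. f \<in> J \<Longrightarrow> g \<in> J \<Longrightarrow> (\<lambda>x. f x + a * g x) \<in> J" and zero: "(\<lambda>x. 0) \<in> J"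
  shows "\<exists>y\<in>J. \<forall>z\<in>J. (\<Sum>x\<in>S. (g x - y x) * cnj (z x)) = 0"
proof -
  have "\<exists>E N. finite E \<and> E \<subseteq> J \<and> (\<forall>f\<in>J. f = (\<lambda>x. \<Sum>e\<in>E. N e * hermitian S f e * e x)) \<and>
    (\<forall>g. \<forall>z\<in>J. hermitian S (\<lambda>x. g x - (\<Sum>e\<in>E. N e * hermitian S g e * e x)) z = 0)"
    by (rule orthogonal_expansion[OF S]) (use supp lin in blast)+
  then obtain E N where E: "finite E" "E \<subseteq> J" "\<forall>z\<in>J. hermitian S (\<lambda>x. g x - (\<Sum>e\<in>E. N e * hermitian S g e * e x)) z = 0"
    by blast
  let ?y = "\<lambda>x. \<Sum>e\<in>E. N e * hermitian S g e * e x"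
  have "(\<lambda>x. 0 + ?y x) \<in> J" by (rule closed_under_sums[OF lin E(1,2) zero])
  then have y: "?y \<in> J" by simp
  from E(3) have "\<forall>z\<in>J. (\<Sum>x\<in>S. (g x - ?y x) * cnj (z x)) = 0" unfolding hermitian_def[of S "\<lambda>x. g x - ?y x"] .
  then show ?thesis by (rule bexI[OF _ y])
qed

lemma regular_left_module:
  assumes "ring R"
  shows "left_module R (regular_module R)"
proof -
  interpret ring R by (rule assms)
  have "abelian_group (regular_module R)"
  proof (rule abelian_groupI)
    fix x assume "x \<in> carrier (regular_module R)"
    then have x: "x \<in> carrier R" unfolding regular_module_def by simp
    show "\<exists>y\<in>carrier (regular_module R). y \<oplus>\<^bsub>regular_module R\<^esub> x = \<zero>\<^bsub>regular_module R\<^esub>"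
      by (rule bexI[of _ "\<ominus>\<^bsub>R\<^esub> x"]) (use x in \<open>simp_all add: regular_module_def l_neg\<close>)
  qed (simp_all add: regular_module_def a_assoc, simp_all add: a_comm)
  then show ?thesis
    by (intro left_module.intro left_module_axioms.intro assms)
      (simp_all add: regular_module_def l_distr r_distr m_assoc)
qed

context tonal_alg_pos
begin

section \<open>The representation by partial injections\<close>

lemma finite_uniform: "finite U"
  using finite_subset[OF _ finite_tonal] uniform_tonal by blast

lemma drel_uniform_inj: "p \<in> U \<Longrightarrow> q \<in> U \<Longrightarrow> drel p = drel q \<Longrightarrow> p = q"
  using drel_inj uniform_diagrams by blast

lemma uniform_converse_comp:
  assumes "s \<in> U"
  shows "(drel s)\<inverse> O drel s = Id_on (Range (drel s))" "drel s O (drel s)\<inverse> = Id_on (Domain (drel s))"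
  using uniform_functional[OF assms] by (auto simp: Id_on_def)

text \<open>
  \<open>act s t t'\<close> says that \<open>s\<close> maps \<open>t\<close> to \<open>t'\<close> in the Vagner--Preston representation of the
  inverse monoid of uniform diagrams: \<open>t' = s t\<close>, where the product only counts if it has as many
  parts as \<open>t\<close>. Diagrams that are not uniform act as zero.
\<close>

definition act :: "diagram \<Rightarrow> diagram \<Rightarrow> diagram \<Rightarrow> bool" where
  "act s t t' \<longleftrightarrow> s \<in> U \<and> t \<in> U \<and> t' \<in> U \<and> Domain (drel t) \<subseteq> Range (drel s) \<and> drel t' = drel s O drel t"

text \<open>The domain condition says that nothing of \<open>t\<close> is lost under
  \<open>s\<close>, so the converse of \<open>s\<close> takes the result back to
  \<open>t\<close>.\<close>

lemma act_flip_imp: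
  assumes "act s t t'"
  shows "act (flip s) t' t"
proof -
  have a: "s \<in> U" "t \<in> U" "t' \<in> U" "Domain (drel t) \<subseteq> Range (drel s)" "drel t' = drel s O drel t"
    using assms unfolding act_def by auto
  have "drel (flip s) O drel t' = Id_on (Range (drel s)) O drel t"
    unfolding a(5) drel_flip O_assoc[symmetric] uniform_converse_comp[OF a(1)] ..
  also have "\<dots> = drel t" using a(4) by (rule Id_on_relcomp)
  finally have "drel t = drel (flip s) O drel t'" by simp
  moreover have "Domain (drel t') \<subseteq> Range (drel (flip s))" unfolding a(5) drel_flip by auto
  ultimately show ?thesis unfolding act_def using a(1-3) flip_uniform by blast
qed

lemma act_flip: "act (flip s) t t' \<longleftrightarrow> act s t' t"
  using act_flip_imp[of s t' t] act_flip_imp[of "flip s" t t'] by auto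

text \<open>The intermediate diagram must be the product of \<open>q\<close> and \<open>t\<close>.
  Injectivity of the relation of \<open>q\<close> carries the domain condition over to
  \<open>p\<close>; conversely, the result \<open>t''\<close> covers the upper row by small sets,
  which forces the product of \<open>p\<close> and \<open>q\<close> to be uniform.\<close>

lemma act_comp:
  assumes p: "p \<in> T" and q: "q \<in> T"
  shows "act (diagram_comp p q) t t'' \<longleftrightarrow> (\<exists>t'. act q t t' \<and> act p t' t'')"
proof
  note c = drel_comp[OF tonal_diagrams[OF p] tonal_diagrams[OF q]]
  assume "act (diagram_comp p q) t t''"
  then have a: "diagram_comp p q \<in> U" "t \<in> U" "t'' \<in> U" "Domain (drel t) \<subseteq> Range (drel p O drel q)"
    "drel t'' = (drel p O drel q) O drel t" unfolding act_def c by auto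
  have pq: "p \<in> U" "q \<in> U" using uniform_factors[OF p q a(1)] by auto
  let ?t' = "diagram_comp q t"
  have c': "drel ?t' = drel q O drel t" using drel_comp pq a uniform_diagrams by blast
  have sub: "Domain (drel t) \<subseteq> Range (drel q)" using a(4) by blast
  have "?t' \<in> U"
  proof (rule uniform_compI[OF pq(2) a(2)])
    fix y assume "y \<in> {1..n}"
    then obtain D E where "(D, E) \<in> drel t" "y \<in> E" "card E \<le> l" using uniform_cover(2)[OF a(2)] by blast
    then show "\<exists>A B. (A, B) \<in> drel q O drel t \<and> y \<in> B \<and> card B \<le> l" using sub by blast
  qed
  then have "act q t ?t'" unfolding act_def using pq a sub c' by blast
  moreover have "Domain (drel ?t') \<subseteq> Range (drel p)"
  proof
    fix A assume "A \<in> Domain (drel ?t')"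
    then obtain B E where AB: "(A, B) \<in> drel q" "(B, E) \<in> drel t" unfolding c' by blast
    then obtain C A' where CA: "(C, A') \<in> drel p" "(A', B) \<in> drel q" using a(4) by blast
    then have "A = A'" using uniform_functional(2)[OF pq(2)] AB by blast
    then show "A \<in> Range (drel p)" using CA by blast
  qed
  then have "act p ?t' t''" unfolding act_def using pq a \<open>?t' \<in> U\<close> c' by (simp add: O_assoc)
  ultimately show "\<exists>t'. act q t t' \<and> act p t' t''" by blast
next
  note c = drel_comp[OF tonal_diagrams[OF p] tonal_diagrams[OF q]]
  assume "\<exists>t'. act q t t' \<and> act p t' t''"
  then obtain t' where "act q t t'" "act p t' t''" by blast
  then have a: "p \<in> U" "q \<in> U" "t \<in> U" "t' \<in> U" "t'' \<in> U" "Domain (drel t) \<subseteq> Range (drel q)"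
    "drel t' = drel q O drel t" "Domain (drel t') \<subseteq> Range (drel p)" "drel t'' = drel p O drel t'"
    unfolding act_def by auto
  have "diagram_comp p q \<in> U"
  proof (rule uniformI_upper[OF tonal_comp[OF p q]])
    fix x assume "x \<in> {1..n}"
    then obtain A B where "(A, B) \<in> drel t''" "x \<in> A" "card A \<le> l" using uniform_cover(1)[OF a(5)] by blast
    then show "\<exists>A B. (A, B) \<in> drel (diagram_comp p q) \<and> x \<in> A \<and> card A \<le> l"
      unfolding a(9,7) c by blast
  next
    fix A assume "(A, {}) \<in> drel (diagram_comp p q)"
    then show "A = {}" unfolding c using uniform_empty(2)[OF a(1)] uniform_empty(2)[OF a(2)] by blast
  qed
  moreover have "Domain (drel t) \<subseteq> Range (drel p O drel q)"
  proof
    fix D assume "D \<in> Domain (drel t)"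
    then obtain C E where CE: "(C, D) \<in> drel q" "(D, E) \<in> drel t" using a(6) by blast
    then have "C \<in> Domain (drel t')" unfolding a(7) by blast
    then show "D \<in> Range (drel p O drel q)" using a(8) CE by blast
  qed
  ultimately show "act (diagram_comp p q) t t''" unfolding act_def c using a by (simp add: O_assoc)
qed

lemma act_unique: "act s t t' \<Longrightarrow> act s t u \<Longrightarrow> t' = u"
  unfolding act_def using drel_uniform_inj by auto

text \<open>Matrix entries with the source first: the coefficient of \<open>t'\<close> in the image
  of \<open>t\<close> under \<open>x\<close>. This explains the order of the factors in
  \<open>rep_mult\<close>.\<close>

definition rep :: "(diagram \<Rightarrow> 'k) \<Rightarrow> diagram \<Rightarrow> diagram \<Rightarrow> 'k" where
  "rep x t t' = (\<Sum>s\<in>T. x s * (if act s t t' then 1 else 0))"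

text \<open>The powers of \<delta> drop out because every diagram that contributes is uniform, and a
  uniform factor admits no loop.\<close>

lemma rep_mult: "rep (x \<bullet> y) t t'' = (\<Sum>t'\<in>U. rep y t t' * rep x t' t'')"
proof -
  have 1: "\<delta> ^ diagram_loops p q * (if act (diagram_comp p q) t t'' then 1 else 0) =
      (\<Sum>t'\<in>U. (if act q t t' then 1 else 0) * (if act p t' t'' then 1 else 0))"
    if pq: "p \<in> T" "q \<in> T" for p q
  proof (cases "act (diagram_comp p q) t t''")
    case True
    then obtain u where u: "act q t u" "act p u t''" using act_comp[OF pq] by blast
    then have uU: "u \<in> U" "p \<in> U" unfolding act_def by auto
    have "(\<Sum>t'\<in>U. (if act q t t' then 1 else 0) * (if act p t' t'' then 1 else 0)) =
        (\<Sum>t'\<in>U. if t' = u then 1 else (0::'k))"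
      using u act_unique by (intro sum.cong refl) auto
    also have "\<dots> = 1" using uU finite_uniform by simp
    finally show ?thesis
      using True uniform_loops[OF tonal_diagrams[OF pq(1)] tonal_diagrams[OF pq(2)], of l] uU by simp
  next
    case False
    then have "(\<Sum>t'\<in>U. (if act q t t' then 1 else 0) * (if act p t' t'' then 1 else (0::'k))) = 0"
      using act_comp[OF pq] by (intro sum.neutral) auto
    then show ?thesis using False by simp
  qed
  have "rep (x \<bullet> y) t t'' = (\<Sum>p\<in>T. \<Sum>q\<in>T. x p * y q *
      (\<Sum>t'\<in>U. (if act q t t' then 1 else 0) * (if act p t' t'' then 1 else 0)))"
    unfolding rep_def sum_mult_P using 1 by (intro sum.cong refl) (simp only: mult.assoc)
  also have "\<dots> = (\<Sum>p\<in>T. \<Sum>q\<in>T. \<Sum>t'\<in>U. (y q * (if act q t t' then 1 else 0)) * (x p * (if act p t' t'' then 1 else 0)))"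
    unfolding sum_distrib_left by (intro sum.cong refl) (simp only: ac_simps)
  also have "\<dots> = (\<Sum>t'\<in>U. \<Sum>p\<in>T. \<Sum>q\<in>T. (y q * (if act q t t' then 1 else 0)) * (x p * (if act p t' t'' then 1 else 0)))"
    by (subst (2) sum.swap, subst sum.swap) (rule refl)
  also have "\<dots> = (\<Sum>t'\<in>U. rep y t t' * rep x t' t'')"
    unfolding rep_def sum_product by (intro sum.cong refl sum.swap)
  finally show ?thesis .
qed

lemma rep_add: "rep (\<lambda>p. x p + y p) t t' = rep x t t' + rep y t t'"
  unfolding rep_def by (simp only: distrib_right sum.distrib)

text \<open>A partial bijection has as many pairs as values, so the number of parts can be read off
  from the lower sets alone.\<close>

lemma card_Range_uniform: "s \<in> U \<Longrightarrow> card (Range (drel s)) = card (drel s)"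
proof -
  assume s: "s \<in> U"
  have "inj_on snd (drel s)"
  proof (rule inj_onI)
    fix a b assume "a \<in> drel s" "b \<in> drel s" "snd a = snd b"
    then show "a = b" by (cases a; cases b) (simp, use uniform_functional(2)[OF s] in blast)
  qed
  then show ?thesis using card_image[of snd "drel s"] by (simp add: Range_snd)
qed

lemma flip_comp_self:
  assumes "s \<in> U"
  shows "diagram_comp (flip s) s \<in> U" "drel (diagram_comp (flip s) s) = Id_on (Range (drel s))"
proof -
  note f = flip_uniform[OF assms]
  show c: "drel (diagram_comp (flip s) s) = Id_on (Range (drel s))"
    using drel_comp[OF uniform_diagrams[OF f] uniform_diagrams[OF assms]] uniform_converse_comp[OF assms]
    by (simp add: drel_flip)
  show "diagram_comp (flip s) s \<in> U"
  proof (rule uniform_compI[OF f assms])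
    fix y assume "y \<in> {1..n}"
    then obtain A B where "(A, B) \<in> drel s" "y \<in> B" "card B \<le> l" using uniform_cover(2)[OF assms] by blast
    then show "\<exists>A B. (A, B) \<in> drel (flip s) O drel s \<and> y \<in> B \<and> card B \<le> l" unfolding drel_flip by blast
  qed
qed

text \<open>Triangularity with respect to the number of parts. In the uniform support of
  \<open>x\<close> take \<open>u\<close> with the largest relation, and apply \<open>x\<close> to
  the partial identity on the range of \<open>u\<close>. A diagram \<open>v\<close> in the support
  that sends this to \<open>u\<close> has at least the range of \<open>u\<close>, hence by
  maximality the same relation; so the entry at \<open>u\<close> is \<open>x u\<close>.\<close>

lemma rep_faithful:
  assumes "\<And>t t'. t \<in> U \<Longrightarrow> t' \<in> U \<Longrightarrow> rep x t t' = 0" "s \<in> U"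
  shows "x s = 0"
proof (rule ccontr)
  assume "x s \<noteq> 0"
  let ?A = "{s \<in> U. x s \<noteq> 0}"
  have A: "finite ?A" "?A \<noteq> {}" using finite_uniform assms(2) \<open>x s \<noteq> 0\<close> by auto
  have "Max ((\<lambda>v. card (drel v)) ` ?A) \<in> (\<lambda>v. card (drel v)) ` ?A" using A by (intro Max_in) auto
  then obtain u where u1: "u \<in> ?A" "card (drel u) = Max ((\<lambda>v. card (drel v)) ` ?A)" by auto
  have u: "u \<in> ?A" "\<And>v. v \<in> ?A \<Longrightarrow> card (drel v) \<le> card (drel u)"
    using u1 A(1) by (auto intro!: Max_ge)
  have uU: "u \<in> U" using u by simp
  let ?t = "diagram_comp (flip u) u"
  note t = flip_comp_self[OF uU]
  have "v = u" if v: "v \<in> U" "x v \<noteq> 0" "act v ?t u" for v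
  proof -
    have sub: "Range (drel u) \<subseteq> Range (drel v)" using v(3) unfolding act_def t(2) by auto
    have "card (Range (drel v)) \<le> card (Range (drel u))" using u(2)[of v] v card_Range_uniform uU by simp
    moreover have "finite (Range (drel v))" using finite_drel[OF uniform_diagrams[OF v(1)]] by (rule finite_Range)
    ultimately have "Range (drel u) = Range (drel v)" using sub by (metis card_seteq)
    then have "drel u = drel v" using v(3) relcomp_Id_on[of "drel v" "Range (drel u)"] unfolding act_def t(2) by simp
    then show ?thesis using drel_uniform_inj v(1) uU by auto
  qed
  moreover have "act u ?t u" unfolding act_def using t uU relcomp_Id_on[of "drel u" "Range (drel u)"] by simp
  ultimately have "x v * (if act v ?t u then 1 else 0) = (if v = u then x u else 0)" for v
    unfolding act_def by auto
  then have "rep x ?t u = x u" unfolding rep_def using uniform_tonal[OF uU] finite_tonal by simp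
  then show False using assms(1)[OF t(1) uU] u(1) by simp
qed

lemma rep_cap_ideal: "x \<in> cap_ideal \<delta> l n \<Longrightarrow> rep x t t' = 0"
  unfolding rep_def cap_ideal_eq act_def by (intro sum.neutral) auto

lemma cap_ideal_iff_rep:
  "x \<in> cap_ideal \<delta> l n \<longleftrightarrow> x \<in> carrier P \<and> (\<forall>t\<in>U. \<forall>t'\<in>U. rep x t t' = 0)"
  using rep_cap_ideal rep_faithful[of x] unfolding cap_ideal_eq by blast

end

section \<open>The invariant Hermitian form and orthogonal complements\<close>

locale tonal_alg_complex = tonal_alg_pos l n \<delta> for l n :: nat and \<delta> :: complex
begin

text \<open>The Hilbert-Schmidt form pulled back along \<open>rep\<close>. It is positive
  semidefinite, and on the algebra exactly the elements of the cap ideal have norm zero.\<close>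

definition ip :: "(diagram \<Rightarrow> complex) \<Rightarrow> (diagram \<Rightarrow> complex) \<Rightarrow> complex" where
  "ip x y = (\<Sum>t\<in>U. \<Sum>t'\<in>U. rep x t t' * cnj (rep y t t'))"

definition star :: "(diagram \<Rightarrow> complex) \<Rightarrow> diagram \<Rightarrow> complex" where
  "star x p = cnj (x (flip p))"

lemma star_closed: "x \<in> carrier P \<Longrightarrow> star x \<in> carrier P"
  unfolding carrier_iff star_def using flip_tonal[of "flip _"] by auto

lemma rep_star: "rep (star x) t t' = cnj (rep x t' t)"
proof -
  have "bij_betw flip T T" by (rule bij_betwI[of _ _ _ flip]) (auto intro: flip_tonal)
  then have "rep (star x) t t' = (\<Sum>s\<in>T. star x (flip s) * (if act (flip s) t t' then 1 else 0))"
    unfolding rep_def by (rule sum.reindex_bij_betw[symmetric])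
  then show ?thesis unfolding rep_def star_def act_flip cnj_sum by (simp cong: if_cong) (intro sum.cong refl, simp)
qed

lemma ip_adjoint: "ip (a \<bullet> x) y = ip x (star a \<bullet> y)"
proof -
  have "ip (a \<bullet> x) y = (\<Sum>t\<in>U. \<Sum>t''\<in>U. \<Sum>t'\<in>U. rep x t t' * rep a t' t'' * cnj (rep y t t''))"
    unfolding ip_def rep_mult sum_distrib_right ..
  also have "\<dots> = (\<Sum>t\<in>U. \<Sum>t'\<in>U. \<Sum>t''\<in>U. rep x t t' * rep a t' t'' * cnj (rep y t t''))"
    by (rule sum.cong[OF refl], rule sum.swap)
  also have "\<dots> = ip x (star a \<bullet> y)"
    unfolding ip_def rep_mult rep_star cnj_sum sum_distrib_left by (intro sum.cong refl) (simp add: ac_simps)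
  finally show ?thesis .
qed

lemma rep_uminus: "rep (\<lambda>p. - x p) t t' = - rep x t t'"
  unfolding rep_def by (simp add: sum_negf)

lemma ip_add: "ip (\<lambda>p. x p + y p) z = ip x z + ip y z"
  unfolding ip_def rep_add by (simp add: distrib_right sum.distrib)

lemma ip_uminus: "ip (\<lambda>p. - x p) z = - ip x z"
  unfolding ip_def rep_uminus by (simp add: sum_negf)

lemma ip_self_eq_0:
  assumes "x \<in> carrier P" "ip x x = 0"
  shows "x \<in> cap_ideal \<delta> l n"
proof -
  have "complex_of_real (\<Sum>t\<in>U. \<Sum>t'\<in>U. (cmod (rep x t t'))\<^sup>2) = 0"
    using assms(2) unfolding ip_def by (simp add: complex_norm_square del: of_real_power)
  then have "(\<Sum>t\<in>U. \<Sum>t'\<in>U. (cmod (rep x t t'))\<^sup>2) = 0" by (simp only: of_real_eq_0_iff)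
  then have "\<forall>t\<in>U. (\<Sum>t'\<in>U. (cmod (rep x t t'))\<^sup>2) = 0"
    using finite_uniform by (subst (asm) sum_nonneg_eq_0_iff) (auto intro: sum_nonneg)
  then have "\<forall>t\<in>U. \<forall>t'\<in>U. rep x t t' = 0"
    using finite_uniform by (simp add: sum_nonneg_eq_0_iff)
  then show ?thesis using assms(1) cap_ideal_iff_rep by blast
qed

lemma scale_in_left_ideal:
  assumes J: "\<And>a x. a \<in> carrier P \<Longrightarrow> x \<in> J \<Longrightarrow> a \<bullet> x \<in> J" "x \<in> J" "J \<subseteq> carrier P"
  shows "(\<lambda>p. c * x p) \<in> J"
proof -
  have "(\<lambda>p. c * x p) = dterm c (diagram_id n) \<bullet> x" using mult_one_left[of x c] J(2,3) by auto
  then show ?thesis using J(1)[OF dterm_in[OF diagram_id_tonal] J(2)] by simp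
qed

lemma left_ideal_projection:
  assumes J: "J \<subseteq> carrier P" "\<And>a x. a \<in> carrier P \<Longrightarrow> x \<in> J \<Longrightarrow> a \<bullet> x \<in> J"
    and add: "\<And>x y. x \<in> J \<Longrightarrow> y \<in> J \<Longrightarrow> (\<lambda>p. x p + y p) \<in> J" and zero: "(\<lambda>p. 0) \<in> J"
  shows "\<exists>y\<in>J. \<forall>z\<in>J. ip (\<lambda>p. x p + - y p) z = 0"
proof -
  \<comment> \<open>The matrix of \<open>x\<close> as a function on pairs, set to 0 outside a finite
    set so that \<open>orthogonal_projection\<close> applies.\<close>
  define \<Phi> where "\<Phi> x tt = (if tt \<in> U \<times> U then rep x (fst tt) (snd tt) else 0)" for x tt
  have scale: "rep (\<lambda>p. c * x p) t t' = c * rep x t t'" for c x t t'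
    unfolding rep_def sum_distrib_left by (simp only: mult.assoc)
  have lin: "\<Phi> (\<lambda>p. x p + a * y p) = (\<lambda>tt. \<Phi> x tt + a * \<Phi> y tt)" for x a y
    unfolding \<Phi>_def rep_add scale by auto
  have ip: "ip x y = (\<Sum>tt\<in>U \<times> U. \<Phi> x tt * cnj (\<Phi> y tt))" for x y
    unfolding ip_def sum.cartesian_product by (intro sum.cong refl) (auto simp: \<Phi>_def)
  have "\<exists>y\<in>\<Phi> ` J. \<forall>z\<in>\<Phi> ` J. (\<Sum>tt\<in>U \<times> U. (\<Phi> x tt - y tt) * cnj (z tt)) = 0"
  proof (rule orthogonal_projection)
    show "finite (U \<times> U)" using finite_uniform by simp
    show "f tt = 0" if "f \<in> \<Phi> ` J" "tt \<notin> U \<times> U" for f tt using that unfolding \<Phi>_def by auto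
    show "(\<lambda>tt. f tt + a * g tt) \<in> \<Phi> ` J" if "f \<in> \<Phi> ` J" "g \<in> \<Phi> ` J" for f g a
    proof -
      obtain u v where uv: "u \<in> J" "v \<in> J" "f = \<Phi> u" "g = \<Phi> v" using \<open>f \<in> _\<close> \<open>g \<in> _\<close> by blast
      have "(\<lambda>p. u p + a * v p) \<in> J" by (rule add[OF uv(1) scale_in_left_ideal[OF J(2) uv(2) J(1)]])
      then show ?thesis unfolding uv(3,4) lin[symmetric] by (rule imageI)
    qed
    have "\<Phi> (\<lambda>p. 0) = (\<lambda>tt. 0)" unfolding \<Phi>_def rep_def by auto
    then show "(\<lambda>tt. 0) \<in> \<Phi> ` J" using zero by (metis imageI)
  qed
  then obtain y where y: "y \<in> J" "\<And>z. z \<in> J \<Longrightarrow> (\<Sum>tt\<in>U \<times> U. (\<Phi> x tt - \<Phi> y tt) * cnj (\<Phi> z tt)) = 0"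
    by blast
  have "ip (\<lambda>p. x p + - y p) z = 0" if "z \<in> J" for z
    using y(2)[OF that] lin[of x "-1" y] unfolding ip by simp
  then show ?thesis using y(1) by blast
qed

lemma capless_algebra_ring: "ring (capless_algebra \<delta> l n)"
  unfolding capless_algebra_def by (rule ideal.quotient_is_ring[OF cap_ideal])

text \<open>A submodule \<open>N\<close> lifts to a left ideal \<open>J\<close> containing the cap
  ideal. Its orthogonal space \<open>K\<close> is a left ideal because multiplication has adjoints,
  meets \<open>J\<close> only in elements of norm zero, hence in the cap ideal, and together with
  \<open>J\<close> spans everything by orthogonal projection.\<close>

lemma semisimple_capless_algebra: "semisimple_ring (capless_algebra \<delta> l n)"
proof -
  interpret ring P by (rule ring_P)
  define I where "I = cap_ideal \<delta> l n"
  interpret I: ideal I P unfolding I_def by (rule cap_ideal)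
  define Q where "Q = P Quot I"
  define M where "M = regular_module Q"
  have capless: "capless_algebra \<delta> l n = Q" unfolding capless_algebra_def Q_def I_def ..
  interpret Q: ring Q using capless_algebra_ring unfolding capless .
  have M: "left_module Q M" unfolding M_def by (rule regular_left_module[OF Q.ring_axioms])
  then interpret M: left_module Q M .
  have cM: "carrier M = carrier Q" and zM: "\<zero>\<^bsub>M\<^esub> = \<zero>\<^bsub>Q\<^esub>" and aM: "add M = add Q" and sM: "smult M = monoid.mult Q"
    unfolding M_def regular_module_def by simp_all
  have cQ: "carrier Q = (\<lambda>x. I +>\<^bsub>P\<^esub> x) ` carrier P" unfolding Q_def FactRing_def A_RCOSETS_defs by (auto simp: a_r_coset_def)
  have zQ: "\<zero>\<^bsub>Q\<^esub> = I" unfolding Q_def FactRing_def by simp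
  have mQ: "(I +>\<^bsub>P\<^esub> x) \<otimes>\<^bsub>Q\<^esub> (I +>\<^bsub>P\<^esub> y) = I +>\<^bsub>P\<^esub> (x \<bullet> y)" if "x \<in> carrier P" "y \<in> carrier P" for x y
    unfolding Q_def FactRing_def using I.rcoset_mult_add[OF that] by simp
  have aQ: "(I +>\<^bsub>P\<^esub> x) \<oplus>\<^bsub>Q\<^esub> (I +>\<^bsub>P\<^esub> y) = I +>\<^bsub>P\<^esub> (x \<oplus>\<^bsub>P\<^esub> y)" if "x \<in> carrier P" "y \<in> carrier P" for x y
    unfolding Q_def FactRing_def using I.a_rcos_sum[OF that] by simp
  have coset_I: "I +>\<^bsub>P\<^esub> x = I" if "x \<in> I" for x using I.a_rcos_const[OF that] .
  have coset_eq: "(I +>\<^bsub>P\<^esub> x = I +>\<^bsub>P\<^esub> y) \<longleftrightarrow> x \<ominus>\<^bsub>P\<^esub> y \<in> I" if "x \<in> carrier P" "y \<in> carrier P" for x y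
    using quotient_eq_iff_same_a_r_cos[OF I.ideal_axioms that] by simp
  have "\<exists>N'. submodule N' Q M \<and> N \<inter> N' = {\<zero>\<^bsub>M\<^esub>} \<and> N <+>\<^bsub>M\<^esub> N' = carrier M" if N: "submodule N Q M" for N
  proof -
    interpret N: submodule N Q M by (rule N)
    have Nsub: "N \<subseteq> carrier Q" using N.subset cM by simp
    have Nadd: "u \<oplus>\<^bsub>Q\<^esub> v \<in> N" if "u \<in> N" "v \<in> N" for u v using N.m_closed[OF that] aM by simp
    have Nzero: "I \<in> N" using N.one_closed zM zQ by simp
    have Nsm: "u \<otimes>\<^bsub>Q\<^esub> v \<in> N" if "u \<in> carrier Q" "v \<in> N" for u v using N.smult_closed[OF that] sM by simp
    define J where "J = {x \<in> carrier P. I +>\<^bsub>P\<^esub> x \<in> N}"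
    have Jc: "J \<subseteq> carrier P" unfolding J_def by blast
    have IJ: "I \<subseteq> J" unfolding J_def using coset_I Nzero I.a_Hcarr by auto
    have Jmult: "a \<bullet> x \<in> J" if "a \<in> carrier P" "x \<in> J" for a x
    proof -
      have x: "x \<in> carrier P" "I +>\<^bsub>P\<^esub> x \<in> N" using that(2) unfolding J_def by auto
      have "I +>\<^bsub>P\<^esub> a \<in> carrier Q" using that(1) cQ by blast
      then show ?thesis using Nsm[OF _ x(2), of "I +>\<^bsub>P\<^esub> a"] mQ[OF that(1) x(1)] m_closed[OF that(1) x(1)]
        unfolding J_def by simp
    qed
    have Jadd: "(\<lambda>p. x p + y p) \<in> J" if "x \<in> J" "y \<in> J" for x y
      using that Nadd[of "I +>\<^bsub>P\<^esub> x" "I +>\<^bsub>P\<^esub> y"] aQ[of x y] a_closed[of x y] unfolding J_def add_P by simp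
    have Jzero: "(\<lambda>p. 0) \<in> J" using IJ I.zero_closed zero_P by auto
    have Jneg: "(\<lambda>p. - x p) \<in> J" if "x \<in> J" for x
      using scale_in_left_ideal[OF Jmult that Jc, of "-1"] by simp
    define K where "K = {x \<in> carrier P. \<forall>z\<in>J. ip x z = 0}"
    have Kc: "K \<subseteq> carrier P" unfolding K_def by blast
    define N' where "N' = (\<lambda>x. I +>\<^bsub>P\<^esub> x) ` K"
    have Kneg: "(\<lambda>p. - x p) \<in> K" if "x \<in> K" for x using that unfolding K_def carrier_iff by (auto simp: ip_uminus)
    have Kadd: "(\<lambda>p. x p + y p) \<in> K" if "x \<in> K" "y \<in> K" for x y using that unfolding K_def carrier_iff by (auto simp: ip_add)
    have "submodule N' Q M"
    proof (intro submodule.intro submodule_axioms.intro subgroup.intro)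
      show "N' \<subseteq> carrier (add_monoid M)" using Kc cM cQ unfolding N'_def by auto
    next
      fix u v assume "u \<in> N'" "v \<in> N'"
      then obtain x y where xy: "x \<in> K" "y \<in> K" "u = I +>\<^bsub>P\<^esub> x" "v = I +>\<^bsub>P\<^esub> y" unfolding N'_def by blast
      have "u \<oplus>\<^bsub>Q\<^esub> v = I +>\<^bsub>P\<^esub> (\<lambda>p. x p + y p)" using aQ[of x y] xy Kc add_P by auto
      then show "u \<otimes>\<^bsub>add_monoid M\<^esub> v \<in> N'" using Kadd[OF xy(1,2)] aM unfolding N'_def by auto
    next
      have "(\<lambda>p. 0) \<in> K" unfolding K_def carrier_iff ip_def rep_def by auto
      moreover have "I +>\<^bsub>P\<^esub> (\<lambda>p. 0) = I" using coset_I I.zero_closed zero_P by simp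
      ultimately show "\<one>\<^bsub>add_monoid M\<^esub> \<in> N'" using zM zQ unfolding N'_def by force
    next
      fix u assume "u \<in> N'"
      then obtain x where x: "x \<in> K" "u = I +>\<^bsub>P\<^esub> x" unfolding N'_def by blast
      let ?v = "I +>\<^bsub>P\<^esub> (\<lambda>p. - x p)"
      have v: "?v \<in> N'" using Kneg[OF x(1)] unfolding N'_def by blast
      have "?v \<oplus>\<^bsub>Q\<^esub> u = I +>\<^bsub>P\<^esub> (\<lambda>p. - x p + x p)"
        unfolding x(2) using aQ[of "\<lambda>p. - x p" x] Kneg[OF x(1)] x(1) Kc add_P by auto
      also have "\<dots> = \<zero>\<^bsub>M\<^esub>" using coset_I I.zero_closed zero_P zM zQ by simp
      finally have "?v \<oplus>\<^bsub>M\<^esub> u = \<zero>\<^bsub>M\<^esub>" using aM by simp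
      moreover have "u \<in> carrier M" "?v \<in> carrier M" using x v Kc Kneg[OF x(1)] cM cQ by auto
      ultimately have "\<ominus>\<^bsub>M\<^esub> u = ?v" by (intro M.minus_equality)
      then show "inv\<^bsub>add_monoid M\<^esub> u \<in> N'" using v unfolding a_inv_def by simp
    next
      fix a u assume "a \<in> carrier Q" "u \<in> N'"
      then obtain b x where bx: "b \<in> carrier P" "x \<in> K" "a = I +>\<^bsub>P\<^esub> b" "u = I +>\<^bsub>P\<^esub> x" unfolding N'_def cQ by blast
      have "b \<bullet> x \<in> K"
        using bx(2) mult_closed ip_adjoint Jmult[OF star_closed[OF bx(1)]] unfolding K_def by auto
      moreover have "a \<odot>\<^bsub>M\<^esub> u = I +>\<^bsub>P\<^esub> (b \<bullet> x)" using mQ[OF bx(1)] bx Kc sM by auto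
      ultimately show "a \<odot>\<^bsub>M\<^esub> u \<in> N'" unfolding N'_def by blast
    qed
    moreover have "N \<inter> N' = {\<zero>\<^bsub>M\<^esub>}"
    proof -
      have "u = I" if u: "u \<in> N" "u \<in> N'" for u
      proof -
        obtain x where x: "x \<in> K" "u = I +>\<^bsub>P\<^esub> x" using u(2) unfolding N'_def by blast
        then have "x \<in> J" using u(1) Kc unfolding J_def by auto
        then have "ip x x = 0" using x(1) unfolding K_def by blast
        then have "x \<in> I" using ip_self_eq_0 x(1) Kc unfolding I_def by blast
        then show ?thesis using coset_I x(2) by simp
      qed
      moreover have "I \<in> N'" using \<open>submodule N' Q M\<close> subgroup.one_closed[OF submodule.axioms(1)] zM zQ by fastforce
      ultimately have "N \<inter> N' = {I}" using Nzero by blast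
      then show ?thesis using zM zQ by simp
    qed
    moreover have "N <+>\<^bsub>M\<^esub> N' = carrier M"
    proof -
      have "u \<in> N <+>\<^bsub>M\<^esub> N'" if u: "u \<in> carrier Q" for u
      proof -
        obtain x where x: "x \<in> carrier P" "u = I +>\<^bsub>P\<^esub> x" using u cQ by blast
        obtain y where y: "y \<in> J" "\<forall>z\<in>J. ip (\<lambda>p. x p + - y p) z = 0"
          using left_ideal_projection[OF Jc Jmult Jadd Jzero, of x] by blast
        let ?w = "\<lambda>p. x p + - y p"
        have "y \<in> carrier P" using y(1) Jc by blast
        then have w: "?w \<in> K" using y(2) x(1) unfolding K_def carrier_iff by simp
        have "(I +>\<^bsub>P\<^esub> y) \<oplus>\<^bsub>Q\<^esub> (I +>\<^bsub>P\<^esub> ?w) = I +>\<^bsub>P\<^esub> (\<lambda>p. y p + ?w p)"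
          using aQ[of y ?w] y(1) w Jc Kc add_P by auto
        then have "u = (I +>\<^bsub>P\<^esub> y) \<oplus>\<^bsub>M\<^esub> (I +>\<^bsub>P\<^esub> ?w)" unfolding aM x(2) by simp
        moreover have "I +>\<^bsub>P\<^esub> y \<in> N" "I +>\<^bsub>P\<^esub> ?w \<in> N'" using y(1) w unfolding J_def N'_def by blast+
        ultimately show ?thesis unfolding set_add_def set_mult_def by auto
      qed
      moreover have "u \<in> carrier Q" if "u \<in> N <+>\<^bsub>M\<^esub> N'" for u
      proof -
        obtain v w where vw: "v \<in> N" "w \<in> N'" "u = v \<oplus>\<^bsub>Q\<^esub> w"
          using \<open>u \<in> _\<close> aM unfolding set_add_def set_mult_def by auto
        moreover have "w \<in> carrier Q" using vw(2) Kc unfolding N'_def cQ by blast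
        ultimately show ?thesis using Nsub Q.a_closed by blast
      qed
      ultimately show ?thesis using cM by auto
    qed
    ultimately show ?thesis by blast
  qed
  then have "semisimple_module Q M" unfolding semisimple_module_def using M by blast
  then show ?thesis unfolding semisimple_ring_def capless using Q.ring_axioms unfolding M_def by blast
qed

end


section \<open>Products with an index diagram of full weight\<close>

locale top_index = tonal_alg_pos l n \<delta> for l n :: nat and \<delta> :: "'k :: {comm_ring, comm_monoid_mult}" +
  fixes m :: "nat \<Rightarrow> nat"
  assumes m: "m \<in> top_indices l n"
begin

abbreviation "a \<equiv> index_diagram l n m"
abbreviation "I \<equiv> lower_ideal \<delta> l n m"
abbreviation "B \<equiv> index_basis l n m"

lemma m_weight: "index_weight l m = n"
  by (rule top_indices_weight[OF l m])

lemma m_index: "m \<in> index_set l n"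
  using m unfolding top_indices_def by simp

lemma a_tonal: "a \<in> T"
  by (rule index_diagram_tonal[OF l m_index])

lemma a_vector: "propagating_vector l a = m"
  by (rule propagating_vector_index_diagram[OF l m_index])

lemma a_uniform: "a \<in> U"
  by (rule full_weight_uniform[OF l a_tonal]) (simp add: a_vector m_weight)

lemma a_eq: "a = (\<lambda>Z. Z <+> Z) ` blocks l m"
  unfolding index_diagram_eq m_weight by (simp add: shift_def)

lemma a_traces: "lower_traces a = blocks l m"
  unfolding uniform_lower_traces[OF a_uniform] unfolding a_eq image_image vimage_Plus by simp

lemma blocks_partition: "partition_on {1..n} (blocks l m)"
  using partition_on_lower_traces[OF tonal_diagrams[OF a_tonal]] unfolding a_traces .

lemma drel_a: "drel a = Id_on (unions (blocks l m))"
proof -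
  have 1: "A = A'" if "(A, A') \<in> drel a" for A A'
  proof -
    obtain F where F: "F \<subseteq> a" "A = Inl -` \<Union>F" "A' = Inr -` \<Union>F" using drel_obtain_parts[OF \<open>(A, A') \<in> drel a\<close>] by metis
    then have "Inl -` s = Inr -` s" if "s \<in> F" for s using that unfolding a_eq by (auto simp: vimage_Plus)
    then show ?thesis unfolding F(2,3) by (auto simp: vimage_Union)
  qed
  have "Range (drel a) = unions (blocks l m)" unfolding Range_drel a_traces ..
  then show ?thesis using 1 unfolding Id_on_def by auto
qed

lemma card_blocks: "Z \<in> blocks l m \<Longrightarrow> card Z \<in> {1..l}"
proof -
  assume "Z \<in> blocks l m"
  then have "Z <+> Z \<in> a" unfolding a_eq by simp
  then have "upper_size (Z <+> Z) \<le> l" "0 < upper_size (Z <+> Z)"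
    using a_uniform upper_size_pos[OF tonal_diagrams[OF a_tonal] _ uniform_propagating(2)[OF a_uniform]]
    unfolding uniform_def by auto
  then show ?thesis unfolding upper_size_Plus by simp
qed

text \<open>The lower half of each part of the product is a union of blocks. Fusing the sizes of
  these blocks gives the tone of the part; if the part does not propagate, this tone is
  \<open>l\<close> and the entry can be deleted. Summing over the parts gives the difference of the
  two vectors.\<close>

lemma comp_a_vector_le:
  assumes p: "p \<in> T"
  shows "index_le l (int \<circ> propagating_vector l (diagram_comp p a)) (int \<circ> m)"
proof -
  let ?q = "diagram_comp p a" and ?bl = "blocks l m"
  have q: "?q \<in> T" using tonal_comp[OF p a_tonal] .
  note qd = tonal_diagrams[OF q]
  note fq = diagrams_finite[OF qd]
  have finb: "finite ?bl" using finite_elements[OF _ blocks_partition] by simp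
  have low: "Inr -` s \<in> unions ?bl" if "s \<in> ?q" for s
    using drel_part[OF that] unfolding drel_comp[OF tonal_diagrams[OF p] tonal_diagrams[OF a_tonal]] drel_a by auto
  define F where "F s = {Z \<in> ?bl. Z \<subseteq> Inr -` s}" for s :: "(nat + nat) set"
  have bne: "Z \<noteq> {}" if "Z \<in> ?bl" for Z using card_blocks[OF that] by auto
  have UF: "\<Union>(F s) = Inr -` s" if "s \<in> ?q" for s
  proof -
    obtain G where G: "G \<subseteq> ?bl" "Inr -` s = \<Union>G" using low[OF \<open>s \<in> ?q\<close>] unfolding unions_def by blast
    then show ?thesis unfolding F_def by blast
  qed
  have dj: "s = u" if h: "s \<in> ?q" "u \<in> ?q" "Z \<in> F s" "Z \<in> F u" for s u Z
  proof -
    have "Z \<noteq> {}" using bne h(3) unfolding F_def by simp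
    then obtain z where "Inr z \<in> s" "Inr z \<in> u" using h unfolding F_def by blast
    then show ?thesis using part_of_eq[OF qd h(1)] part_of_eq[OF qd h(2)] by metis
  qed
  have bl: "?bl = (\<Union>s\<in>?q. F s)"
  proof -
    have "Z \<in> (\<Union>s\<in>?q. F s)" if Z: "Z \<in> ?bl" for Z
    proof -
      obtain z where z: "z \<in> Z" using bne[OF Z] by blast
      then have "z \<in> {1..n}" using partition_onD1[OF blocks_partition] Z by blast
      then obtain s where s: "s \<in> ?q" "Inr z \<in> s" using diagram_part_exists(2)[OF qd] by blast
      then obtain Z' where "Z' \<in> F s" "z \<in> Z'" using UF[OF s(1)] by blast
      moreover from this have "Z' = Z" using partition_onD2[OF blocks_partition] Z z unfolding F_def disjoint_def by blast
      ultimately show ?thesis using s(1) by blast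
    qed
    then show ?thesis unfolding F_def by blast
  qed
  have mh: "int (m h) = (\<Sum>s\<in>?q. \<Sum>Z\<in>F s. of_bool (h = card Z))" if h: "h \<in> {1..l}" for h
  proof -
    have "m h = card {Z \<in> ?bl. card Z = h}"
      using uniform_propagating_vector[OF a_uniform h] unfolding a_vector a_traces .
    then have "int (m h) = (\<Sum>Z\<in>?bl. of_bool (h = card Z))"
      using finb by (simp add: of_bool_def sum.If_cases Int_def eq_commute)
    also have "\<dots> = (\<Sum>s\<in>?q. \<Sum>Z\<in>F s. of_bool (h = card Z))"
      unfolding bl by (rule sum.UNION_disjoint[OF fq]) (use finb dj in \<open>auto simp: F_def\<close>)
    finally show ?thesis .
  qed
  have qh: "int (propagating_vector l ?q h) = (\<Sum>s\<in>?q. of_bool (propagating s \<and> h = tone l (upper_size s)))"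
    if h: "h \<in> {1..l}" for h
    unfolding propagating_vector_tone[OF l h] using fq
    by (simp add: of_bool_def sum.If_cases Int_def eq_commute)
  have "fusion_cone l (\<lambda>h. of_bool (propagating s \<and> h = tone l (upper_size s)) - (\<Sum>Z\<in>F s. of_bool (h = card Z)))"
    if s: "s \<in> ?q" for s
  proof (cases "Inr -` s = {}")
    case True
    then have "F s = {}" using bne unfolding F_def by auto
    moreover have "\<not> propagating s" using True unfolding propagating_def by simp
    ultimately show ?thesis using cone_zero by simp
  next
    case False
    then have Fne: "F s \<noteq> {}" using UF[OF s] by auto
    have finF: "finite (F s)" using finb unfolding F_def by simp
    have "(\<Sum>Z\<in>F s. card Z) = card (\<Union>(F s))"
    proof (rule card_Union_disjoint[symmetric])
      show "pairwise disjnt (F s)"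
        using partition_onD2[OF blocks_partition] unfolding F_def disjoint_def pairwise_def disjnt_def by blast
      show "finite Z" if "Z \<in> F s" for Z using card_blocks[of Z] that unfolding F_def by (intro card_ge_0_finite) auto
    qed
    then have sum: "(\<Sum>Z\<in>F s. card Z) = lower_size s" unfolding UF[OF s] lower_size_def .
    have "card Z \<in> {1..l}" if "Z \<in> F s" for Z using card_blocks[of Z] that unfolding F_def by blast
    from cone_fuse_all[OF l finF Fne, of card, OF this, unfolded sum]
    have c: "fusion_cone l (\<lambda>h. of_bool (h = tone l (lower_size s)) - (\<Sum>Z\<in>F s. of_bool (h = card Z)))" .
    show ?thesis
    proof (cases "propagating s")
      case True
      have "upper_size s mod l = lower_size s mod l" using q s unfolding tonal_def by simp
      then have "tone l (upper_size s) = tone l (lower_size s)" by (rule tone_cong[OF l])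
      then show ?thesis using c True by simp
    next
      case False
      have "tone l (lower_size s) = l"
        using nonpropagating_size(2)[OF q s False] tone_eq_iff[OF l, of l "lower_size s"] l by simp
      then show ?thesis using cone_add[OF c cone_remove[OF l]] False by (auto elim: cone_cong)
    qed
  qed
  from cone_sum[OF this] show ?thesis
    unfolding index_le_cone
  proof (rule cone_cong)
    fix h assume h: "h \<in> {1..l}"
    show "(\<Sum>s\<in>?q. of_bool (propagating s \<and> h = tone l (upper_size s)) - (\<Sum>Z\<in>F s. of_bool (h = card Z))) =
        (int \<circ> propagating_vector l ?q) h - (int \<circ> m) h"
      unfolding comp_apply sum_subtractf qh[OF h] mh[OF h] ..
  qed
qed

lemma card_drel_Range: "p \<in> U \<Longrightarrow> card (Range (drel p)) = 2 ^ (\<Sum>i\<in>{1..l}. propagating_vector l p i)"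
  using card_Range_uniform card_drel[OF uniform_diagrams] uniform_card_parts[OF l] by metis

text \<open>Full weight makes every basis diagram uniform, and then no nonpropagating bottom parts
  exist. Conversely the range determines the lower traces, and the sizes of these determine the
  propagating vector.\<close>

lemma B_eq: "B = {p \<in> U. Range (drel p) = unions (blocks l m)}"
proof (intro subset_antisym subsetI)
  fix p assume "p \<in> B"
  then have p: "p \<in> T" "propagating_vector l p = m" "lower_traces p = lower_traces a"
    unfolding index_basis_def lower_traces_def by auto
  have "p \<in> U" by (rule full_weight_uniform[OF l p(1)]) (simp add: p(2) m_weight)
  then show "p \<in> {p \<in> U. Range (drel p) = unions (blocks l m)}" by (simp add: Range_drel p(3) a_traces)
next
  fix p assume "p \<in> {p \<in> U. Range (drel p) = unions (blocks l m)}"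
  then have p: "p \<in> U" "unions (lower_traces p) = unions (lower_traces a)" unfolding Range_drel a_traces by auto
  have tr: "lower_traces p = lower_traces a"
    by (rule unions_inj[OF partition_on_lower_traces partition_on_lower_traces p(2)])
      (use uniform_diagrams p(1) a_uniform in blast)+
  have "propagating_vector l p i = propagating_vector l a i" for i
    using uniform_propagating_vector[OF p(1)] uniform_propagating_vector[OF a_uniform] tr
      propagating_vector_outside by metis
  moreover have "{s \<in> r. Inl -` s = {}} = {}" if "r \<in> U" for r using uniform_propagating(2)[OF that] by auto
  ultimately show "p \<in> B"
    using p(1) a_uniform tr uniform_tonal a_vector unfolding index_basis_def lower_traces_def by auto
qed

lemma B_uniform: "p \<in> B \<Longrightarrow> p \<in> U" and B_tonal: "p \<in> B \<Longrightarrow> p \<in> T"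
  using B_eq uniform_tonal by auto

lemma finite_B: "finite B"
  using finite_subset[OF _ finite_tonal] B_tonal by blast

lemma B_comp_a: "p \<in> B \<Longrightarrow> diagram_comp p a = p"
proof -
  assume p: "p \<in> B"
  note d = uniform_diagrams[OF B_uniform[OF p]] uniform_diagrams[OF a_uniform]
  have "drel (diagram_comp p a) = drel p"
    unfolding drel_comp[OF d] drel_a by (rule relcomp_Id_on) (use p B_eq in auto)
  then show ?thesis by (rule drel_inj[OF diagram_comp_in[OF d] d(1)])
qed

lemma a_in_B: "a \<in> B"
  unfolding B_eq using a_uniform drel_a by auto

lemma generators_in: "{diagram_elt (index_diagram l n m') | m'. m' \<in> index_set l n \<and>
    index_le l (int \<circ> m') (int \<circ> m) \<and> m' \<noteq> m} \<subseteq> carrier P"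
  using index_diagram_tonal[OF l] diagram_elt_in by auto

lemma ideal_I: "ideal I P"
  unfolding lower_ideal_def by (rule ring.genideal_ideal[OF ring_P generators_in])

text \<open>If the propagating vector changes, it drops strictly in the order and
  \<open>same_vector_in_ideal\<close> applies. If it does not, the product has as many parts as
  \<open>a\<close>; all its lower sets are unions of blocks, so by counting every union of blocks
  occurs.\<close>

lemma comp_a_cases:
  assumes p: "p \<in> T"
  shows "diagram_comp p a \<in> B \<or> diagram_elt (diagram_comp p a) \<in> I"
proof (cases "propagating_vector l (diagram_comp p a) = m")
  case False
  let ?q = "diagram_comp p a"
  let ?m = "propagating_vector l ?q"
  have q: "?q \<in> T" using tonal_comp[OF p a_tonal] .
  have m': "?m \<in> index_set l n" by (rule propagating_vector_index_set[OF l q])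
  then have "diagram_elt (index_diagram l n ?m) \<in> I"
    using ring.genideal_self[OF ring_P generators_in] comp_a_vector_le[OF p] False unfolding lower_ideal_def by blast
  then show ?thesis
    using same_vector_in_ideal[OF ideal_I _ q index_diagram_tonal[OF l m']]
      propagating_vector_index_diagram[OF l m'] by simp
next
  case True
  let ?q = "diagram_comp p a"
  have q: "?q \<in> T" using tonal_comp[OF p a_tonal] .
  have qU: "?q \<in> U" by (rule full_weight_uniform[OF l q]) (simp add: True m_weight)
  have sub: "Range (drel ?q) \<subseteq> unions (blocks l m)"
    unfolding drel_comp[OF tonal_diagrams[OF p] tonal_diagrams[OF a_tonal]] drel_a by auto
  have "card (unions (blocks l m)) = card (Range (drel ?q))"
    using card_drel_Range[OF qU] card_drel_Range[OF a_uniform] unfolding True a_vector drel_a by simp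
  moreover have "finite (unions (blocks l m))"
    using finite_Range[OF finite_drel[OF tonal_diagrams[OF a_tonal]]] unfolding drel_a by simp
  ultimately have "Range (drel ?q) = unions (blocks l m)" using sub by (metis card_subset_eq)
  then show ?thesis using qU B_eq by blast
qed

text \<open>
  All diagrams occurring in the ideal that are uniform have fewer parts than \<open>a\<close>, because the
  index vectors below \<open>m\<close> have a smaller sum of entries.
\<close>

lemma I_vanishes:
  assumes x: "x \<in> I" and p: "p \<in> B"
  shows "x p = 0"
proof -
  define N where "N = (\<Sum>i\<in>{1..l}. m i)"
  define S where "S = {p \<in> U. N \<le> card p}"
  \<comment> \<open>Products do not gain parts: the range is contained in that of the right factor,
    the domain in that of the left one.\<close>
  have le: "card r \<le> card p \<and> card r \<le> card q"
    if "p \<in> U" "q \<in> U" "r \<in> U" "r = diagram_comp p q" for p q r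
  proof -
    note d = that(1-3)[THEN uniform_diagrams]
    have dr: "drel r = drel p O drel q" unfolding that(4) by (rule drel_comp[OF d(1,2)])
    have fin: "finite (drel p)" "finite (drel q)" using finite_drel d by blast+
    have "card (Range (drel r)) \<le> card (Range (drel q))" unfolding dr
      by (rule card_mono[OF finite_Range[OF fin(2)]]) auto
    moreover have "card (Range (drel (flip r))) \<le> card (Range (drel (flip p)))" unfolding dr drel_flip
      by (rule card_mono[OF finite_Range]) (use fin(1) in auto)
    ultimately have "card (drel r) \<le> card (drel q)" "card (drel (flip r)) \<le> card (drel (flip p))"
      using card_Range_uniform that flip_uniform by simp_all
    then show ?thesis using card_drel[OF d(1)] card_drel[OF d(2)] card_drel[OF d(3)] by (simp add: drel_flip)
  qed
  have J: "ideal (vanishing S) P"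
  proof (rule ideal_vanishing)
    fix p q assume pq: "p \<in> T" "q \<in> T" "diagram_comp p q \<in> S"
    then have c: "diagram_comp p q \<in> U" "N \<le> card (diagram_comp p q)" unfolding S_def by auto
    have "p \<in> U" "q \<in> U" using uniform_factors[OF pq(1,2) c(1)] by auto
    then show "p \<in> S \<and> q \<in> S" using le[OF _ _ c(1) refl] c(2) unfolding S_def by auto
  qed
  have "I \<subseteq> vanishing S"
    unfolding lower_ideal_def
  proof (rule ring.genideal_minimal[OF ring_P J], rule subsetI)
    fix y :: "diagram \<Rightarrow> 'k"
    assume "y \<in> {diagram_elt (index_diagram l n m') | m'. m' \<in> index_set l n \<and>
      index_le l (int \<circ> m') (int \<circ> m) \<and> m' \<noteq> m}"
    then obtain m' where m': "y = diagram_elt (index_diagram l n m')" "m' \<in> index_set l n"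
      "fusion_cone l (\<lambda>h. int (m' h) - int (m h))" "m' \<noteq> m" unfolding index_le_cone by auto
    have "(\<Sum>h\<in>{1..l}. int (m' h) - int (m h)) \<noteq> 0"
    proof
      assume "(\<Sum>h\<in>{1..l}. int (m' h) - int (m h)) = 0"
      then have "m' h = m h" if "h \<in> {1..l}" for h using cone_sum_le(2)[OF m'(3) _ that] by simp
      then have "m' h = m h" for h using m'(2) m_index unfolding index_set_def by (cases "h \<in> {1..l}") auto
      then show False using m'(4) by blast
    qed
    then have "(\<Sum>h\<in>{1..l}. int (m' h)) < (\<Sum>h\<in>{1..l}. int (m h))"
      using cone_sum_le(1)[OF m'(3)] by (simp add: sum_subtractf)
    then have lt: "(\<Sum>h\<in>{1..l}. m' h) < N" unfolding N_def by (simp flip: of_nat_sum)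
    have "index_diagram l n m' \<notin> S"
      using lt uniform_card_parts[OF l, of "index_diagram l n m'" n] propagating_vector_index_diagram[OF l m'(2)]
      unfolding S_def by auto
    then show "y \<in> vanishing S"
      using diagram_elt_in[OF index_diagram_tonal[OF l m'(2)]] unfolding m'(1) by (auto simp: diagram_elt_def)
  qed
  moreover have "p \<in> S"
  proof -
    have "card (Range (drel p)) = card (Range (drel a))" using p unfolding B_eq drel_a by auto
    then have "card p = card a"
      using card_Range_uniform card_drel[OF uniform_diagrams] B_uniform[OF p] a_uniform
      by (metis power_inject_exp one_less_numeral_iff semiring_norm(76))
    then show ?thesis unfolding S_def N_def
      using B_uniform[OF p] uniform_card_parts[OF l a_uniform] a_vector by simp
  qed
  ultimately show ?thesis using x by blast
qed

end


section \<open>Permutations of blocks\<close>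

lemma drel_image_Plus:
  "drel ((\<lambda>k. u k <+> v k) ` K) = (\<lambda>S. (\<Union>(u ` S), \<Union>(v ` S))) ` Pow K"
proof -
  have *: "\<Union>((\<lambda>k. u k <+> v k) ` S) = \<Union>(u ` S) <+> \<Union>(v ` S)" for S by (auto simp: Plus_def)
  have "(A, B) \<in> drel ((\<lambda>k. u k <+> v k) ` K) \<longleftrightarrow> (\<exists>S\<subseteq>K. A <+> B = \<Union>(u ` S) <+> \<Union>(v ` S))" for A B
  proof
    assume "(A, B) \<in> drel ((\<lambda>k. u k <+> v k) ` K)"
    then obtain F where F: "F \<subseteq> (\<lambda>k. u k <+> v k) ` K" "A <+> B = \<Union>F" unfolding drel_def unions_def by auto
    then obtain S where S: "S \<subseteq> K" "F = (\<lambda>k. u k <+> v k) ` S" by (meson subset_imageE)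
    then show "\<exists>S\<subseteq>K. A <+> B = \<Union>(u ` S) <+> \<Union>(v ` S)" using F(2) * by metis
  next
    assume "\<exists>S\<subseteq>K. A <+> B = \<Union>(u ` S) <+> \<Union>(v ` S)"
    then obtain S where S: "S \<subseteq> K" "A <+> B = \<Union>((\<lambda>k. u k <+> v k) ` S)" unfolding * by blast
    then show "(A, B) \<in> drel ((\<lambda>k. u k <+> v k) ` K)" unfolding drel_def unions_def by auto
  qed
  then show ?thesis by (auto simp: Plus_inject)
qed

lemma diagram_of_families:
  assumes "\<And>k. k \<in> K \<Longrightarrow> v k \<noteq> {}" "\<Union>(u ` K) = {1..n}" "\<Union>(v ` K) = {1..m}"
    and "\<And>k k'. k \<in> K \<Longrightarrow> k' \<in> K \<Longrightarrow> k \<noteq> k' \<Longrightarrow> u k \<inter> u k' = {} \<and> v k \<inter> v k' = {}"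
  shows "(\<lambda>k. u k <+> v k) ` K \<in> diagrams n m"
proof (rule diagramsI)
  show "{} \<notin> (\<lambda>k. u k <+> v k) ` K" using assms(1) by (auto simp: Plus_def)
  have "\<Union>((\<lambda>k. u k <+> v k) ` K) = \<Union>(u ` K) <+> \<Union>(v ` K)" by (auto simp: Plus_def)
  then show "\<Union>((\<lambda>k. u k <+> v k) ` K) = {1..n} <+> {1..m}" unfolding assms(2,3) .
  show "disjoint ((\<lambda>k. u k <+> v k) ` K)"
    unfolding disjoint_def
  proof (intro ballI impI)
    fix s t assume "s \<in> (\<lambda>k. u k <+> v k) ` K" "t \<in> (\<lambda>k. u k <+> v k) ` K" "s \<noteq> t"
    then obtain k k' where k: "k \<in> K" "k' \<in> K" "s = u k <+> v k" "t = u k' <+> v k'" by blast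
    then have "k \<noteq> k'" using \<open>s \<noteq> t\<close> by blast
    then show "s \<inter> t = {}" unfolding k(3,4) using assms(4)[OF k(1,2)] by (auto simp: Plus_def)
  qed
qed

context tonal_alg_pos
begin

text \<open>Nothing of \<open>q\<close> is lost in the product, so the small lower sets of
  \<open>q\<close> still cover the lower row.\<close>

lemma uniform_comp_Domain:
  assumes "p \<in> U" "q \<in> U" "Domain (drel q) \<subseteq> Range (drel p)"
  shows "diagram_comp p q \<in> U"
proof (rule uniform_compI[OF assms(1,2)])
  fix y assume "y \<in> {1..n}"
  then obtain D E where "(D, E) \<in> drel q" "y \<in> E" "card E \<le> l" using uniform_cover(2)[OF assms(2)] by blast
  then show "\<exists>A B. (A, B) \<in> drel p O drel q \<and> y \<in> B \<and> card B \<le> l" using assms(3) by blast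
qed

end

context top_index
begin

abbreviation "X0 \<equiv> (SIGMA i:{1..l}. {1..m i})"
abbreviation "G \<equiv> sym_product l m"

definition lb :: "nat \<times> nat \<Rightarrow> nat set" where
  "lb k = lower_block l m (fst k) (snd k)"

definition perm_index :: "(nat \<Rightarrow> nat \<Rightarrow> nat) \<Rightarrow> nat \<times> nat \<Rightarrow> nat \<times> nat" where
  "perm_index \<sigma> k = (fst k, \<sigma> (fst k) (snd k))"

lemma blocks_lb: "blocks l m = lb ` X0"
  unfolding blocks_def lb_def by (simp add: case_prod_beta)

lemma lb_inj: "inj_on lb X0"
proof (rule inj_onI)
  fix k k' assume "k \<in> X0" "k' \<in> X0" "lb k = lb k'"
  then show "k = k'" using lower_block_inj[of "fst k" "fst k'" "snd k" "snd k'" l m] unfolding lb_def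
    by (cases k; cases k') auto
qed

lemma lb_nonempty: "k \<in> X0 \<Longrightarrow> lb k \<noteq> {}"
  using card_blocks[of "lb k"] unfolding blocks_lb by fastforce

lemma lb_disjoint: "k \<in> X0 \<Longrightarrow> k' \<in> X0 \<Longrightarrow> k \<noteq> k' \<Longrightarrow> lb k \<inter> lb k' = {}"
  using disjointD[OF partition_onD2[OF blocks_partition], of "lb k" "lb k'"] inj_onD[OF lb_inj, of k k']
  unfolding blocks_lb by auto

lemma lb_Union: "\<Union>(lb ` X0) = {1..n}"
  using partition_onD1[OF blocks_partition] unfolding blocks_lb by simp

lemma card_lb: "k \<in> X0 \<Longrightarrow> card (lb k) = fst k"
  unfolding lb_def using card_lower_block[of "snd k" l m "fst k"] by auto

lemma Union_lb_inj: "S \<subseteq> X0 \<Longrightarrow> S' \<subseteq> X0 \<Longrightarrow> \<Union>(lb ` S) = \<Union>(lb ` S') \<Longrightarrow> S = S'"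
  using inj_onD[OF inj_on_Union_partition[OF blocks_partition], of "lb ` S" "lb ` S'"]
    inj_on_image_eq_iff[OF lb_inj, of S S'] unfolding blocks_lb by auto

lemma carrier_G: "carrier G = (\<Pi>\<^sub>E i\<in>{1..l}. {\<pi>. \<pi> permutes {1..m i}})"
  unfolding sym_product_def product_group_def sym_group_def by simp

lemma finite_G: "finite (carrier G)"
  unfolding carrier_G by (intro finite_PiE finite_permutations) auto

lemma G_permutes: "\<sigma> \<in> carrier G \<Longrightarrow> i \<in> {1..l} \<Longrightarrow> \<sigma> i permutes {1..m i}"
  unfolding carrier_G by auto

lemma mult_G: "\<sigma> \<otimes>\<^bsub>G\<^esub> \<tau> = (\<lambda>i\<in>{1..l}. \<sigma> i \<circ> \<tau> i)"
  unfolding sym_product_def product_group_def sym_group_def by simp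

lemma one_G: "\<one>\<^bsub>G\<^esub> = (\<lambda>i\<in>{1..l}. id)"
  unfolding sym_product_def product_group_def sym_group_def by simp

lemma group_G: "group G"
  unfolding sym_product_def by (intro product_group) (use sym_group_is_group in auto)

lemma perm_index_bij:
  assumes "\<sigma> \<in> carrier G"
  shows "perm_index \<sigma> ` X0 = X0" "inj_on (perm_index \<sigma>) X0"
proof -
  show "inj_on (perm_index \<sigma>) X0"
  proof (rule inj_onI)
    fix k k' assume k: "k \<in> X0" "k' \<in> X0" "perm_index \<sigma> k = perm_index \<sigma> k'"
    then have "fst k = fst k'" "\<sigma> (fst k) (snd k) = \<sigma> (fst k) (snd k')" unfolding perm_index_def by auto
    moreover have "inj (\<sigma> (fst k))" using G_permutes[OF assms, of "fst k"] k(1) permutes_inj by auto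
    ultimately show "k = k'" by (auto dest: injD intro: prod_eqI)
  qed
  have "perm_index \<sigma> k \<in> X0" if "k \<in> X0" for k
    using that G_permutes[OF assms, of "fst k"] permutes_in_image[of "\<sigma> (fst k)" "{1..m (fst k)}" "snd k"]
    unfolding perm_index_def by auto
  moreover have "k \<in> perm_index \<sigma> ` X0" if k: "k \<in> X0" for k
  proof -
    have "\<sigma> (fst k) ` {1..m (fst k)} = {1..m (fst k)}" by (rule permutes_image[OF G_permutes[OF assms]]) (use k in auto)
    then obtain j where j: "j \<in> {1..m (fst k)}" "snd k = \<sigma> (fst k) j" using k by (metis SigmaD2 imageE prod.collapse)
    then have "k = perm_index \<sigma> (fst k, j)" unfolding perm_index_def by (simp add: prod_eq_iff)
    moreover have "(fst k, j) \<in> X0" using j k by auto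
    ultimately show ?thesis by blast
  qed
  ultimately show "perm_index \<sigma> ` X0 = X0" by blast
qed

lemma perm_index_in: "\<sigma> \<in> carrier G \<Longrightarrow> k \<in> X0 \<Longrightarrow> perm_index \<sigma> k \<in> X0"
  using perm_index_bij(1) by blast

text \<open>Realizes the symmetric groups inside the diagrams, with \<open>a\<close> as the
  identity. Permuting the upper blocks, not the lower ones, makes composition of diagrams match the
  group multiplication.\<close>

definition block_perm :: "(nat \<Rightarrow> nat \<Rightarrow> nat) \<Rightarrow> diagram" where
  "block_perm \<sigma> = (\<lambda>k. lb (perm_index \<sigma> k) <+> lb k) ` X0"

text \<open>Labels the parts of a basis diagram by their lower blocks, so that the right action
  becomes a reindexing of the upper halves \<open>t\<close>.\<close>

lemma B_parts:
  assumes p: "p \<in> B"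
  shows "\<exists>t. p = (\<lambda>k. t k <+> lb k) ` X0 \<and> (\<forall>k\<in>X0. t k \<noteq> {}) \<and> \<Union>(t ` X0) = {1..n} \<and>
    (\<forall>k\<in>X0. \<forall>k'\<in>X0. k \<noteq> k' \<longrightarrow> t k \<inter> t k' = {})"
proof -
  note U = B_uniform[OF p]
  note d = uniform_diagrams[OF U]
  have "unions (lower_traces p) = unions (blocks l m)" using p unfolding B_eq Range_drel by auto
  then have tr: "lower_traces p = blocks l m"
    by (rule unions_inj[OF partition_on_lower_traces[OF d] blocks_partition])
  have "\<exists>s\<in>p. Inr -` s = lb k" if "k \<in> X0" for k
    using tr that unfolding uniform_lower_traces[OF U] blocks_lb by (metis (no_types, lifting) imageE imageI)
  then obtain c where c: "\<And>k. k \<in> X0 \<Longrightarrow> c k \<in> p \<and> Inr -` c k = lb k" by metis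
  define t where "t k = Inl -` c k" for k
  have ct: "c k = t k <+> lb k" if "k \<in> X0" for k
    using c[OF that] Plus_vimages[of "c k"] unfolding t_def by simp
  have inj: "c k \<inter> c k' = {}" if "k \<in> X0" "k' \<in> X0" "k \<noteq> k'" for k k'
  proof -
    have "lb k \<noteq> lb k'" using that inj_onD[OF lb_inj] by blast
    then have "c k \<noteq> c k'" using c that by metis
    then show ?thesis using c that partition_onD2 d unfolding diagrams_def disjoint_def by blast
  qed
  have cX: "c ` X0 = p"
  proof (intro subset_antisym subsetI)
    fix s assume s: "s \<in> p"
    then have "Inr -` s \<in> blocks l m" using tr unfolding uniform_lower_traces[OF U] by blast
    then obtain k where k: "k \<in> X0" "Inr -` s = lb k" unfolding blocks_lb by blast
    then obtain y where "y \<in> lb k" using lb_nonempty by blast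
    then have "Inr y \<in> s" "Inr y \<in> c k" using k c by blast+
    then have "s = c k" using part_of_eq[OF d s] part_of_eq[OF d conjunct1[OF c[OF k(1)]]] by metis
    then show "s \<in> c ` X0" using k(1) by blast
  qed (use c in blast)
  show ?thesis
  proof (intro exI conjI ballI impI)
    show "p = (\<lambda>k. t k <+> lb k) ` X0" using cX ct by (metis (no_types, lifting) image_cong)
    show "t k \<noteq> {}" if "k \<in> X0" for k using uniform_propagating(2)[OF U] c[OF that] unfolding t_def by blast
    show "t k \<inter> t k' = {}" if "k \<in> X0" "k' \<in> X0" "k \<noteq> k'" for k k' using inj[OF that] unfolding t_def by blast
    have "\<Union>(t ` X0) = Inl -` \<Union>(c ` X0)" unfolding t_def by auto
    then show "\<Union>(t ` X0) = {1..n}" unfolding cX using diagram_full_vimages(1)[OF d] by simp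
  qed
qed

lemma Union_perm_index: "\<sigma> \<in> carrier G \<Longrightarrow> \<Union>((\<lambda>k. t (perm_index \<sigma> k)) ` X0) = \<Union>(t ` X0)"
  using perm_index_bij(1)[of \<sigma>] by (metis image_image)

lemma permuted_diagram:
  assumes \<sigma>: "\<sigma> \<in> carrier G" and t: "\<Union>(t ` X0) = {1..n}"
    "\<And>k k'. k \<in> X0 \<Longrightarrow> k' \<in> X0 \<Longrightarrow> k \<noteq> k' \<Longrightarrow> t k \<inter> t k' = {}"
  shows "(\<lambda>k. t (perm_index \<sigma> k) <+> lb k) ` X0 \<in> diagrams n n"
proof (rule diagram_of_families)
  show "\<Union>((\<lambda>k. t (perm_index \<sigma> k)) ` X0) = {1..n}" using Union_perm_index[OF \<sigma>] t(1) by metis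
  show "\<Union>(lb ` X0) = {1..n}" by (rule lb_Union)
  show "lb k \<noteq> {}" if "k \<in> X0" for k by (rule lb_nonempty[OF that])
  show "t (perm_index \<sigma> k) \<inter> t (perm_index \<sigma> k') = {} \<and> lb k \<inter> lb k' = {}"
    if "k \<in> X0" "k' \<in> X0" "k \<noteq> k'" for k k'
    using t(2)[OF perm_index_in[OF \<sigma> that(1)] perm_index_in[OF \<sigma> that(2)]] that
      inj_onD[OF perm_index_bij(2)[OF \<sigma>]] lb_disjoint[OF that] by blast
qed

lemma block_perm_diagrams: "\<sigma> \<in> carrier G \<Longrightarrow> block_perm \<sigma> \<in> diagrams n n"
  unfolding block_perm_def by (rule permuted_diagram) (use lb_Union lb_disjoint in auto)

lemma block_perm_uniform:
  assumes "\<sigma> \<in> carrier G"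
  shows "block_perm \<sigma> \<in> U"
proof -
  have "upper_size s = lower_size s \<and> upper_size s \<le> l" if "s \<in> block_perm \<sigma>" for s
  proof -
    obtain k where k: "k \<in> X0" "s = lb (perm_index \<sigma> k) <+> lb k" using \<open>s \<in> _\<close> unfolding block_perm_def by blast
    have "card (lb (perm_index \<sigma> k)) = fst k" using card_lb[OF perm_index_in[OF assms k(1)]] by (simp add: perm_index_def)
    then show ?thesis using card_lb[OF k(1)] k by (auto simp: upper_size_Plus)
  qed
  then show ?thesis using block_perm_diagrams[OF assms] unfolding uniform_def by blast
qed

lemma drel_block_perm: "drel (block_perm \<sigma>) = (\<lambda>S. (\<Union>((\<lambda>k. lb (perm_index \<sigma> k)) ` S), \<Union>(lb ` S))) ` Pow X0"
  unfolding block_perm_def by (rule drel_image_Plus)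

lemma unions_blocks: "unions (blocks l m) = (\<lambda>S. \<Union>(lb ` S)) ` Pow X0"
proof -
  have "Pow (lb ` X0) = image lb ` Pow X0" by (rule image_Pow_surj[symmetric]) simp
  then show ?thesis unfolding unions_def blocks_lb by (simp add: image_image)
qed

lemma block_perm_B: "\<sigma> \<in> carrier G \<Longrightarrow> block_perm \<sigma> \<in> B"
  unfolding B_eq using block_perm_uniform by (simp add: unions_blocks drel_block_perm Range_snd image_image)

lemma Domain_block_perm:
  assumes "\<sigma> \<in> carrier G"
  shows "Domain (drel (block_perm \<sigma>)) = unions (blocks l m)"
proof -
  have "image (perm_index \<sigma>) ` Pow X0 = Pow X0" using image_Pow_surj[OF perm_index_bij(1)[OF assms]] .
  then have "unions (blocks l m) = (\<lambda>S. \<Union>(lb ` S)) ` image (perm_index \<sigma>) ` Pow X0" unfolding unions_blocks by simp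
  then show ?thesis unfolding drel_block_perm by (simp add: Domain_fst image_image)
qed

lemma comp_block_perm_B:
  assumes "p \<in> B" "\<sigma> \<in> carrier G"
  shows "diagram_comp p (block_perm \<sigma>) \<in> B"
proof -
  note g = block_perm_B[OF assms(2)]
  have "Range (drel p) = Domain (drel (block_perm \<sigma>))" using assms B_eq Domain_block_perm by auto
  moreover from this have "Range (drel p O drel (block_perm \<sigma>)) = Range (drel (block_perm \<sigma>))" by blast
  ultimately show ?thesis
    using uniform_comp_Domain[OF B_uniform[OF assms(1)] B_uniform[OF g]] g
      drel_comp[OF uniform_diagrams[OF B_uniform[OF assms(1)]] uniform_diagrams[OF B_uniform[OF g]]]
    unfolding B_eq by simp
qed

text \<open>The middle set of a related pair is a union of blocks and determines its set of indices,
  so composing relations amounts to substituting \<open>perm_index \<sigma>\<close>.\<close>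

lemma comp_block_perm:
  assumes p: "p = (\<lambda>k. t k <+> lb k) ` X0" "p \<in> diagrams n n"
    and t: "\<Union>(t ` X0) = {1..n}" "\<And>k k'. k \<in> X0 \<Longrightarrow> k' \<in> X0 \<Longrightarrow> k \<noteq> k' \<Longrightarrow> t k \<inter> t k' = {}"
    and \<sigma>: "\<sigma> \<in> carrier G"
  shows "diagram_comp p (block_perm \<sigma>) = (\<lambda>k. t (perm_index \<sigma> k) <+> lb k) ` X0"
proof (rule drel_inj)
  note gd = block_perm_diagrams[OF \<sigma>]
  show "diagram_comp p (block_perm \<sigma>) \<in> diagrams n n" by (rule diagram_comp_in[OF p(2) gd])
  show "(\<lambda>k. t (perm_index \<sigma> k) <+> lb k) ` X0 \<in> diagrams n n" by (rule permuted_diagram[OF \<sigma> t])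
  have drp: "drel p = (\<lambda>S. (\<Union>(t ` S), \<Union>(lb ` S))) ` Pow X0" unfolding p(1) by (rule drel_image_Plus)
  have eq: "\<Union>((\<lambda>k. u (perm_index \<sigma> k)) ` S) = \<Union>(u ` perm_index \<sigma> ` S)" for u :: "nat \<times> nat \<Rightarrow> nat set" and S
    by (simp add: image_image)
  have "(A, C) \<in> drel p O drel (block_perm \<sigma>) \<longleftrightarrow>
      (A, C) \<in> (\<lambda>S. (\<Union>((\<lambda>k. t (perm_index \<sigma> k)) ` S), \<Union>(lb ` S))) ` Pow X0" for A C
  proof
    assume "(A, C) \<in> drel p O drel (block_perm \<sigma>)"
    then obtain M where "(A, M) \<in> drel p" "(M, C) \<in> drel (block_perm \<sigma>)" by blast
    then obtain S S' where S: "S \<subseteq> X0" "A = \<Union>(t ` S)" "M = \<Union>(lb ` S)"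
      and S': "S' \<subseteq> X0" "M = \<Union>(lb ` perm_index \<sigma> ` S')" "C = \<Union>(lb ` S')"
      unfolding drp drel_block_perm eq by blast
    have "perm_index \<sigma> ` S' \<subseteq> X0" using S'(1) perm_index_bij(1)[OF \<sigma>] by blast
    then have "S = perm_index \<sigma> ` S'" using Union_lb_inj[OF S(1)] S(3) S'(2) by metis
    then show "(A, C) \<in> (\<lambda>S. (\<Union>((\<lambda>k. t (perm_index \<sigma> k)) ` S), \<Union>(lb ` S))) ` Pow X0"
      unfolding eq using S S' by blast
  next
    assume "(A, C) \<in> (\<lambda>S. (\<Union>((\<lambda>k. t (perm_index \<sigma> k)) ` S), \<Union>(lb ` S))) ` Pow X0"
    then obtain S where S: "S \<subseteq> X0" "A = \<Union>(t ` perm_index \<sigma> ` S)" "C = \<Union>(lb ` S)" unfolding eq by blast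
    have "perm_index \<sigma> ` S \<subseteq> X0" using S(1) perm_index_bij(1)[OF \<sigma>] by blast
    then have "(A, \<Union>(lb ` perm_index \<sigma> ` S)) \<in> drel p" unfolding drp S(2) by blast
    moreover have "(\<Union>(lb ` perm_index \<sigma> ` S), C) \<in> drel (block_perm \<sigma>)" unfolding drel_block_perm eq S(3) using S(1) by blast
    ultimately show "(A, C) \<in> drel p O drel (block_perm \<sigma>)" by blast
  qed
  then show "drel (diagram_comp p (block_perm \<sigma>)) = drel ((\<lambda>k. t (perm_index \<sigma> k) <+> lb k) ` X0)"
    unfolding drel_comp[OF p(2) gd] drel_image_Plus by (rule rel_eqI)
qed

text \<open>As right multiplication by a diagram, the block action commutes with left multiplication
  by associativity.\<close>

lemma permute_blocks_comp:
  assumes p: "p \<in> B" and \<sigma>: "\<sigma> \<in> carrier G"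
  shows "permute_blocks l m p \<sigma> = diagram_comp p (block_perm \<sigma>)"
proof -
  note U = B_uniform[OF p]
  obtain t where t0: "p = (\<lambda>k. t k <+> lb k) ` X0 \<and> (\<forall>k\<in>X0. t k \<noteq> {}) \<and> \<Union>(t ` X0) = {1..n} \<and>
    (\<forall>k\<in>X0. \<forall>k'\<in>X0. k \<noteq> k' \<longrightarrow> t k \<inter> t k' = {})" using B_parts[OF p] ..
  note t1 = conjunct2[OF t0] and t2 = conjunct2[OF conjunct2[OF t0]]
  note t = conjunct1[OF t0] bspec[OF conjunct1[OF t1]] conjunct1[OF t2] bspec[OF bspec[OF conjunct2[OF t2]], THEN mp]
  have "{s \<in> p. \<not> propagating s} = {}" using uniform_propagating(1)[OF U] by blast
  moreover have "{Inl ` (Inl -` s) \<union> Inr ` lower_block l m i j | s i j. s \<in> p \<and> propagating s \<and>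
        i \<in> {1..l} \<and> j \<in> {1..m i} \<and> Inr -` s = lower_block l m i (\<sigma> i j)} =
      (\<lambda>k. t (perm_index \<sigma> k) <+> lb k) ` X0" (is "?L = ?R")
  proof (intro subset_antisym subsetI)
    fix s' assume "s' \<in> ?L"
    then obtain s i j where s: "s' = Inl ` (Inl -` s) \<union> Inr ` lower_block l m i j" "s \<in> p"
      "(i, j) \<in> X0" "Inr -` s = lower_block l m i (\<sigma> i j)" by auto
    obtain k where k: "k \<in> X0" "s = t k <+> lb k" using s(2) t(1) by blast
    have "lb k = lb (perm_index \<sigma> (i, j))" using s(4) unfolding k(2) vimage_Plus by (simp add: lb_def perm_index_def)
    then have "k = perm_index \<sigma> (i, j)" using inj_onD[OF lb_inj _ k(1) perm_index_in[OF \<sigma> s(3)]] by blast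
    then have "s' = t (perm_index \<sigma> (i, j)) <+> lb (i, j)" unfolding s(1) k(2) vimage_Plus by (simp add: Plus_def lb_def)
    then show "s' \<in> ?R" using s(3) by blast
  next
    fix s' assume "s' \<in> ?R"
    then obtain i j where k: "(i, j) \<in> X0" "s' = t (perm_index \<sigma> (i, j)) <+> lb (i, j)" by auto
    let ?s = "t (perm_index \<sigma> (i, j)) <+> lb (perm_index \<sigma> (i, j))"
    have "?s \<in> p" unfolding t(1) by (rule rev_image_eqI[OF perm_index_in[OF \<sigma> k(1)] refl])
    moreover have "s' = Inl ` (Inl -` ?s) \<union> Inr ` lower_block l m i j" unfolding k(2) vimage_Plus by (simp add: Plus_def lb_def)
    moreover have "Inr -` ?s = lower_block l m i (\<sigma> i j)" unfolding vimage_Plus by (simp add: lb_def perm_index_def)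
    ultimately show "s' \<in> ?L" using uniform_propagating(1)[OF U] k(1) by blast
  qed
  moreover have "diagram_comp p (block_perm \<sigma>) = (\<lambda>k. t (perm_index \<sigma> k) <+> lb k) ` X0"
    by (rule comp_block_perm[OF t(1) uniform_diagrams[OF U] t(3,4) \<sigma>])
  ultimately show ?thesis unfolding permute_blocks_def by (simp only: Un_empty_left)
qed

lemma block_perm_mult:
  assumes "\<sigma> \<in> carrier G" "\<tau> \<in> carrier G"
  shows "diagram_comp (block_perm \<sigma>) (block_perm \<tau>) = block_perm (\<sigma> \<otimes>\<^bsub>G\<^esub> \<tau>)"
proof -
  have "diagram_comp (block_perm \<sigma>) (block_perm \<tau>) = (\<lambda>k. lb (perm_index \<sigma> (perm_index \<tau> k)) <+> lb k) ` X0"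
  proof (rule comp_block_perm[OF block_perm_def block_perm_diagrams[OF assms(1)] _ _ assms(2)])
    show "\<Union>((\<lambda>k. lb (perm_index \<sigma> k)) ` X0) = {1..n}" using Union_perm_index[OF assms(1)] lb_Union by metis
    show "lb (perm_index \<sigma> k) \<inter> lb (perm_index \<sigma> k') = {}" if "k \<in> X0" "k' \<in> X0" "k \<noteq> k'" for k k'
      using lb_disjoint perm_index_in[OF assms(1)] that inj_onD[OF perm_index_bij(2)[OF assms(1)]] by metis
  qed
  also have "\<dots> = block_perm (\<sigma> \<otimes>\<^bsub>G\<^esub> \<tau>)"
    unfolding block_perm_def mult_G by (intro image_cong refl) (auto simp: perm_index_def)
  finally show ?thesis .
qed

lemma block_perm_one: "block_perm \<one>\<^bsub>G\<^esub> = a"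
  unfolding block_perm_def one_G a_eq blocks_lb image_image by (intro image_cong refl) (auto simp: perm_index_def)

text \<open>Membership of \<open>h\<close> makes all lower halves blocks, membership of the flip all
  upper halves. Upper and lower sizes agree, so blocks are matched with blocks of the same size,
  which gives one permutation for each size.\<close>

lemma obtain_block_perm:
  assumes h: "h \<in> B" "flip h \<in> B"
  obtains \<sigma> where "\<sigma> \<in> carrier G" "h = block_perm \<sigma>"
proof -
  obtain t where t0: "h = (\<lambda>k. t k <+> lb k) ` X0 \<and> (\<forall>k\<in>X0. t k \<noteq> {}) \<and> \<Union>(t ` X0) = {1..n} \<and>
    (\<forall>k\<in>X0. \<forall>k'\<in>X0. k \<noteq> k' \<longrightarrow> t k \<inter> t k' = {})" using B_parts[OF h(1)] ..
  note t1 = conjunct2[OF t0] and t2 = conjunct2[OF conjunct2[OF t0]]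
  note t = conjunct1[OF t0] bspec[OF conjunct1[OF t1]] conjunct1[OF t2] bspec[OF bspec[OF conjunct2[OF t2]], THEN mp]
  have ex: "\<exists>j'\<in>{1..m i}. t (i, j) = lb (i, j')" if ij: "i \<in> {1..l}" "j \<in> {1..m i}" for i j
  proof -
    have k: "(i, j) \<in> X0" using ij by auto
    then have "t (i, j) <+> lb (i, j) \<in> h" unfolding t(1) by blast
    then have c: "card (t (i, j)) = card (lb (i, j))" and "case_sum Inr Inl -` (t (i, j) <+> lb (i, j)) \<in> flip h"
      using B_uniform[OF h(1)] unfolding uniform_def flip_def by (auto simp: upper_size_Plus)
    then have "lb (i, j) <+> t (i, j) \<in> flip h" by (simp add: case_sum_vimage_Plus)
    moreover obtain t' where "flip h = (\<lambda>k. t' k <+> lb k) ` X0" using B_parts[OF h(2)] by (elim exE conjE)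
    ultimately obtain k' where k': "k' \<in> X0" "t (i, j) = lb k'" by (auto simp: Plus_inject)
    then have "fst k' = i" using c card_lb[OF k'(1)] card_lb[OF k] by simp
    then show ?thesis using k' by (cases k') auto
  qed
  \<comment> \<open>Outside \<open>{1..m i}\<close> the map is the identity, as
    \<open>permutes\<close> demands.\<close>
  define \<sigma> where "\<sigma> = (\<lambda>i\<in>{1..l}. \<lambda>j. if j \<in> {1..m i} then (SOME j'. j' \<in> {1..m i} \<and> t (i, j) = lb (i, j')) else j)"
  have \<sigma>: "\<sigma> i j \<in> {1..m i} \<and> t (i, j) = lb (i, \<sigma> i j)" if "i \<in> {1..l}" "j \<in> {1..m i}" for i j
  proof -
    have "\<exists>j'. j' \<in> {1..m i} \<and> t (i, j) = lb (i, j')" using ex[OF that] by blast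
    from someI_ex[OF this] show ?thesis using that unfolding \<sigma>_def by simp
  qed
  have "\<sigma> i permutes {1..m i}" if i: "i \<in> {1..l}" for i
  proof (rule bij_imp_permutes)
    have inj: "inj_on (\<sigma> i) {1..m i}"
    proof (rule inj_onI)
      fix j j' assume j: "j \<in> {1..m i}" "j' \<in> {1..m i}" "\<sigma> i j = \<sigma> i j'"
      then have "t (i, j) = t (i, j')" using \<sigma>[OF i] by metis
      then have "t (i, j) \<inter> t (i, j') \<noteq> {}" using t(2)[of "(i, j)"] i j by auto
      then show "j = j'" using t(4)[of "(i, j)" "(i, j')"] i j by auto
    qed
    moreover have "\<sigma> i ` {1..m i} \<subseteq> {1..m i}" using \<sigma>[OF i] by blast
    ultimately show "bij_betw (\<sigma> i) {1..m i} {1..m i}" unfolding bij_betw_def using endo_inj_surj[of "{1..m i}" "\<sigma> i"] by auto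
    show "\<sigma> i x = x" if "x \<notin> {1..m i}" for x using that i unfolding \<sigma>_def by auto
  qed
  then have "\<sigma> \<in> carrier G" unfolding carrier_G by (auto simp: \<sigma>_def)
  moreover have "h = block_perm \<sigma>"
    unfolding t(1) block_perm_def by (intro image_cong refl) (use \<sigma> in \<open>auto simp: perm_index_def\<close>)
  ultimately show ?thesis using that by blast
qed



section \<open>The left ideal of an index diagram\<close>

abbreviation "LM \<equiv> index_left_ideal \<delta> l n m"
abbreviation "cls x \<equiv> I +>\<^bsub>P\<^esub> x"

text \<open>Normal forms: every class in the left ideal has exactly one representative here, by
  \<open>carrier_LM\<close> and \<open>cls_supp_inj\<close>.\<close>

definition supp_B :: "(diagram \<Rightarrow> 'k) set" where
  "supp_B = {x. \<forall>p. p \<notin> B \<longrightarrow> x p = 0}"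

definition restr :: "(diagram \<Rightarrow> 'k) \<Rightarrow> diagram \<Rightarrow> 'k" where
  "restr x = (\<lambda>p. if p \<in> B then x p else 0)"

lemma restr_supp: "restr x \<in> supp_B"
  unfolding restr_def supp_B_def by simp

lemma supp_B_carrier: "x \<in> supp_B \<Longrightarrow> x \<in> carrier P"
  unfolding supp_B_def carrier_iff using B_tonal by blast

lemma restr_carrier: "restr x \<in> carrier P"
  using supp_B_carrier restr_supp by blast

lemma a_carrier: "diagram_elt a \<in> carrier P"
  by (rule diagram_elt_in[OF a_tonal])

lemma supp_B_mult_a:
  assumes "x \<in> supp_B"
  shows "x \<bullet> diagram_elt a = x"
proof
  fix q
  have "(x \<bullet> diagram_elt a) q = (\<Sum>p\<in>T. if p = q then x p else 0)"
    unfolding diagram_elt_dterm mult_dterm_right[OF a_tonal]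
  proof (intro sum.cong refl)
    fix p assume p: "p \<in> T"
    show "(if diagram_comp p a = q then x p * 1 * \<delta> ^ diagram_loops p a else 0) = (if p = q then x p else 0)"
    proof (cases "p \<in> B")
      case True
      then show ?thesis
        using B_comp_a[OF True] uniform_loops[OF tonal_diagrams[OF p] tonal_diagrams[OF a_tonal], of l] a_uniform by auto
    next
      case False
      then have "x p = 0" using assms unfolding supp_B_def by simp
      then show ?thesis by auto
    qed
  qed
  then show "(x \<bullet> diagram_elt a) q = x q"
    using finite_tonal carrier_eq_0[OF supp_B_carrier[OF assms], of q] by auto
qed

text \<open>A diagram with nonzero coefficient in the product is of the form
  \<open>diagram_comp p a\<close>. By \<open>comp_a_cases\<close> it is a basis diagram or lies in
  the lower ideal, so dropping the coefficients outside \<open>B\<close> does not change the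
  class.\<close>

lemma mult_a_restr:
  assumes "y \<in> carrier P"
  shows "(\<lambda>p. (y \<bullet> diagram_elt a) p + - restr (y \<bullet> diagram_elt a) p) \<in> I" (is "?z \<in> I")
proof (rule ideal_supported[OF ideal_I])
  show "?z \<in> carrier P" using mult_closed[of y "diagram_elt a"] restr_carrier unfolding carrier_iff by simp
  fix q assume q: "q \<in> T" "?z q \<noteq> 0"
  then have qB: "q \<notin> B" and "(y \<bullet> diagram_elt a) q \<noteq> 0" unfolding restr_def by (auto split: if_splits)
  have "\<exists>p\<in>T. diagram_comp p a = q"
  proof (rule ccontr)
    assume "\<not> (\<exists>p\<in>T. diagram_comp p a = q)"
    then have "(y \<bullet> diagram_elt a) q = 0"
      unfolding diagram_elt_dterm mult_dterm_right[OF a_tonal] by (intro sum.neutral) auto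
    then show False using \<open>(y \<bullet> diagram_elt a) q \<noteq> 0\<close> by simp
  qed
  then show "diagram_elt q \<in> I" using comp_a_cases qB by blast
qed

lemma cls_eq_iff: "x \<in> carrier P \<Longrightarrow> y \<in> carrier P \<Longrightarrow> cls x = cls y \<longleftrightarrow> (\<lambda>p. x p + - y p) \<in> I"
  using ring.quotient_eq_iff_same_a_r_cos[OF ring_P ideal_I, of x y]
  by (simp add: a_minus_def minus_P add_P)

lemma cls_supp_inj: "x \<in> supp_B \<Longrightarrow> y \<in> supp_B \<Longrightarrow> cls x = cls y \<Longrightarrow> x = y"
proof
  fix p assume xy: "x \<in> supp_B" "y \<in> supp_B" "cls x = cls y"
  then have "(\<lambda>p. x p + - y p) \<in> I" using cls_eq_iff supp_B_carrier by blast
  then have "p \<in> B \<Longrightarrow> x p + - y p = 0" using I_vanishes[of "\<lambda>p. x p + - y p" p] by blast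
  then show "x p = y p" using xy(1,2) unfolding supp_B_def by (cases "p \<in> B") auto
qed

lemma cls_mult: "x \<in> carrier P \<Longrightarrow> y \<in> carrier P \<Longrightarrow> cls x \<otimes>\<^bsub>P Quot I\<^esub> cls y = cls (x \<bullet> y)"
  unfolding FactRing_def using ideal.rcoset_mult_add[OF ideal_I] by simp

lemma cls_add: "x \<in> carrier P \<Longrightarrow> y \<in> carrier P \<Longrightarrow> cls x \<oplus>\<^bsub>P Quot I\<^esub> cls y = cls (\<lambda>p. x p + y p)"
  unfolding FactRing_def using abelian_subgroup.a_rcos_sum[OF ideal.axioms(1)[OF ideal_I, THEN abelian_subgroupI3] ] 
  by (simp add: add_P ring.is_abelian_group[OF ring_P])

lemma carrier_Quot: "carrier (P Quot I) = cls ` carrier P"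
  unfolding FactRing_def A_RCOSETS_defs by (auto simp: a_r_coset_def)

lemma cls_mult_a:
  assumes "y \<in> carrier P"
  shows "cls (y \<bullet> diagram_elt a) = cls (restr (y \<bullet> diagram_elt a))"
  unfolding cls_eq_iff[OF mult_closed restr_carrier] by (rule mult_a_restr[OF assms])

lemma carrier_LM: "carrier LM = cls ` supp_B"
proof (intro subset_antisym subsetI)
  fix Z assume "Z \<in> carrier LM"
  then obtain y where y: "y \<in> carrier P" "Z = cls y \<otimes>\<^bsub>P Quot I\<^esub> cls (diagram_elt a)"
    unfolding index_left_ideal_def Let_def by (auto simp: carrier_Quot)
  then have "Z = cls (restr (y \<bullet> diagram_elt a))" using cls_mult[OF y(1) a_carrier] cls_mult_a[OF y(1)] by simp
  then show "Z \<in> cls ` supp_B" using restr_supp by blast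
next
  fix Z assume "Z \<in> cls ` supp_B"
  then obtain x where x: "x \<in> supp_B" "Z = cls x" by blast
  then have "Z = cls x \<otimes>\<^bsub>P Quot I\<^esub> cls (diagram_elt a)"
    using cls_mult[OF supp_B_carrier[OF x(1)] a_carrier] supp_B_mult_a[OF x(1)] by simp
  then show "Z \<in> carrier LM" unfolding index_left_ideal_def Let_def using supp_B_carrier[OF x(1)]
    by (auto simp: carrier_Quot)
qed

lemma zero_LM: "\<zero>\<^bsub>LM\<^esub> = cls (\<lambda>p. 0)"
proof -
  have "cls (\<lambda>p. 0) = I"
    using ideal_zero[OF ideal_I] abelian_subgroup.a_rcos_const[OF abelian_subgroupI3[OF ideal.axioms(1)[OF ideal_I] ring.is_abelian_group[OF ring_P]]] by blast
  then show ?thesis unfolding index_left_ideal_def Let_def FactRing_def by simp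
qed

lemma add_LM: "x \<in> carrier P \<Longrightarrow> y \<in> carrier P \<Longrightarrow> cls x \<oplus>\<^bsub>LM\<^esub> cls y = cls (\<lambda>p. x p + y p)"
  unfolding index_left_ideal_def Let_def using cls_add by simp

lemma smult_LM: "f \<in> carrier P \<Longrightarrow> x \<in> carrier P \<Longrightarrow> f \<odot>\<^bsub>LM\<^esub> cls x = cls (f \<bullet> x)"
  unfolding index_left_ideal_def Let_def using cls_mult by simp

lemma cls_mult_supp:
  assumes "f \<in> carrier P" "x \<in> supp_B"
  shows "cls (f \<bullet> x) = cls (restr (f \<bullet> x))"
proof -
  have "f \<bullet> x = (f \<bullet> x) \<bullet> diagram_elt a"
    by (simp only: mult_assoc_P supp_B_mult_a[OF assms(2)])
  then show ?thesis using cls_mult_a[OF mult_closed[of f x]] by metis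
qed

lemma supp_add: "x \<in> supp_B \<Longrightarrow> y \<in> supp_B \<Longrightarrow> (\<lambda>p. x p + y p) \<in> supp_B"
  unfolding supp_B_def by simp

lemma LM_left_module: "left_module P LM"
proof (intro left_module.intro left_module_axioms.intro ring_P)
  show "abelian_group LM"
  proof (rule abelian_groupI)
    show "\<zero>\<^bsub>LM\<^esub> \<in> carrier LM" unfolding zero_LM carrier_LM by (rule imageI) (simp add: supp_B_def)
  next
    fix u v assume "u \<in> carrier LM" "v \<in> carrier LM"
    then show "u \<oplus>\<^bsub>LM\<^esub> v \<in> carrier LM"
      unfolding carrier_LM by (auto simp: add_LM supp_B_carrier intro!: imageI supp_add)
  next
    fix u v w assume "u \<in> carrier LM" "v \<in> carrier LM" "w \<in> carrier LM"
    then obtain x y z where "x \<in> supp_B" "y \<in> supp_B" "z \<in> supp_B" "u = cls x" "v = cls y" "w = cls z"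
      unfolding carrier_LM by blast
    then show "u \<oplus>\<^bsub>LM\<^esub> v \<oplus>\<^bsub>LM\<^esub> w = u \<oplus>\<^bsub>LM\<^esub> (v \<oplus>\<^bsub>LM\<^esub> w)"
      by (simp add: add_LM supp_B_carrier supp_add add.assoc)
  next
    fix u v assume "u \<in> carrier LM" "v \<in> carrier LM"
    then show "u \<oplus>\<^bsub>LM\<^esub> v = v \<oplus>\<^bsub>LM\<^esub> u" unfolding carrier_LM by (auto simp: add_LM supp_B_carrier add.commute)
  next
    fix u assume "u \<in> carrier LM"
    then obtain x where x: "x \<in> supp_B" "u = cls x" unfolding carrier_LM by blast
    have z: "(\<lambda>p. 0) \<in> supp_B" unfolding supp_B_def by simp
    then show "\<zero>\<^bsub>LM\<^esub> \<oplus>\<^bsub>LM\<^esub> u = u" using x by (simp add: zero_LM add_LM supp_B_carrier)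
    have "(\<lambda>p. - x p) \<in> supp_B" using x(1) unfolding supp_B_def by simp
    then show "\<exists>v\<in>carrier LM. v \<oplus>\<^bsub>LM\<^esub> u = \<zero>\<^bsub>LM\<^esub>"
      using x by (intro bexI[of _ "cls (\<lambda>p. - x p)"]) (auto simp: zero_LM add_LM supp_B_carrier carrier_LM)
  qed
next
  fix f u assume "f \<in> carrier P" "u \<in> carrier LM"
  then obtain x where x: "x \<in> supp_B" "u = cls x" unfolding carrier_LM by blast
  then show "f \<odot>\<^bsub>LM\<^esub> u \<in> carrier LM"
    using smult_LM[OF \<open>f \<in> carrier P\<close> supp_B_carrier[OF x(1)]] cls_mult_supp[OF \<open>f \<in> carrier P\<close> x(1)] restr_supp
    unfolding carrier_LM by auto
next
  fix f g u assume fg: "f \<in> carrier P" "g \<in> carrier P" "u \<in> carrier LM"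
  then obtain x where x: "x \<in> supp_B" "u = cls x" unfolding carrier_LM by blast
  note c = supp_B_carrier[OF x(1)]
  have "f \<oplus>\<^bsub>P\<^esub> g \<in> carrier P" using fg ring.ring_simprules(1)[OF ring_P] by blast
  then show "(f \<oplus>\<^bsub>P\<^esub> g) \<odot>\<^bsub>LM\<^esub> u = f \<odot>\<^bsub>LM\<^esub> u \<oplus>\<^bsub>LM\<^esub> g \<odot>\<^bsub>LM\<^esub> u"
    using fg c unfolding x(2) by (simp add: smult_LM add_LM mult_closed add_P mult_add_left)
  show "(f \<bullet> g) \<odot>\<^bsub>LM\<^esub> u = f \<odot>\<^bsub>LM\<^esub> (g \<odot>\<^bsub>LM\<^esub> u)"
    using fg c unfolding x(2) by (simp add: smult_LM mult_closed mult_assoc_P)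
next
  fix f u v assume fg: "f \<in> carrier P" "u \<in> carrier LM" "v \<in> carrier LM"
  then obtain x y where x: "x \<in> supp_B" "u = cls x" "y \<in> supp_B" "v = cls y" unfolding carrier_LM by blast
  note c = supp_B_carrier[OF x(1)] supp_B_carrier[OF x(3)]
  show "f \<odot>\<^bsub>LM\<^esub> (u \<oplus>\<^bsub>LM\<^esub> v) = f \<odot>\<^bsub>LM\<^esub> u \<oplus>\<^bsub>LM\<^esub> f \<odot>\<^bsub>LM\<^esub> v"
    using fg(1) c supp_B_carrier[OF supp_add[OF x(1,3)]] unfolding x(2,4)
    by (simp add: smult_LM add_LM mult_closed mult_add_right)
next
  fix u assume "u \<in> carrier LM"
  then obtain x where x: "x \<in> supp_B" "u = cls x" unfolding carrier_LM by blast
  note c = supp_B_carrier[OF x(1)]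
  have o: "\<one>\<^bsub>P\<^esub> \<in> carrier P" "\<one>\<^bsub>P\<^esub> \<bullet> x = x" using ring.ring_simprules(6,12)[OF ring_P] c by auto
  show "\<one>\<^bsub>P\<^esub> \<odot>\<^bsub>LM\<^esub> u = u" unfolding x(2) smult_LM[OF o(1) c] o(2) ..
qed

text \<open>The image of a group ring element in the algebra; the right action on normal forms is
  right multiplication by it.\<close>

definition grp :: "((nat \<Rightarrow> nat \<Rightarrow> nat) \<Rightarrow> 'k) \<Rightarrow> diagram \<Rightarrow> 'k" where
  "grp f = (\<lambda>q. \<Sum>\<sigma>\<in>carrier G. dterm (f \<sigma>) (block_perm \<sigma>) q)"

lemma dterm_B: "p \<in> B \<Longrightarrow> dterm c p \<in> supp_B"
  unfolding supp_B_def group_ring_single_def by auto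

lemma supp_sum: "(\<And>j. j \<in> J \<Longrightarrow> f j \<in> supp_B) \<Longrightarrow> (\<lambda>q. \<Sum>j\<in>J. f j q) \<in> supp_B"
  unfolding supp_B_def by simp

lemma grp_supp: "grp f \<in> supp_B"
  unfolding grp_def by (intro supp_sum dterm_B block_perm_B)

lemma supp_mult_grp:
  assumes x: "x \<in> supp_B"
  shows "x \<bullet> grp f = (\<lambda>q. \<Sum>\<sigma>\<in>carrier G. \<Sum>p\<in>B. if diagram_comp p (block_perm \<sigma>) = q then x p * f \<sigma> else 0)"
proof
  fix q
  have "(x \<bullet> dterm (f \<sigma>) (block_perm \<sigma>)) q = (\<Sum>p\<in>B. if diagram_comp p (block_perm \<sigma>) = q then x p * f \<sigma> else 0)"
    if \<sigma>: "\<sigma> \<in> carrier G" for \<sigma>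
  proof -
    note g = block_perm_uniform[OF \<sigma>]
    have "(x \<bullet> dterm (f \<sigma>) (block_perm \<sigma>)) q =
        (\<Sum>p\<in>T. if diagram_comp p (block_perm \<sigma>) = q then x p * f \<sigma> else 0)"
      unfolding mult_dterm_right[OF uniform_tonal[OF g]]
      using uniform_loops[OF tonal_diagrams[of _ l] uniform_diagrams[OF g], of _ l] g by (intro sum.cong refl) simp
    also have "\<dots> = (\<Sum>p\<in>B. if diagram_comp p (block_perm \<sigma>) = q then x p * f \<sigma> else 0)"
      by (rule sum.mono_neutral_right) (use finite_tonal B_tonal x in \<open>auto simp: supp_B_def\<close>)
    finally show ?thesis .
  qed
  then show "(x \<bullet> grp f) q = (\<Sum>\<sigma>\<in>carrier G. \<Sum>p\<in>B. if diagram_comp p (block_perm \<sigma>) = q then x p * f \<sigma> else 0)"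
    unfolding grp_def mult_sum_right by (intro sum.cong refl)
qed

lemma supp_mult_grp_supp: "x \<in> supp_B \<Longrightarrow> x \<bullet> grp f \<in> supp_B"
proof -
  have "(\<lambda>q. \<Sum>\<sigma>\<in>carrier G. \<Sum>p\<in>B. if diagram_comp p (block_perm \<sigma>) = q then x p * f \<sigma> else 0) \<in> supp_B"
    unfolding supp_B_def mem_Collect_eq using comp_block_perm_B by (intro allI impI sum.neutral ballI) auto
  then show "x \<in> supp_B \<Longrightarrow> x \<bullet> grp f \<in> supp_B" by (simp only: supp_mult_grp)
qed

text \<open>The definite description picks the normal form \<open>x\<close>, and
  \<open>permute_blocks_comp\<close> turns the double sum into a product in the algebra.\<close>

lemma right_action:
  assumes x: "x \<in> supp_B"
  shows "index_right_action \<delta> l n m (cls x) f = cls (x \<bullet> grp f)"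
proof -
  have the: "(THE y. y \<in> cls x \<and> (\<forall>p. p \<notin> B \<longrightarrow> y p = 0)) = x"
  proof (rule the_equality)
    show "x \<in> cls x \<and> (\<forall>p. p \<notin> B \<longrightarrow> x p = 0)"
      using x abelian_subgroup.a_rcos_self[OF abelian_subgroupI3[OF ideal.axioms(1)[OF ideal_I] ring.is_abelian_group[OF ring_P]] supp_B_carrier[OF x]]
      unfolding supp_B_def by blast
  next
    fix y assume y: "y \<in> cls x \<and> (\<forall>p. p \<notin> B \<longrightarrow> y p = 0)"
    then have ys: "y \<in> supp_B" unfolding supp_B_def by simp
    obtain i where i: "i \<in> I" "y = (\<lambda>p. i p + x p)" using y unfolding a_r_coset_def' add_P by auto
    then have "(\<lambda>p. y p + - x p) = i" by auto
    then have "cls y = cls x" using cls_eq_iff[OF supp_B_carrier[OF ys] supp_B_carrier[OF x]] i(1) by simp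
    then show "y = x" using cls_supp_inj[OF ys x] by blast
  qed
  have "(\<lambda>q. \<Sum>(p, \<sigma>) \<in> {(p, \<sigma>) \<in> B \<times> carrier G. permute_blocks l m p \<sigma> = q}. x p * f \<sigma>) = x \<bullet> grp f"
  proof
    fix q
    have "(\<Sum>(p, \<sigma>) \<in> {(p, \<sigma>) \<in> B \<times> carrier G. permute_blocks l m p \<sigma> = q}. x p * f \<sigma>) =
        (\<Sum>z\<in>{z \<in> B \<times> carrier G. permute_blocks l m (fst z) (snd z) = q}. x (fst z) * f (snd z))"
      by (intro sum.cong) auto
    also have "\<dots> = (\<Sum>z\<in>B \<times> carrier G. if permute_blocks l m (fst z) (snd z) = q then x (fst z) * f (snd z) else 0)"
      by (rule sum.inter_filter) (simp add: finite_B finite_G)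
    also have "\<dots> = (\<Sum>p\<in>B. \<Sum>\<sigma>\<in>carrier G. if permute_blocks l m p \<sigma> = q then x p * f \<sigma> else 0)"
      by (simp add: sum.cartesian_product case_prod_beta)
    also have "\<dots> = (\<Sum>\<sigma>\<in>carrier G. \<Sum>p\<in>B. if permute_blocks l m p \<sigma> = q then x p * f \<sigma> else 0)"
      by (rule sum.swap)
    also have "\<dots> = (x \<bullet> grp f) q"
      unfolding supp_mult_grp[OF x] by (intro sum.cong refl) (simp add: permute_blocks_comp)
    finally show "(\<Sum>(p, \<sigma>) \<in> {(p, \<sigma>) \<in> B \<times> carrier G. permute_blocks l m p \<sigma> = q}. x p * f \<sigma>) = (x \<bullet> grp f) q" .
  qed
  then show ?thesis unfolding index_right_action_def Let_def the by simp
qed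

lemma right_action_closed: "u \<in> carrier LM \<Longrightarrow> index_right_action \<delta> l n m u f \<in> carrier LM"
  unfolding carrier_LM using right_action supp_mult_grp_supp by auto

lemma right_action_commutes:
  assumes "f \<in> carrier P" "u \<in> carrier LM"
  shows "index_right_action \<delta> l n m (f \<odot>\<^bsub>LM\<^esub> u) g = f \<odot>\<^bsub>LM\<^esub> index_right_action \<delta> l n m u g"
proof -
  obtain x where x: "x \<in> supp_B" "u = cls x" using assms(2) unfolding carrier_LM by blast
  note c = supp_B_carrier[OF x(1)] and gc = supp_B_carrier[OF grp_supp[of g]]
  let ?r = "restr (f \<bullet> x)"
  have "f \<odot>\<^bsub>LM\<^esub> u = cls ?r" unfolding x(2) smult_LM[OF assms(1) c] by (rule cls_mult_supp[OF assms(1) x(1)])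
  then have "index_right_action \<delta> l n m (f \<odot>\<^bsub>LM\<^esub> u) g = cls (?r \<bullet> grp g)" using right_action[OF restr_supp] by simp
  also have "\<dots> = cls ?r \<otimes>\<^bsub>P Quot I\<^esub> cls (grp g)" using cls_mult[OF restr_carrier gc] by simp
  also have "\<dots> = cls (f \<bullet> x) \<otimes>\<^bsub>P Quot I\<^esub> cls (grp g)" using cls_mult_supp[OF assms(1) x(1)] by simp
  also have "\<dots> = cls (f \<bullet> (x \<bullet> grp g))" using cls_mult[OF mult_closed gc] by (simp add: mult_assoc_P)
  also have "\<dots> = f \<odot>\<^bsub>LM\<^esub> index_right_action \<delta> l n m u g"
    unfolding x(2) right_action[OF x(1)] using smult_LM[OF assms(1) mult_closed] by simp
  finally show ?thesis .
qed

text \<open>The product with \<open>r\<close> stays in the cap ideal, hence vanishes on all uniform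
  diagrams and in particular on \<open>B\<close>, so its normal form is 0.\<close>

lemma cap_ideal_kills:
  assumes "r \<in> cap_ideal \<delta> l n" "u \<in> carrier LM"
  shows "r \<odot>\<^bsub>LM\<^esub> u = \<zero>\<^bsub>LM\<^esub>"
proof -
  obtain x where x: "x \<in> supp_B" "u = cls x" using assms(2) unfolding carrier_LM by blast
  note c = supp_B_carrier[OF x(1)]
  have r: "r \<in> carrier P" using ideal_subset[OF cap_ideal assms(1)] .
  have "r \<bullet> x \<in> cap_ideal \<delta> l n" by (rule ideal.I_r_closed[OF cap_ideal assms(1) c])
  then have "restr (r \<bullet> x) = (\<lambda>p. 0)" unfolding restr_def cap_ideal_eq using B_uniform by auto
  then show ?thesis unfolding x(2) smult_LM[OF r c] cls_mult_supp[OF r x(1)] zero_LM by simp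
qed

end


section \<open>Modules given by generators and relations\<close>

text \<open>The last assumption says that the action preserves the relation subgroup; it makes the
  formula on cosets in \<open>presented_module\<close> independent of representatives.\<close>

locale presentation =
  fixes S :: "'x set" and L :: "('x \<Rightarrow>\<^sub>0 int) set" and \<phi> :: "'r \<Rightarrow> 'x \<Rightarrow> ('x \<Rightarrow>\<^sub>0 int)" and A :: "'r set"
  assumes L_keys: "r \<in> L \<Longrightarrow> Poly_Mapping.keys r \<subseteq> S"
    and \<phi>_keys: "a \<in> A \<Longrightarrow> x \<in> S \<Longrightarrow> Poly_Mapping.keys (\<phi> a x) \<subseteq> S"
    and \<phi>_rel: "a \<in> A \<Longrightarrow> r \<in> L \<Longrightarrow> frag_extend (\<phi> a) r \<in> generate (free_Abelian_group S) L"
begin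

abbreviation "F \<equiv> free_Abelian_group S"
abbreviation "H \<equiv> generate F L"
abbreviation "PM \<equiv> presented_module S L \<phi>"

definition cl :: "('x \<Rightarrow>\<^sub>0 int) \<Rightarrow> ('x \<Rightarrow>\<^sub>0 int) set" where
  "cl z = H #>\<^bsub>F\<^esub> z"

lemma H_zero: "0 \<in> H"
  using generate.one[of F L] by simp

lemma H_incl: "r \<in> L \<Longrightarrow> r \<in> H"
  by (rule generate.incl)

lemma H_add: "g \<in> H \<Longrightarrow> h \<in> H \<Longrightarrow> g + h \<in> H"
  using generate.eng[of g F L h] by simp

lemma H_minus: "h \<in> H \<Longrightarrow> - h \<in> H"
proof (induction rule: generate.induct)
  case (incl h)
  then show ?case using generate.inv[OF incl, of F] L_keys by simp
next
  case (inv h)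
  then show ?case using generate.incl[OF inv, of F] L_keys by simp
next
  case (eng g h)
  then show ?case using H_add[of "- g" "- h"] by simp
qed (simp add: H_zero)

lemma H_diff: "g \<in> H \<Longrightarrow> h \<in> H \<Longrightarrow> g - h \<in> H"
  using H_add[of g "- h"] H_minus by simp

lemma H_sum: "(\<And>j. j \<in> J \<Longrightarrow> f j \<in> H) \<Longrightarrow> (\<Sum>j\<in>J. f j) \<in> H"
  by (induction J rule: infinite_finite_induct) (auto simp: H_zero H_add)

lemma ext_H:
  assumes a: "a \<in> A" and h: "h \<in> H"
  shows "frag_extend (\<phi> a) h \<in> H"
  using h
proof (induction rule: generate.induct)
  case (incl h)
  then show ?case by (rule \<phi>_rel[OF a])
next
  case (inv h)
  then show ?case using L_keys[OF inv] H_minus[OF \<phi>_rel[OF a inv]] by (simp add: frag_extend_minus)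
next
  case (eng g h)
  then show ?case using H_add by (simp add: frag_extend_add)
qed (simp add: H_zero)

lemma mem_cl: "z' \<in> cl z \<longleftrightarrow> z' - z \<in> H"
  unfolding cl_def r_coset_def by (force simp: algebra_simps intro: bexI[of _ "z' - z"])

lemma cl_eq_iff: "cl z = cl z' \<longleftrightarrow> z - z' \<in> H"
proof
  assume "cl z = cl z'"
  then show "z - z' \<in> H" using mem_cl[of z z] mem_cl[of z z'] H_zero by simp
next
  assume h: "z - z' \<in> H"
  have "y - z \<in> H \<longleftrightarrow> y - z' \<in> H" for y
    using H_add[OF _ h, of "y - z"] H_diff[OF _ h, of "y - z'"] by (auto simp: algebra_simps)
  then show "cl z = cl z'" using mem_cl by blast
qed

lemma carrier_PM: "carrier PM = cl ` {z. Poly_Mapping.keys z \<subseteq> S}"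
  unfolding presented_module_def Let_def FactGroup_def RCOSETS_def cl_def
  by (auto simp: free_Abelian_group_def)

lemma cl_in: "Poly_Mapping.keys z \<subseteq> S \<Longrightarrow> cl z \<in> carrier PM"
  unfolding carrier_PM by simp

lemma zero_PM: "\<zero>\<^bsub>PM\<^esub> = cl 0"
  unfolding presented_module_def Let_def FactGroup_def cl_def r_coset_def by simp

lemma add_PM: "cl x \<oplus>\<^bsub>PM\<^esub> cl y = cl (x + y)"
proof -
  have "cl x \<oplus>\<^bsub>PM\<^esub> cl y = {u + v | u v. u \<in> cl x \<and> v \<in> cl y}"
    unfolding presented_module_def Let_def FactGroup_def set_mult_def by auto
  also have "\<dots> = cl (x + y)"
  proof (intro subset_antisym subsetI)
    fix z assume "z \<in> {u + v | u v. u \<in> cl x \<and> v \<in> cl y}"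
    then obtain u v where "z = u + v" "u - x \<in> H" "v - y \<in> H" unfolding mem_cl by blast
    then show "z \<in> cl (x + y)" unfolding mem_cl using H_add[of "u - x" "v - y"] by (simp add: algebra_simps)
  next
    fix z assume "z \<in> cl (x + y)"
    then have "z = (z - y) + y" "z - y \<in> cl x" "y \<in> cl y" unfolding mem_cl by (simp_all add: algebra_simps H_zero)
    then show "z \<in> {u + v | u v. u \<in> cl x \<and> v \<in> cl y}" by blast
  qed
  finally show ?thesis .
qed

lemma smult_PM:
  assumes "a \<in> A"
  shows "a \<odot>\<^bsub>PM\<^esub> cl z = cl (frag_extend (\<phi> a) z)"
proof -
  have "a \<odot>\<^bsub>PM\<^esub> cl z = (\<Union>z'\<in>cl z. cl (frag_extend (\<phi> a) z'))"
    unfolding presented_module_def Let_def cl_def by simp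
  moreover have "cl (frag_extend (\<phi> a) z') = cl (frag_extend (\<phi> a) z)" if "z' \<in> cl z" for z'
    using that ext_H[OF assms] unfolding mem_cl cl_eq_iff by (simp add: frag_extend_diff[symmetric])
  moreover have "z \<in> cl z" unfolding mem_cl by (simp add: H_zero)
  ultimately show ?thesis by blast
qed

lemma ext_keys: "a \<in> A \<Longrightarrow> Poly_Mapping.keys z \<subseteq> S \<Longrightarrow> Poly_Mapping.keys (frag_extend (\<phi> a) z) \<subseteq> S"
  using keys_frag_extend[of "\<phi> a" z] \<phi>_keys by blast

lemma abelian_group_PM: "abelian_group PM"
proof (rule abelian_groupI)
  fix u v assume "u \<in> carrier PM" "v \<in> carrier PM"
  then obtain x y where "u = cl x" "v = cl y" "Poly_Mapping.keys x \<subseteq> S" "Poly_Mapping.keys y \<subseteq> S" unfolding carrier_PM by blast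
  then show "u \<oplus>\<^bsub>PM\<^esub> v \<in> carrier PM" using keys_add[of x y] by (auto simp: add_PM intro!: cl_in)
next
  fix u v w assume "u \<in> carrier PM" "v \<in> carrier PM" "w \<in> carrier PM"
  then obtain x y z where "u = cl x" "v = cl y" "w = cl z" unfolding carrier_PM by blast
  then show "u \<oplus>\<^bsub>PM\<^esub> v \<oplus>\<^bsub>PM\<^esub> w = u \<oplus>\<^bsub>PM\<^esub> (v \<oplus>\<^bsub>PM\<^esub> w)" by (simp add: add_PM add.assoc)
next
  fix u v assume "u \<in> carrier PM" "v \<in> carrier PM"
  then obtain x y where "u = cl x" "v = cl y" unfolding carrier_PM by blast
  then show "u \<oplus>\<^bsub>PM\<^esub> v = v \<oplus>\<^bsub>PM\<^esub> u" by (simp add: add_PM add.commute)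
next
  fix u assume "u \<in> carrier PM"
  then obtain x where x: "u = cl x" "Poly_Mapping.keys x \<subseteq> S" unfolding carrier_PM by blast
  then show "\<zero>\<^bsub>PM\<^esub> \<oplus>\<^bsub>PM\<^esub> u = u" by (simp add: zero_PM add_PM)
  show "\<exists>v\<in>carrier PM. v \<oplus>\<^bsub>PM\<^esub> u = \<zero>\<^bsub>PM\<^esub>"
    using x by (intro bexI[of _ "cl (- x)"] cl_in) (simp_all add: zero_PM add_PM)
qed (simp add: zero_PM cl_in)

lemma smult_closed_PM: "a \<in> A \<Longrightarrow> u \<in> carrier PM \<Longrightarrow> a \<odot>\<^bsub>PM\<^esub> u \<in> carrier PM"
  unfolding carrier_PM by (auto simp: smult_PM ext_keys)

lemma smult_add_PM:
  assumes "a \<in> A" "u \<in> carrier PM" "v \<in> carrier PM"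
  shows "a \<odot>\<^bsub>PM\<^esub> (u \<oplus>\<^bsub>PM\<^esub> v) = a \<odot>\<^bsub>PM\<^esub> u \<oplus>\<^bsub>PM\<^esub> a \<odot>\<^bsub>PM\<^esub> v"
  using assms unfolding carrier_PM by (auto simp: smult_PM add_PM frag_extend_add)

text \<open>Both sides of each module axiom are additive, so it suffices to compare them on
  generators modulo the relations.\<close>

lemma left_module_PM:
  assumes R: "ring R" "carrier R = A"
    and add: "\<And>a b x. a \<in> A \<Longrightarrow> b \<in> A \<Longrightarrow> x \<in> S \<Longrightarrow> \<phi> (a \<oplus>\<^bsub>R\<^esub> b) x - (\<phi> a x + \<phi> b x) \<in> H"
    and mult: "\<And>a b x. a \<in> A \<Longrightarrow> b \<in> A \<Longrightarrow> x \<in> S \<Longrightarrow> \<phi> (a \<otimes>\<^bsub>R\<^esub> b) x - frag_extend (\<phi> a) (\<phi> b x) \<in> H"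
    and one: "\<And>x. x \<in> S \<Longrightarrow> \<phi> \<one>\<^bsub>R\<^esub> x - frag_of x \<in> H"
  shows "left_module R PM"
proof -
  interpret ring R by (rule R(1))
  have red: "d z \<in> H" if z: "Poly_Mapping.keys z \<subseteq> S" and d: "\<And>x. x \<in> S \<Longrightarrow> d (frag_of x) \<in> H"
    "\<And>y z. d (y - z) = d y - d z" for d :: "('x \<Rightarrow>\<^sub>0 int) \<Rightarrow> ('x \<Rightarrow>\<^sub>0 int)" and z
    using z by (rule free_Abelian_group_induct) (use d(1) d(2)[of 0 0] d(2) H_zero H_diff in auto)
  show ?thesis
  proof (intro left_module.intro left_module_axioms.intro R(1) abelian_group_PM)
    fix a b u assume ab: "a \<in> carrier R" "b \<in> carrier R" "u \<in> carrier PM"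
    then obtain z where z: "u = cl z" "Poly_Mapping.keys z \<subseteq> S" unfolding carrier_PM by blast
    have ab': "a \<in> A" "b \<in> A" "a \<oplus>\<^bsub>R\<^esub> b \<in> A" "a \<otimes>\<^bsub>R\<^esub> b \<in> A" using ab R(2) a_closed m_closed by auto
    have "frag_extend (\<phi> (a \<oplus>\<^bsub>R\<^esub> b)) z - (frag_extend (\<phi> a) z + frag_extend (\<phi> b) z) \<in> H"
      by (rule red[OF z(2)]) (use add ab' in \<open>auto simp: frag_extend_diff\<close>)
    then show "(a \<oplus>\<^bsub>R\<^esub> b) \<odot>\<^bsub>PM\<^esub> u = a \<odot>\<^bsub>PM\<^esub> u \<oplus>\<^bsub>PM\<^esub> b \<odot>\<^bsub>PM\<^esub> u"
      unfolding z(1) using ab' by (simp add: smult_PM add_PM cl_eq_iff)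
    have "frag_extend (\<phi> (a \<otimes>\<^bsub>R\<^esub> b)) z - frag_extend (\<phi> a) (frag_extend (\<phi> b) z) \<in> H"
      by (rule red[OF z(2)]) (use mult ab' in \<open>auto simp: frag_extend_diff\<close>)
    then show "(a \<otimes>\<^bsub>R\<^esub> b) \<odot>\<^bsub>PM\<^esub> u = a \<odot>\<^bsub>PM\<^esub> (b \<odot>\<^bsub>PM\<^esub> u)"
      unfolding z(1) using ab' by (simp add: smult_PM cl_eq_iff)
  next
    fix u assume "u \<in> carrier PM"
    then obtain z where z: "u = cl z" "Poly_Mapping.keys z \<subseteq> S" unfolding carrier_PM by blast
    have "frag_extend (\<phi> \<one>\<^bsub>R\<^esub>) z - z \<in> H"
      by (rule red[OF z(2)]) (use one in \<open>auto simp: frag_extend_diff\<close>)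
    then show "\<one>\<^bsub>R\<^esub> \<odot>\<^bsub>PM\<^esub> u = u" unfolding z(1) using R(2) one_closed by (simp add: smult_PM cl_eq_iff)
  qed (use smult_closed_PM smult_add_PM R(2) in auto)
qed

section \<open>Functionals on presented modules\<close>

definition functional :: "('x \<Rightarrow> complex) \<Rightarrow> ('x \<Rightarrow>\<^sub>0 int) \<Rightarrow> complex" where
  "functional g z = (\<Sum>x\<in>Poly_Mapping.keys z. of_int (Poly_Mapping.lookup z x) * g x)"

lemma functional_on:
  assumes "finite K" "Poly_Mapping.keys z \<subseteq> K"
  shows "functional g z = (\<Sum>x\<in>K. of_int (Poly_Mapping.lookup z x) * g x)"
  unfolding functional_def by (rule sum.mono_neutral_left) (use assms in \<open>auto simp: in_keys_iff\<close>)

lemma functional_add: "functional g (y + z) = functional g y + functional g z"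
proof -
  let ?K = "Poly_Mapping.keys y \<union> Poly_Mapping.keys z"
  have "Poly_Mapping.keys (y + z) \<subseteq> ?K" by (rule keys_add)
  then show ?thesis
    using functional_on[of ?K "y + z" g] functional_on[of ?K y g] functional_on[of ?K z g]
    by (simp add: lookup_add distrib_right sum.distrib)
qed

lemma functional_uminus: "functional g (- z) = - functional g z"
  using functional_add[of g z "- z"] by (simp add: functional_def add_eq_0_iff)

lemma functional_diff: "functional g (y - z) = functional g y - functional g z"
  using functional_add[of g y "- z"] functional_uminus by simp

lemma functional_of: "functional g (frag_of x) = g x"
  unfolding functional_def by simp

lemma functional_H:
  assumes "\<And>r. r \<in> L \<Longrightarrow> functional g r = 0" "h \<in> H"
  shows "functional g h = 0"
  using assms(2)
proof (induction rule: generate.induct)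
  case one
  show ?case by (simp add: functional_def)
next
  case (inv h)
  then show ?case using L_keys assms(1) by (simp add: functional_uminus)
next
  case (eng g' h)
  then show ?case by (simp add: functional_add)
qed (use assms(1) in auto)

text \<open>A functional that kills the relations is well defined on classes. This is the means of
  proving that an element of a presented module is nonzero.\<close>

lemma functional_cl:
  assumes "\<And>r. r \<in> L \<Longrightarrow> functional g r = 0" "cl y = cl z"
  shows "functional g y = functional g z"
  using functional_H[OF assms(1), of "y - z"] assms(2) unfolding cl_eq_iff by (simp add: functional_diff)

end


section \<open>Tensor products over a ring\<close>

definition tensor_relations where
  "tensor_relations R M \<rho> N =
     {frag_of (x \<oplus>\<^bsub>M\<^esub> y, v) - frag_of (x, v) - frag_of (y, v) | x y v.
         x \<in> carrier M \<and> y \<in> carrier M \<and> v \<in> carrier N} \<union>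
      {frag_of (x, v \<oplus>\<^bsub>N\<^esub> w) - frag_of (x, v) - frag_of (x, w) | x v w.
         x \<in> carrier M \<and> v \<in> carrier N \<and> w \<in> carrier N} \<union>
      {frag_of (\<rho> x r, v) - frag_of (x, r \<odot>\<^bsub>N\<^esub> v) | x r v.
         x \<in> carrier M \<and> r \<in> carrier R \<and> v \<in> carrier N}"

lemma tensor_module_presented:
  "tensor_module R M \<rho> N = presented_module (carrier M \<times> carrier N) (tensor_relations R M \<rho> N)
    (\<lambda>a (x, v). frag_of (a \<odot>\<^bsub>M\<^esub> x, v))"
  unfolding tensor_module_def tensor_relations_def ..

locale tensor_setup = left_module P M
  for P :: "('p, 'c) ring_scheme" and M :: "('p, 'x, 't) module_scheme" +
  fixes R :: "('r, 's) ring_scheme" and \<rho> :: "'x \<Rightarrow> 'r \<Rightarrow> 'x" and N :: "('r, 'v, 'u) module_scheme"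
  assumes \<rho>_closed: "x \<in> carrier M \<Longrightarrow> r \<in> carrier R \<Longrightarrow> \<rho> x r \<in> carrier M"
    and \<rho>_commutes: "a \<in> carrier P \<Longrightarrow> x \<in> carrier M \<Longrightarrow> r \<in> carrier R \<Longrightarrow> \<rho> (a \<odot>\<^bsub>M\<^esub> x) r = a \<odot>\<^bsub>M\<^esub> \<rho> x r"
    and N_add: "v \<in> carrier N \<Longrightarrow> w \<in> carrier N \<Longrightarrow> v \<oplus>\<^bsub>N\<^esub> w \<in> carrier N"
    and N_smult: "r \<in> carrier R \<Longrightarrow> v \<in> carrier N \<Longrightarrow> r \<odot>\<^bsub>N\<^esub> v \<in> carrier N"
begin

abbreviation "TM \<equiv> tensor_module R M \<rho> N"
abbreviation "act_gen \<equiv> \<lambda>a (x, v). frag_of (a \<odot>\<^bsub>M\<^esub> x, v)"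

sublocale T: presentation "carrier M \<times> carrier N" "tensor_relations R M \<rho> N" act_gen "carrier P"
proof
  fix r assume "r \<in> tensor_relations R M \<rho> N"
  then show "Poly_Mapping.keys r \<subseteq> carrier M \<times> carrier N"
    unfolding tensor_relations_def
    using \<rho>_closed N_add N_smult M.a_closed by (auto dest!: subsetD[OF keys_diff] split: if_splits)
next
  fix a r assume a: "a \<in> carrier P" and r: "r \<in> tensor_relations R M \<rho> N"
  have "frag_extend (act_gen a) r \<in> tensor_relations R M \<rho> N"
    using r[unfolded tensor_relations_def]
  proof (elim UnE)
    assume "r \<in> {frag_of (x \<oplus>\<^bsub>M\<^esub> y, v) - frag_of (x, v) - frag_of (y, v) | x y v.
         x \<in> carrier M \<and> y \<in> carrier M \<and> v \<in> carrier N}"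
    then obtain x y v where xyv: "x \<in> carrier M" "y \<in> carrier M" "v \<in> carrier N"
      "r = frag_of (x \<oplus>\<^bsub>M\<^esub> y, v) - frag_of (x, v) - frag_of (y, v)" by blast
    have "frag_extend (act_gen a) r = frag_of (a \<odot>\<^bsub>M\<^esub> x \<oplus>\<^bsub>M\<^esub> a \<odot>\<^bsub>M\<^esub> y, v) - frag_of (a \<odot>\<^bsub>M\<^esub> x, v) - frag_of (a \<odot>\<^bsub>M\<^esub> y, v)"
      unfolding xyv(4) using smult_r_distr a xyv by (simp add: frag_extend_diff)
    then show "frag_extend (act_gen a) r \<in> tensor_relations R M \<rho> N"
      unfolding tensor_relations_def using smult_closed[OF a] xyv by blast
  next
    assume "r \<in> {frag_of (x, v \<oplus>\<^bsub>N\<^esub> w) - frag_of (x, v) - frag_of (x, w) | x v w.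
         x \<in> carrier M \<and> v \<in> carrier N \<and> w \<in> carrier N}"
    then obtain x v w where xyv: "x \<in> carrier M" "v \<in> carrier N" "w \<in> carrier N"
      "r = frag_of (x, v \<oplus>\<^bsub>N\<^esub> w) - frag_of (x, v) - frag_of (x, w)" by blast
    then show "frag_extend (act_gen a) r \<in> tensor_relations R M \<rho> N"
      unfolding tensor_relations_def using smult_closed[OF a] by (simp add: frag_extend_diff) blast
  next
    assume "r \<in> {frag_of (\<rho> x r, v) - frag_of (x, r \<odot>\<^bsub>N\<^esub> v) | x r v.
         x \<in> carrier M \<and> r \<in> carrier R \<and> v \<in> carrier N}"
    then obtain x s v where xyv: "x \<in> carrier M" "s \<in> carrier R" "v \<in> carrier N"
      "r = frag_of (\<rho> x s, v) - frag_of (x, s \<odot>\<^bsub>N\<^esub> v)" by blast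
    have "frag_extend (act_gen a) r = frag_of (\<rho> (a \<odot>\<^bsub>M\<^esub> x) s, v) - frag_of (a \<odot>\<^bsub>M\<^esub> x, s \<odot>\<^bsub>N\<^esub> v)"
      unfolding xyv(4) using \<rho>_commutes[OF a xyv(1,2)] by (simp add: frag_extend_diff)
    then show "frag_extend (act_gen a) r \<in> tensor_relations R M \<rho> N"
      unfolding tensor_relations_def using smult_closed[OF a xyv(1)] xyv by blast
  qed
  then show "frag_extend (act_gen a) r \<in> generate (free_Abelian_group (carrier M \<times> carrier N)) (tensor_relations R M \<rho> N)"
    by (rule generate.incl)
qed (use smult_closed in auto)

lemma TM_eq: "TM = T.PM"
  by (rule tensor_module_presented)

definition tens :: "'x \<Rightarrow> 'v \<Rightarrow> ('x \<times> 'v \<Rightarrow>\<^sub>0 int) set" where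
  "tens x v = T.cl (frag_of (x, v))"

lemma tens_in: "x \<in> carrier M \<Longrightarrow> v \<in> carrier N \<Longrightarrow> tens x v \<in> carrier TM"
  unfolding tens_def TM_eq by (rule T.cl_in) simp

lemma tens_add_left:
  assumes "x \<in> carrier M" "y \<in> carrier M" "v \<in> carrier N"
  shows "tens (x \<oplus>\<^bsub>M\<^esub> y) v = tens x v \<oplus>\<^bsub>TM\<^esub> tens y v"
  unfolding tens_def TM_eq T.add_PM T.cl_eq_iff
  by (rule T.H_incl) (use assms in \<open>auto simp: tensor_relations_def diff_diff_eq\<close>)

lemma tens_add_right:
  assumes "x \<in> carrier M" "v \<in> carrier N" "w \<in> carrier N"
  shows "tens x (v \<oplus>\<^bsub>N\<^esub> w) = tens x v \<oplus>\<^bsub>TM\<^esub> tens x w"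
  unfolding tens_def TM_eq T.add_PM T.cl_eq_iff
  by (rule T.H_incl) (use assms in \<open>auto simp: tensor_relations_def diff_diff_eq\<close>)

lemma tens_balanced:
  assumes "x \<in> carrier M" "r \<in> carrier R" "v \<in> carrier N"
  shows "tens (\<rho> x r) v = tens x (r \<odot>\<^bsub>N\<^esub> v)"
  unfolding tens_def TM_eq T.cl_eq_iff
  by (rule T.H_incl) (use assms in \<open>auto simp: tensor_relations_def\<close>)

lemma smult_tens: "a \<in> carrier P \<Longrightarrow> a \<odot>\<^bsub>TM\<^esub> tens x v = tens (a \<odot>\<^bsub>M\<^esub> x) v"
  unfolding tens_def TM_eq by (simp add: T.smult_PM)

lemma TM_left_module: "left_module P TM"
  unfolding TM_eq
proof (rule T.left_module_PM)
  fix a b z assume ab: "a \<in> carrier P" "b \<in> carrier P" "z \<in> carrier M \<times> carrier N"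
  then obtain x v where z: "z = (x, v)" "x \<in> carrier M" "v \<in> carrier N" by auto
  have "frag_of (a \<odot>\<^bsub>M\<^esub> x \<oplus>\<^bsub>M\<^esub> b \<odot>\<^bsub>M\<^esub> x, v) - frag_of (a \<odot>\<^bsub>M\<^esub> x, v) - frag_of (b \<odot>\<^bsub>M\<^esub> x, v) \<in> T.H"
    by (rule T.H_incl) (use smult_closed ab z in \<open>unfold tensor_relations_def, blast\<close>)
  then show "act_gen (a \<oplus>\<^bsub>P\<^esub> b) z - (act_gen a z + act_gen b z) \<in> T.H"
    unfolding z(1) using smult_l_distr ab z by (simp add: diff_diff_eq)
  show "act_gen (a \<otimes>\<^bsub>P\<^esub> b) z - frag_extend (act_gen a) (act_gen b z) \<in> T.H"
    unfolding z(1) using smult_assoc1[OF ab(1,2) z(2)] by (simp add: T.H_zero)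
next
  fix z assume "z \<in> carrier M \<times> carrier N"
  then show "act_gen \<one>\<^bsub>P\<^esub> z - frag_of z \<in> T.H" using smult_one by (auto simp: T.H_zero)
qed (use R.ring_axioms in auto)

text \<open>Differences instead of sums match the induction over the free abelian group, whose
  elements have negative coefficients as well.\<close>

lemma TM_induct [consumes 1, case_names zero diff tens]:
  assumes "u \<in> carrier TM" "Q \<zero>\<^bsub>TM\<^esub>"
    and "\<And>u v. u \<in> carrier TM \<Longrightarrow> v \<in> carrier TM \<Longrightarrow> Q u \<Longrightarrow> Q v \<Longrightarrow> Q (u \<ominus>\<^bsub>TM\<^esub> v)"
    and "\<And>x v. x \<in> carrier M \<Longrightarrow> v \<in> carrier N \<Longrightarrow> Q (tens x v)"
  shows "Q u"
proof -
  interpret TM: abelian_group TM unfolding TM_eq by (rule T.abelian_group_PM)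
  obtain z where z: "u = T.cl z" "Poly_Mapping.keys z \<subseteq> carrier M \<times> carrier N" using assms(1) unfolding TM_eq T.carrier_PM by blast
  have minus: "T.cl y \<ominus>\<^bsub>TM\<^esub> T.cl z = T.cl (y - z)"
    if "Poly_Mapping.keys y \<subseteq> carrier M \<times> carrier N" "Poly_Mapping.keys z \<subseteq> carrier M \<times> carrier N" for y z
  proof -
    have "\<ominus>\<^bsub>TM\<^esub> T.cl z = T.cl (- z)"
      by (rule TM.minus_equality) (use that in \<open>auto simp: TM_eq T.add_PM T.zero_PM intro!: T.cl_in\<close>)
    then show ?thesis unfolding a_minus_def by (simp add: TM_eq T.add_PM)
  qed
  show ?thesis unfolding z(1) using z(2)
  proof (rule free_Abelian_group_induct)
    show "Q (T.cl 0)" using assms(2) unfolding TM_eq T.zero_PM .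
    show "Q (T.cl (y - z))" if "Poly_Mapping.keys y \<subseteq> carrier M \<times> carrier N" "Poly_Mapping.keys z \<subseteq> carrier M \<times> carrier N"
      "Q (T.cl y)" "Q (T.cl z)" for y z
    proof -
      have "T.cl y \<in> carrier TM" "T.cl z \<in> carrier TM" unfolding TM_eq using that(1,2) by (simp_all only: T.cl_in)
      then show ?thesis using assms(3)[OF _ _ that(3,4)] unfolding minus[OF that(1,2)] by simp
    qed
    show "Q (T.cl (frag_of z))" if "z \<in> carrier M \<times> carrier N" for z
      using assms(4)[of "fst z" "snd z"] that unfolding tens_def by auto
  qed
qed

end


section \<open>The action of the symmetric group on polytabloids\<close>

lemma map_image_tabloid: "map ((`) \<sigma>) (tabloid \<mu> t) = tabloid \<mu> (\<sigma> \<circ> t)"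
  unfolding tabloid_def by (auto simp: image_iff)

lemma map_inv_image:
  fixes \<sigma> :: "'a \<Rightarrow> 'a"
  assumes "bij \<sigma>"
  shows "map ((`) \<sigma>) T = T' \<longleftrightarrow> T = map ((`) (inv' \<sigma>)) T'"
proof -
  have "map ((`) (inv' \<sigma>)) (map ((`) \<sigma>) T) = T" "map ((`) \<sigma>) (map ((`) (inv' \<sigma>)) T') = T'" for T T' :: "'a set list"
    using assms bij_is_inj[OF assms] bij_is_surj[OF assms]
    by (simp_all add: comp_def image_inv_f_f image_f_inv_f map_idI)
  then show ?thesis by metis
qed

lemma column_stabilizer_permutes: "\<pi> \<in> column_stabilizer \<mu> t \<Longrightarrow> \<pi> permutes {1..sum_list \<mu>}"
  unfolding column_stabilizer_def by simp

lemma finite_column_stabilizer: "finite (column_stabilizer \<mu> t)"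
  using finite_permutations[of "{1..sum_list \<mu>}"] unfolding column_stabilizer_def by simp

lemma column_image: "{(\<sigma> \<circ> t) (a, b) | a. (a, b) \<in> young_cells \<mu>} = \<sigma> ` {t (a, b) | a. (a, b) \<in> young_cells \<mu>}"
  by auto

lemma conjugate_column_stabilizer:
  assumes \<sigma>: "\<sigma> permutes {1..sum_list \<mu>}" and \<pi>: "\<pi> \<in> column_stabilizer \<mu> t"
  shows "\<sigma> \<circ> \<pi> \<circ> inv' \<sigma> \<in> column_stabilizer \<mu> (\<sigma> \<circ> t)"
proof -
  have "\<sigma> \<circ> \<pi> \<circ> inv' \<sigma> permutes {1..sum_list \<mu>}"
    using \<sigma> column_stabilizer_permutes[OF \<pi>] by (intro permutes_compose permutes_inv)
  moreover have "(\<sigma> \<circ> \<pi> \<circ> inv' \<sigma>) ` \<sigma> ` Z = \<sigma> ` \<pi> ` Z" for Z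
    by (simp add: image_image permutes_inverses(2)[OF \<sigma>])
  ultimately show ?thesis using \<pi> unfolding column_stabilizer_def column_image by simp
qed

lemma evenperm_conjugate:
  fixes n :: nat
  assumes "\<sigma> permutes {1..n}" "\<pi> permutes {1..n}"
  shows "evenperm (\<sigma> \<circ> \<pi> \<circ> inv' \<sigma>) = evenperm \<pi>"
proof -
  have "permutation p" if "p permutes {1..n}" for p unfolding permutation_permutes by (rule exI[of _ "{1..n}"], rule conjI[OF finite_atLeastAtMost that])
  then have p: "permutation \<sigma>" "permutation \<pi>" "permutation (inv' \<sigma>)"
    using assms permutes_inv[OF assms(1)] by simp_all
  then show ?thesis by (auto simp: evenperm_comp evenperm_inv permutation_compose)
qed

text \<open>Conjugation by \<sigma> carries the column stabilizer of \<open>t\<close> to that of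
  \<open>\<sigma> \<circ> t\<close> and preserves signs.\<close>

lemma polytabloid_permuted:
  assumes \<sigma>: "\<sigma> permutes {1..sum_list \<mu>}"
  shows "polytabloid \<mu> t (map ((`) (inv' \<sigma>)) T) = (polytabloid \<mu> (\<sigma> \<circ> t) T :: 'k :: {comm_ring, comm_monoid_mult})"
proof -
  let ?c = "\<lambda>\<pi>. \<sigma> \<circ> \<pi> \<circ> inv' \<sigma>" and ?d = "\<lambda>\<pi>. inv' \<sigma> \<circ> \<pi> \<circ> \<sigma>"
  have i: "inv' \<sigma> permutes {1..sum_list \<mu>}" by (rule permutes_inv[OF \<sigma>])
  have ii: "inv' (inv' \<sigma>) = \<sigma>" by (rule permutes_inv_inv[OF \<sigma>])
  have o: "inv' \<sigma> \<circ> (\<sigma> \<circ> f) = f" "\<sigma> \<circ> (inv' \<sigma> \<circ> f) = f" for f :: "'b \<Rightarrow> nat"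
    using permutes_inv_o[OF \<sigma>] by (simp_all add: o_assoc)
  have bij: "bij_betw ?c (column_stabilizer \<mu> t) (column_stabilizer \<mu> (\<sigma> \<circ> t))"
  proof (rule bij_betwI[of _ _ _ ?d])
    show "?c \<in> column_stabilizer \<mu> t \<rightarrow> column_stabilizer \<mu> (\<sigma> \<circ> t)"
      using conjugate_column_stabilizer[OF \<sigma>] by blast
    show "?d \<in> column_stabilizer \<mu> (\<sigma> \<circ> t) \<rightarrow> column_stabilizer \<mu> t"
      using conjugate_column_stabilizer[OF i, of _ "\<sigma> \<circ> t"] unfolding o ii by blast
    show "?d (?c \<pi>) = \<pi>" for \<pi> using permutes_inv_o[OF \<sigma>] by (simp add: fun_eq_iff permutes_inverses[OF \<sigma>])
    show "?c (?d \<pi>) = \<pi>" for \<pi> using permutes_inv_o[OF \<sigma>] by (simp add: fun_eq_iff permutes_inverses[OF \<sigma>])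
  qed
  have "polytabloid \<mu> (\<sigma> \<circ> t) T = (\<Sum>\<pi>\<in>column_stabilizer \<mu> t.
      if tabloid \<mu> (?c \<pi> \<circ> (\<sigma> \<circ> t)) = T then (if evenperm (?c \<pi>) then 1 else - 1) else (0::'k))"
    unfolding polytabloid_def by (rule sum.reindex_bij_betw[OF bij, symmetric])
  also have "\<dots> = polytabloid \<mu> t (map ((`) (inv' \<sigma>)) T)"
    unfolding polytabloid_def
  proof (intro sum.cong refl)
    fix \<pi> assume \<pi>: "\<pi> \<in> column_stabilizer \<mu> t"
    have "?c \<pi> \<circ> (\<sigma> \<circ> t) = \<sigma> \<circ> (\<pi> \<circ> t)" by (simp add: fun_eq_iff permutes_inverses[OF \<sigma>])
    then have "tabloid \<mu> (?c \<pi> \<circ> (\<sigma> \<circ> t)) = T \<longleftrightarrow> tabloid \<mu> (\<pi> \<circ> t) = map ((`) (inv' \<sigma>)) T"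
      using map_inv_image[OF permutes_bij[OF \<sigma>], of "tabloid \<mu> (\<pi> \<circ> t)" T] by (simp only: map_image_tabloid)
    moreover have "evenperm (?c \<pi>) = evenperm \<pi>" by (rule evenperm_conjugate[OF \<sigma> column_stabilizer_permutes[OF \<pi>]])
    ultimately show "(if tabloid \<mu> (?c \<pi> \<circ> (\<sigma> \<circ> t)) = T then (if evenperm (?c \<pi>) then 1 else - 1) else 0) =
        (if tabloid \<mu> (\<pi> \<circ> t) = map ((`) (inv' \<sigma>)) T then (if evenperm \<pi> then 1 else - 1) else (0::'k))" by simp
  qed
  finally show ?thesis by simp
qed

lemma tableaux_permuted: "\<sigma> permutes {1..sum_list \<mu>} \<Longrightarrow> t \<in> tableaux \<mu> \<Longrightarrow> \<sigma> \<circ> t \<in> tableaux \<mu>"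
  unfolding tableaux_def using bij_betw_trans permutes_imp_bij by blast

lemma carrier_specht:
  "carrier (specht \<mu>) = {(\<lambda>T. \<Sum>t\<in>A. c t * polytabloid \<mu> t T) | A c. finite A \<and> A \<subseteq> tableaux \<mu>}"
  unfolding specht_def by simp

lemma specht_ops:
  "\<zero>\<^bsub>specht \<mu>\<^esub> = (\<lambda>T. 0)" "u \<oplus>\<^bsub>specht \<mu>\<^esub> v = (\<lambda>T. u T + v T)"
  "f \<odot>\<^bsub>specht \<mu>\<^esub> v = (\<lambda>T. \<Sum>\<sigma>\<in>carrier (sym_group (sum_list \<mu>)). f \<sigma> * v (map ((`) (inv' \<sigma>)) T))"
  unfolding specht_def by simp_all

lemma specht_zero: "(\<lambda>T. 0) \<in> carrier (specht \<mu>)"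
  unfolding carrier_specht by (rule CollectI, rule exI[of _ "{}"]) auto

lemma specht_add:
  assumes "u \<in> carrier (specht \<mu>)" "v \<in> carrier (specht \<mu>)"
  shows "(\<lambda>T. u T + v T) \<in> carrier (specht \<mu>)"
proof -
  obtain A c B d where A: "finite A" "A \<subseteq> tableaux \<mu>" "u = (\<lambda>T. \<Sum>t\<in>A. c t * polytabloid \<mu> t T)"
    and B: "finite B" "B \<subseteq> tableaux \<mu>" "v = (\<lambda>T. \<Sum>t\<in>B. d t * polytabloid \<mu> t T)"
    using assms unfolding carrier_specht by blast
  have "(\<Sum>t\<in>A. c t * polytabloid \<mu> t T) = (\<Sum>t\<in>A \<union> B. (if t \<in> A then c t else 0) * polytabloid \<mu> t T)" for T
    using A(1) B(1) by (intro sum.mono_neutral_cong_left) auto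
  moreover have "(\<Sum>t\<in>B. d t * polytabloid \<mu> t T) = (\<Sum>t\<in>A \<union> B. (if t \<in> B then d t else 0) * polytabloid \<mu> t T)" for T
    using A(1) B(1) by (intro sum.mono_neutral_cong_left) auto
  ultimately have "(\<lambda>T. u T + v T) = (\<lambda>T. \<Sum>t\<in>A \<union> B. ((if t \<in> A then c t else 0) + (if t \<in> B then d t else 0)) * polytabloid \<mu> t T)"
    unfolding A(3) B(3) by (simp add: distrib_right sum.distrib)
  moreover have "finite (A \<union> B)" "A \<union> B \<subseteq> tableaux \<mu>" using A B by auto
  ultimately show ?thesis unfolding carrier_specht
    by (intro CollectI exI[of _ "A \<union> B"] exI[of _ "\<lambda>t. (if t \<in> A then c t else 0) + (if t \<in> B then d t else 0)"] conjI)
qed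

lemma specht_sum:
  "(\<And>j. j \<in> J \<Longrightarrow> f j \<in> carrier (specht \<mu>)) \<Longrightarrow> (\<lambda>T. \<Sum>j\<in>J. f j T) \<in> carrier (specht \<mu>)"
proof (induction J rule: infinite_finite_induct)
  case (insert j J)
  then show ?case using specht_add[of "f j" \<mu> "\<lambda>T. \<Sum>j\<in>J. f j T"] by simp
qed (simp_all add: specht_zero)

lemma specht_polytabloid: "t \<in> tableaux \<mu> \<Longrightarrow> (\<lambda>T. c * polytabloid \<mu> t T) \<in> carrier (specht \<mu>)"
  unfolding carrier_specht by (rule CollectI, rule exI[of _ "{t}"], rule exI[of _ "\<lambda>_. c"]) simp

lemma specht_induct [consumes 1, case_names zero add polytabloid]:
  assumes "v \<in> carrier (specht \<mu>)" "Q (\<lambda>T. 0)"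
    and "\<And>u v. u \<in> carrier (specht \<mu>) \<Longrightarrow> v \<in> carrier (specht \<mu>) \<Longrightarrow> Q u \<Longrightarrow> Q v \<Longrightarrow> Q (\<lambda>T. u T + v T)"
    and "\<And>t c. t \<in> tableaux \<mu> \<Longrightarrow> Q (\<lambda>T. c * polytabloid \<mu> t T)"
  shows "Q v"
proof -
  obtain A c where A: "finite A" "A \<subseteq> tableaux \<mu>" "v = (\<lambda>T. \<Sum>t\<in>A. c t * polytabloid \<mu> t T)"
    using assms(1) unfolding carrier_specht by blast
  have "(\<lambda>T. \<Sum>t\<in>A. c t * polytabloid \<mu> t T) \<in> carrier (specht \<mu>) \<and> Q (\<lambda>T. \<Sum>t\<in>A. c t * polytabloid \<mu> t T)"
    using A(1,2)
  proof (induction A)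
    case (insert t A)
    then have "t \<in> tableaux \<mu>" by simp
    then show ?case using insert assms(3)[OF specht_polytabloid, of t "\<lambda>T. \<Sum>t\<in>A. c t * polytabloid \<mu> t T" "c t"] assms(4)
      specht_add[OF specht_polytabloid, of t \<mu> "\<lambda>T. \<Sum>t\<in>A. c t * polytabloid \<mu> t T" "c t"] by simp
  qed (simp add: specht_zero assms(2))
  then show ?thesis unfolding A(3) by simp
qed

lemma specht_single:
  assumes "\<sigma> permutes {1..sum_list \<mu>}"
  shows "group_ring_single c \<sigma> \<odot>\<^bsub>specht \<mu>\<^esub> v = (\<lambda>T. c * v (map ((`) (inv' \<sigma>)) T))"
proof -
  have "finite (carrier (sym_group (sum_list \<mu>)))" unfolding sym_group_def by (simp add: finite_permutations)
  moreover have "\<sigma> \<in> carrier (sym_group (sum_list \<mu>))" using assms unfolding sym_group_def by simp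
  moreover have "group_ring_single c \<sigma> \<pi> * w = (if \<pi> = \<sigma> then c * w else 0)" for \<pi> and w :: 'a
    unfolding group_ring_single_def by simp
  ultimately show ?thesis unfolding specht_ops by (intro ext) simp
qed

lemma specht_single_closed:
  assumes "\<sigma> permutes {1..sum_list \<mu>}" "v \<in> carrier (specht \<mu>)"
  shows "group_ring_single c \<sigma> \<odot>\<^bsub>specht \<mu>\<^esub> v \<in> carrier (specht \<mu>)"
  unfolding specht_single[OF assms(1)] using assms(2)
proof (induction rule: specht_induct)
  case (add u v)
  then show ?case using specht_add by (simp add: distrib_left)
next
  case (polytabloid t d)
  then show ?case
    using specht_polytabloid[OF tableaux_permuted[OF assms(1) polytabloid], of "c * d"]
    by (simp add: polytabloid_permuted[OF assms(1)] mult.assoc)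
qed (simp add: specht_zero)

lemma specht_scale_closed: "v \<in> carrier (specht \<mu>) \<Longrightarrow> (\<lambda>T. c * v T) \<in> carrier (specht \<mu>)"
  using specht_single_closed[OF permutes_id, of v \<mu> c] specht_single[OF permutes_id, of \<mu> c v] by simp


section \<open>Outer tensor products of Specht modules\<close>

definition specht_slots :: "nat \<Rightarrow> (nat \<Rightarrow> nat list) \<Rightarrow> (nat \<Rightarrow> nat set list \<Rightarrow> 'k :: {comm_ring, comm_monoid_mult}) set" where
  "specht_slots l \<mu> = (\<Pi>\<^sub>E i\<in>{1..l}. carrier (specht (\<mu> i)))"

definition outer_relations :: "nat \<Rightarrow> (nat \<Rightarrow> nat list) \<Rightarrow> ((nat \<Rightarrow> nat set list \<Rightarrow> 'k :: {comm_ring, comm_monoid_mult}) \<Rightarrow>\<^sub>0 int) set" where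
  "outer_relations l \<mu> =
     {frag_of (x(i := (\<lambda>T. u T + v T))) - frag_of (x(i := u)) - frag_of (x(i := v)) | x i u v.
         x \<in> specht_slots l \<mu> \<and> i \<in> {1..l} \<and> u \<in> carrier (specht (\<mu> i)) \<and> v \<in> carrier (specht (\<mu> i))} \<union>
      {frag_of (x(i := (\<lambda>T. c * x i T))) - frag_of (x(j := (\<lambda>T. c * x j T))) | x i j c.
         x \<in> specht_slots l \<mu> \<and> i \<in> {1..l} \<and> j \<in> {1..l}}"

definition slot_action ::
    "nat \<Rightarrow> 'k :: {comm_ring, comm_monoid_mult} \<Rightarrow> (nat \<Rightarrow> nat \<Rightarrow> nat) \<Rightarrow> (nat \<Rightarrow> nat set list \<Rightarrow> 'k) \<Rightarrow> nat \<Rightarrow> nat set list \<Rightarrow> 'k" where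
  "slot_action l c \<sigma> x = (\<lambda>i\<in>{1..l}. \<lambda>T. (if i = 1 then c else 1) * x i (map ((`) (inv' (\<sigma> i))) T))"

locale specht_tuple =
  fixes l :: nat and m :: "nat \<Rightarrow> nat" and \<mu> :: "nat \<Rightarrow> nat list"
    and \<delta> :: "'k :: {comm_ring, comm_monoid_mult}"
  assumes l1: "1 \<le> l" and \<mu>: "\<mu> \<in> partition_tuples l m"
begin

lemma sum_\<mu>: "i \<in> {1..l} \<Longrightarrow> sum_list (\<mu> i) = m i"
  using \<mu> unfolding partition_tuples_def integer_partition_def by auto

abbreviation "SG \<equiv> carrier (sym_product l m)"
abbreviation ogen :: "((nat \<Rightarrow> nat \<Rightarrow> nat) \<Rightarrow> 'k) \<Rightarrow> (nat \<Rightarrow> nat set list \<Rightarrow> 'k) \<Rightarrow> ((nat \<Rightarrow> nat set list \<Rightarrow> 'k) \<Rightarrow>\<^sub>0 int)" where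
  "ogen \<equiv> \<lambda>f x. \<Sum>\<sigma>\<in>SG. frag_of (slot_action l (f \<sigma>) \<sigma> x)"

lemma SG: "SG = (\<Pi>\<^sub>E i\<in>{1..l}. {\<pi>. \<pi> permutes {1..m i}})"
  unfolding sym_product_def product_group_def sym_group_def by simp

lemma SG_permutes: "\<sigma> \<in> SG \<Longrightarrow> i \<in> {1..l} \<Longrightarrow> \<sigma> i permutes {1..sum_list (\<mu> i)}"
  unfolding SG sum_\<mu> by auto

lemma single_one: "group_ring_single c \<one>\<^bsub>sym_group (m i)\<^esub> \<odot>\<^bsub>specht (\<mu> i)\<^esub> v = (\<lambda>T. c * v T)" if "i \<in> {1..l}"
  using specht_single[of id "\<mu> i" c v] permutes_id by (simp add: sym_group_def)

lemma specht_product_presented: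
  "specht_product l m \<mu> = presented_module (specht_slots l \<mu>) (outer_relations l \<mu>) ogen"
proof -
  have ac: "(\<lambda>i\<in>{1..l}. group_ring_single (if i = 1 then f \<sigma> else 1) (\<sigma> i) \<odot>\<^bsub>specht (\<mu> i)\<^esub> x i) = slot_action l (f \<sigma>) \<sigma> x"
    if "\<sigma> \<in> SG" for f :: "(nat \<Rightarrow> nat \<Rightarrow> nat) \<Rightarrow> 'k" and \<sigma> x
    unfolding slot_action_def by (intro restrict_ext) (rule specht_single[OF SG_permutes[OF that]])
  have rel: "{frag_of ((x :: nat \<Rightarrow> nat set list \<Rightarrow> 'k)(i := group_ring_single c \<one>\<^bsub>sym_group (m i)\<^esub> \<odot>\<^bsub>specht (\<mu> i)\<^esub> x i)) -
       frag_of (x(j := group_ring_single c \<one>\<^bsub>sym_group (m j)\<^esub> \<odot>\<^bsub>specht (\<mu> j)\<^esub> x j)) | x i j c.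
         x \<in> specht_slots l \<mu> \<and> i \<in> {1..l} \<and> j \<in> {1..l}} =
      {frag_of ((x :: nat \<Rightarrow> nat set list \<Rightarrow> 'k)(i := (\<lambda>T. c * x i T))) - frag_of (x(j := (\<lambda>T. c * x j T))) | x i j c.
         x \<in> specht_slots l \<mu> \<and> i \<in> {1..l} \<and> j \<in> {1..l}}" (is "{?f x i j c | x i j c. ?Q x i j} = {?g x i j c | x i j c. ?Q x i j}")
  proof -
    have "?f x i j c = ?g x i j c" if "?Q x i j" for x :: "nat \<Rightarrow> nat set list \<Rightarrow> 'k" and i j c using that by (elim conjE) (simp only: single_one)
    then show ?thesis by (metis (no_types, lifting))
  qed
  have gen: "(\<lambda>f x. \<Sum>\<sigma>\<in>carrier (product_group {1..l} (\<lambda>i. sym_group (m i))).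
        frag_of (\<lambda>i\<in>{1..l}. group_ring_single (if i = 1 then f \<sigma> else 1) (\<sigma> i) \<odot>\<^bsub>specht (\<mu> i)\<^esub> x i)) =
      (ogen :: ((nat \<Rightarrow> nat \<Rightarrow> nat) \<Rightarrow> 'k) \<Rightarrow> _)"
    using ac unfolding sym_product_def[symmetric] by (intro ext sum.cong refl) simp
  show ?thesis
    unfolding specht_product_def outer_tensor_module_def specht_slots_def[symmetric] outer_relations_def specht_ops(2) rel gen ..
qed

lemma slots_upd: "x \<in> specht_slots l \<mu> \<Longrightarrow> i \<in> {1..l} \<Longrightarrow> v \<in> carrier (specht (\<mu> i)) \<Longrightarrow> x(i := v) \<in> specht_slots l \<mu>"
  unfolding specht_slots_def by (auto simp: PiE_iff extensional_def)

lemma slots_in: "x \<in> specht_slots l \<mu> \<Longrightarrow> i \<in> {1..l} \<Longrightarrow> x i \<in> carrier (specht (\<mu> i))"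
  unfolding specht_slots_def by auto

lemma slot_action_in: "\<sigma> \<in> SG \<Longrightarrow> x \<in> specht_slots l \<mu> \<Longrightarrow> slot_action l c \<sigma> x \<in> specht_slots l \<mu>"
proof -
  assume \<sigma>: "\<sigma> \<in> SG" and x: "x \<in> specht_slots l \<mu>"
  have "(\<lambda>T. (if i = 1 then c else 1) * x i (map ((`) (inv' (\<sigma> i))) T)) \<in> carrier (specht (\<mu> i))" if "i \<in> {1..l}" for i
    using specht_single_closed[OF SG_permutes[OF \<sigma> that] slots_in[OF x that]]
    unfolding specht_single[OF SG_permutes[OF \<sigma> that]] .
  then show ?thesis unfolding specht_slots_def slot_action_def restrict_PiE_iff by blast
qed

lemma outer_relations_addI:
  "x \<in> specht_slots l \<mu> \<Longrightarrow> i \<in> {1..l} \<Longrightarrow> u \<in> carrier (specht (\<mu> i)) \<Longrightarrow> v \<in> carrier (specht (\<mu> i)) \<Longrightarrow>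
    frag_of (x(i := (\<lambda>T. u T + v T))) - frag_of (x(i := u)) - frag_of (x(i := v)) \<in> outer_relations l \<mu>"
  unfolding outer_relations_def by blast

lemma outer_relations_scaleI:
  "x \<in> specht_slots l \<mu> \<Longrightarrow> i \<in> {1..l} \<Longrightarrow> j \<in> {1..l} \<Longrightarrow>
    frag_of (x(i := (\<lambda>T. c * x i T))) - frag_of (x(j := (\<lambda>T. c * x j T))) \<in> outer_relations l \<mu>"
  unfolding outer_relations_def by blast

lemma slot_action_upd:
  "i \<in> {1..l} \<Longrightarrow> slot_action l c \<sigma> (x(i := v)) =
    (slot_action l c \<sigma> x)(i := (\<lambda>T. (if i = 1 then c else 1) * v (map ((`) (inv' (\<sigma> i))) T)))"
  unfolding slot_action_def by (auto simp: fun_eq_iff)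

text \<open>Each single group element maps relations to relations; their sum \<open>ogen f\<close>
  only maps them into the generated subgroup.\<close>

lemma slot_action_rel:
  assumes \<sigma>: "\<sigma> \<in> SG" and r: "r \<in> outer_relations l \<mu>"
  shows "frag_extend (\<lambda>x. frag_of (slot_action l c \<sigma> x)) r \<in> outer_relations l \<mu>"
  using r[unfolded outer_relations_def]
proof (elim UnE)
  assume "r \<in> {frag_of (x(i := (\<lambda>T. u T + v T))) - frag_of (x(i := u)) - frag_of (x(i := v)) | x i u v.
         x \<in> specht_slots l \<mu> \<and> i \<in> {1..l} \<and> u \<in> carrier (specht (\<mu> i)) \<and> v \<in> carrier (specht (\<mu> i))}"
  then obtain x i u v where r: "r = frag_of (x(i := (\<lambda>T. u T + v T))) - frag_of (x(i := u)) - frag_of (x(i := v))"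
    and x: "x \<in> specht_slots l \<mu>" "i \<in> {1..l}" "u \<in> carrier (specht (\<mu> i))" "v \<in> carrier (specht (\<mu> i))" by blast
  let ?y = "slot_action l c \<sigma> x" and ?s = "\<lambda>w T. (if i = 1 then c else 1) * w (map ((`) (inv' (\<sigma> i))) T)"
  have s: "?s w \<in> carrier (specht (\<mu> i))" if "w \<in> carrier (specht (\<mu> i))" for w
    using specht_single_closed[OF SG_permutes[OF \<sigma> x(2)] that] unfolding specht_single[OF SG_permutes[OF \<sigma> x(2)]] .
  have "?s (\<lambda>T. u T + v T) = (\<lambda>T. ?s u T + ?s v T)" by (simp add: distrib_left)
  then have "frag_extend (\<lambda>x. frag_of (slot_action l c \<sigma> x)) r =
      frag_of (?y(i := (\<lambda>T. ?s u T + ?s v T))) - frag_of (?y(i := ?s u)) - frag_of (?y(i := ?s v))"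
    unfolding r by (simp add: frag_extend_diff slot_action_upd[OF x(2)])
  then show ?thesis using outer_relations_addI[OF slot_action_in[OF \<sigma> x(1)] x(2) s[OF x(3)] s[OF x(4)], of c] by simp
next
  assume "r \<in> {frag_of (x(i := (\<lambda>T. d * x i T))) - frag_of (x(j := (\<lambda>T. d * x j T))) | x i j d.
         x \<in> specht_slots l \<mu> \<and> i \<in> {1..l} \<and> j \<in> {1..l}}"
  then obtain x i j d where r: "r = frag_of (x(i := (\<lambda>T. d * x i T))) - frag_of (x(j := (\<lambda>T. d * x j T)))"
    and x: "x \<in> specht_slots l \<mu>" "i \<in> {1..l}" "j \<in> {1..l}" by blast
  let ?y = "slot_action l c \<sigma> x"
  have e: "(\<lambda>T. (if k = 1 then c else 1) * (d * x k (map ((`) (inv' (\<sigma> k))) T))) = (\<lambda>T. d * ?y k T)" if "k \<in> {1..l}" for k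
    using that unfolding slot_action_def by (auto simp: fun_eq_iff ac_simps)
  have "frag_extend (\<lambda>x. frag_of (slot_action l c \<sigma> x)) r =
      frag_of (?y(i := (\<lambda>T. d * ?y i T))) - frag_of (?y(j := (\<lambda>T. d * ?y j T)))"
    unfolding r frag_extend_diff frag_extend_of slot_action_upd[OF x(2)] slot_action_upd[OF x(3)] e[OF x(2)] e[OF x(3)] ..
  then show ?thesis using outer_relations_scaleI[OF slot_action_in[OF \<sigma> x(1)] x(2,3), of c d] by simp
qed

lemma finite_SG: "finite SG"
  unfolding SG by (intro finite_PiE finite_permutations) auto

lemma ogen_extend: "frag_extend (ogen f) z = (\<Sum>\<sigma>\<in>SG. frag_extend (\<lambda>x. frag_of (slot_action l (f \<sigma>) \<sigma> x)) z)"
  by (rule free_Abelian_group_induct[of z UNIV]) (simp_all add: frag_extend_diff sum_subtractf)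

sublocale N: presentation "specht_slots l \<mu> :: (nat \<Rightarrow> nat set list \<Rightarrow> 'k) set" "outer_relations l \<mu>" ogen UNIV
proof
  fix r :: "(nat \<Rightarrow> nat set list \<Rightarrow> 'k) \<Rightarrow>\<^sub>0 int"
  assume "r \<in> outer_relations l \<mu>"
  then show "Poly_Mapping.keys r \<subseteq> specht_slots l \<mu>"
    unfolding outer_relations_def
  proof (elim UnE CollectE exE conjE)
    fix x i and u v :: "nat set list \<Rightarrow> 'k"
    assume x: "x \<in> specht_slots l \<mu>" "i \<in> {1..l}" "u \<in> carrier (specht (\<mu> i))" "v \<in> carrier (specht (\<mu> i))"
      and r: "r = frag_of (x(i := (\<lambda>T. u T + v T))) - frag_of (x(i := u)) - frag_of (x(i := v))"
    have "Poly_Mapping.keys r \<subseteq> {x(i := (\<lambda>T. u T + v T)), x(i := u), x(i := v)}"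
      unfolding r by (auto dest!: subsetD[OF keys_diff] split: if_splits)
    then show ?thesis using slots_upd[OF x(1,2)] specht_add[OF x(3,4)] x(3,4) by blast
  next
    fix x i j and c :: 'k
    assume x: "x \<in> specht_slots l \<mu>" "i \<in> {1..l}" "j \<in> {1..l}"
      and r: "r = frag_of (x(i := (\<lambda>T. c * x i T))) - frag_of (x(j := (\<lambda>T. c * x j T)))"
    have "Poly_Mapping.keys r \<subseteq> {x(i := (\<lambda>T. c * x i T)), x(j := (\<lambda>T. c * x j T))}"
      unfolding r by (auto dest!: subsetD[OF keys_diff] split: if_splits)
    then show ?thesis
      using slots_upd[OF x(1,2) specht_scale_closed[OF slots_in[OF x(1,2)]]]
        slots_upd[OF x(1,3) specht_scale_closed[OF slots_in[OF x(1,3)]]] by blast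
  qed
next
  fix f :: "(nat \<Rightarrow> nat \<Rightarrow> nat) \<Rightarrow> 'k" and x :: "nat \<Rightarrow> nat set list \<Rightarrow> 'k"
  assume "x \<in> specht_slots l \<mu>"
  then show "Poly_Mapping.keys (ogen f x) \<subseteq> specht_slots l \<mu>"
    using slot_action_in keys_sum[of "\<lambda>\<sigma>. frag_of (slot_action l (f \<sigma>) \<sigma> x)" SG] by fastforce
next
  fix f :: "(nat \<Rightarrow> nat \<Rightarrow> nat) \<Rightarrow> 'k" and r :: "(nat \<Rightarrow> nat set list \<Rightarrow> 'k) \<Rightarrow>\<^sub>0 int"
  assume r: "r \<in> outer_relations l \<mu>"
  let ?H = "generate (free_Abelian_group (specht_slots l \<mu>)) (outer_relations l \<mu>)"
  have "(\<Sum>\<sigma>\<in>S. frag_extend (\<lambda>x. frag_of (slot_action l (f \<sigma>) \<sigma> x)) r) \<in> ?H" if "S \<subseteq> SG" for S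
    using finite_subset[OF that finite_SG] that
  proof (induction S)
    case empty
    show ?case using generate.one[of "free_Abelian_group (specht_slots l \<mu>)"] by simp
  next
    case (insert \<sigma> S)
    then have "frag_extend (\<lambda>x. frag_of (slot_action l (f \<sigma>) \<sigma> x)) r \<in> ?H"
      by (intro generate.incl slot_action_rel[OF _ r]) simp
    from generate.eng[OF this, of "\<Sum>\<sigma>\<in>S. frag_extend (\<lambda>x. frag_of (slot_action l (f \<sigma>) \<sigma> x)) r"]
    show ?case using insert by simp
  qed
  then show "frag_extend (ogen f) r \<in> ?H" unfolding ogen_extend by simp
qed

lemma NM_eq: "specht_product l m \<mu> = N.PM"
  by (rule specht_product_presented)

end


section \<open>Modules over quotient rings\<close>

context left_module
begin

lemma smult_zero_right: "a \<in> carrier R \<Longrightarrow> a \<odot>\<^bsub>M\<^esub> \<zero>\<^bsub>M\<^esub> = \<zero>\<^bsub>M\<^esub>"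
  using smult_r_distr[of a "\<zero>\<^bsub>M\<^esub>" "\<zero>\<^bsub>M\<^esub>"] smult_closed[of a "\<zero>\<^bsub>M\<^esub>"] M.zero_closed
  by (metis M.l_zero M.r_zero M.add.l_cancel)

lemma smult_minus_right: "a \<in> carrier R \<Longrightarrow> x \<in> carrier M \<Longrightarrow> a \<odot>\<^bsub>M\<^esub> (\<ominus>\<^bsub>M\<^esub> x) = \<ominus>\<^bsub>M\<^esub> (a \<odot>\<^bsub>M\<^esub> x)"
proof (rule M.minus_equality[symmetric])
  assume a: "a \<in> carrier R" and x: "x \<in> carrier M"
  have "a \<odot>\<^bsub>M\<^esub> (\<ominus>\<^bsub>M\<^esub> x) \<oplus>\<^bsub>M\<^esub> a \<odot>\<^bsub>M\<^esub> x = a \<odot>\<^bsub>M\<^esub> (\<ominus>\<^bsub>M\<^esub> x \<oplus>\<^bsub>M\<^esub> x)"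
    using smult_r_distr[OF a _ x, of "\<ominus>\<^bsub>M\<^esub> x"] x by simp
  then show "a \<odot>\<^bsub>M\<^esub> (\<ominus>\<^bsub>M\<^esub> x) \<oplus>\<^bsub>M\<^esub> a \<odot>\<^bsub>M\<^esub> x = \<zero>\<^bsub>M\<^esub>" using smult_zero_right[OF a] x by (simp add: M.l_neg)
qed (auto intro: smult_closed)

lemma smult_diff_right:
  "a \<in> carrier R \<Longrightarrow> x \<in> carrier M \<Longrightarrow> y \<in> carrier M \<Longrightarrow> a \<odot>\<^bsub>M\<^esub> (x \<ominus>\<^bsub>M\<^esub> y) = a \<odot>\<^bsub>M\<^esub> x \<ominus>\<^bsub>M\<^esub> a \<odot>\<^bsub>M\<^esub> y"
  unfolding a_minus_def using smult_r_distr[of a x "\<ominus>\<^bsub>M\<^esub> y"] smult_minus_right by simp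

text \<open>A coset acts through an arbitrarily chosen representative; as the ideal acts by zero,
  the choice does not matter.\<close>

lemma factors_through_annihilated_ideal:
  assumes I: "ideal I R" and kill: "\<And>r x. r \<in> I \<Longrightarrow> x \<in> carrier M \<Longrightarrow> r \<odot>\<^bsub>M\<^esub> x = \<zero>\<^bsub>M\<^esub>"
  shows "factors_through_quotient R I M"
proof -
  interpret I: ideal I R by (rule I)
  define Q where "Q = R Quot I"
  define N :: "('a set, 'b) module" where "N = \<lparr>carrier = carrier M, monoid.mult = undefined, one = undefined,
    ring.zero = \<zero>\<^bsub>M\<^esub>, add = add M, smult = (\<lambda>Z x. (SOME r. r \<in> Z) \<odot>\<^bsub>M\<^esub> x)\<rparr>"
  have N: "carrier N = carrier M" "\<zero>\<^bsub>N\<^esub> = \<zero>\<^bsub>M\<^esub>" "add N = add M" unfolding N_def by simp_all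
  have sm: "(I +>\<^bsub>R\<^esub> r) \<odot>\<^bsub>N\<^esub> x = r \<odot>\<^bsub>M\<^esub> x" if r: "r \<in> carrier R" and x: "x \<in> carrier M" for r x
  proof -
    have "(SOME s. s \<in> I +>\<^bsub>R\<^esub> r) \<in> I +>\<^bsub>R\<^esub> r" by (rule someI[of _ r]) (rule I.a_rcos_self[OF r])
    then obtain i where i: "i \<in> I" "(SOME s. s \<in> I +>\<^bsub>R\<^esub> r) = i \<oplus>\<^bsub>R\<^esub> r" unfolding a_r_coset_def' by blast
    then have "(I +>\<^bsub>R\<^esub> r) \<odot>\<^bsub>N\<^esub> x = (i \<oplus>\<^bsub>R\<^esub> r) \<odot>\<^bsub>M\<^esub> x" unfolding N_def by simp
    also have "\<dots> = r \<odot>\<^bsub>M\<^esub> x"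
      using smult_l_distr[OF I.a_Hcarr[OF i(1)] r x] kill[OF i(1) x] smult_closed[OF r x] by simp
    finally show ?thesis .
  qed
  have cQ: "carrier Q = (\<lambda>r. I +>\<^bsub>R\<^esub> r) ` carrier R"
    unfolding Q_def FactRing_def A_RCOSETS_defs by (auto simp: a_r_coset_def)
  have mQ: "(I +>\<^bsub>R\<^esub> x) \<otimes>\<^bsub>Q\<^esub> (I +>\<^bsub>R\<^esub> y) = I +>\<^bsub>R\<^esub> (x \<otimes>\<^bsub>R\<^esub> y)" if "x \<in> carrier R" "y \<in> carrier R" for x y
    unfolding Q_def FactRing_def using I.rcoset_mult_add[OF that] by simp
  have aQ: "(I +>\<^bsub>R\<^esub> x) \<oplus>\<^bsub>Q\<^esub> (I +>\<^bsub>R\<^esub> y) = I +>\<^bsub>R\<^esub> (x \<oplus>\<^bsub>R\<^esub> y)" if "x \<in> carrier R" "y \<in> carrier R" for x y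
    unfolding Q_def FactRing_def using I.a_rcos_sum[OF that] by simp
  have oQ: "\<one>\<^bsub>Q\<^esub> = I +>\<^bsub>R\<^esub> \<one>\<^bsub>R\<^esub>" unfolding Q_def FactRing_def by simp
  have "left_module Q N"
  proof (intro left_module.intro left_module_axioms.intro)
    show "ring Q" unfolding Q_def by (rule I.quotient_is_ring)
    show "abelian_group N"
    proof (rule abelian_groupI)
      show "\<exists>y\<in>carrier N. y \<oplus>\<^bsub>N\<^esub> x = \<zero>\<^bsub>N\<^esub>" if "x \<in> carrier N" for x
        using that unfolding N by (intro bexI[of _ "\<ominus>\<^bsub>M\<^esub> x"]) (auto simp: M.l_neg)
    qed (auto simp: N M.a_ac)
  next
    fix c d x assume c: "c \<in> carrier Q" "d \<in> carrier Q" "x \<in> carrier N"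
    then obtain r s where rs: "c = I +>\<^bsub>R\<^esub> r" "r \<in> carrier R" "d = I +>\<^bsub>R\<^esub> s" "s \<in> carrier R" unfolding cQ by blast
    have x: "x \<in> carrier M" using c N by simp
    show "(c \<oplus>\<^bsub>Q\<^esub> d) \<odot>\<^bsub>N\<^esub> x = c \<odot>\<^bsub>N\<^esub> x \<oplus>\<^bsub>N\<^esub> d \<odot>\<^bsub>N\<^esub> x"
      unfolding rs(1,3) aQ[OF rs(2,4)] N sm[OF rs(2) x] sm[OF rs(4) x] sm[OF R.a_closed[OF rs(2,4)] x]
      by (rule smult_l_distr[OF rs(2,4) x])
    show "(c \<otimes>\<^bsub>Q\<^esub> d) \<odot>\<^bsub>N\<^esub> x = c \<odot>\<^bsub>N\<^esub> (d \<odot>\<^bsub>N\<^esub> x)"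
      unfolding rs(1,3) mQ[OF rs(2,4)] N sm[OF rs(4) x] sm[OF rs(2) smult_closed[OF rs(4) x]] sm[OF R.m_closed[OF rs(2,4)] x]
      by (rule smult_assoc1[OF rs(2,4) x])
  next
    fix c x assume c: "c \<in> carrier Q" "x \<in> carrier N"
    then obtain r where r: "c = I +>\<^bsub>R\<^esub> r" "r \<in> carrier R" unfolding cQ by blast
    then show "c \<odot>\<^bsub>N\<^esub> x \<in> carrier N" using sm smult_closed c N by simp
  next
    fix c x y assume c: "c \<in> carrier Q" "x \<in> carrier N" "y \<in> carrier N"
    then obtain r where r: "c = I +>\<^bsub>R\<^esub> r" "r \<in> carrier R" unfolding cQ by blast
    then show "c \<odot>\<^bsub>N\<^esub> (x \<oplus>\<^bsub>N\<^esub> y) = c \<odot>\<^bsub>N\<^esub> x \<oplus>\<^bsub>N\<^esub> c \<odot>\<^bsub>N\<^esub> y" using sm smult_r_distr c N by simp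
  next
    fix x assume "x \<in> carrier N"
    then show "\<one>\<^bsub>Q\<^esub> \<odot>\<^bsub>N\<^esub> x = x" using sm smult_one N oQ by simp
  qed
  then show ?thesis
    unfolding factors_through_quotient_def using left_module_axioms N sm unfolding Q_def by blast
qed

end


section \<open>Standard modules\<close>

locale standard_setup = top_index l n \<delta> m + specht_tuple l m \<mu> \<delta>
  for l n :: nat and \<delta> :: "'k :: {comm_ring, comm_monoid_mult}" and m :: "nat \<Rightarrow> nat" and \<mu> :: "nat \<Rightarrow> nat list"
begin

abbreviation NM :: "((nat \<Rightarrow> nat \<Rightarrow> nat) \<Rightarrow> 'k, ((nat \<Rightarrow> nat set list \<Rightarrow> 'k) \<Rightarrow>\<^sub>0 int) set) module" where
  "NM \<equiv> specht_product l m \<mu>"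

sublocale ST: tensor_setup P LM "group_ring G" "index_right_action \<delta> l n m" NM
proof (intro tensor_setup.intro tensor_setup_axioms.intro LM_left_module)
  show "v \<oplus>\<^bsub>NM\<^esub> w \<in> carrier NM" if "v \<in> carrier NM" "w \<in> carrier NM" for v w
    using that abelian_group.axioms(1)[OF N.abelian_group_PM] unfolding NM_eq by (simp add: abelian_monoid.a_closed)
  show "r \<odot>\<^bsub>NM\<^esub> v \<in> carrier NM" if "v \<in> carrier NM" for v r
    using that N.smult_closed_PM unfolding NM_eq by simp
qed (use right_action_closed right_action_commutes in blast)+

lemma standard_module_eq: "standard_module \<delta> l n m \<mu> = ST.TM"
  unfolding standard_module_def ..

sublocale TM: left_module P ST.TM
  by (rule ST.TM_left_module)

sublocale NA: abelian_group NM
  unfolding NM_eq by (rule N.abelian_group_PM)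

lemma TM_double: "u \<in> carrier ST.TM \<Longrightarrow> u \<oplus>\<^bsub>ST.TM\<^esub> u = u \<Longrightarrow> u = \<zero>\<^bsub>ST.TM\<^esub>"
  by (metis TM.M.add.r_cancel_one)

lemma TM_diff_eq: "z \<in> carrier ST.TM \<Longrightarrow> y \<in> carrier ST.TM \<Longrightarrow> z \<oplus>\<^bsub>ST.TM\<^esub> y = x \<Longrightarrow> x \<ominus>\<^bsub>ST.TM\<^esub> y = z"
  by (auto simp: a_minus_def TM.M.a_assoc TM.M.r_neg)

lemma tens_zero_left: "v \<in> carrier NM \<Longrightarrow> ST.tens \<zero>\<^bsub>LM\<^esub> v = \<zero>\<^bsub>ST.TM\<^esub>"
proof -
  assume v: "v \<in> carrier NM"
  have "ST.tens \<zero>\<^bsub>LM\<^esub> v \<oplus>\<^bsub>ST.TM\<^esub> ST.tens \<zero>\<^bsub>LM\<^esub> v = ST.tens \<zero>\<^bsub>LM\<^esub> v"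
    using ST.tens_add_left[of "\<zero>\<^bsub>LM\<^esub>" "\<zero>\<^bsub>LM\<^esub>" v] v by simp
  then show ?thesis using TM_double[OF ST.tens_in] v by simp
qed

lemma tens_zero_right: "x \<in> carrier LM \<Longrightarrow> ST.tens x \<zero>\<^bsub>NM\<^esub> = \<zero>\<^bsub>ST.TM\<^esub>"
  using ST.tens_add_right[of x "\<zero>\<^bsub>NM\<^esub>" "\<zero>\<^bsub>NM\<^esub>"] TM_double[OF ST.tens_in, of x "\<zero>\<^bsub>NM\<^esub>"] by simp

lemma cap_ideal_kills_TM:
  assumes r: "r \<in> cap_ideal \<delta> l n" and u: "u \<in> carrier ST.TM"
  shows "r \<odot>\<^bsub>ST.TM\<^esub> u = \<zero>\<^bsub>ST.TM\<^esub>"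
proof -
  have rP: "r \<in> carrier P" by (rule ideal_subset[OF cap_ideal r])
  show ?thesis
    using u
  proof (induction rule: ST.TM_induct)
    case zero
    show ?case by (rule TM.smult_zero_right[OF rP])
  next
    case (diff u v)
    then show ?case using TM.smult_diff_right[OF rP] by (simp add: a_minus_def TM.M.r_neg)
  next
    case (tens x v)
    then show ?case using ST.smult_tens[OF rP] cap_ideal_kills[OF r] tens_zero_left by simp
  qed
qed

lemma standard_module_factors:
  "factors_through_quotient P (cap_ideal \<delta> l n) (standard_module \<delta> l n m \<mu>)"
  unfolding standard_module_eq by (rule TM.factors_through_annihilated_ideal[OF cap_ideal cap_ideal_kills_TM])


subsection \<open>Reduction of submodules to the Specht module\<close>

text \<open>The possible upper halves of basis diagrams, each encoded by the unions of its
  blocks.\<close>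

definition doms :: "nat set set set" where
  "doms = (\<lambda>q. Domain (drel q)) ` B"

definition rep_of :: "nat set set \<Rightarrow> diagram" where
  "rep_of D = (SOME q. q \<in> B \<and> Domain (drel q) = D)"

lemma rep_of: "D \<in> doms \<Longrightarrow> rep_of D \<in> B \<and> Domain (drel (rep_of D)) = D"
  unfolding doms_def rep_of_def by (rule someI_ex) auto

text \<open>The partial identity on the upper half \<open>D\<close>. On normal forms it acts as the
  projection to the basis diagrams with this upper half, as \<open>restr_idem_mult\<close>
  shows.\<close>

definition idem :: "nat set set \<Rightarrow> diagram" where
  "idem D = diagram_comp (rep_of D) (flip (rep_of D))"

lemma flip_comp_B:
  assumes "q \<in> B"
  shows "diagram_comp (flip q) q = a"
proof (rule drel_uniform_inj)
  note U = B_uniform[OF assms]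
  show "diagram_comp (flip q) q \<in> U" "a \<in> U" using flip_comp_self(1)[OF U] a_uniform by auto
  show "drel (diagram_comp (flip q) q) = drel a"
    unfolding flip_comp_self(2)[OF U] drel_a using assms B_eq by auto
qed

lemma idem_uniform: "D \<in> doms \<Longrightarrow> idem D \<in> U" and drel_idem: "D \<in> doms \<Longrightarrow> drel (idem D) = Id_on D"
proof -
  assume D: "D \<in> doms"
  note U = B_uniform[OF conjunct1[OF rep_of[OF D]]]
  have "idem D = diagram_comp (flip (flip (rep_of D))) (flip (rep_of D))" unfolding idem_def by simp
  then show "idem D \<in> U" "drel (idem D) = Id_on D"
    using flip_comp_self[OF flip_uniform[OF U]] rep_of[OF D] by (simp_all add: drel_flip)
qed

text \<open>If the product stays in \<open>B\<close>, then every lower set of \<open>q\<close> is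
  still reached, so by injectivity the domain of \<open>q\<close> lies in \<open>D\<close>. All
  domains of basis diagrams have the same cardinality, so it equals \<open>D\<close>.\<close>

lemma idem_comp:
  assumes D: "D \<in> doms" and q: "q \<in> B"
  shows "Domain (drel q) = D \<Longrightarrow> diagram_comp (idem D) q = q"
    "Domain (drel q) \<noteq> D \<Longrightarrow> diagram_comp (idem D) q \<notin> B"
proof -
  note d = uniform_diagrams[OF idem_uniform[OF D]] uniform_diagrams[OF B_uniform[OF q]]
  note c = drel_comp[OF d]
  show "diagram_comp (idem D) q = q" if "Domain (drel q) = D"
    by (rule drel_inj[OF diagram_comp_in[OF d] d(2)]) (use that in \<open>simp add: c drel_idem[OF D] Id_on_relcomp\<close>)
  assume ne: "Domain (drel q) \<noteq> D"
  show "diagram_comp (idem D) q \<notin> B"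
  proof
    assume "diagram_comp (idem D) q \<in> B"
    then have R: "Range (Id_on D O drel q) = Range (drel q)" using q c unfolding B_eq drel_idem[OF D] by simp
    have sub: "Domain (drel q) \<subseteq> D"
    proof
      fix A assume "A \<in> Domain (drel q)"
      then obtain C where C: "(A, C) \<in> drel q" by blast
      then have "C \<in> Range (Id_on D O drel q)" using R by blast
      then obtain A' where "A' \<in> D" "(A', C) \<in> drel q" by auto
      then show "A \<in> D" using uniform_functional(2)[OF B_uniform[OF q] C] by simp
    qed
    have card: "card (Domain (drel p)) = card (unions (blocks l m))" if "p \<in> B" for p
    proof -
      have "card (Range (drel (flip p))) = card (Range (drel p))"
        using card_Range_uniform[OF flip_uniform[OF B_uniform[OF that]]] card_Range_uniform[OF B_uniform[OF that]]
        by (simp add: drel_flip)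
      then show ?thesis using that unfolding B_eq by (simp add: drel_flip)
    qed
    have "card (Domain (drel q)) = card D" using card[OF q] card[of "rep_of D"] rep_of[OF D] by simp
    moreover have "finite D"
      using rep_of[OF D] finite_Domain[OF finite_drel[OF uniform_diagrams[OF B_uniform]]] by metis
    ultimately show False using card_subset_eq[OF _ sub] ne by simp
  qed
qed

text \<open>The product of \<open>flip q'\<close> and \<open>q\<close> has blocks on both sides and
  is therefore a block permutation; \<open>q'\<close> times its flip is the partial identity on the
  common domain.\<close>

lemma same_domain_orbit:
  assumes "q \<in> B" "q' \<in> B" "Domain (drel q) = Domain (drel q')"
  shows "\<exists>\<sigma>\<in>carrier G. q = diagram_comp q' (block_perm \<sigma>)"
proof -
  note U = B_uniform[OF assms(1)] B_uniform[OF assms(2)]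
  note d = U[THEN uniform_diagrams]
  have *: "diagram_comp (flip p') p \<in> B" if "p \<in> B" "p' \<in> B" "Domain (drel p) = Domain (drel p')" for p p'
  proof -
    note pU = B_uniform[OF that(1)] B_uniform[OF that(2)]
    note pd = flip_in[OF uniform_diagrams[OF pU(2)]] uniform_diagrams[OF pU(1)]
    have "diagram_comp (flip p') p \<in> U"
      by (rule uniform_comp_Domain[OF flip_uniform[OF pU(2)] pU(1)]) (simp add: drel_flip that(3))
    moreover have "Range (drel (diagram_comp (flip p') p)) = Range (drel p)"
      unfolding drel_comp[OF pd] drel_flip using that(3) by blast
    ultimately show ?thesis using that(1) unfolding B_eq by simp
  qed
  have "flip (diagram_comp (flip q') q) = diagram_comp (flip q) q'"
    using flip_comp(1)[OF flip_in[OF d(2)] d(1)] by simp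
  then obtain \<sigma> where \<sigma>: "\<sigma> \<in> carrier G" "diagram_comp (flip q') q = block_perm \<sigma>"
    using obtain_block_perm[of "diagram_comp (flip q') q"] *[OF assms] *[OF assms(2,1) assms(3)[symmetric]] by metis
  have "diagram_comp q' (block_perm \<sigma>) = diagram_comp (diagram_comp q' (flip q')) q"
    unfolding \<sigma>(2)[symmetric] by (rule diagram_comp_assoc[symmetric, OF d(2) flip_in[OF d(2)] d(1)])
  also have "\<dots> = q"
  proof (rule drel_inj[OF diagram_comp_in[OF diagram_comp_in[OF d(2) flip_in[OF d(2)]] d(1)] d(1)])
    show "drel (diagram_comp (diagram_comp q' (flip q')) q) = drel q"
      unfolding drel_comp[OF diagram_comp_in[OF d(2) flip_in[OF d(2)]] d(1)] drel_comp[OF d(2) flip_in[OF d(2)]] drel_flip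
        uniform_converse_comp(2)[OF U(2)] by (rule Id_on_relcomp) (simp add: assms(3))
  qed
  finally show ?thesis using \<sigma>(1) by metis
qed

lemma block_perm_inj: "inj_on block_perm (carrier G)"
proof (rule inj_onI)
  fix \<sigma> \<tau> assume s: "\<sigma> \<in> carrier G" "\<tau> \<in> carrier G" "block_perm \<sigma> = block_perm \<tau>"
  have "\<sigma> i j = \<tau> i j" if "(i, j) \<in> X0" for i j
  proof -
    have "lb (perm_index \<sigma> (i, j)) <+> lb (i, j) \<in> block_perm \<tau>" using that s(3) unfolding block_perm_def by blast
    then obtain k where k: "k \<in> X0" "lb (perm_index \<sigma> (i, j)) = lb (perm_index \<tau> k)" "lb (i, j) = lb k"
      unfolding block_perm_def by (auto simp: Plus_inject)
    then have "k = (i, j)" using inj_onD[OF lb_inj _ that k(1)] by simp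
    then have "perm_index \<sigma> (i, j) = perm_index \<tau> (i, j)"
      using inj_onD[OF lb_inj k(2)] perm_index_in[OF s(1) that] perm_index_in[OF s(2) k(1)] by simp
    then show ?thesis unfolding perm_index_def by simp
  qed
  then have "\<sigma> i = \<tau> i" if i: "i \<in> {1..l}" for i
  proof (intro ext)
    fix j show "\<sigma> i j = \<tau> i j"
    proof (cases "j \<in> {1..m i}")
      case False
      then show ?thesis using permutes_not_in[OF G_permutes[OF s(1) i]] permutes_not_in[OF G_permutes[OF s(2) i]] by simp
    qed (use i \<open>\<And>j i. (i, j) \<in> X0 \<Longrightarrow> \<sigma> i j = \<tau> i j\<close> in simp)
  qed
  then show "\<sigma> = \<tau>" using s(1,2) unfolding carrier_G by (intro PiE_ext) auto
qed

text \<open>Freeness of the right action: multiplying by \<open>flip q\<close> from the left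
  recovers the block permutation.\<close>

lemma comp_block_perm_inj:
  assumes "q \<in> B" "\<sigma> \<in> carrier G" "\<tau> \<in> carrier G" "diagram_comp q (block_perm \<sigma>) = diagram_comp q (block_perm \<tau>)"
  shows "\<sigma> = \<tau>"
proof -
  note d = uniform_diagrams[OF B_uniform[OF assms(1)]]
  have "diagram_comp (flip q) (diagram_comp q (block_perm \<sigma>)) = block_perm \<sigma>" if "\<sigma> \<in> carrier G" for \<sigma>
  proof -
    note g = block_perm_diagrams[OF that]
    have "diagram_comp (flip q) (diagram_comp q (block_perm \<sigma>)) = diagram_comp a (block_perm \<sigma>)"
      using diagram_comp_assoc[OF flip_in[OF d] d g] flip_comp_B[OF assms(1)] by simp
    also have "\<dots> = block_perm (\<one>\<^bsub>G\<^esub> \<otimes>\<^bsub>G\<^esub> \<sigma>)"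
      unfolding block_perm_one[symmetric] by (rule block_perm_mult[OF _ that]) (rule monoid.one_closed[OF group.is_monoid[OF group_G]])
    finally show ?thesis using monoid.l_one[OF group.is_monoid[OF group_G] that] by simp
  qed
  then show ?thesis using inj_onD[OF block_perm_inj _ assms(2,3)] assms(2-4) by metis
qed

lemma dterm1_mult_supp:
  assumes "p \<in> U" "x \<in> supp_B"
  shows "(diagram_elt p \<bullet> x) q = (\<Sum>p'\<in>B. if diagram_comp p p' = q then x p' else 0)"
proof -
  have "(diagram_elt p \<bullet> x) q = (\<Sum>p'\<in>T. if diagram_comp p p' = q then x p' else 0)"
    unfolding diagram_elt_dterm mult_dterm_left[OF uniform_tonal[OF assms(1)]]
    using uniform_loops[OF uniform_diagrams[OF assms(1)] tonal_diagrams[of _ l], of _ l] assms(1) by (intro sum.cong refl) simp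
  also have "\<dots> = (\<Sum>p'\<in>B. if diagram_comp p p' = q then x p' else 0)"
    by (rule sum.mono_neutral_right) (use finite_tonal B_tonal assms(2) in \<open>auto simp: supp_B_def\<close>)
  finally show ?thesis .
qed

definition proj :: "nat set set \<Rightarrow> (diagram \<Rightarrow> 'k) \<Rightarrow> diagram \<Rightarrow> 'k" where
  "proj D x = (\<lambda>q. if q \<in> B \<and> Domain (drel q) = D then x q else 0)"

lemma restr_idem_mult:
  assumes D: "D \<in> doms" and x: "x \<in> supp_B"
  shows "restr (diagram_elt (idem D) \<bullet> x) = proj D x"
proof
  fix q
  show "restr (diagram_elt (idem D) \<bullet> x) q = proj D x q"
  proof (cases "q \<in> B")
    case True
    have "(if diagram_comp (idem D) p = q then x p else 0) = (if p = q then (if Domain (drel q) = D then x q else 0) else 0)"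
      if p: "p \<in> B" for p
      using idem_comp[OF D p] True by (cases "Domain (drel p) = D") auto
    then have "(diagram_elt (idem D) \<bullet> x) q = (\<Sum>p\<in>B. if p = q then (if Domain (drel q) = D then x q else 0) else 0)"
      unfolding dterm1_mult_supp[OF idem_uniform[OF D] x] by (intro sum.cong refl)
    then show ?thesis using True finite_B unfolding restr_def proj_def by simp
  qed (simp add: restr_def proj_def)
qed

lemma smult_idem: "D \<in> doms \<Longrightarrow> x \<in> supp_B \<Longrightarrow> diagram_elt (idem D) \<odot>\<^bsub>LM\<^esub> cls x = cls (proj D x)"
  using smult_LM[OF diagram_elt_in[OF uniform_tonal[OF idem_uniform]] supp_B_carrier]
    cls_mult_supp[OF diagram_elt_in[OF uniform_tonal[OF idem_uniform]]] restr_idem_mult by simp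

lemma diagram_elt_supp: "q \<in> B \<Longrightarrow> diagram_elt q \<in> supp_B"
  unfolding supp_B_def diagram_elt_def by auto

text \<open>The basis diagrams with upper half \<open>D\<close> form one free orbit through
  \<open>rep_of D\<close>, so the component of \<open>x\<close> at \<open>D\<close> is
  \<open>rep_of D\<close> times a group ring element whose coefficients are read off along this
  orbit.\<close>

lemma proj_eq_grp:
  assumes D: "D \<in> doms"
  shows "proj D x = diagram_elt (rep_of D) \<bullet>
    grp (\<lambda>\<sigma>. if \<sigma> \<in> carrier G then x (diagram_comp (rep_of D) (block_perm \<sigma>)) else 0)" (is "_ = _ \<bullet> grp ?f")
proof
  fix q
  have r: "rep_of D \<in> B" "Domain (drel (rep_of D)) = D" using rep_of[OF D] by auto
  have "(diagram_elt (rep_of D) \<bullet> grp ?f) q =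
      (\<Sum>\<sigma>\<in>carrier G. \<Sum>p\<in>B. if diagram_comp p (block_perm \<sigma>) = q then diagram_elt (rep_of D) p * ?f \<sigma> else 0)"
    unfolding supp_mult_grp[OF diagram_elt_supp[OF r(1)]] ..
  also have "\<dots> = (\<Sum>\<sigma>\<in>carrier G. if diagram_comp (rep_of D) (block_perm \<sigma>) = q then x q else 0)"
  proof (rule sum.cong[OF refl])
    fix \<sigma> assume \<sigma>: "\<sigma> \<in> carrier G"
    have "(\<Sum>p\<in>B. if diagram_comp p (block_perm \<sigma>) = q then diagram_elt (rep_of D) p * ?f \<sigma> else 0) =
        (\<Sum>p\<in>B. if p = rep_of D then (if diagram_comp (rep_of D) (block_perm \<sigma>) = q then x q else 0) else 0)"
      using \<sigma> by (intro sum.cong refl) (auto simp: diagram_elt_def)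
    then show "(\<Sum>p\<in>B. if diagram_comp p (block_perm \<sigma>) = q then diagram_elt (rep_of D) p * ?f \<sigma> else 0) =
        (if diagram_comp (rep_of D) (block_perm \<sigma>) = q then x q else 0)" using finite_B r(1) by simp
  qed
  also have "\<dots> = proj D x q"
  proof (cases "q \<in> B \<and> Domain (drel q) = D")
    case True
    then obtain \<tau> where \<tau>: "\<tau> \<in> carrier G" "q = diagram_comp (rep_of D) (block_perm \<tau>)"
      using same_domain_orbit[of q "rep_of D"] r by auto
    have "(\<Sum>\<sigma>\<in>carrier G. if diagram_comp (rep_of D) (block_perm \<sigma>) = q then x q else 0) =
        (\<Sum>\<sigma>\<in>carrier G. if \<sigma> = \<tau> then x q else 0)"
      using comp_block_perm_inj[OF r(1)] \<tau> by (intro sum.cong refl) auto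
    then show ?thesis using True \<tau>(1) finite_G unfolding proj_def by simp
  next
    case False
    have "diagram_comp (rep_of D) (block_perm \<sigma>) \<noteq> q" if \<sigma>: "\<sigma> \<in> carrier G" for \<sigma>
    proof
      assume q: "diagram_comp (rep_of D) (block_perm \<sigma>) = q"
      then have "q \<in> B" using comp_block_perm_B[OF r(1) \<sigma>] by simp
      moreover have "Domain (drel q) = D"
      proof -
        have "Range (drel (rep_of D)) = Domain (drel (block_perm \<sigma>))" using r(1) Domain_block_perm[OF \<sigma>] B_eq by auto
        then have "Domain (drel (rep_of D) O drel (block_perm \<sigma>)) = Domain (drel (rep_of D))" by blast
        then show ?thesis
          unfolding q[symmetric] drel_comp[OF uniform_diagrams[OF B_uniform[OF r(1)]] block_perm_diagrams[OF \<sigma>]] using r(2) by simp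
      qed
      ultimately show False using False by blast
    qed
    then have "(\<Sum>\<sigma>\<in>carrier G. if diagram_comp (rep_of D) (block_perm \<sigma>) = q then x q else 0) = 0" by (intro sum.neutral) auto
    then show ?thesis using False unfolding proj_def by auto
  qed
  finally show "proj D x q = (diagram_elt (rep_of D) \<bullet> grp ?f) q" by simp
qed

definition gen :: "nat set set \<Rightarrow> (diagram \<Rightarrow> 'k) set" where
  "gen D = cls (diagram_elt (rep_of D))"

lemma gen_in: "D \<in> doms \<Longrightarrow> gen D \<in> carrier LM"
  unfolding gen_def carrier_LM using diagram_elt_supp rep_of by blast

lemma group_ring_carrier:
  assumes "\<And>\<sigma>. \<sigma> \<notin> carrier G \<Longrightarrow> f \<sigma> = 0"
  shows "f \<in> carrier (group_ring G)"
proof -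
  have sub: "{g. f g \<noteq> 0} \<subseteq> carrier G" using assms by auto
  then have "finite {g. f g \<noteq> 0}" using finite_G finite_subset by blast
  then show ?thesis unfolding group_ring_def using sub by simp
qed

text \<open>On a pure tensor the idempotent leaves \<open>gen D\<close> acted on by a group ring
  element, which then moves across the tensor sign. Hence its image consists of pure tensors with
  the fixed left factor \<open>gen D\<close>.\<close>

lemma smult_idem_TM:
  assumes D: "D \<in> doms" and u: "u \<in> carrier ST.TM"
  shows "\<exists>v\<in>carrier NM. diagram_elt (idem D) \<odot>\<^bsub>ST.TM\<^esub> u = ST.tens (gen D) v"
  using u
proof (induction rule: ST.TM_induct)
  case zero
  show ?case
    using TM.smult_zero_right[OF diagram_elt_in[OF uniform_tonal[OF idem_uniform[OF D]]]] tens_zero_right[OF gen_in[OF D]]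
    by (intro bexI[of _ "\<zero>\<^bsub>NM\<^esub>"]) simp_all
next
  case (diff u v)
  obtain x y where xy: "x \<in> carrier NM" "diagram_elt (idem D) \<odot>\<^bsub>ST.TM\<^esub> u = ST.tens (gen D) x"
    "y \<in> carrier NM" "diagram_elt (idem D) \<odot>\<^bsub>ST.TM\<^esub> v = ST.tens (gen D) y" using diff by blast
  have "ST.tens (gen D) (x \<ominus>\<^bsub>NM\<^esub> y) \<oplus>\<^bsub>ST.TM\<^esub> ST.tens (gen D) y = ST.tens (gen D) x"
    using ST.tens_add_right[OF gen_in[OF D], of "x \<ominus>\<^bsub>NM\<^esub> y" y] xy(1,3)
    by (simp add: a_minus_def NA.a_assoc NA.l_neg)
  then have "ST.tens (gen D) x \<ominus>\<^bsub>ST.TM\<^esub> ST.tens (gen D) y = ST.tens (gen D) (x \<ominus>\<^bsub>NM\<^esub> y)"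
    using TM_diff_eq[OF ST.tens_in[OF gen_in[OF D] NA.minus_closed[OF xy(1,3)]] ST.tens_in[OF gen_in[OF D] xy(3)]] by simp
  moreover have "x \<ominus>\<^bsub>NM\<^esub> y \<in> carrier NM" using xy by simp
  ultimately show ?case
    using TM.smult_diff_right[OF diagram_elt_in[OF uniform_tonal[OF idem_uniform[OF D]]] diff.hyps(1,2)] xy by metis
next
  case (tens Z v)
  then obtain x where x: "x \<in> supp_B" "Z = cls x" unfolding carrier_LM by blast
  define f where "f = (\<lambda>\<sigma>. if \<sigma> \<in> carrier G then x (diagram_comp (rep_of D) (block_perm \<sigma>)) else 0)"
  have f: "f \<in> carrier (group_ring G)" by (rule group_ring_carrier) (simp add: f_def)
  have "diagram_elt (idem D) \<odot>\<^bsub>ST.TM\<^esub> ST.tens Z v = ST.tens (cls (proj D x)) v"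
    using ST.smult_tens[OF diagram_elt_in[OF uniform_tonal[OF idem_uniform[OF D]]]] smult_idem[OF D x(1)] x(2) by simp
  also have "cls (proj D x) = index_right_action \<delta> l n m (gen D) f"
    unfolding gen_def right_action[OF diagram_elt_supp[OF conjunct1[OF rep_of[OF D]]]] proj_eq_grp[OF D] f_def ..
  also have "ST.tens (index_right_action \<delta> l n m (gen D) f) v = ST.tens (gen D) (f \<odot>\<^bsub>NM\<^esub> v)"
    by (rule ST.tens_balanced[OF gen_in[OF D] f tens(2)])
  finally show ?case using ST.N_smult[OF f tens(2)] by blast
qed

lemma finite_doms: "finite doms"
  unfolding doms_def using finite_B by simp

lemma idem_sum_identity:
  assumes u: "u \<in> carrier ST.TM"
  shows "(\<lambda>q. \<Sum>D\<in>doms. diagram_elt (idem D) q) \<odot>\<^bsub>ST.TM\<^esub> u = u"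
proof -
  define E where "E = (\<lambda>q. \<Sum>D\<in>doms. diagram_elt (idem D) q :: 'k)"
  have E: "E \<in> carrier P" unfolding E_def
    by (rule carrier_sum) (rule diagram_elt_in[OF uniform_tonal[OF idem_uniform]])
  have "E \<odot>\<^bsub>ST.TM\<^esub> u = u"
    using u
  proof (induction rule: ST.TM_induct)
    case zero
    show ?case by (rule TM.smult_zero_right[OF E])
  next
    case (diff u v)
    then show ?case using TM.smult_diff_right[OF E] by simp
  next
    case (tens Z v)
    then obtain x where x: "x \<in> supp_B" "Z = cls x" unfolding carrier_LM by blast
    have "restr (E \<bullet> x) = x"
    proof
      fix q
      show "restr (E \<bullet> x) q = x q"
      proof (cases "q \<in> B")
        case True
        have "(E \<bullet> x) q = (\<Sum>D\<in>doms. (diagram_elt (idem D) \<bullet> x) q)" unfolding E_def mult_sum_left ..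
        also have "\<dots> = (\<Sum>D\<in>doms. if D = Domain (drel q) then x q else 0)"
        proof (rule sum.cong[OF refl])
          fix D assume D: "D \<in> doms"
          show "(diagram_elt (idem D) \<bullet> x) q = (if D = Domain (drel q) then x q else 0)"
            using fun_cong[OF restr_idem_mult[OF D x(1)], of q] True unfolding restr_def proj_def by auto
        qed
        also have "\<dots> = x q" using True finite_doms unfolding doms_def by simp
        finally show ?thesis using True unfolding restr_def by simp
      qed (use x(1) in \<open>simp add: restr_def supp_B_def\<close>)
    qed
    then have "E \<odot>\<^bsub>LM\<^esub> Z = Z" using smult_LM[OF E supp_B_carrier[OF x(1)]] cls_mult_supp[OF E x(1)] x(2) by simp
    then show ?case using ST.smult_tens[OF E] by simp
  qed
  then show ?thesis unfolding E_def .
qed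

text \<open>The sum of all the idempotents acts as the identity, so they cannot all annihilate a
  nonzero element.\<close>

lemma exists_idem_nonzero:
  assumes u: "u \<in> carrier ST.TM" "u \<noteq> \<zero>\<^bsub>ST.TM\<^esub>"
  shows "\<exists>D\<in>doms. diagram_elt (idem D) \<odot>\<^bsub>ST.TM\<^esub> u \<noteq> \<zero>\<^bsub>ST.TM\<^esub>"
proof (rule ccontr)
  assume z: "\<not> (\<exists>D\<in>doms. diagram_elt (idem D) \<odot>\<^bsub>ST.TM\<^esub> u \<noteq> \<zero>\<^bsub>ST.TM\<^esub>)"
  have "(\<lambda>q. \<Sum>D\<in>Ds. diagram_elt (idem D) q) \<odot>\<^bsub>ST.TM\<^esub> u = \<zero>\<^bsub>ST.TM\<^esub>" if "Ds \<subseteq> doms" for Ds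
    using finite_subset[OF that finite_doms] that
  proof (induction Ds)
    case empty
    have z: "(\<lambda>q. 0) \<in> carrier P" unfolding tonal_algebra_def by simp
    have "(\<lambda>q. 0) \<odot>\<^bsub>ST.TM\<^esub> u \<oplus>\<^bsub>ST.TM\<^esub> (\<lambda>q. 0) \<odot>\<^bsub>ST.TM\<^esub> u = (\<lambda>q. 0) \<odot>\<^bsub>ST.TM\<^esub> u"
      using TM.smult_l_distr[OF z z u(1)] by (simp add: add_P)
    then show ?case using TM_double[OF TM.smult_closed[OF z u(1)]] by simp
  next
    case (insert D Ds)
    have c: "diagram_elt (idem D) \<in> carrier P" "(\<lambda>q. \<Sum>D\<in>Ds. diagram_elt (idem D) q) \<in> carrier P"
      using insert.prems by (auto intro!: carrier_sum diagram_elt_in[OF uniform_tonal[OF idem_uniform]])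
    show ?case using TM.smult_l_distr[OF c u(1)] insert z by (simp add: add_P)
  qed
  then show False using idem_sum_identity[OF u(1)] u(2) by auto
qed

text \<open>
  A submodule meets \<open>gen D \<otimes> N\<close> for some \<open>D\<close> in a nonzero submodule of the Specht module \<open>N\<close>.
\<close>

lemma simple_standard_module:
  assumes NS: "\<And>N'. N' \<subseteq> carrier NM \<Longrightarrow> (\<And>u v. u \<in> N' \<Longrightarrow> v \<in> N' \<Longrightarrow> u \<oplus>\<^bsub>NM\<^esub> v \<in> N') \<Longrightarrow>
      (\<And>f u. f \<in> carrier (group_ring G) \<Longrightarrow> u \<in> N' \<Longrightarrow> f \<odot>\<^bsub>NM\<^esub> u \<in> N') \<Longrightarrow>
      (\<exists>u\<in>N'. u \<noteq> \<zero>\<^bsub>NM\<^esub>) \<Longrightarrow> N' = carrier NM"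
    and nonzero: "\<exists>u\<in>carrier ST.TM. u \<noteq> \<zero>\<^bsub>ST.TM\<^esub>"
  shows "simple_module P (standard_module \<delta> l n m \<mu>)"
  unfolding standard_module_eq simple_module_def
proof (intro conjI allI impI)
  show "left_module P ST.TM" by (rule ST.TM_left_module)
  show "carrier ST.TM \<noteq> {\<zero>\<^bsub>ST.TM\<^esub>}" using nonzero by auto
  fix V assume V: "submodule V P ST.TM"
  interpret V: submodule V P ST.TM by (rule V)
  have Vadd: "u \<oplus>\<^bsub>ST.TM\<^esub> v \<in> V" if "u \<in> V" "v \<in> V" for u v using V.m_closed[OF that] by simp
  have Vz: "\<zero>\<^bsub>ST.TM\<^esub> \<in> V" using V.one_closed by simp
  have Vsub: "V \<subseteq> carrier ST.TM" using V.subset by simp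
  have Vm: "\<ominus>\<^bsub>ST.TM\<^esub> v \<in> V" if "v \<in> V" for v using V.m_inv_closed[OF that] unfolding a_inv_def by simp
  show "V = {\<zero>\<^bsub>ST.TM\<^esub>} \<or> V = carrier ST.TM"
  proof (cases "V = {\<zero>\<^bsub>ST.TM\<^esub>}")
    case False
    then obtain u where u: "u \<in> V" "u \<noteq> \<zero>\<^bsub>ST.TM\<^esub>" using Vz by blast
    then obtain D where D: "D \<in> doms" "diagram_elt (idem D) \<odot>\<^bsub>ST.TM\<^esub> u \<noteq> \<zero>\<^bsub>ST.TM\<^esub>"
      using exists_idem_nonzero Vsub by blast
    obtain v where v: "v \<in> carrier NM" "diagram_elt (idem D) \<odot>\<^bsub>ST.TM\<^esub> u = ST.tens (gen D) v"
      using smult_idem_TM[OF D(1)] u(1) Vsub by blast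
    have r: "rep_of D \<in> B" using rep_of[OF D(1)] by blast
    note rc = diagram_elt_in[OF B_tonal[OF r]]
    have fr: "diagram_elt (flip (rep_of D)) \<in> carrier P" by (rule diagram_elt_in[OF flip_tonal[OF B_tonal[OF r]]])
    have fa: "diagram_elt (flip (rep_of D)) \<bullet> diagram_elt (rep_of D) = diagram_elt a"
      using mult_elts_uniform[OF flip_tonal[OF B_tonal[OF r]] B_tonal[OF r]] B_uniform[OF r] flip_comp_B[OF r] by simp
    \<comment> \<open>The flip takes \<open>rep_of D\<close> to \<open>a\<close>, and from
      \<open>a\<close> every element of the left ideal can be reached.\<close>
    have act: "(x \<bullet> diagram_elt (flip (rep_of D))) \<odot>\<^bsub>LM\<^esub> gen D = cls x" if "x \<in> supp_B" for x
      unfolding gen_def smult_LM[OF mult_closed rc] mult_assoc_P fa supp_B_mult_a[OF that] ..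
    define N' where "N' = {v \<in> carrier NM. ST.tens (gen D) v \<in> V}"
    have "N' = carrier NM"
    proof (rule NS)
      show "N' \<subseteq> carrier NM" unfolding N'_def by blast
      show "x \<oplus>\<^bsub>NM\<^esub> y \<in> N'" if "x \<in> N'" "y \<in> N'" for x y
        using that ST.N_add ST.tens_add_right[OF gen_in[OF D(1)]] Vadd unfolding N'_def by auto
      show "f \<odot>\<^bsub>NM\<^esub> x \<in> N'" if f: "f \<in> carrier (group_ring G)" and x: "x \<in> N'" for f x
      proof -
        \<comment> \<open>The right action on \<open>gen D\<close> is also the effect of a left
          multiplication, under which the submodule \<open>V\<close> is closed.\<close>
        let ?x = "diagram_elt (rep_of D) \<bullet> grp f"
        have xs: "?x \<in> supp_B" by (rule supp_mult_grp_supp[OF diagram_elt_supp[OF r]])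
        have "ST.tens (gen D) (f \<odot>\<^bsub>NM\<^esub> x) = ST.tens (index_right_action \<delta> l n m (gen D) f) x"
          using ST.tens_balanced[OF gen_in[OF D(1)] f, of x] x unfolding N'_def by simp
        also have "\<dots> = ST.tens (cls ?x) x" unfolding gen_def right_action[OF diagram_elt_supp[OF r]] ..
        also have "\<dots> = (?x \<bullet> diagram_elt (flip (rep_of D))) \<odot>\<^bsub>ST.TM\<^esub> ST.tens (gen D) x"
          using ST.smult_tens[OF mult_closed] act[OF xs] by simp
        also have "\<dots> \<in> V" using V.smult_closed[OF mult_closed] x unfolding N'_def by blast
        finally show ?thesis using ST.N_smult[OF f] x unfolding N'_def by blast
      qed
      have vV: "ST.tens (gen D) v \<in> V"
        using V.smult_closed[OF diagram_elt_in[OF uniform_tonal[OF idem_uniform[OF D(1)]]] u(1)] v(2) by simp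
      have "v \<noteq> \<zero>\<^bsub>NM\<^esub>"
      proof
        assume v0: "v = \<zero>\<^bsub>NM\<^esub>"
        show False using D(2) v(2) tens_zero_right[OF gen_in[OF D(1)]] v0 by simp
      qed
      then show "\<exists>u\<in>N'. u \<noteq> \<zero>\<^bsub>NM\<^esub>" using v(1) vV unfolding N'_def by blast
    qed
    then have gV: "ST.tens (gen D) w \<in> V" if "w \<in> carrier NM" for w using that unfolding N'_def by blast
    have "w \<in> V" if "w \<in> carrier ST.TM" for w
      using that
    proof (induction rule: ST.TM_induct)
      case zero
      show ?case by (rule Vz)
    next
      case (diff u v)
      then show ?case unfolding a_minus_def using Vadd Vm by blast
    next
      case (tens Z v)
      then obtain x where x: "x \<in> supp_B" "Z = cls x" unfolding carrier_LM by blast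
      have "ST.tens Z v = (x \<bullet> diagram_elt (flip (rep_of D))) \<odot>\<^bsub>ST.TM\<^esub> ST.tens (gen D) v"
        using ST.smult_tens[OF mult_closed] act[OF x(1)] x(2) by simp
      then show ?case using V.smult_closed[OF mult_closed gV[OF tens(2)]] by simp
    qed
    then show ?thesis using Vsub by blast
  qed simp
qed

end


section \<open>Complex Specht modules\<close>

lemma finite_young_cells: "finite (young_cells \<mu>)"
proof -
  have "young_cells \<mu> = (SIGMA a:{..<length \<mu>}. {..<\<mu> ! a})" unfolding young_cells_def by auto
  then show ?thesis by simp
qed

text \<open>As the rows weakly decrease in length, a column is an initial segment of row indices;
  its height is the first missing row.\<close>

lemma column_height:
  assumes "sorted_wrt (\<ge>) \<mu>"
  shows "\<exists>h. \<forall>a. (a, b) \<in> young_cells \<mu> \<longleftrightarrow> a < h"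
proof (intro exI allI)
  fix a
  have ex: "(length \<mu>, b) \<notin> young_cells \<mu>" unfolding young_cells_def by simp
  show "(a, b) \<in> young_cells \<mu> \<longleftrightarrow> a < (LEAST a. (a, b) \<notin> young_cells \<mu>)" (is "_ \<longleftrightarrow> _ < ?h")
  proof
    assume a: "(a, b) \<in> young_cells \<mu>"
    show "a < ?h"
    proof (rule ccontr)
      assume "\<not> a < ?h"
      then have "?h = a \<or> \<mu> ! a \<le> \<mu> ! ?h" using sorted_wrt_nth_less[OF assms, of ?h a] a unfolding young_cells_def by fastforce
      then have "(?h, b) \<in> young_cells \<mu>" using a \<open>\<not> a < ?h\<close> unfolding young_cells_def by auto
      then show False using LeastI[of "\<lambda>a. (a, b) \<notin> young_cells \<mu>", OF ex] by blast
    qed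
  next
    assume "a < ?h"
    then show "(a, b) \<in> young_cells \<mu>" using not_less_Least by blast
  qed
qed

text \<open>
  For a partition \<open>\<mu>\<close>, at most \<open>min k h\<close> of the images of the \<open>h\<close> cells of a column lie in the first
  \<open>k\<close> rows; as the first \<open>k\<close> rows are filled, equality holds.
\<close>

lemma column_rearrangement:
  assumes \<mu>: "sorted_wrt (\<ge>) \<mu>" and g: "bij_betw g (young_cells \<mu>) (young_cells \<mu>)"
    and inj: "\<And>c d. c \<in> young_cells \<mu> \<Longrightarrow> d \<in> young_cells \<mu> \<Longrightarrow> snd c = snd d \<Longrightarrow> fst (g c) = fst (g d) \<Longrightarrow> c = d"
    and c: "c \<in> young_cells \<mu>"
  shows "(fst (g c), snd c) \<in> young_cells \<mu>"
proof -
  let ?Y = "young_cells \<mu>"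
  note fin = finite_young_cells[of \<mu>]
  obtain k where k: "\<And>a. (a, snd c) \<in> ?Y \<longleftrightarrow> a < k" using column_height[OF \<mu>] by blast
  \<comment> \<open>Here \<open>k\<close> is the height of the column of \<open>c\<close>. For each
    column, \<open>f\<close> counts the cells that \<open>g\<close> sends to the first
    \<open>k\<close> rows and \<open>e\<close> those that lie there. The totals agree since
    \<open>g\<close> is a bijection, and \<open>f\<close> is at most \<open>e\<close>; so they agree
    in the column of \<open>c\<close>, where \<open>e\<close> counts every cell.\<close>
  define f where "f b = card {d \<in> ?Y. snd d = b \<and> fst (g d) < k}" for b
  define e where "e b = card {d \<in> ?Y. snd d = b \<and> fst d < k}" for b
  have split: "(\<Sum>b\<in>snd ` ?Y. card {d \<in> ?Y. snd d = b \<and> Q d}) = card {d \<in> ?Y. Q d}" for Q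
  proof -
    have "{d \<in> ?Y. Q d} = (\<Union>b\<in>snd ` ?Y. {d \<in> ?Y. snd d = b \<and> Q d})" by auto
    then have "card {d \<in> ?Y. Q d} = card (\<Union>b\<in>snd ` ?Y. {d \<in> ?Y. snd d = b \<and> Q d})" by simp
    also have "\<dots> = (\<Sum>b\<in>snd ` ?Y. card {d \<in> ?Y. snd d = b \<and> Q d})"
    proof (rule card_UN_disjoint)
      show "finite (snd ` ?Y)" using fin by simp
      show "\<forall>b\<in>snd ` ?Y. finite {d \<in> ?Y. snd d = b \<and> Q d}" using fin by simp
      show "\<forall>b\<in>snd ` ?Y. \<forall>b'\<in>snd ` ?Y. b \<noteq> b' \<longrightarrow> {d \<in> ?Y. snd d = b \<and> Q d} \<inter> {d \<in> ?Y. snd d = b' \<and> Q d} = {}" by auto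
    qed
    finally show ?thesis ..
  qed
  have "bij_betw g {d \<in> ?Y. fst (g d) < k} {d \<in> ?Y. fst d < k}"
  proof (rule bij_betw_imageI)
    show "inj_on g {d \<in> ?Y. fst (g d) < k}" by (rule inj_on_subset[OF bij_betw_imp_inj_on[OF g]]) simp
    show "g ` {d \<in> ?Y. fst (g d) < k} = {d \<in> ?Y. fst d < k}"
    proof (intro equalityI subsetI)
      fix d assume "d \<in> {d \<in> ?Y. fst d < k}"
      then obtain d' where "d' \<in> ?Y" "d = g d'" "fst d < k" using bij_betw_imp_surj_on[OF g] by blast
      then show "d \<in> g ` {d \<in> ?Y. fst (g d) < k}" by simp
    qed (use bij_betw_apply[OF g] in auto)
  qed
  then have total: "sum f (snd ` ?Y) = sum e (snd ` ?Y)"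
    unfolding f_def e_def split by (rule bij_betw_same_card)
  have le: "f b \<le> e b" for b
  proof -
    obtain h where h: "\<And>a. (a, b) \<in> ?Y \<longleftrightarrow> a < h" using column_height[OF \<mu>] by blast
    have col: "{d \<in> ?Y. snd d = b \<and> fst d < j} = (\<lambda>a. (a, b)) ` {..<min h j}" for j
    proof (intro equalityI subsetI)
      fix d assume "d \<in> {d \<in> ?Y. snd d = b \<and> fst d < j}"
      then have "d = (fst d, b)" "(fst d, b) \<in> ?Y" "fst d < j" by (auto simp: prod_eq_iff)
      then show "d \<in> (\<lambda>a. (a, b)) ` {..<min h j}" unfolding h by (intro image_eqI[of _ _ "fst d"]) simp_all
    next
      fix d assume "d \<in> (\<lambda>a. (a, b)) ` {..<min h j}"
      then obtain a where "d = (a, b)" "a < h" "a < j" by auto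
      then show "d \<in> {d \<in> ?Y. snd d = b \<and> fst d < j}" by (simp add: h)
    qed
    have eb: "e b = min h k" unfolding e_def col by (simp add: card_image inj_on_def)
    have "f b \<le> card ((\<lambda>a. (a, b)) ` {..<h})"
      unfolding f_def by (rule card_mono) (use col[of h] in \<open>auto simp: h\<close>)
    moreover have "f b \<le> card {..<k}"
      unfolding f_def by (rule card_inj_on_le[of "fst \<circ> g"]) (use inj in \<open>auto simp: inj_on_def\<close>)
    ultimately show ?thesis unfolding eb by (simp add: card_image inj_on_def)
  qed
  have "f (snd c) = e (snd c)"
    by (rule sum_mono_inv[OF total _ _ finite_imageI[OF fin]]) (use le c in auto)
  moreover have "{d \<in> ?Y. snd d = snd c \<and> fst d < k} = {d \<in> ?Y. snd d = snd c}"
  proof (intro Collect_cong)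
    fix d
    have "d \<in> ?Y \<and> snd d = snd c \<Longrightarrow> fst d < k" using k[of "fst d"] by (metis prod.collapse)
    then show "d \<in> ?Y \<and> snd d = snd c \<and> fst d < k \<longleftrightarrow> d \<in> ?Y \<and> snd d = snd c" by argo
  qed
  ultimately have "card {d \<in> ?Y. snd d = snd c \<and> fst (g d) < k} = card {d \<in> ?Y. snd d = snd c}" unfolding f_def e_def by simp
  then have "{d \<in> ?Y. snd d = snd c \<and> fst (g d) < k} = {d \<in> ?Y. snd d = snd c}"
    by (rule card_subset_eq[rotated 2]) (use fin in auto)
  then have "fst (g c) < k" using c by blast
  then show ?thesis using k by simp
qed

lemma tableauD:
  assumes "t \<in> tableaux \<mu>"
  shows "inj_on t (young_cells \<mu>)" "t ` young_cells \<mu> = {1..sum_list \<mu>}"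
  using assms unfolding tableaux_def bij_betw_def by auto

text \<open>Inclusion row by row suffices because corresponding rows have the same finite
  size.\<close>

lemma tabloid_eqI:
  assumes t: "t \<in> tableaux \<mu>" and t': "t' \<in> tableaux \<mu>"
    and rows: "\<And>a b. (a, b) \<in> young_cells \<mu> \<Longrightarrow> \<exists>b'. (a, b') \<in> young_cells \<mu> \<and> t' (a, b) = t (a, b')"
  shows "tabloid \<mu> t' = tabloid \<mu> t"
  unfolding tabloid_def
proof (rule map_cong[OF refl])
  fix a assume "a \<in> set [0..<length \<mu>]"
  have im: "{u (a, b) | b. (a, b) \<in> young_cells \<mu>} = u ` Pair a ` {b. (a, b) \<in> young_cells \<mu>}" for u :: "nat \<times> nat \<Rightarrow> nat" by auto
  have fin: "finite (Pair a ` {b. (a, b) \<in> young_cells \<mu>})" by (rule finite_subset[OF _ finite_young_cells]) auto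
  have card: "card {u (a, b) | b. (a, b) \<in> young_cells \<mu>} = card (Pair a ` {b. (a, b) \<in> young_cells \<mu>})"
    if "u \<in> tableaux \<mu>" for u
    unfolding im using tableauD(1)[OF that] by (intro card_image) (auto simp: inj_on_def)
  show "{t' (a, b) | b. (a, b) \<in> young_cells \<mu>} = {t (a, b) | b. (a, b) \<in> young_cells \<mu>}"
  proof (rule card_subset_eq)
    show "finite {t (a, b) | b. (a, b) \<in> young_cells \<mu>}" unfolding im using fin by simp
    show "{t' (a, b) | b. (a, b) \<in> young_cells \<mu>} \<subseteq> {t (a, b) | b. (a, b) \<in> young_cells \<mu>}" using rows by blast
  qed (simp only: card[OF t] card[OF t'])
qed

text \<open>Assume that no two entries share a column of \<open>t\<close> and a row of
  \<open>t'\<close>. Move each entry inside its column of \<open>t\<close> to the row that it has in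
  \<open>t'\<close>; by \<open>column_rearrangement\<close> this cell exists. The resulting column
  permutation takes the tabloid of \<open>t'\<close> to that of \<open>t\<close>.\<close>

lemma straighten:
  assumes \<mu>: "sorted_wrt (\<ge>) \<mu>" and t: "t \<in> tableaux \<mu>" and t': "t' \<in> tableaux \<mu>"
    and inj: "\<And>a a' b j j'. (a, b) \<in> young_cells \<mu> \<Longrightarrow> (a', b) \<in> young_cells \<mu> \<Longrightarrow> (j, j') \<in> young_cells \<mu> \<Longrightarrow>
      \<exists>j''. (j, j'') \<in> young_cells \<mu> \<and> t (a, b) = t' (j, j') \<and> t (a', b) = t' (j, j'') \<Longrightarrow> a = a'"
  shows "\<exists>\<psi>\<in>column_stabilizer \<mu> t. map ((`) \<psi>) (tabloid \<mu> t') = tabloid \<mu> t"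
proof -
  let ?Y = "young_cells \<mu>" and ?N = "{1..sum_list \<mu>}"
  define u where "u = inv_into ?Y t"
  define u' where "u' = inv_into ?Y t'"
  define g where "g = u' \<circ> t"
  have bt: "bij_betw t ?Y ?N" "bij_betw t' ?Y ?N" using t t' unfolding tableaux_def by auto
  have bu: "bij_betw u ?N ?Y" "bij_betw u' ?N ?Y" unfolding u_def u'_def using bt bij_betw_inv_into by auto
  have g: "bij_betw g ?Y ?Y" unfolding g_def using bij_betw_trans bt(1) bu(2) by blast
  have ut: "u (t c) = c" if "c \<in> ?Y" for c unfolding u_def using bij_betw_inv_into_left[OF bt(1) that] .
  have tg: "t' (g c) = t c" if "c \<in> ?Y" for c
    unfolding g_def u'_def comp_def using bij_betw_inv_into_right[OF bt(2)] bij_betwE[OF bt(1)] that by simp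
  have gY: "g c \<in> ?Y" if "c \<in> ?Y" for c using bij_betwE[OF g] that by simp
  have g_inj: "c = d" if cd: "c \<in> ?Y" "d \<in> ?Y" "snd c = snd d" "fst (g c) = fst (g d)" for c d
  proof -
    have "fst c = fst d"
    proof (rule inj[of "fst c" "snd c" "fst d" "fst (g c)" "snd (g c)"])
      show "\<exists>j''. (fst (g c), j'') \<in> ?Y \<and> t (fst c, snd c) = t' (fst (g c), snd (g c)) \<and> t (fst d, snd c) = t' (fst (g c), j'')"
      proof (intro exI[of _ "snd (g d)"] conjI)
        show "(fst (g c), snd (g d)) \<in> ?Y" using gY[OF cd(2)] cd(4) by simp
        show "t (fst c, snd c) = t' (fst (g c), snd (g c))" using tg[OF cd(1)] by simp
        show "t (fst d, snd c) = t' (fst (g c), snd (g d))" unfolding cd(3,4) using tg[OF cd(2)] by simp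
      qed
      show "(fst c, snd c) \<in> ?Y" "(fst (g c), snd (g c)) \<in> ?Y" using cd(1) gY[OF cd(1)] by simp_all
      show "(fst d, snd c) \<in> ?Y" unfolding cd(3) using cd(2) by simp
    qed
    then show ?thesis using cd(3) by (rule prod_eqI)
  qed
  define h where "h c = (fst (g c), snd c)" for c
  have hY: "h c \<in> ?Y" if "c \<in> ?Y" for c unfolding h_def by (rule column_rearrangement[OF \<mu> g g_inj that])
  have h_inj: "inj_on h ?Y" by (rule inj_onI) (use g_inj in \<open>auto simp: h_def\<close>)
  have bh: "bij_betw h ?Y ?Y"
    unfolding bij_betw_def using h_inj hY endo_inj_surj[OF finite_young_cells _ h_inj] by blast
  define \<psi> where "\<psi> x = (if x \<in> ?N then t (h (u x)) else x)" for x
  have \<psi>t: "\<psi> (t c) = t (h c)" if "c \<in> ?Y" for c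
    unfolding \<psi>_def using ut[OF that] bij_betwE[OF bt(1)] that by simp
  have "bij_betw (t \<circ> (h \<circ> u)) ?N ?N" by (rule bij_betw_trans[OF bij_betw_trans[OF bu(1) bh] bt(1)])
  then have "bij_betw \<psi> ?N ?N" by (rule bij_betw_cong[THEN iffD1, rotated]) (simp add: \<psi>_def)
  then have perm: "\<psi> permutes ?N" by (rule bij_imp_permutes) (simp only: \<psi>_def if_False)
  have "\<psi> ` {t (a, b) | a. (a, b) \<in> ?Y} = {t (a, b) | a. (a, b) \<in> ?Y}" for b
  proof (rule endo_inj_surj)
    have "{t (a, b) | a. (a, b) \<in> ?Y} \<subseteq> t ` ?Y" by auto
    then show "finite {t (a, b) | a. (a, b) \<in> ?Y}" by (rule finite_subset) (rule finite_imageI[OF finite_young_cells])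
    show "\<psi> ` {t (a, b) | a. (a, b) \<in> ?Y} \<subseteq> {t (a, b) | a. (a, b) \<in> ?Y}"
    proof
      fix y assume "y \<in> \<psi> ` {t (a, b) | a. (a, b) \<in> ?Y}"
      then obtain a where a: "(a, b) \<in> ?Y" "y = \<psi> (t (a, b))" by blast
      then have "y = t (fst (g (a, b)), b)" "(fst (g (a, b)), b) \<in> ?Y"
        using \<psi>t[OF a(1)] hY[OF a(1)] unfolding h_def by simp_all
      then show "y \<in> {t (a, b) | a. (a, b) \<in> ?Y}" by blast
    qed
    show "inj_on \<psi> {t (a, b) | a. (a, b) \<in> ?Y}" using permutes_inj[OF perm] inj_on_subset by blast
  qed
  then have stab: "\<psi> \<in> column_stabilizer \<mu> t" unfolding column_stabilizer_def using perm by blast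
  have "tabloid \<mu> (\<psi> \<circ> t') = tabloid \<mu> t"
  proof (rule tabloid_eqI[OF t tableaux_permuted[OF perm t']])
    fix a b assume ab: "(a, b) \<in> ?Y"
    define c where "c = u (t' (a, b))"
    have c: "c \<in> ?Y" "t c = t' (a, b)"
      unfolding c_def u_def using bij_betw_inv_into_right[OF bt(1)] bij_betwE[OF bu(1)] bij_betwE[OF bt(2)] ab by (auto simp: u_def)
    have "g c = (a, b)" using tg[OF c(1)] c(2) inj_onD[OF tableauD(1)[OF t'] _ gY[OF c(1)] ab] by simp
    then have "(\<psi> \<circ> t') (a, b) = t (a, snd c)" "(a, snd c) \<in> ?Y"
      using \<psi>t[OF c(1)] c(2) hY[OF c(1)] unfolding h_def by simp_all
    then show "\<exists>b'. (a, b') \<in> ?Y \<and> (\<psi> \<circ> t') (a, b) = t (a, b')" by blast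
  qed
  then show ?thesis using stab by (intro bexI[of _ \<psi>]) (simp_all only: map_image_tabloid)
qed

section \<open>Signed column sums\<close>

abbreviation sg :: "(nat \<Rightarrow> nat) \<Rightarrow> complex" where
  "sg \<pi> \<equiv> (if evenperm \<pi> then 1 else - 1)"

lemma permutes_permutation: "\<pi> permutes {1..n :: nat} \<Longrightarrow> permutation \<pi>"
  unfolding permutation_permutes by (rule exI[of _ "{1..n}"]) simp

lemma sg_comp: "\<pi> permutes {1..n :: nat} \<Longrightarrow> \<psi> permutes {1..n} \<Longrightarrow> sg (\<pi> \<circ> \<psi>) = sg \<pi> * sg \<psi>"
  using evenperm_comp[OF permutes_permutation permutes_permutation] by simp

lemma sg_inv: "\<pi> permutes {1..n :: nat} \<Longrightarrow> sg (inv' \<pi>) = sg \<pi>"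
  using evenperm_inv[OF permutes_permutation] by simp

lemma column_stabilizer_comp:
  "\<pi> \<in> column_stabilizer \<mu> t \<Longrightarrow> \<psi> \<in> column_stabilizer \<mu> t \<Longrightarrow> \<pi> \<circ> \<psi> \<in> column_stabilizer \<mu> t"
  unfolding column_stabilizer_def by (auto simp only: permutes_compose image_comp[symmetric] mem_Collect_eq)

lemma column_stabilizer_inv: "\<pi> \<in> column_stabilizer \<mu> t \<Longrightarrow> inv' \<pi> \<in> column_stabilizer \<mu> t"
proof -
  assume \<pi>: "\<pi> \<in> column_stabilizer \<mu> t"
  note p = column_stabilizer_permutes[OF \<pi>]
  have "inv' \<pi> ` {t (a, b) | a. (a, b) \<in> young_cells \<mu>} = {t (a, b) | a. (a, b) \<in> young_cells \<mu>}" (is "_ ` ?C = _") for b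
  proof -
    have "inv' \<pi> ` ?C = inv' \<pi> ` \<pi> ` ?C" using \<pi> unfolding column_stabilizer_def by simp
    also have "\<dots> = ?C" by (simp only: image_image permutes_inverses(2)[OF p] image_ident)
    finally show ?thesis .
  qed
  then show ?thesis using permutes_inv[OF p] unfolding column_stabilizer_def by blast
qed

lemma image_functions_comp: "(`) (f \<circ> g) = (`) f \<circ> (`) g"
  by (simp add: fun_eq_iff image_comp)

text \<open>Matrix entries, on tabloids, of the signed column sum of \<open>t\<close>, the group
  ring element adding up all signed column permutations: the coefficient of \<open>T\<close> in the
  image of \<open>T'\<close>.\<close>

definition column_sum :: "nat list \<Rightarrow> (nat \<times> nat \<Rightarrow> nat) \<Rightarrow> nat set list \<Rightarrow> nat set list \<Rightarrow> complex" where
  "column_sum \<mu> t T T' = (\<Sum>\<pi>\<in>column_stabilizer \<mu> t. if map ((`) \<pi>) T' = T then sg \<pi> else 0)"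

lemma polytabloid_column_sum: "polytabloid \<mu> t T = column_sum \<mu> t T (tabloid \<mu> t)"
  unfolding polytabloid_def column_sum_def map_image_tabloid ..

text \<open>Absorbing a column permutation into the signed column sum changes it by the sign
  only.\<close>

lemma column_sum_shift:
  assumes \<psi>: "\<psi> \<in> column_stabilizer \<mu> t"
  shows "column_sum \<mu> t T (map ((`) \<psi>) T') = sg \<psi> * column_sum \<mu> t T T'"
proof -
  let ?C = "column_stabilizer \<mu> t"
  note p = column_stabilizer_permutes[OF \<psi>]
  have bij: "bij_betw (\<lambda>\<pi>. \<pi> \<circ> \<psi>) ?C ?C"
  proof (rule bij_betwI[of _ _ _ "\<lambda>\<pi>. \<pi> \<circ> inv' \<psi>"])
    show "(\<lambda>\<pi>. \<pi> \<circ> \<psi>) \<in> ?C \<rightarrow> ?C" using column_stabilizer_comp[OF _ \<psi>] by blast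
    show "(\<lambda>\<pi>. \<pi> \<circ> inv' \<psi>) \<in> ?C \<rightarrow> ?C" using column_stabilizer_comp[OF _ column_stabilizer_inv[OF \<psi>]] by blast
    show "\<pi> \<circ> \<psi> \<circ> inv' \<psi> = \<pi>" "\<pi> \<circ> inv' \<psi> \<circ> \<psi> = \<pi>" for \<pi> by (simp_all add: fun_eq_iff permutes_inverses[OF p])
  qed
  have "sg \<psi> * column_sum \<mu> t T T' = (\<Sum>\<pi>\<in>?C. sg \<psi> * (if map ((`) \<pi>) T' = T then sg \<pi> else 0))"
    unfolding column_sum_def by (rule sum_distrib_left)
  also have "\<dots> = (\<Sum>\<pi>\<in>?C. sg \<psi> * (if map ((`) (\<pi> \<circ> \<psi>)) T' = T then sg (\<pi> \<circ> \<psi>) else 0))"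
    by (rule sum.reindex_bij_betw[OF bij, symmetric])
  also have "\<dots> = column_sum \<mu> t T (map ((`) \<psi>) T')"
    unfolding column_sum_def
  proof (rule sum.cong[OF refl])
    fix \<pi> assume "\<pi> \<in> ?C"
    then have sg: "sg (\<pi> \<circ> \<psi>) = sg \<pi> * sg \<psi>" by (rule sg_comp[OF column_stabilizer_permutes p])
    have im: "map ((`) (\<pi> \<circ> \<psi>)) T' = map ((`) \<pi>) (map ((`) \<psi>) T')"
      unfolding image_functions_comp by (simp del: map_eq_conv)
    show "sg \<psi> * (if map ((`) (\<pi> \<circ> \<psi>)) T' = T then sg (\<pi> \<circ> \<psi>) else 0) =
        (if map ((`) \<pi>) (map ((`) \<psi>) T') = T then sg \<pi> else 0)"
      unfolding im[symmetric] sg by simp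
  qed
  finally show ?thesis ..
qed

text \<open>Inversion permutes the column stabilizer and preserves signs, so the signed column sum
  is self-adjoint.\<close>

lemma column_sum_sym: "column_sum \<mu> t T T' = column_sum \<mu> t T' T"
proof -
  let ?C = "column_stabilizer \<mu> t"
  have ii: "inv' (inv' \<pi>) = \<pi>" if "\<pi> \<in> ?C" for \<pi> using permutes_inv_inv[OF column_stabilizer_permutes[OF that]] .
  have "bij_betw inv' ?C ?C"
    by (rule bij_betwI[of _ _ _ inv']) (use ii column_stabilizer_inv in auto)
  then have "column_sum \<mu> t T T' = (\<Sum>\<pi>\<in>?C. if map ((`) (inv' \<pi>)) T' = T then sg (inv' \<pi>) else 0)"
    unfolding column_sum_def by (rule sum.reindex_bij_betw[symmetric])
  also have "\<dots> = column_sum \<mu> t T' T"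
    unfolding column_sum_def
  proof (rule sum.cong[OF refl])
    fix \<pi> assume "\<pi> \<in> ?C"
    then have p: "\<pi> permutes {1..sum_list \<mu>}" by (rule column_stabilizer_permutes)
    have "map ((`) (inv' \<pi>)) T' = T \<longleftrightarrow> map ((`) \<pi>) T = T'" using map_inv_image[OF permutes_bij[OF p], of T T'] by auto
    then show "(if map ((`) (inv' \<pi>)) T' = T then sg (inv' \<pi>) else 0) = (if map ((`) \<pi>) T = T' then sg \<pi> else 0)"
      by (simp only: sg_inv[OF p])
  qed
  finally show ?thesis .
qed

text \<open>A column permutation that fixes the tabloid keeps every entry in its column and in its
  row, hence is the identity. This provides the normalization of the polytabloid.\<close>

lemma polytabloid_own:
  assumes t: "t \<in> tableaux \<mu>"
  shows "polytabloid \<mu> t (tabloid \<mu> t) = (1 :: complex)"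
proof -
  have "\<pi> = id" if \<pi>: "\<pi> \<in> column_stabilizer \<mu> t" and eq: "tabloid \<mu> (\<pi> \<circ> t) = tabloid \<mu> t" for \<pi>
  proof
    fix x
    note p = column_stabilizer_permutes[OF \<pi>]
    show "\<pi> x = id x"
    proof (cases "x \<in> {1..sum_list \<mu>}")
      case True
      then obtain a b where ab: "(a, b) \<in> young_cells \<mu>" "x = t (a, b)" using tableauD(2)[OF t] by force
      then have "\<pi> x \<in> \<pi> ` {t (a, b) | a. (a, b) \<in> young_cells \<mu>}" by blast
      then obtain a' where a': "(a', b) \<in> young_cells \<mu>" "\<pi> x = t (a', b)" using \<pi> unfolding column_stabilizer_def by blast
      have la: "a < length \<mu>" using ab(1) unfolding young_cells_def by simp
      then have "{(\<pi> \<circ> t) (a, b) | b. (a, b) \<in> young_cells \<mu>} = {t (a, b) | b. (a, b) \<in> young_cells \<mu>}"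
        using arg_cong[OF eq, of "\<lambda>T. T ! a"] unfolding tabloid_def by simp
      then have "\<pi> x \<in> {t (a, b) | b. (a, b) \<in> young_cells \<mu>}" using ab by auto
      then obtain b' where b': "(a, b') \<in> young_cells \<mu>" "\<pi> x = t (a, b')" by blast
      have "(a', b) = (a, b')" using inj_onD[OF tableauD(1)[OF t] _ a'(1) b'(1)] a'(2) b'(2) by simp
      then show ?thesis using a'(2) ab(2) by simp
    qed (use permutes_not_in[OF p] in simp)
  qed
  moreover have "id \<in> column_stabilizer \<mu> t" unfolding column_stabilizer_def by (simp add: permutes_id)
  ultimately have "polytabloid \<mu> t (tabloid \<mu> t) = (\<Sum>\<pi>\<in>column_stabilizer \<mu> t. if \<pi> = id then 1 else (0 :: complex))"
    unfolding polytabloid_def by (intro sum.cong refl) auto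
  then show ?thesis using \<open>id \<in> _\<close> finite_column_stabilizer by simp
qed

text \<open>The signed column sum sends every tabloid to a multiple of the polytabloid of
  \<open>t\<close>. Either \<open>straighten\<close> applies and the image is the polytabloid up to
  sign, or two entries share a column of \<open>t\<close> and a row of \<open>t'\<close>, and their
  transposition fixes the tabloid while changing the sign of the image. Symmetry identifies the
  multiple as a coefficient of the polytabloid.\<close>

lemma column_sum_tabloid:
  assumes \<mu>: "sorted_wrt (\<ge>) \<mu>" and t: "t \<in> tableaux \<mu>" and t': "t' \<in> tableaux \<mu>"
  shows "column_sum \<mu> t T (tabloid \<mu> t') = polytabloid \<mu> t T * polytabloid \<mu> t (tabloid \<mu> t')"
proof (cases "\<exists>\<psi>\<in>column_stabilizer \<mu> t. map ((`) \<psi>) (tabloid \<mu> t') = tabloid \<mu> t")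
  case True
  then obtain \<psi> where \<psi>: "\<psi> \<in> column_stabilizer \<mu> t" "map ((`) \<psi>) (tabloid \<mu> t') = tabloid \<mu> t" by blast
  have "polytabloid \<mu> t S = sg \<psi> * column_sum \<mu> t S (tabloid \<mu> t')" for S
    unfolding polytabloid_column_sum \<psi>(2)[symmetric] by (rule column_sum_shift[OF \<psi>(1)])
  \<comment> \<open>The instance at the tabloid of \<open>t\<close>, where the polytabloid has
    coefficient 1, determines the factor.\<close>
  from this[of T] this[of "tabloid \<mu> t"] show ?thesis
    using polytabloid_own[OF t] unfolding polytabloid_column_sum[of \<mu> t "tabloid \<mu> t'"] column_sum_sym[of \<mu> t "tabloid \<mu> t'"]
    by (auto split: if_splits)
next
  case False
  then have "\<exists>a a' b j j'. (a, b) \<in> young_cells \<mu> \<and> (a', b) \<in> young_cells \<mu> \<and> (j, j') \<in> young_cells \<mu> \<and>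
      (\<exists>j''. (j, j'') \<in> young_cells \<mu> \<and> t (a, b) = t' (j, j') \<and> t (a', b) = t' (j, j'')) \<and> a \<noteq> a'"
    using straighten[OF \<mu> t t'] by blast
  then obtain a a' b j j' j'' where ab: "(a, b) \<in> young_cells \<mu>" "(a', b) \<in> young_cells \<mu>" "a \<noteq> a'"
    and j: "(j, j') \<in> young_cells \<mu>" "(j, j'') \<in> young_cells \<mu>" "t (a, b) = t' (j, j')" "t (a', b) = t' (j, j'')" by blast
  define \<tau> where "\<tau> = transpose (t (a, b)) (t (a', b))"
  have ne: "t (a, b) \<noteq> t (a', b)" using inj_onD[OF tableauD(1)[OF t] _ ab(1,2)] ab(3) by auto
  have mem: "t c \<in> {1..sum_list \<mu>}" if "c \<in> young_cells \<mu>" for c using that tableauD(2)[OF t] by blast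
  have perm: "\<tau> permutes {1..sum_list \<mu>}" unfolding \<tau>_def by (rule permutes_swap_id[OF mem[OF ab(1)] mem[OF ab(2)]])
  have "\<tau> ` {t (a, d) | a. (a, d) \<in> young_cells \<mu>} = {t (a, d) | a. (a, d) \<in> young_cells \<mu>}" for d
  proof (cases "d = b")
    case True
    then show ?thesis unfolding \<tau>_def using ab by (intro transpose_image_eq) blast
  next
    case False
    then have "t (a, b) \<notin> {t (a, d) | a. (a, d) \<in> young_cells \<mu>}" "t (a', b) \<notin> {t (a, d) | a. (a, d) \<in> young_cells \<mu>}"
      using inj_onD[OF tableauD(1)[OF t]] ab by blast+
    then show ?thesis unfolding \<tau>_def by (intro transpose_image_eq) blast
  qed
  then have stab: "\<tau> \<in> column_stabilizer \<mu> t" unfolding column_stabilizer_def using perm by blast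
  have "map ((`) \<tau>) (tabloid \<mu> t') = tabloid \<mu> t'"
    unfolding tabloid_def map_map
  proof (intro map_cong refl)
    fix i
    have "\<tau> ` {t' (i, b) | b. (i, b) \<in> young_cells \<mu>} = {t' (i, b) | b. (i, b) \<in> young_cells \<mu>}"
    proof (cases "i = j")
      case True
      then show ?thesis unfolding \<tau>_def j(3,4) using j(1,2) by (intro transpose_image_eq) blast
    next
      case False
      then have "t' (j, j') \<notin> {t' (i, b) | b. (i, b) \<in> young_cells \<mu>}" "t' (j, j'') \<notin> {t' (i, b) | b. (i, b) \<in> young_cells \<mu>}"
        using inj_onD[OF tableauD(1)[OF t']] j(1,2) by blast+
      then show ?thesis unfolding \<tau>_def j(3,4) by (intro transpose_image_eq) blast
    qed
    then show "((`) \<tau> \<circ> (\<lambda>a. {t' (a, b) | b. (a, b) \<in> young_cells \<mu>})) i = {t' (i, b) | b. (i, b) \<in> young_cells \<mu>}" by simp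
  qed
  moreover have "sg \<tau> = - 1" using ne unfolding \<tau>_def by (simp add: evenperm_swap)
  ultimately have "column_sum \<mu> t S (tabloid \<mu> t') = 0" for S
    using column_sum_shift[OF stab, of S "tabloid \<mu> t'"] by simp
  then show ?thesis unfolding polytabloid_column_sum[of \<mu> t "tabloid \<mu> t'"] column_sum_sym[of \<mu> t "tabloid \<mu> t'"] by simp
qed

text \<open>Tableaux are functions on all pairs of numbers, so a tableau moved by a permutation
  matches another one on the cells only.\<close>

lemma polytabloid_cong:
  assumes "\<And>c. c \<in> young_cells \<mu> \<Longrightarrow> t c = t' c"
  shows "polytabloid \<mu> t = polytabloid \<mu> t'"
proof -
  have "{f (t (a, b)) | a. (a, b) \<in> young_cells \<mu>} = {f (t' (a, b)) | a. (a, b) \<in> young_cells \<mu>}"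
    "{f (t (a, b)) | b. (a, b) \<in> young_cells \<mu>} = {f (t' (a, b)) | b. (a, b) \<in> young_cells \<mu>}" for f :: "nat \<Rightarrow> nat" and a b
    using assms by force+
  note this this[of id]
  then show ?thesis unfolding polytabloid_def column_stabilizer_def tabloid_def by simp
qed

section \<open>Rank one operators on Specht modules\<close>

definition tabloids :: "nat list \<Rightarrow> nat set list set" where
  "tabloids \<mu> = tabloid \<mu> ` tableaux \<mu>"

lemma finite_tabloids: "finite (tabloids \<mu>)"
proof (rule finite_subset)
  show "tabloids \<mu> \<subseteq> {T. set T \<subseteq> Pow {1..sum_list \<mu>} \<and> length T = length \<mu>}"
  proof
    fix T assume "T \<in> tabloids \<mu>"
    then obtain t where t: "t \<in> tableaux \<mu>" "T = tabloid \<mu> t" unfolding tabloids_def by blast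
    have "t c \<in> {1..sum_list \<mu>}" if "c \<in> young_cells \<mu>" for c using that tableauD(2)[OF t(1)] by blast
    then show "T \<in> {T. set T \<subseteq> Pow {1..sum_list \<mu>} \<and> length T = length \<mu>}" unfolding t(2) tabloid_def by auto
  qed
  show "finite {T. set T \<subseteq> Pow {1..sum_list \<mu>} \<and> length T = length \<mu>}" by (rule finite_lists_length_eq) simp
qed

lemma specht_support:
  fixes v :: "nat set list \<Rightarrow> 'a :: {comm_ring, comm_monoid_mult}"
  assumes "v \<in> carrier (specht \<mu>)" "T \<notin> tabloids \<mu>"
  shows "v T = 0"
  using assms
proof (induction rule: specht_induct)
  case (polytabloid t c)
  have "tabloid \<mu> (\<pi> \<circ> t) \<noteq> T" if "\<pi> \<in> column_stabilizer \<mu> t" for \<pi>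
    using tableaux_permuted[OF column_stabilizer_permutes[OF that] polytabloid(1)] polytabloid(2) unfolding tabloids_def by blast
  then have "polytabloid \<mu> t T = (0 :: 'a)" unfolding polytabloid_def by (intro sum.neutral) simp
  then show ?case by simp
qed simp_all

text \<open>The inner product with a polytabloid. Polytabloids are real valued by
  \<open>cnj_polytabloid\<close>, so it agrees with \<open>hermitian\<close> although no conjugate
  is written.\<close>

definition pairing :: "nat list \<Rightarrow> (nat set list \<Rightarrow> complex) \<Rightarrow> (nat \<times> nat \<Rightarrow> nat) \<Rightarrow> complex" where
  "pairing \<mu> v s = (\<Sum>T\<in>tabloids \<mu>. v T * polytabloid \<mu> s T)"

text \<open>By \<open>column_sum_tabloid\<close> the signed column sum of \<open>s\<close> takes
  \<open>v\<close> to \<open>pairing \<mu> v s\<close> times the polytabloid of \<open>s\<close>.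
  Following it by a permutation of the entries that carries \<open>s\<close> to \<open>r\<close>
  replaces this polytabloid by that of \<open>r\<close>.\<close>

lemma specht_rank_one:
  assumes \<mu>: "sorted_wrt (\<ge>) \<mu>" and r: "r \<in> tableaux \<mu>" and s: "s \<in> tableaux \<mu>"
  shows "\<exists>F. \<forall>v\<in>carrier (specht \<mu>). F \<odot>\<^bsub>specht \<mu>\<^esub> v = (\<lambda>T. pairing \<mu> v s * polytabloid \<mu> r T)"
proof -
  let ?N = "{1..sum_list \<mu>}" and ?C = "column_stabilizer \<mu> s" and ?Y = "young_cells \<mu>"
  have bij: "bij_betw (r \<circ> inv_into ?Y s) ?N ?N"
    using r s unfolding tableaux_def by (blast intro: bij_betw_trans bij_betw_inv_into)
  define \<theta> where "\<theta> x = (if x \<in> ?N then r (inv_into ?Y s x) else x)" for x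
  have "bij_betw \<theta> ?N ?N" by (rule bij_betw_cong[THEN iffD1, OF _ bij]) (simp add: \<theta>_def)
  then have \<theta>: "\<theta> permutes ?N" by (rule bij_imp_permutes) (simp only: \<theta>_def if_False)
  have \<theta>s: "polytabloid \<mu> (\<theta> \<circ> s) = (polytabloid \<mu> r :: nat set list \<Rightarrow> complex)"
  proof (rule polytabloid_cong)
    fix c assume c: "c \<in> ?Y"
    have "s c \<in> ?N" using c tableauD(2)[OF s] by blast
    then show "(\<theta> \<circ> s) c = r c" unfolding \<theta>_def using inv_into_f_f[OF tableauD(1)[OF s] c] by simp
  qed
  define F where "F \<sigma> = (\<Sum>\<pi>\<in>?C. if \<sigma> = \<theta> \<circ> \<pi> then sg \<pi> else 0)" for \<sigma>
  have "F \<odot>\<^bsub>specht \<mu>\<^esub> v = (\<lambda>T. pairing \<mu> v s * polytabloid \<mu> r T)" if v: "v \<in> carrier (specht \<mu>)" for v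
  proof
    fix T
    let ?T = "map ((`) (inv' \<theta>)) T"
    have cS: "carrier (sym_group (sum_list \<mu>)) = {\<sigma>. \<sigma> permutes ?N}" unfolding sym_group_def by simp
    have fS: "finite {\<sigma>. \<sigma> permutes ?N}" by (simp add: finite_permutations)
    have "(F \<odot>\<^bsub>specht \<mu>\<^esub> v) T =
        (\<Sum>\<sigma>\<in>{\<sigma>. \<sigma> permutes ?N}. \<Sum>\<pi>\<in>?C. if \<sigma> = \<theta> \<circ> \<pi> then sg \<pi> * v (map ((`) (inv' \<sigma>)) T) else 0)"
      unfolding specht_ops cS F_def sum_distrib_right by (intro sum.cong refl) simp
    also have "\<dots> = (\<Sum>\<pi>\<in>?C. \<Sum>\<sigma>\<in>{\<sigma>. \<sigma> permutes ?N}. if \<sigma> = \<theta> \<circ> \<pi> then sg \<pi> * v (map ((`) (inv' \<sigma>)) T) else 0)"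
      by (rule sum.swap)
    also have "\<dots> = (\<Sum>\<pi>\<in>?C. sg \<pi> * v (map ((`) (inv' \<pi>)) ?T))"
    proof (rule sum.cong[OF refl])
      fix \<pi> assume "\<pi> \<in> ?C"
      then have p: "\<pi> permutes ?N" by (rule column_stabilizer_permutes)
      have "\<theta> \<circ> \<pi> permutes ?N" by (rule permutes_compose[OF p \<theta>])
      moreover have "inv' (\<theta> \<circ> \<pi>) = inv' \<pi> \<circ> inv' \<theta>" by (rule o_inv_distrib[OF permutes_bij[OF \<theta>] permutes_bij[OF p]])
      ultimately show "(\<Sum>\<sigma>\<in>{\<sigma>. \<sigma> permutes ?N}. if \<sigma> = \<theta> \<circ> \<pi> then sg \<pi> * v (map ((`) (inv' \<sigma>)) T) else 0) = sg \<pi> * v (map ((`) (inv' \<pi>)) ?T)"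
        using fS by (simp add: image_functions_comp)
    qed
    also have "\<dots> = (\<Sum>\<pi>\<in>?C. \<Sum>T'\<in>tabloids \<mu>. v T' * (if map ((`) \<pi>) T' = ?T then sg \<pi> else 0))"
    proof (rule sum.cong[OF refl])
      fix \<pi> assume "\<pi> \<in> ?C"
      then have p: "\<pi> permutes ?N" by (rule column_stabilizer_permutes)
      have "map ((`) \<pi>) T' = ?T \<longleftrightarrow> T' = map ((`) (inv' \<pi>)) ?T" for T' by (rule map_inv_image[OF permutes_bij[OF p]])
      then have "(\<Sum>T'\<in>tabloids \<mu>. v T' * (if map ((`) \<pi>) T' = ?T then sg \<pi> else 0)) =
          (\<Sum>T'\<in>tabloids \<mu>. if T' = map ((`) (inv' \<pi>)) ?T then sg \<pi> * v (map ((`) (inv' \<pi>)) ?T) else 0)"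
        by (intro sum.cong refl) simp
      also have "\<dots> = sg \<pi> * v (map ((`) (inv' \<pi>)) ?T)"
        using finite_tabloids specht_support[OF v, of "map ((`) (inv' \<pi>)) ?T"] by (simp only: sum.delta) auto
      finally show "sg \<pi> * v (map ((`) (inv' \<pi>)) ?T) = (\<Sum>T'\<in>tabloids \<mu>. v T' * (if map ((`) \<pi>) T' = ?T then sg \<pi> else 0))" ..
    qed
    also have "\<dots> = (\<Sum>T'\<in>tabloids \<mu>. v T' * column_sum \<mu> s ?T T')"
      unfolding column_sum_def sum_distrib_left by (rule sum.swap)
    also have "\<dots> = (\<Sum>T'\<in>tabloids \<mu>. v T' * polytabloid \<mu> s T' * polytabloid \<mu> s ?T)"
      using column_sum_tabloid[OF \<mu> s] by (intro sum.cong refl) (auto simp: tabloids_def)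
    also have "\<dots> = pairing \<mu> v s * polytabloid \<mu> r T"
      unfolding pairing_def sum_distrib_right polytabloid_permuted[OF \<theta>] \<theta>s ..
    finally show "(F \<odot>\<^bsub>specht \<mu>\<^esub> v) T = pairing \<mu> v s * polytabloid \<mu> r T" .
  qed
  then show ?thesis by blast
qed

lemma cnj_polytabloid: "cnj (polytabloid \<mu> t T) = polytabloid \<mu> t T"
  unfolding polytabloid_def cnj_sum by (intro sum.cong refl) simp

text \<open>Writes the identity as a combination of the operators of \<open>specht_rank_one\<close>:
  expand along an orthogonal basis, then write each basis vector through finitely many polytabloids,
  both where it occurs as a vector and inside the inner product.\<close>

lemma specht_expansion:
  "\<exists>R c. finite R \<and> R \<subseteq> tableaux \<mu> \<and>
     (\<forall>v\<in>carrier (specht \<mu>). v = (\<lambda>T. \<Sum>r\<in>R. \<Sum>s\<in>R. c r s * pairing \<mu> v s * polytabloid \<mu> r T))"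
proof -
  let ?e = "polytabloid \<mu> :: _ \<Rightarrow> nat set list \<Rightarrow> complex" and ?h = "hermitian (tabloids \<mu>)"
  have "(\<lambda>T. f T + a * g T) \<in> carrier (specht \<mu>)"
    if "f \<in> carrier (specht \<mu>)" "g \<in> carrier (specht \<mu>)" for f g and a :: complex
    by (rule specht_add[OF that(1) specht_scale_closed[OF that(2)]])
  then have "\<exists>E N. finite E \<and> E \<subseteq> carrier (specht \<mu>) \<and>
      (\<forall>v\<in>carrier (specht \<mu>). v = (\<lambda>T. \<Sum>b\<in>E. N b * ?h v b * b T)) \<and>
      (\<forall>g. \<forall>z\<in>carrier (specht \<mu>). ?h (\<lambda>T. g T - (\<Sum>b\<in>E. N b * ?h g b * b T)) z = 0)"
    by (intro orthogonal_expansion[OF finite_tabloids]) (use specht_support in blast)+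
  then obtain E N where E: "finite E" "E \<subseteq> carrier (specht \<mu>)"
    "\<forall>v\<in>carrier (specht \<mu>). v = (\<lambda>T. \<Sum>b\<in>E. N b * ?h v b * b T)" by blast
  have "\<exists>A. finite A \<and> A \<subseteq> tableaux \<mu> \<and> (\<exists>c. b = (\<lambda>T. \<Sum>t\<in>A. c t * ?e t T))" if "b \<in> E" for b
    using subsetD[OF E(2) that] unfolding carrier_specht mem_Collect_eq by (elim exE) (intro exI conjI; simp)
  then obtain A where A: "\<forall>b\<in>E. finite (A b) \<and> A b \<subseteq> tableaux \<mu> \<and> (\<exists>c. b = (\<lambda>T. \<Sum>t\<in>A b. c t * ?e t T))" by metis
  define R where "R = \<Union>(A ` E)"
  have R: "finite R" "R \<subseteq> tableaux \<mu>" using A E(1) unfolding R_def by auto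
  have "\<exists>c. b = (\<lambda>T. \<Sum>t\<in>R. c t * ?e t T)" if b: "b \<in> E" for b
  proof -
    obtain c where "b = (\<lambda>T. \<Sum>t\<in>A b. c t * ?e t T)" using A b by blast
    moreover have "(\<Sum>t\<in>A b. c t * ?e t T) = (\<Sum>t\<in>R. (if t \<in> A b then c t else 0) * ?e t T)" for T
      by (rule sum.mono_neutral_cong_left) (use R(1) b in \<open>auto simp: R_def\<close>)
    ultimately show ?thesis by (intro exI[of _ "\<lambda>t. if t \<in> A b then c t else 0"]) simp
  qed
  then obtain c where c: "\<And>b. b \<in> E \<Longrightarrow> b = (\<lambda>T. \<Sum>t\<in>R. c b t * ?e t T)" by metis
  have pair: "?h v (?e s) = pairing \<mu> v s" for v s unfolding hermitian_def pairing_def cnj_polytabloid ..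
  have "v T = (\<Sum>r\<in>R. \<Sum>s\<in>R. (\<Sum>b\<in>E. N b * c b r * cnj (c b s)) * pairing \<mu> v s * ?e r T)"
    if v: "v \<in> carrier (specht \<mu>)" for v T
  proof -
    have "v T = (\<Sum>b\<in>E. N b * ?h v b * b T)" using fun_cong[OF bspec[OF E(3) v]] .
    also have "\<dots> = (\<Sum>b\<in>E. N b * (\<Sum>s\<in>R. cnj (c b s) * pairing \<mu> v s) * (\<Sum>r\<in>R. c b r * ?e r T))"
    proof (rule sum.cong[OF refl])
      fix b assume b: "b \<in> E"
      have "?h v b = (\<Sum>s\<in>R. cnj (c b s) * pairing \<mu> v s)"
        using arg_cong[OF c[OF b], of "?h v"] unfolding hermitian_sum_right pair .
      then show "N b * ?h v b * b T = N b * (\<Sum>s\<in>R. cnj (c b s) * pairing \<mu> v s) * (\<Sum>r\<in>R. c b r * ?e r T)"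
        using fun_cong[OF c[OF b], of T] by simp
    qed
    also have "\<dots> = (\<Sum>b\<in>E. \<Sum>r\<in>R. \<Sum>s\<in>R. N b * c b r * cnj (c b s) * pairing \<mu> v s * ?e r T)"
      unfolding sum_distrib_left sum_distrib_right by (intro sum.cong refl) (simp add: mult_ac)
    also have "\<dots> = (\<Sum>r\<in>R. \<Sum>s\<in>R. \<Sum>b\<in>E. N b * c b r * cnj (c b s) * pairing \<mu> v s * ?e r T)"
      by (subst sum.swap) (rule sum.cong[OF refl], rule sum.swap)
    finally show ?thesis unfolding sum_distrib_right .
  qed
  then show ?thesis using R by (intro exI[of _ R] exI[of _ "\<lambda>r s. \<Sum>b\<in>E. N b * c b r * cnj (c b s)"]) auto
qed

lemma tableaux_nonempty: "tableaux \<mu> \<noteq> {}"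
proof -
  have "young_cells \<mu> = (SIGMA a:{..<length \<mu>}. {..<\<mu> ! a})" unfolding young_cells_def by auto
  then have "card (young_cells \<mu>) = card {1..sum_list \<mu>}" by (simp add: sum_list_sum_nth atLeast0LessThan)
  then have "\<exists>t. bij_betw t (young_cells \<mu>) {1..sum_list \<mu>}" by (intro finite_same_card_bij finite_young_cells) simp_all
  then show ?thesis unfolding tableaux_def by blast
qed


subsection \<open>Outer tensor products\<close>

locale complex_tuple = specht_tuple l m \<mu> \<delta>
  for l :: nat and m :: "nat \<Rightarrow> nat" and \<mu> :: "nat \<Rightarrow> nat list" and \<delta> :: complex
begin

lemma shape: "i \<in> {1..l} \<Longrightarrow> sorted_wrt (\<ge>) (\<mu> i)"
  using \<mu> unfolding partition_tuples_def integer_partition_def by auto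

lemma one_in: "1 \<in> {1..l}"
  using l1 by simp

lemma cl_sum: "(\<And>j. j \<in> J \<Longrightarrow> N.cl (f j) = N.cl (g j)) \<Longrightarrow> N.cl (sum f J) = N.cl (sum g J)"
  unfolding N.cl_eq_iff sum_subtractf[symmetric] by (rule N.H_sum)

lemma cl_add: "N.cl y = N.cl y' \<Longrightarrow> N.cl z = N.cl z' \<Longrightarrow> N.cl (y + z) = N.cl (y' + z')"
  unfolding N.cl_eq_iff using N.H_add[of "y - y'" "z - z'"] by (simp add: algebra_simps)

lemma cl_diff: "N.cl y = N.cl y' \<Longrightarrow> N.cl z = N.cl z' \<Longrightarrow> N.cl (y - z) = N.cl (y' - z')"
  unfolding N.cl_eq_iff using N.H_diff[of "y - y'" "z - z'"] by (simp add: algebra_simps)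

lemma cl_add_slot:
  assumes "x \<in> specht_slots l \<mu>" "i \<in> {1..l}" "u \<in> carrier (specht (\<mu> i))" "v \<in> carrier (specht (\<mu> i))"
  shows "N.cl (frag_of (x(i := (\<lambda>T. u T + v T)))) = N.cl (frag_of (x(i := u)) + frag_of (x(i := v)))"
  unfolding N.cl_eq_iff using N.H_incl[OF outer_relations_addI[OF assms]] by (simp add: algebra_simps)

lemma cl_zero_slot:
  assumes "x \<in> specht_slots l \<mu>" "i \<in> {1..l}"
  shows "N.cl (frag_of (x(i := (\<lambda>T. 0)))) = N.cl 0"
  using N.H_minus[OF N.H_incl[OF outer_relations_addI[OF assms specht_zero specht_zero]]] unfolding N.cl_eq_iff by simp

lemma cl_sum_slot:
  assumes x: "x \<in> specht_slots l \<mu>" and i: "i \<in> {1..l}" and J: "finite J" and w: "\<And>j. j \<in> J \<Longrightarrow> w j \<in> carrier (specht (\<mu> i))"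
  shows "N.cl (frag_of (x(i := (\<lambda>T. \<Sum>j\<in>J. w j T)))) = N.cl (\<Sum>j\<in>J. frag_of (x(i := w j)))"
  using J w
proof (induction J)
  case (insert j J)
  have w: "w j \<in> carrier (specht (\<mu> i))" "(\<lambda>T. \<Sum>j\<in>J. w j T) \<in> carrier (specht (\<mu> i))"
    using insert.prems by (auto intro: specht_sum)
  have "N.cl (frag_of (x(i := w j)) + frag_of (x(i := (\<lambda>T. \<Sum>j\<in>J. w j T)))) =
      N.cl (frag_of (x(i := w j)) + (\<Sum>j\<in>J. frag_of (x(i := w j))))"
    by (rule cl_add[OF refl]) (rule insert.IH, use insert.prems in simp)
  from trans[OF cl_add_slot[OF x i w] this] show ?case unfolding sum.insert[OF insert.hyps] .
qed (simp add: cl_zero_slot[OF x i])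

text \<open>Expands one slot at a time. The slots outside \<open>J\<close> keep arbitrary values
  \<open>x\<close>, so that in the induction the slot treated last can be absorbed into
  \<open>x\<close>.\<close>

lemma multilinear_expansion:
  fixes A :: "nat \<Rightarrow> 'a set" and y :: "nat \<Rightarrow> 'a \<Rightarrow> nat set list \<Rightarrow> complex"
  assumes J: "finite J" "J \<subseteq> {1..l}" and x: "x \<in> specht_slots l \<mu>"
    and A: "\<And>i. i \<in> J \<Longrightarrow> finite (A i)" and y: "\<And>i a. i \<in> J \<Longrightarrow> a \<in> A i \<Longrightarrow> y i a \<in> carrier (specht (\<mu> i))"
  shows "N.cl (frag_of (\<lambda>i. if i \<in> J then (\<lambda>T. \<Sum>a\<in>A i. y i a T) else x i)) =
    N.cl (\<Sum>a\<in>PiE J A. frag_of (\<lambda>i. if i \<in> J then y i (a i) else x i))"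
  using J A y x
proof (induction J arbitrary: x)
  case (insert j J)
  have j: "j \<in> {1..l}" using insert.prems(1) by simp
  define x' where "x' = x(j := (\<lambda>T. \<Sum>a\<in>A j. y j a T))"
  have x': "x' \<in> specht_slots l \<mu>" unfolding x'_def by (intro slots_upd[OF insert.prems(4) j] specht_sum insert.prems(3)) simp_all
  have base: "(\<lambda>i. if i \<in> J then y i (a i) else x i) \<in> specht_slots l \<mu>" if "a \<in> PiE J A" for a
    unfolding specht_slots_def
  proof (rule PiE_I)
    fix i assume i: "i \<in> {1..l}"
    show "(if i \<in> J then y i (a i) else x i) \<in> carrier (specht (\<mu> i))"
      using insert.prems(3)[of i "a i"] PiE_mem[OF that, of i] slots_in[OF insert.prems(4) i] by simp
  next
    fix i assume "i \<notin> {1..l}"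
    then show "(if i \<in> J then y i (a i) else x i) = undefined"
      using insert.prems(1,4) unfolding specht_slots_def by auto
  qed
  have "N.cl (frag_of (\<lambda>i. if i \<in> insert j J then (\<lambda>T. \<Sum>a\<in>A i. y i a T) else x i)) =
      N.cl (frag_of (\<lambda>i. if i \<in> J then (\<lambda>T. \<Sum>a\<in>A i. y i a T) else x' i))"
    using insert.hyps by (intro arg_cong[of _ _ "\<lambda>x. N.cl (frag_of x)"]) (auto simp: x'_def)
  also have "\<dots> = N.cl (\<Sum>a\<in>PiE J A. frag_of (\<lambda>i. if i \<in> J then y i (a i) else x' i))"
    by (rule insert.IH) (use insert.prems x' in auto)
  also have "\<dots> = N.cl (\<Sum>a\<in>PiE J A. \<Sum>b\<in>A j. frag_of ((\<lambda>i. if i \<in> J then y i (a i) else x i)(j := y j b)))"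
  proof (rule cl_sum)
    fix a assume a: "a \<in> PiE J A"
    have "(\<lambda>i. if i \<in> J then y i (a i) else x' i) = (\<lambda>i. if i \<in> J then y i (a i) else x i)(j := (\<lambda>T. \<Sum>b\<in>A j. y j b T))"
      unfolding x'_def using insert.hyps by auto
    then show "N.cl (frag_of (\<lambda>i. if i \<in> J then y i (a i) else x' i)) =
        N.cl (\<Sum>b\<in>A j. frag_of ((\<lambda>i. if i \<in> J then y i (a i) else x i)(j := y j b)))"
      using cl_sum_slot[OF base[OF a] j, of "A j" "y j"] insert.prems by simp
  qed
  also have "(\<Sum>a\<in>PiE J A. \<Sum>b\<in>A j. frag_of ((\<lambda>i. if i \<in> J then y i (a i) else x i)(j := y j b))) =
      (\<Sum>(b, a)\<in>A j \<times> PiE J A. frag_of ((\<lambda>i. if i \<in> J then y i (a i) else x i)(j := y j b)))"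
    by (subst sum.swap) (rule sum.cartesian_product)
  also have "\<dots> = (\<Sum>a\<in>PiE (insert j J) A. frag_of (\<lambda>i. if i \<in> insert j J then y i (a i) else x i))"
    unfolding PiE_insert_eq sum.reindex[OF inj_combinator[OF insert.hyps(2)]]
  proof (rule sum.cong[OF refl])
    fix p assume "p \<in> A j \<times> PiE J A"
    have "(\<lambda>i. if i \<in> J then y i (snd p i) else x i)(j := y j (fst p)) = (\<lambda>i. if i \<in> insert j J then y i (((snd p)(j := fst p)) i) else x i)"
      using insert.hyps by auto
    then show "(case p of (b, a) \<Rightarrow> frag_of ((\<lambda>i. if i \<in> J then y i (a i) else x i)(j := y j b))) =
        ((\<lambda>a. frag_of (\<lambda>i. if i \<in> insert j J then y i (a i) else x i)) \<circ> (\<lambda>(y, g). g(j := y))) p"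
      by (simp add: case_prod_unfold)
  qed
  finally show ?case .
qed simp

text \<open>Scalar multiplication of a pure tensor, performed in slot 1 as in the action of the
  group ring.\<close>

definition scaled :: "complex \<Rightarrow> (nat \<Rightarrow> nat set list \<Rightarrow> complex) \<Rightarrow> nat \<Rightarrow> nat set list \<Rightarrow> complex" where
  "scaled c y = y(1 := (\<lambda>T. c * y 1 T))"

lemma scaled_in: "y \<in> specht_slots l \<mu> \<Longrightarrow> scaled c y \<in> specht_slots l \<mu>"
  unfolding scaled_def by (intro slots_upd specht_scale_closed slots_in one_in)

lemma scaled_zero: "y \<in> specht_slots l \<mu> \<Longrightarrow> N.cl (frag_of (scaled 0 y)) = N.cl 0"
  unfolding scaled_def using cl_zero_slot[OF _ one_in] by simp

lemma scaled_diff: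
  assumes "y \<in> specht_slots l \<mu>"
  shows "N.cl (frag_of (scaled (a - b) y)) = N.cl (frag_of (scaled a y) - frag_of (scaled b y))"
proof -
  have "N.cl (frag_of (scaled a y)) = N.cl (frag_of (scaled (a - b) y) + frag_of (scaled b y))"
    using cl_add_slot[OF assms one_in specht_scale_closed[OF slots_in[OF assms one_in], of "a - b"] specht_scale_closed[OF slots_in[OF assms one_in], of b]]
    unfolding scaled_def by (simp add: distrib_right[symmetric])
  from cl_diff[OF this refl, of "frag_of (scaled b y)"] show ?thesis by simp
qed

lemma collect_scalars:
  assumes "finite J" "J \<subseteq> {1..l}" "y \<in> specht_slots l \<mu>"
  shows "N.cl (frag_of (\<lambda>i. if i \<in> J then (\<lambda>T. d i * y i T) else y i)) = N.cl (frag_of (scaled (\<Prod>i\<in>J. d i) y))"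
  using assms
proof (induction J arbitrary: y)
  case empty
  then show ?case unfolding scaled_def by simp
next
  case (insert j J)
  have j: "j \<in> {1..l}" using insert.prems by simp
  let ?y = "\<lambda>i. if i \<in> J then (\<lambda>T. d i * y i T) else y i"
  have y: "?y \<in> specht_slots l \<mu>"
    unfolding specht_slots_def
  proof (rule PiE_I)
    fix i assume i: "i \<in> {1..l}"
    show "?y i \<in> carrier (specht (\<mu> i))" using specht_scale_closed[OF slots_in[OF insert.prems(2) i]] slots_in[OF insert.prems(2) i] by simp
  next
    fix i assume "i \<notin> {1..l}"
    then show "?y i = undefined" using insert.prems unfolding specht_slots_def by auto
  qed
  have "N.cl (frag_of (\<lambda>i. if i \<in> insert j J then (\<lambda>T. d i * y i T) else y i)) = N.cl (frag_of (?y(j := (\<lambda>T. d j * ?y j T))))"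
    using insert.hyps by (intro arg_cong[of _ _ "\<lambda>x. N.cl (frag_of x)"]) auto
  \<comment> \<open>The defining relations allow the scalar of slot \<open>j\<close> to be moved to
    slot 1.\<close>
  also have "\<dots> = N.cl (frag_of (?y(1 := (\<lambda>T. d j * ?y 1 T))))"
    unfolding N.cl_eq_iff by (rule N.H_incl[OF outer_relations_scaleI[OF y j one_in]])
  also have "\<dots> = N.cl (frag_of (\<lambda>i. if i \<in> J then (\<lambda>T. d i * scaled (d j) y i T) else scaled (d j) y i))"
    by (intro arg_cong[of _ _ "\<lambda>x. N.cl (frag_of x)"]) (auto simp: scaled_def fun_eq_iff)
  also have "\<dots> = N.cl (frag_of (scaled (\<Prod>i\<in>J. d i) (scaled (d j) y)))"
    by (rule insert.IH) (use insert.prems scaled_in in auto)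
  also have "scaled (\<Prod>i\<in>J. d i) (scaled (d j) y) = scaled (\<Prod>i\<in>insert j J. d i) y"
    using insert.hyps unfolding scaled_def by (auto simp: fun_eq_iff mult_ac)
  finally show ?case .
qed

lemma restrict_slots: "(\<And>i. i \<in> {1..l} \<Longrightarrow> y i \<in> carrier (specht (\<mu> i))) \<Longrightarrow> (\<lambda>i\<in>{1..l}. y i) \<in> specht_slots l \<mu>"
  unfolding specht_slots_def by (rule restrict_PiE_iff[THEN iffD2]) blast

lemma collect_all_scalars:
  assumes "\<And>i. i \<in> {1..l} \<Longrightarrow> y i \<in> carrier (specht (\<mu> i))"
  shows "N.cl (frag_of (\<lambda>i\<in>{1..l}. \<lambda>T. d i * y i T)) = N.cl (frag_of (scaled (\<Prod>i\<in>{1..l}. d i) (\<lambda>i\<in>{1..l}. y i)))"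
proof -
  have e: "(\<lambda>i\<in>{1..l}. \<lambda>T. d i * y i T) = (\<lambda>i. if i \<in> {1..l} then (\<lambda>T. d i * (\<lambda>i\<in>{1..l}. y i) i T) else (\<lambda>i\<in>{1..l}. y i) i)"
    by (auto simp: restrict_def fun_eq_iff)
  show ?thesis unfolding e by (rule collect_scalars[OF finite_atLeastAtMost subset_refl restrict_slots[OF assms]])
qed

lemma expand_all:
  fixes A :: "nat \<Rightarrow> 'a set" and y :: "nat \<Rightarrow> 'a \<Rightarrow> nat set list \<Rightarrow> complex"
  assumes A: "\<And>i. i \<in> {1..l} \<Longrightarrow> finite (A i)" and y: "\<And>i a. i \<in> {1..l} \<Longrightarrow> a \<in> A i \<Longrightarrow> y i a \<in> carrier (specht (\<mu> i))"
  shows "N.cl (frag_of (\<lambda>i\<in>{1..l}. \<lambda>T. \<Sum>a\<in>A i. y i a T)) = N.cl (\<Sum>a\<in>PiE {1..l} A. frag_of (\<lambda>i\<in>{1..l}. y i (a i)))"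
proof -
  \<comment> \<open>All slots in \<open>{1..l}\<close> are overwritten; the zero tuple supplies the
    values outside.\<close>
  define z where "z = (\<lambda>i\<in>{1..l}. \<lambda>T :: nat set list. 0 :: complex)"
  have z: "z \<in> specht_slots l \<mu>" unfolding z_def by (rule restrict_slots[OF specht_zero])
  have e: "(\<lambda>i\<in>{1..l}. w i) = (\<lambda>i. if i \<in> {1..l} then w i else z i)" for w :: "nat \<Rightarrow> nat set list \<Rightarrow> complex"
    by (auto simp: restrict_def fun_eq_iff z_def)
  show ?thesis unfolding e by (rule multilinear_expansion[OF finite_atLeastAtMost subset_refl z A y])
qed

text \<open>A function on the product group that is a product of functions of the components acts on
  pure tensors slot by slot: collecting the sum over the product group is multilinear expansion read
  backwards.\<close>

lemma product_action:
  assumes x: "x \<in> specht_slots l \<mu>" and f: "\<And>\<sigma>. \<sigma> \<in> SG \<Longrightarrow> f \<sigma> = (\<Prod>i\<in>{1..l}. F i (\<sigma> i))"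
  shows "N.cl (ogen f x) = N.cl (frag_of (\<lambda>i\<in>{1..l}. F i \<odot>\<^bsub>specht (\<mu> i)\<^esub> x i))"
proof -
  let ?a = "\<lambda>i \<pi> T. x i (map ((`) (inv' \<pi>)) T)"
  have a: "?a i \<pi> \<in> carrier (specht (\<mu> i))" if "i \<in> {1..l}" "\<pi> permutes {1..m i}" for i \<pi>
    using specht_single_closed[OF _ slots_in[OF x that(1)], of \<pi> 1] specht_single[of \<pi> "\<mu> i" 1 "x i"] that(2)
    unfolding sum_\<mu>[OF that(1)] by simp
  have perm: "\<sigma> i permutes {1..m i}" if "\<sigma> \<in> SG" "i \<in> {1..l}" for \<sigma> i using SG_permutes[OF that] unfolding sum_\<mu>[OF that(2)] .
  have "N.cl (ogen f x) = N.cl (\<Sum>\<sigma>\<in>SG. frag_of (\<lambda>i\<in>{1..l}. \<lambda>T. F i (\<sigma> i) * ?a i (\<sigma> i) T))"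
  proof (rule cl_sum)
    fix \<sigma> assume \<sigma>: "\<sigma> \<in> SG"
    have "slot_action l (f \<sigma>) \<sigma> x = scaled (\<Prod>i\<in>{1..l}. F i (\<sigma> i)) (\<lambda>i\<in>{1..l}. ?a i (\<sigma> i))"
      unfolding f[OF \<sigma>] slot_action_def scaled_def using one_in by (auto simp: fun_eq_iff restrict_def)
    then show "N.cl (frag_of (slot_action l (f \<sigma>) \<sigma> x)) = N.cl (frag_of (\<lambda>i\<in>{1..l}. \<lambda>T. F i (\<sigma> i) * ?a i (\<sigma> i) T))"
      using collect_all_scalars[of "\<lambda>i. ?a i (\<sigma> i)" "\<lambda>i. F i (\<sigma> i)"] a perm[OF \<sigma>] by simp
  qed
  also have "\<dots> = N.cl (frag_of (\<lambda>i\<in>{1..l}. \<lambda>T. \<Sum>\<pi>\<in>{\<pi>. \<pi> permutes {1..m i}}. F i \<pi> * ?a i \<pi> T))"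
    unfolding SG
    by (rule expand_all[symmetric, of "\<lambda>i. {\<pi>. \<pi> permutes {1..m i}}" "\<lambda>i \<pi> T. F i \<pi> * ?a i \<pi> T"])
      (auto intro!: finite_permutations specht_scale_closed a)
  also have "(\<lambda>i\<in>{1..l}. \<lambda>T. \<Sum>\<pi>\<in>{\<pi>. \<pi> permutes {1..m i}}. F i \<pi> * ?a i \<pi> T) = (\<lambda>i\<in>{1..l}. F i \<odot>\<^bsub>specht (\<mu> i)\<^esub> x i)"
    by (intro restrict_ext) (simp only: specht_ops(3) sum_\<mu> sym_group_def partial_object.simps)
  finally show ?thesis .
qed

text \<open>Expanding the identity in every slot writes each element as a sum of the tensors
  \<open>E q\<close> with coefficients \<open>cc q\<close> times \<open>lam q\<close>. So a nonzero
  \<open>u\<close> has a nonzero value under some \<open>lam s\<close>, and a product of rank one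
  operators sends \<open>u\<close> to any prescribed multiple of any \<open>E q\<close>. Sums of
  these exhaust the module.\<close>

lemma specht_product_simple:
  assumes sub: "N' \<subseteq> carrier N.PM" and add: "\<And>u v. u \<in> N' \<Longrightarrow> v \<in> N' \<Longrightarrow> u \<oplus>\<^bsub>N.PM\<^esub> v \<in> N'"
    and smult: "\<And>f u. (\<And>\<sigma>. \<sigma> \<notin> SG \<Longrightarrow> f \<sigma> = 0) \<Longrightarrow> u \<in> N' \<Longrightarrow> f \<odot>\<^bsub>N.PM\<^esub> u \<in> N'"
    and nz: "\<exists>u\<in>N'. u \<noteq> \<zero>\<^bsub>N.PM\<^esub>"
  shows "N' = carrier N.PM"
proof -
  have "\<forall>i\<in>{1..l}. \<exists>Rc. finite (fst Rc) \<and> fst Rc \<subseteq> tableaux (\<mu> i) \<and> (\<forall>v\<in>carrier (specht (\<mu> i)).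
      v = (\<lambda>T. \<Sum>r\<in>fst Rc. \<Sum>s\<in>fst Rc. snd Rc r s * pairing (\<mu> i) v s * polytabloid (\<mu> i) r T))"
  proof
    fix i
    from specht_expansion[of "\<mu> i"] obtain R c where Rc: "finite R \<and> R \<subseteq> tableaux (\<mu> i) \<and> (\<forall>v\<in>carrier (specht (\<mu> i)).
        v = (\<lambda>T. \<Sum>r\<in>R. \<Sum>s\<in>R. c r s * pairing (\<mu> i) v s * polytabloid (\<mu> i) r T))" by blast
    show "\<exists>Rc. finite (fst Rc) \<and> fst Rc \<subseteq> tableaux (\<mu> i) \<and> (\<forall>v\<in>carrier (specht (\<mu> i)).
        v = (\<lambda>T. \<Sum>r\<in>fst Rc. \<Sum>s\<in>fst Rc. snd Rc r s * pairing (\<mu> i) v s * polytabloid (\<mu> i) r T))"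
      by (rule exI[of _ "(R, c)"]) (use Rc in simp)
  qed
  then obtain Rc where Rc: "\<forall>i\<in>{1..l}. finite (fst (Rc i)) \<and> fst (Rc i) \<subseteq> tableaux (\<mu> i) \<and> (\<forall>v\<in>carrier (specht (\<mu> i)).
      v = (\<lambda>T. \<Sum>r\<in>fst (Rc i). \<Sum>s\<in>fst (Rc i). snd (Rc i) r s * pairing (\<mu> i) v s * polytabloid (\<mu> i) r T))"
    unfolding bchoice_iff by blast
  define R where "R i = fst (Rc i)" for i
  define c where "c i = snd (Rc i)" for i
  have R: "finite (R i)" "R i \<subseteq> tableaux (\<mu> i)" if "i \<in> {1..l}" for i using bspec[OF Rc that] unfolding R_def by blast+
  have expand: "v = (\<lambda>T. \<Sum>r\<in>R i. \<Sum>s\<in>R i. c i r s * pairing (\<mu> i) v s * polytabloid (\<mu> i) r T)"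
    if "i \<in> {1..l}" "v \<in> carrier (specht (\<mu> i))" for i v using bspec[OF Rc that(1)] that(2) unfolding R_def c_def by blast
  define RS where "RS = (\<Pi>\<^sub>E i\<in>{1..l}. R i \<times> R i)"
  \<comment> \<open>The first components of \<open>q\<close> give the polytabloids in the image, the
    second ones those paired with the argument.\<close>
  define E where "E q = (\<lambda>i\<in>{1..l}. polytabloid (\<mu> i) (fst (q i)) :: nat set list \<Rightarrow> complex)"
    for q :: "nat \<Rightarrow> (nat \<times> nat \<Rightarrow> nat) \<times> (nat \<times> nat \<Rightarrow> nat)"
  define lam where "lam q x = (\<Prod>i\<in>{1..l}. pairing (\<mu> i) (x i) (snd (q i)))"
    for q :: "nat \<Rightarrow> (nat \<times> nat \<Rightarrow> nat) \<times> (nat \<times> nat \<Rightarrow> nat)" and x :: "nat \<Rightarrow> nat set list \<Rightarrow> complex"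
  define cc where "cc q = (\<Prod>i\<in>{1..l}. c i (fst (q i)) (snd (q i)))" for q
  have RSD: "fst (q i) \<in> tableaux (\<mu> i)" "snd (q i) \<in> tableaux (\<mu> i)" if "q \<in> RS" "i \<in> {1..l}" for q i
    using PiE_mem[OF that[unfolded RS_def]] R(2)[OF that(2)] by auto
  have poly: "polytabloid (\<mu> i) t \<in> carrier (specht (\<mu> i))" if "t \<in> tableaux (\<mu> i)" for t i
    using specht_polytabloid[OF that, of 1] by simp
  have E: "E q \<in> specht_slots l \<mu>" if "q \<in> RS" for q
    unfolding E_def by (rule restrict_slots) (rule poly[OF RSD(1)[OF that]])
  have pure: "N.cl (frag_of x) = N.cl (\<Sum>q\<in>RS. frag_of (scaled (cc q * lam q x) (E q)))" if x: "x \<in> specht_slots l \<mu>" for x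
  proof -
    let ?y = "\<lambda>i p T. c i (fst p) (snd p) * pairing (\<mu> i) (x i) (snd p) * polytabloid (\<mu> i) (fst p) T"
    have "x = (\<lambda>i\<in>{1..l}. \<lambda>T. \<Sum>p\<in>R i \<times> R i. ?y i p T)"
    proof
      fix i
      show "x i = (\<lambda>i\<in>{1..l}. \<lambda>T. \<Sum>p\<in>R i \<times> R i. ?y i p T) i"
      proof (cases "i \<in> {1..l}")
        case True
        then show ?thesis using expand[OF True slots_in[OF x True]] by (simp add: sum.cartesian_product case_prod_unfold)
      next
        case False
        then show ?thesis using x unfolding specht_slots_def by auto
      qed
    qed
    then have "N.cl (frag_of x) = N.cl (frag_of (\<lambda>i\<in>{1..l}. \<lambda>T. \<Sum>p\<in>R i \<times> R i. ?y i p T))" by simp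
    also have "\<dots> = N.cl (\<Sum>q\<in>RS. frag_of (\<lambda>i\<in>{1..l}. ?y i (q i)))"
      unfolding RS_def 
    proof (rule expand_all)
      show "finite (R i \<times> R i)" if "i \<in> {1..l}" for i using R(1)[OF that] by simp
      show "?y i p \<in> carrier (specht (\<mu> i))" if "i \<in> {1..l}" "p \<in> R i \<times> R i" for i p
        by (rule specht_polytabloid) (use R(2)[OF that(1)] that(2) in auto)
    qed
    also have "\<dots> = N.cl (\<Sum>q\<in>RS. frag_of (scaled (cc q * lam q x) (E q)))"
    proof (rule cl_sum)
      fix q assume q: "q \<in> RS"
      show "N.cl (frag_of (\<lambda>i\<in>{1..l}. ?y i (q i))) = N.cl (frag_of (scaled (cc q * lam q x) (E q)))"
        unfolding cc_def lam_def E_def prod.distrib[symmetric] by (rule collect_all_scalars) (rule poly[OF RSD(1)[OF q]])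
    qed
    finally show ?thesis .
  qed
  have keys: "N.cl z = N.cl (\<Sum>q\<in>RS. frag_of (scaled (cc q * N.functional (lam q) z) (E q)))"
    if "Poly_Mapping.keys z \<subseteq> specht_slots l \<mu>" for z
    using that
  proof (rule free_Abelian_group_induct)
    have "N.cl (\<Sum>q\<in>RS. frag_of (scaled 0 (E q))) = N.cl (\<Sum>q\<in>RS. 0)" by (rule cl_sum) (rule scaled_zero[OF E])
    then show "N.cl 0 = N.cl (\<Sum>q\<in>RS. frag_of (scaled (cc q * N.functional (lam q) 0) (E q)))"
      by (simp add: N.functional_def)
  next
    fix y z assume "N.cl y = N.cl (\<Sum>q\<in>RS. frag_of (scaled (cc q * N.functional (lam q) y) (E q)))"
      "N.cl z = N.cl (\<Sum>q\<in>RS. frag_of (scaled (cc q * N.functional (lam q) z) (E q)))"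
    from cl_diff[OF this] have "N.cl (y - z) = N.cl (\<Sum>q\<in>RS. frag_of (scaled (cc q * N.functional (lam q) y) (E q)) -
        frag_of (scaled (cc q * N.functional (lam q) z) (E q)))" by (simp add: sum_subtractf)
    also have "\<dots> = N.cl (\<Sum>q\<in>RS. frag_of (scaled (cc q * N.functional (lam q) (y - z)) (E q)))"
      by (rule cl_sum) (simp add: N.functional_diff right_diff_distrib scaled_diff E)
    finally show "N.cl (y - z) = N.cl (\<Sum>q\<in>RS. frag_of (scaled (cc q * N.functional (lam q) (y - z)) (E q)))" .
  qed (use pure N.functional_of in auto)
  have act: "\<exists>f. (\<forall>\<sigma>. \<sigma> \<notin> SG \<longrightarrow> f \<sigma> = 0) \<and> (\<forall>z. Poly_Mapping.keys z \<subseteq> specht_slots l \<mu> \<longrightarrow>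
      f \<odot>\<^bsub>N.PM\<^esub> N.cl z = N.cl (frag_of (scaled (d * N.functional (lam s) z) (E q))))" if q: "q \<in> RS" and s: "s \<in> RS" for q s d
  proof -
    have "\<forall>i\<in>{1..l}. \<exists>F. \<forall>v\<in>carrier (specht (\<mu> i)).
        F \<odot>\<^bsub>specht (\<mu> i)\<^esub> v = (\<lambda>T. pairing (\<mu> i) v (snd (s i)) * polytabloid (\<mu> i) (fst (q i)) T)"
      using specht_rank_one[OF shape] RSD(1)[OF q] RSD(2)[OF s] by blast
    then obtain F where F: "\<forall>i\<in>{1..l}. \<forall>v\<in>carrier (specht (\<mu> i)).
        F i \<odot>\<^bsub>specht (\<mu> i)\<^esub> v = (\<lambda>T. pairing (\<mu> i) v (snd (s i)) * polytabloid (\<mu> i) (fst (q i)) T)"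
      unfolding bchoice_iff by blast
    \<comment> \<open>The scalar \<open>d\<close> is put into slot 1 alone, so that it enters the
      product of all slots once.\<close>
    define F' where "F' i \<sigma> = (if i = 1 then d else 1) * F i \<sigma>" for i \<sigma>
    define f where "f \<sigma> = (if \<sigma> \<in> SG then \<Prod>i\<in>{1..l}. F' i (\<sigma> i) else 0)" for \<sigma>
    have F': "F' i \<odot>\<^bsub>specht (\<mu> i)\<^esub> v = (\<lambda>T. ((if i = 1 then d else 1) * pairing (\<mu> i) v (snd (s i))) * polytabloid (\<mu> i) (fst (q i)) T)"
      if "i \<in> {1..l}" "v \<in> carrier (specht (\<mu> i))" for i v
    proof -
      have "F' i \<odot>\<^bsub>specht (\<mu> i)\<^esub> v = (\<lambda>T. (if i = 1 then d else 1) * (F i \<odot>\<^bsub>specht (\<mu> i)\<^esub> v) T)"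
        unfolding specht_ops(3) F'_def sum_distrib_left mult.assoc ..
      then show ?thesis using F that by (simp add: mult.assoc)
    qed
    have gen: "N.cl (ogen f x) = N.cl (frag_of (scaled (d * lam s x) (E q)))" if x: "x \<in> specht_slots l \<mu>" for x
    proof -
      have "N.cl (ogen f x) = N.cl (frag_of (\<lambda>i\<in>{1..l}. F' i \<odot>\<^bsub>specht (\<mu> i)\<^esub> x i))"
        by (rule product_action[OF x]) (simp add: f_def)
      also have "(\<lambda>i\<in>{1..l}. F' i \<odot>\<^bsub>specht (\<mu> i)\<^esub> x i) =
          (\<lambda>i\<in>{1..l}. \<lambda>T. ((if i = 1 then d else 1) * pairing (\<mu> i) (x i) (snd (s i))) * polytabloid (\<mu> i) (fst (q i)) T)"
        by (intro restrict_ext) (use F' slots_in[OF x] in blast)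
      also have "N.cl (frag_of \<dots>) = N.cl (frag_of (scaled (\<Prod>i\<in>{1..l}. (if i = 1 then d else 1) * pairing (\<mu> i) (x i) (snd (s i))) (E q)))"
        unfolding E_def by (rule collect_all_scalars) (rule poly[OF RSD(1)[OF q]])
      also have "(\<Prod>i\<in>{1..l}. (if i = 1 then d else 1) * pairing (\<mu> i) (x i) (snd (s i))) = d * lam s x"
        unfolding lam_def prod.distrib using one_in by (simp only: prod.delta' prod.delta finite_atLeastAtMost if_True)
      finally show ?thesis .
    qed
    have "N.cl (frag_extend (ogen f) z) = N.cl (frag_of (scaled (d * N.functional (lam s) z) (E q)))"
      if "Poly_Mapping.keys z \<subseteq> specht_slots l \<mu>" for z
      using that
    proof (rule free_Abelian_group_induct)
      show "N.cl (frag_extend (ogen f) 0) = N.cl (frag_of (scaled (d * N.functional (lam s) 0) (E q)))"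
        using scaled_zero[OF E[OF q]] by (simp add: N.functional_def)
    next
      fix y z assume "N.cl (frag_extend (ogen f) y) = N.cl (frag_of (scaled (d * N.functional (lam s) y) (E q)))"
        "N.cl (frag_extend (ogen f) z) = N.cl (frag_of (scaled (d * N.functional (lam s) z) (E q)))"
      from cl_diff[OF this] show "N.cl (frag_extend (ogen f) (y - z)) = N.cl (frag_of (scaled (d * N.functional (lam s) (y - z)) (E q)))"
        unfolding frag_extend_diff N.functional_diff right_diff_distrib scaled_diff[OF E[OF q]] .
    qed (use gen N.functional_of frag_extend_of in auto)
    then show ?thesis using N.smult_PM[of f] by (intro exI[of _ f]) (simp add: f_def)
  qed
  obtain u where u: "u \<in> N'" "u \<noteq> \<zero>\<^bsub>N.PM\<^esub>" using nz by blast
  then obtain z where z: "u = N.cl z" "Poly_Mapping.keys z \<subseteq> specht_slots l \<mu>" using sub unfolding N.carrier_PM by blast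
  have "\<exists>s\<in>RS. N.functional (lam s) z \<noteq> 0"
  proof (rule ccontr)
    assume "\<not> ?thesis"
    then have "N.cl z = N.cl (\<Sum>q\<in>RS. frag_of (scaled 0 (E q)))" using keys[OF z(2)] by simp
    also have "\<dots> = N.cl (\<Sum>q\<in>RS. 0)" by (rule cl_sum) (rule scaled_zero[OF E])
    finally show False using u(2) z(1) unfolding N.zero_PM by simp
  qed
  then obtain s where s: "s \<in> RS" "N.functional (lam s) z \<noteq> 0" by blast
  have gen: "N.cl (frag_of (scaled d (E q))) \<in> N'" if q: "q \<in> RS" for q d
  proof -
    obtain f where f: "\<forall>\<sigma>. \<sigma> \<notin> SG \<longrightarrow> f \<sigma> = 0"
      "\<And>y. Poly_Mapping.keys y \<subseteq> specht_slots l \<mu> \<Longrightarrow> f \<odot>\<^bsub>N.PM\<^esub> N.cl y =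
        N.cl (frag_of (scaled (d / N.functional (lam s) z * N.functional (lam s) y) (E q)))"
      using act[OF q s(1), of "d / N.functional (lam s) z"] by (elim exE conjE) blast
    have "N.cl (frag_of (scaled (d / N.functional (lam s) z * N.functional (lam s) z) (E q))) \<in> N'"
      unfolding f(2)[OF z(2), symmetric] z(1)[symmetric] by (rule smult[OF _ u(1)]) (use f(1) in blast)
    then show ?thesis using s(2) by simp
  qed
  have sums: "N.cl (\<Sum>q\<in>Q. frag_of (scaled (d q) (E q))) \<in> N'" if "finite Q" "Q \<subseteq> RS" for Q d
    using that
  proof (induction Q)
    case empty
    then show ?case using gen[OF s(1), of 0] scaled_zero[OF E[OF s(1)]] by simp
  next
    case (insert q Q)
    then show ?case using add[OF gen[of q "d q"], of "N.cl (\<Sum>q\<in>Q. frag_of (scaled (d q) (E q)))"] by (simp add: N.add_PM)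
  qed
  have "finite RS" unfolding RS_def by (intro finite_PiE) (use R(1) in auto)
  then have "carrier N.PM \<subseteq> N'" unfolding N.carrier_PM using keys sums[of RS] by auto
  then show ?thesis using sub by blast
qed

section \<open>Coordinates on the outer tensor product\<close>

definition evaluate :: "(nat \<Rightarrow> nat set list) \<Rightarrow> (nat \<Rightarrow> nat set list \<Rightarrow> complex) \<Rightarrow> complex" where
  "evaluate T x = (\<Prod>i\<in>{1..l}. x i (T i))"

lemma evaluate_upd: "j \<in> {1..l} \<Longrightarrow> evaluate T (x(j := w)) = w (T j) * (\<Prod>i\<in>{1..l} - {j}. x i (T i))"
  unfolding evaluate_def by (subst prod.remove[of _ j]) (auto intro!: prod.cong)

text \<open>The product of the values is additive in each slot and does not see from which slot a
  scalar comes, so it descends to the outer tensor product.\<close>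

lemma evaluate_relations:
  assumes "r \<in> outer_relations l \<mu>"
  shows "N.functional (evaluate T) r = 0"
  using assms unfolding outer_relations_def
proof (elim UnE CollectE exE conjE)
  fix x i and u v :: "nat set list \<Rightarrow> complex"
  assume "i \<in> {1..l}" and r: "r = frag_of (x(i := (\<lambda>T. u T + v T))) - frag_of (x(i := u)) - frag_of (x(i := v))"
  then show ?thesis by (simp only: N.functional_diff N.functional_of evaluate_upd) (simp add: distrib_right)
next
  fix x i j and c :: complex
  assume ij: "i \<in> {1..l}" "j \<in> {1..l}" and r: "r = frag_of (x(i := (\<lambda>T. c * x i T))) - frag_of (x(j := (\<lambda>T. c * x j T)))"
  have "evaluate T (x(k := (\<lambda>T. c * x k T))) = c * evaluate T x" if "k \<in> {1..l}" for k
    using evaluate_upd[OF that, of T x "\<lambda>T. c * x k T"] evaluate_upd[OF that, of T x "x k"] by simp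
  then show ?thesis unfolding r by (simp only: N.functional_diff N.functional_of ij) simp
qed

definition coefficient :: "((nat \<Rightarrow> nat set list \<Rightarrow> complex) \<Rightarrow>\<^sub>0 int) set \<Rightarrow> (nat \<Rightarrow> nat set list) \<Rightarrow> complex" where
  "coefficient v T = N.functional (evaluate T) (SOME z. v = N.cl z)"

lemma coefficient_cl: "coefficient (N.cl z) T = N.functional (evaluate T) z"
proof -
  have "N.cl z = N.cl (SOME z'. N.cl z = N.cl z')" by (rule someI[of _ z]) simp
  then show ?thesis unfolding coefficient_def by (intro N.functional_cl) (simp_all add: evaluate_relations)
qed

lemma coefficient_add:
  "v \<in> carrier N.PM \<Longrightarrow> w \<in> carrier N.PM \<Longrightarrow> coefficient (v \<oplus>\<^bsub>N.PM\<^esub> w) T = coefficient v T + coefficient w T"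
  unfolding N.carrier_PM by (auto simp: N.add_PM coefficient_cl N.functional_add)

definition permute_tabloids :: "(nat \<Rightarrow> nat \<Rightarrow> nat) \<Rightarrow> (nat \<Rightarrow> nat set list) \<Rightarrow> nat \<Rightarrow> nat set list" where
  "permute_tabloids \<sigma> T = (\<lambda>i\<in>{1..l}. map ((`) (inv' (\<sigma> i))) (T i))"

lemma evaluate_slot_action: "evaluate T (slot_action l c \<sigma> x) = c * evaluate (permute_tabloids \<sigma> T) x"
proof -
  have "evaluate T (slot_action l c \<sigma> x) = (\<Prod>i\<in>{1..l}. (if i = 1 then c else 1) * x i (permute_tabloids \<sigma> T i))"
    unfolding evaluate_def slot_action_def permute_tabloids_def by (intro prod.cong refl) simp
  then show ?thesis
    unfolding evaluate_def prod.distrib using one_in by (simp only: prod.delta finite_atLeastAtMost if_True)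
qed

lemma coefficient_smult:
  assumes "v \<in> carrier N.PM"
  shows "coefficient (f \<odot>\<^bsub>N.PM\<^esub> v) T = (\<Sum>\<sigma>\<in>SG. f \<sigma> * coefficient v (permute_tabloids \<sigma> T))"
proof -
  obtain z where z: "v = N.cl z" "Poly_Mapping.keys z \<subseteq> specht_slots l \<mu>" using assms unfolding N.carrier_PM by blast
  have fsum: "N.functional g (\<Sum>j\<in>J. h j) = (\<Sum>j\<in>J. N.functional g (h j))" for g h and J :: "(nat \<Rightarrow> nat \<Rightarrow> nat) set"
    by (induction J rule: infinite_finite_induct) (simp_all add: N.functional_add N.functional_def[of _ 0])
  have "N.functional (evaluate T) (frag_extend (ogen f) z) = (\<Sum>\<sigma>\<in>SG. f \<sigma> * N.functional (evaluate (permute_tabloids \<sigma> T)) z)"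
    using z(2)
  proof (rule free_Abelian_group_induct)
    fix y z assume "N.functional (evaluate T) (frag_extend (ogen f) y) = (\<Sum>\<sigma>\<in>SG. f \<sigma> * N.functional (evaluate (permute_tabloids \<sigma> T)) y)"
      "N.functional (evaluate T) (frag_extend (ogen f) z) = (\<Sum>\<sigma>\<in>SG. f \<sigma> * N.functional (evaluate (permute_tabloids \<sigma> T)) z)"
    then show "N.functional (evaluate T) (frag_extend (ogen f) (y - z)) =
        (\<Sum>\<sigma>\<in>SG. f \<sigma> * N.functional (evaluate (permute_tabloids \<sigma> T)) (y - z))"
      by (simp add: frag_extend_diff N.functional_diff right_diff_distrib sum_subtractf)
  qed (simp_all add: N.functional_def[of _ 0] fsum N.functional_of evaluate_slot_action)
  then show ?thesis unfolding z(1) using N.smult_PM[of f z] by (simp add: coefficient_cl)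
qed

end


section \<open>Simplicity of the standard modules\<close>

locale complex_setup = standard_setup l n \<delta> m \<mu> + complex_tuple l m \<mu> \<delta>
  for l n :: nat and \<delta> :: complex and m :: "nat \<Rightarrow> nat" and \<mu> :: "nat \<Rightarrow> nat list"
begin

definition representative :: "(diagram \<Rightarrow> complex) set \<Rightarrow> diagram \<Rightarrow> complex" where
  "representative Z = (SOME x. x \<in> supp_B \<and> Z = cls x)"

lemma representative_cls: "x \<in> supp_B \<Longrightarrow> representative (cls x) = x"
proof -
  assume x: "x \<in> supp_B"
  then have "representative (cls x) \<in> supp_B \<and> cls x = cls (representative (cls x))"
    unfolding representative_def by (intro someI[of "\<lambda>y. y \<in> supp_B \<and> cls x = cls y" x]) simp
  then show ?thesis using cls_supp_inj[OF x] by metis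
qed

text \<open>
  Detects nonzero elements of the standard module: coefficients at the diagrams \<open>block_perm \<sigma>\<close> in
  the left factor are paired with coefficients at the tabloids \<open>W\<close> moved by the inverse of \<open>\<sigma>\<close> in
  the right one; the sum over \<open>\<sigma>\<close> makes this compatible with the tensor relations.
\<close>

definition standard_functional ::
    "(nat \<Rightarrow> nat set list) \<Rightarrow> (diagram \<Rightarrow> complex) set \<times> ((nat \<Rightarrow> nat set list \<Rightarrow> complex) \<Rightarrow>\<^sub>0 int) set \<Rightarrow> complex" where
  "standard_functional W = (\<lambda>(Z, v). \<Sum>\<sigma>\<in>SG. representative Z (block_perm \<sigma>) * coefficient v (permute_tabloids \<sigma> W))"

text \<open>The inverse in the definition makes this a right action, matching the right factor in
  the substitution of \<open>standard_functional_balanced\<close>.\<close>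

lemma permute_tabloids_mult:
  assumes "\<sigma> \<in> SG" "\<tau> \<in> SG"
  shows "permute_tabloids (\<tau> \<otimes>\<^bsub>G\<^esub> \<sigma>) W = permute_tabloids \<sigma> (permute_tabloids \<tau> W)"
  unfolding permute_tabloids_def mult_G
proof (rule restrict_ext)
  fix i assume i: "i \<in> {1..l}"
  have "inv' (\<tau> i \<circ> \<sigma> i) = inv' (\<sigma> i) \<circ> inv' (\<tau> i)"
    by (rule o_inv_distrib[OF permutes_bij[OF SG_permutes[OF assms(2) i]] permutes_bij[OF SG_permutes[OF assms(1) i]]])
  then show "map ((`) (inv' ((\<lambda>i\<in>{1..l}. \<tau> i \<circ> \<sigma> i) i))) (W i) =
      map ((`) (inv' (\<sigma> i))) ((\<lambda>i\<in>{1..l}. map ((`) (inv' (\<tau> i))) (W i)) i)"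
    using i by (simp add: image_functions_comp)
qed

text \<open>Right multiplication by a block permutation is invertible on \<open>B\<close>, so for
  each \<sigma> exactly one basis diagram contributes to the coefficient.\<close>

lemma supp_mult_grp_block_perm:
  assumes x: "x \<in> supp_B" and \<rho>: "\<rho> \<in> SG"
  shows "(x \<bullet> grp f) (block_perm \<rho>) = (\<Sum>\<sigma>\<in>SG. x (block_perm (\<rho> \<otimes>\<^bsub>G\<^esub> inv\<^bsub>G\<^esub> \<sigma>)) * f \<sigma>)"
  unfolding supp_mult_grp[OF x]
proof (rule sum.cong[OF refl])
  fix \<sigma> assume \<sigma>: "\<sigma> \<in> SG"
  interpret G: group G by (rule group_G)
  let ?\<tau> = "\<rho> \<otimes>\<^bsub>G\<^esub> inv\<^bsub>G\<^esub> \<sigma>"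
  have \<tau>: "?\<tau> \<in> SG" using \<rho> \<sigma> by simp
  have "diagram_comp p (block_perm \<sigma>) = block_perm \<rho> \<longleftrightarrow> p = block_perm ?\<tau>" if p: "p \<in> B" for p
  proof
    note d = uniform_diagrams[OF B_uniform[OF p]] block_perm_diagrams[OF \<sigma>] block_perm_diagrams[OF G.inv_closed[OF \<sigma>]]
    assume "diagram_comp p (block_perm \<sigma>) = block_perm \<rho>"
    then have "diagram_comp (diagram_comp p (block_perm \<sigma>)) (block_perm (inv\<^bsub>G\<^esub> \<sigma>)) = block_perm ?\<tau>"
      using block_perm_mult[OF \<rho> G.inv_closed[OF \<sigma>]] by simp
    then have "diagram_comp p a = block_perm ?\<tau>"
      unfolding diagram_comp_assoc[OF d] block_perm_mult[OF \<sigma> G.inv_closed[OF \<sigma>]] G.r_inv[OF \<sigma>] block_perm_one .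
    moreover have "diagram_comp p a = p"
    proof (rule drel_inj[OF diagram_comp_in[OF d(1) uniform_diagrams[OF a_uniform]] d(1)])
      show "drel (diagram_comp p a) = drel p"
        unfolding drel_comp[OF d(1) uniform_diagrams[OF a_uniform]] drel_a using p B_eq by (auto simp: Range_iff)
    qed
    ultimately show "p = block_perm ?\<tau>" by simp
  next
    assume "p = block_perm ?\<tau>"
    then show "diagram_comp p (block_perm \<sigma>) = block_perm \<rho>"
      using block_perm_mult[OF \<tau> \<sigma>] G.inv_solve_right' \<rho> \<sigma> by (simp add: G.m_assoc)
  qed
  then have "(\<Sum>p\<in>B. if diagram_comp p (block_perm \<sigma>) = block_perm \<rho> then x p * f \<sigma> else 0) =
      (\<Sum>p\<in>B. if p = block_perm ?\<tau> then x p * f \<sigma> else 0)"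
    by (intro sum.cong refl) simp
  then show "(\<Sum>p\<in>B. if diagram_comp p (block_perm \<sigma>) = block_perm \<rho> then x p * f \<sigma> else 0) = x (block_perm ?\<tau>) * f \<sigma>"
    using finite_B block_perm_B[OF \<tau>] by simp
qed

lemma standard_functional_balanced:
  assumes x: "x \<in> supp_B" and v: "v \<in> carrier N.PM"
  shows "standard_functional W (cls (x \<bullet> grp f), v) = standard_functional W (cls x, f \<odot>\<^bsub>N.PM\<^esub> v)"
proof -
  interpret G: group G by (rule group_G)
  let ?c = "\<lambda>\<sigma>. coefficient v (permute_tabloids \<sigma> W)"
  have "standard_functional W (cls (x \<bullet> grp f), v) =
      (\<Sum>\<rho>\<in>SG. \<Sum>\<sigma>\<in>SG. x (block_perm (\<rho> \<otimes>\<^bsub>G\<^esub> inv\<^bsub>G\<^esub> \<sigma>)) * f \<sigma> * ?c \<rho>)"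
    unfolding standard_functional_def case_prod_conv representative_cls[OF supp_mult_grp_supp[OF x]]
    by (rule sum.cong[OF refl]) (simp add: supp_mult_grp_block_perm[OF x] sum_distrib_right)
  also have "\<dots> = (\<Sum>\<sigma>\<in>SG. \<Sum>\<rho>\<in>SG. x (block_perm (\<rho> \<otimes>\<^bsub>G\<^esub> inv\<^bsub>G\<^esub> \<sigma>)) * f \<sigma> * ?c \<rho>)"
    by (rule sum.swap)
  \<comment> \<open>Substitutes \<rho> by the product of \<tau> and \<sigma>; the group ring element
    then acts on the other factor.\<close>
  also have "\<dots> = (\<Sum>\<sigma>\<in>SG. \<Sum>\<tau>\<in>SG. x (block_perm \<tau>) * f \<sigma> * ?c (\<tau> \<otimes>\<^bsub>G\<^esub> \<sigma>))"
  proof (rule sum.cong[OF refl])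
    fix \<sigma> assume \<sigma>: "\<sigma> \<in> SG"
    have bij: "bij_betw (\<lambda>\<tau>. \<tau> \<otimes>\<^bsub>G\<^esub> \<sigma>) SG SG"
      by (rule bij_betwI[of _ _ _ "\<lambda>\<tau>. \<tau> \<otimes>\<^bsub>G\<^esub> inv\<^bsub>G\<^esub> \<sigma>"]) (use \<sigma> in \<open>simp_all add: G.m_assoc\<close>)
    show "(\<Sum>\<rho>\<in>SG. x (block_perm (\<rho> \<otimes>\<^bsub>G\<^esub> inv\<^bsub>G\<^esub> \<sigma>)) * f \<sigma> * ?c \<rho>) = (\<Sum>\<tau>\<in>SG. x (block_perm \<tau>) * f \<sigma> * ?c (\<tau> \<otimes>\<^bsub>G\<^esub> \<sigma>))"
      unfolding sum.reindex_bij_betw[OF bij, symmetric, of "\<lambda>\<rho>. x (block_perm (\<rho> \<otimes>\<^bsub>G\<^esub> inv\<^bsub>G\<^esub> \<sigma>)) * f \<sigma> * ?c \<rho>"]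
      by (rule sum.cong[OF refl]) (use \<sigma> in \<open>simp add: G.m_assoc\<close>)
  qed
  also have "\<dots> = (\<Sum>\<tau>\<in>SG. \<Sum>\<sigma>\<in>SG. x (block_perm \<tau>) * f \<sigma> * ?c (\<tau> \<otimes>\<^bsub>G\<^esub> \<sigma>))"
    by (rule sum.swap)
  also have "\<dots> = standard_functional W (cls x, f \<odot>\<^bsub>N.PM\<^esub> v)"
    unfolding standard_functional_def case_prod_conv representative_cls[OF x] coefficient_smult[OF v] sum_distrib_left
    by (intro sum.cong refl) (simp add: permute_tabloids_mult mult.assoc)
  finally show ?thesis .
qed

lemma standard_functional_relations:
  assumes "r \<in> tensor_relations (group_ring G) LM (index_right_action \<delta> l n m) NM"
  shows "ST.T.functional (standard_functional W) r = 0"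
  using assms unfolding tensor_relations_def
proof (elim UnE CollectE exE conjE)
  fix Y Z v assume c: "Y \<in> carrier LM" "Z \<in> carrier LM" and r: "r = frag_of (Y \<oplus>\<^bsub>LM\<^esub> Z, v) - frag_of (Y, v) - frag_of (Z, v)"
  obtain y z where yz: "y \<in> supp_B" "Y = cls y" "z \<in> supp_B" "Z = cls z" using c unfolding carrier_LM by blast
  have s: "(\<lambda>p. y p + z p) \<in> supp_B" using yz(1,3) unfolding supp_B_def by simp
  have "Y \<oplus>\<^bsub>LM\<^esub> Z = cls (\<lambda>p. y p + z p)" unfolding yz(2,4) by (rule add_LM[OF supp_B_carrier[OF yz(1)] supp_B_carrier[OF yz(3)]])
  then show ?thesis
    unfolding r ST.T.functional_diff ST.T.functional_of standard_functional_def case_prod_conv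
    by (simp add: yz representative_cls s distrib_right sum.distrib)
next
  fix Z v w assume "v \<in> carrier NM" "w \<in> carrier NM" and r: "r = frag_of (Z, v \<oplus>\<^bsub>NM\<^esub> w) - frag_of (Z, v) - frag_of (Z, w)"
  then show ?thesis
    unfolding r ST.T.functional_diff ST.T.functional_of standard_functional_def case_prod_conv NM_eq
    by (simp add: coefficient_add distrib_left sum.distrib)
next
  fix Z f v assume c: "Z \<in> carrier LM" "v \<in> carrier NM"
    and r: "r = frag_of (index_right_action \<delta> l n m Z f, v) - frag_of (Z, f \<odot>\<^bsub>NM\<^esub> v)"
  obtain x where x: "x \<in> supp_B" "Z = cls x" using c(1) unfolding carrier_LM by blast
  then show ?thesis
    unfolding r ST.T.functional_diff ST.T.functional_of x(2) right_action[OF x(1)]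
    using standard_functional_balanced[OF x(1), of v W f] c(2) unfolding NM_eq by simp
qed

text \<open>The class of \<open>a\<close> tensored with a tuple of polytabloids has value 1 under
  \<open>standard_functional\<close>: only the identity permutation contributes at \<open>a\<close>,
  and every polytabloid has coefficient 1 at its own tabloid.\<close>

lemma standard_module_nonzero: "\<exists>u\<in>carrier ST.TM. u \<noteq> \<zero>\<^bsub>ST.TM\<^esub>"
proof -
  have "\<forall>i. \<exists>t. t \<in> tableaux (\<mu> i)" using tableaux_nonempty by blast
  then obtain t where t: "\<And>i. t i \<in> tableaux (\<mu> i)" by metis
  define W where "W i = tabloid (\<mu> i) (t i)" for i
  define e where "e = (\<lambda>i\<in>{1..l}. polytabloid (\<mu> i) (t i) :: nat set list \<Rightarrow> complex)"
  have e: "e \<in> specht_slots l \<mu>"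
    unfolding e_def by (rule restrict_slots) (use specht_polytabloid[OF t, where c = 1] in simp)
  have v: "N.cl (frag_of e) \<in> carrier NM" unfolding NM_eq by (rule N.cl_in) (simp add: e)
  have Z: "cls (diagram_elt a) \<in> carrier LM" unfolding carrier_LM by (intro imageI diagram_elt_supp a_in_B)
  interpret G: group G by (rule group_G)
  have "standard_functional W (cls (diagram_elt a), N.cl (frag_of e)) =
      (\<Sum>\<sigma>\<in>SG. if \<sigma> = \<one>\<^bsub>G\<^esub> then evaluate (permute_tabloids \<sigma> W) e else 0)"
    unfolding standard_functional_def case_prod_conv representative_cls[OF diagram_elt_supp[OF a_in_B]] coefficient_cl N.functional_of
  proof (rule sum.cong[OF refl])
    fix \<sigma> assume "\<sigma> \<in> SG"
    then have "block_perm \<sigma> = a \<longleftrightarrow> \<sigma> = \<one>\<^bsub>G\<^esub>"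
      using inj_onD[OF block_perm_inj _ _ G.one_closed] block_perm_one by metis
    then show "diagram_elt a (block_perm \<sigma>) * evaluate (permute_tabloids \<sigma> W) e =
        (if \<sigma> = \<one>\<^bsub>G\<^esub> then evaluate (permute_tabloids \<sigma> W) e else 0)" unfolding diagram_elt_def by simp
  qed
  also have "\<dots> = evaluate (permute_tabloids \<one>\<^bsub>G\<^esub> W) e" using finite_SG G.one_closed by (simp only: sum.delta' sum.delta if_True)
  also have "\<dots> = 1"
    unfolding evaluate_def permute_tabloids_def one_G
    by (rule prod.neutral) (use polytabloid_own[OF t] in \<open>simp add: e_def W_def map_idI\<close>)
  finally have one: "standard_functional W (cls (diagram_elt a), N.cl (frag_of e)) = 1" .
  have "ST.tens (cls (diagram_elt a)) (N.cl (frag_of e)) \<noteq> \<zero>\<^bsub>ST.TM\<^esub>"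
  proof
    assume "ST.tens (cls (diagram_elt a)) (N.cl (frag_of e)) = \<zero>\<^bsub>ST.TM\<^esub>"
    then have "ST.T.cl (frag_of (cls (diagram_elt a), N.cl (frag_of e))) = ST.T.cl 0"
      unfolding ST.tens_def ST.TM_eq ST.T.zero_PM .
    from ST.T.functional_cl[OF standard_functional_relations this, of W] show False
      unfolding ST.T.functional_of one by (simp add: ST.T.functional_def)
  qed
  then show ?thesis using ST.tens_in[OF Z v] by blast
qed

lemma standard_module_simple: "simple_module P (standard_module \<delta> l n m \<mu>)"
proof (rule simple_standard_module[OF _ standard_module_nonzero])
  fix N' assume N': "N' \<subseteq> carrier NM" "\<And>u v. u \<in> N' \<Longrightarrow> v \<in> N' \<Longrightarrow> u \<oplus>\<^bsub>NM\<^esub> v \<in> N'"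
    "\<And>f u. f \<in> carrier (group_ring G) \<Longrightarrow> u \<in> N' \<Longrightarrow> f \<odot>\<^bsub>NM\<^esub> u \<in> N'" "\<exists>u\<in>N'. u \<noteq> \<zero>\<^bsub>NM\<^esub>"
  show "N' = carrier NM"
    unfolding NM_eq
  proof (rule specht_product_simple)
    show "f \<odot>\<^bsub>N.PM\<^esub> u \<in> N'" if "\<And>\<sigma>. \<sigma> \<notin> SG \<Longrightarrow> f \<sigma> = 0" "u \<in> N'" for f u
      using N'(3)[OF group_ring_carrier that(2)] that(1) unfolding NM_eq by blast
  qed (use N'(1,2,4) in \<open>simp_all only: NM_eq\<close>)
qed

end

theorem proposition9p3:
  fixes l n :: nat
    and \<delta> :: "'k :: {comm_ring, comm_monoid_mult}"
    and \<delta>' :: complex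
  assumes "l \<ge> 1"
  shows "(\<forall>m \<in> top_indices l n. \<forall>\<mu> \<in> partition_tuples l m.
            factors_through_quotient (tonal_algebra \<delta> l n) (cap_ideal \<delta> l n) (standard_module \<delta> l n m \<mu>)) \<and>
         (\<forall>m \<in> top_indices l n. \<forall>\<mu> \<in> partition_tuples l m.
            simple_module (tonal_algebra \<delta>' l n) (standard_module \<delta>' l n m \<mu>)) \<and>
         semisimple_ring (capless_algebra \<delta>' l n)"
proof (intro conjI ballI)
  fix m \<mu> assume "m \<in> top_indices l n" "\<mu> \<in> partition_tuples l m"
  with assms interpret standard_setup l n \<delta> m \<mu> by unfold_locales
  show "factors_through_quotient (tonal_algebra \<delta> l n) (cap_ideal \<delta> l n) (standard_module \<delta> l n m \<mu>)"
    by (rule standard_module_factors)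
next
  fix m \<mu> assume "m \<in> top_indices l n" "\<mu> \<in> partition_tuples l m"
  with assms interpret complex_setup l n \<delta>' m \<mu> by unfold_locales
  show "simple_module (tonal_algebra \<delta>' l n) (standard_module \<delta>' l n m \<mu>)"
    by (rule standard_module_simple)
next
  from assms interpret tonal_alg_complex l n \<delta>' by unfold_locales
  show "semisimple_ring (capless_algebra \<delta>' l n)"
    by (rule semisimple_capless_algebra)
qed


end
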